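(* Let $\alpha\in(\Lambda^\times)^n$, let $\rho_\alpha:H_{\mathrm{disc}}\to\operatorname{Aut}^{\mathrm{ex}}_\Lambda(\mathcal I_F^{u\text{-}\mathrm{sm}}(\alpha))$, $h\mapsto R_h$, be the strict right-translation 2-representation, and let $p:H^{\det}_{F,n}\to H_{\mathrm{disc}}$ be the projection from the determinant 2-group over $H$ (all defined in the context). Precomposition with $p$ gives an exact $p$-uniformly smooth 2-representation $$\rho_\alpha^{\det}:=\rho_\alpha\circ p:\ H^{\det}_{F,n}\longrightarrow\operatorname{Aut}^{\mathrm{ex}}_\Lambda\bigl(\mathcal I_F^{u\text{-}\mathrm{sm}}(\alpha)\bigr).$$ The determinant Picard kernel (the homotopy fiber of $p$ over the unit object, equivalent to $\operatorname{Pic}_k^{\mathbb Z}$) acts coherently trivially: every kernel object is sent, through the unit coherence of the factorization, to the identity autoequivalence, and every kernel morphism is sent to the identity natural transformation.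
   Context: **Field.** $k=\mathbb F_q$, $E=k((u))$, $F=E((t))$, $\mathcal O_2=k[[u]]+tE[[t]]\subset F$. $v_t:F^\times\to\mathbb Z$, $v_u:E^\times\to\mathbb Z$ are the normalized valuations; a bar denotes reduction modulo $t$ of a $t$-adic unit. For $a,b\in F^\times$ put $\partial_t\{a,b\}=(-1)^{v_t(a)v_t(b)}\,\overline{a^{v_t(b)}b^{-v_t(a)}}\in E^\times$ and $\nu_F\{a,b\}=v_u(\partial_t\{a,b\})$. **Multiplier.** $\Lambda=\mathbb C((X))$, $n\ge1$, $G=\mathrm{GL}_n(F)$, $H=G_L\times G_R$ (two copies of $G$), $B\subset G$ the upper triangular Borel subgroup, $B_H=B_L\times B_R$. For $b=(b_L,b_R)\in B_H$ put $x_r(b)=(b_L)_{rr}$, $y_r(b)=(b_R)_{rr}$; $\sigma_\alpha(b,b')=\prod_{r=1}^n\alpha_r^{-\nu_F\{x_r(b),y_r(b')\}}$, a normalized 2-cocycle on $B_H$. $L_\alpha(b)=\Lambda e_b$, with $m_{b,b'}:L_\alpha(b)\otimes L_\alpha(b')\to L_\alpha(bb')$, $e_b\otimes e_{b'}\mapsto\sigma_\alpha(b,b')e_{bb'}$. **Levels.** For $i,j\ge1$, $K_{ij}=I_n+u^it^jM_n(\mathcal O_2)$, $C^{\mathrm{dbl}}_{ij}=K_{ij,L}\times K_{ij,R}$. $\mathcal C_H$ is the family of finite intersections of $H$-conjugates of the $C^{\mathrm{dbl}}_{ij}$, ordered by reverse inclusion and used as a basis of identity neighbourhoods of $H$. For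 $C\in\mathcal C_H$: $S_C=H/C$, $\mathcal V_C=\operatorname{Fun}(S_C,\operatorname{Vect}_\Lambda)$ (relative to fixed universes $\mathbb U\in\mathbb V$, $\operatorname{Vect}_\Lambda$ consisting of $\mathbb U$-small spaces); for $D\subseteq C$, $\pi^*_{D,C}$ is pullback along $gD\mapsto gC$. **Principal series category.** $(T_bV)_s=L_\alpha(b)\otimes V_{b^{-1}s}$ with $\mu_{b,b'}:T_bT_{b'}\Rightarrow T_{bb'}$ given by $m_{b,b'}\otimes\mathrm{id}$ and $u_V:T_1V\to V$, $e_1\otimes v\mapsto v$. $\mathcal I_C(\alpha)$ is the category of pairs $(V,\varepsilon)$, $V\in\mathcal V_C$, with isomorphisms $\varepsilon_b:T_bV\to V$ ($b\in B_H$) satisfying $\varepsilon_{bb'}\circ\mu_{b,b'}(V)=\varepsilon_b\circ T_b(\varepsilon_{b'})$, $\varepsilon_1=u_V$; morphisms commute with all $\varepsilon_b$. $\mathcal I_F^{u\text{-}\mathrm{sm}}(\alpha)$ has objects $(C,V)$, $C\in\mathcal C_H$, $V\in\mathcal I_C(\alpha)$, and $\operatorname{Hom}((C,V),(C',V'))=\varinjlim_{D\subseteq C\cap C'}\operatorname{Hom}_{\mathcal I_D(\alpha)}(\pi^*_{D,C}V,\pi^*_{D,C'}V')$, $D\in\mathcal C_H$. It is a $\Lambda$-linear abelian category. For $h\in H$, pullback $R_h^C$ along $S_{hCh^{-1}}\to S_C$, $g(hCh^{-1})\mapsto ghC$, commutes strictly with the $T_b$ and with refinement, and induces $R_h:(C,V)\mapsto(hCh^{-1},R_h^CV)$.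 The functors $R_h$ form an exact strict action $\rho_\alpha$ of $H$ on $\mathcal I_F^{u\text{-}\mathrm{sm}}(\alpha)$. **2-groups and 2-representations.** A coherent 2-group is a monoidal groupoid in which every object is tensor-invertible, with coherent choices of weak inverses. $\operatorname{Aut}^{\mathrm{ex}}_\Lambda(\mathcal A)$ is the coherent 2-group of exact $\Lambda$-linear autoequivalences of $\mathcal A$ and natural isomorphisms. A 2-representation of a coherent 2-group $\mathcal G$ on $\mathcal A$ is a strong monoidal functor from $\mathcal G$ to the 2-group of $\Lambda$-linear autoequivalences of $\mathcal A$; it is exact if it lands in $\operatorname{Aut}^{\mathrm{ex}}_\Lambda(\mathcal A)$. For a group $Q$, $Q_{\mathrm{disc}}$ is the discrete strict 2-group with only identity morphisms. A strict action of $H$ is uniformly smooth if every object and every morphism is literally fixed by all elements of some member of $\mathcal C_H$. If $p:\widetilde{\mathcal G}\to H_{\mathrm{disc}}$ is a monoidal projection and a 2-representation factors as $\rho\circ p$, it is called $p$-uniformly smooth if the underlying $H$-action $\rho$ is uniformly smooth. **Determinant 2-group.** For an exact category $\mathcal E$, an elementary Tate object is an admissible Ind-object in $\operatorname{Pro}^a(\mathcal E)$ possessing a lattice (an admissible subobject in $\operatorname{Pro}^a(\mathcal E)$ with quotient in $\operatorname{Ind}^a(\mathcal E)$); $\operatorname{Tate}(\mathcal E)$ is the idempotent completion of the category of these. $2\text{-}\operatorname{Tate}_k$ denotes a fixed model of the exact category $\operatorname{Tate}^{\mathrm{el}}(\operatorname{Tate}(\operatorname{Vect}_k^{\mathrm{fd}}))$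 of elementary 2-Tate objects over $k$ (Braunling–Groechenig–Wolfson). $F=k((u))((t))$ is such an object; put $W_{F,n}=F_L^n\oplus F_R^n$ and let $\operatorname{Aut}_{2\text{-}\operatorname{Tate}_k}(W_{F,n})$ be its ordinary automorphism group. Block-diagonal matrices give a homomorphism $\iota_H:H_{\mathrm{disc}}\to\operatorname{Aut}_{2\text{-}\operatorname{Tate}_k}(W_{F,n})_{\mathrm{disc}}$. $\operatorname{Pic}_k^{\mathbb Z}$ is the graded Picard groupoid of graded one-dimensional $k$-vector spaces ($\pi_0\simeq\mathbb Z$, $\pi_1\simeq k^\times$). The existence of a compatible graded determinant extension is taken as an input: one fixes a coherent central extension of 2-groups $$\operatorname{Pic}_k^{\mathbb Z}\to\widetilde{\operatorname{Aut}}^{\det}_{2\text{-}\operatorname{Tate}_k}(W_{F,n})\to\operatorname{Aut}_{2\text{-}\operatorname{Tate}_k}(W_{F,n})_{\mathrm{disc}}.$$ $H^{\det}_{F,n}$ is the homotopy pullback of this extension along $\iota_H$, in the 2-category of coherent 2-groups, and $p:H^{\det}_{F,n}\to H_{\mathrm{disc}}$ is the first projection; its homotopy fiber over the unit object is equivalent to $\operatorname{Pic}_k^{\mathbb Z}$. *)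

theory Defs
  imports
    "HOL-Analysis.Analysis"
    "HOL-Algebra.Left_Coset"
    "HOL-Computational_Algebra.Formal_Laurent_Series"
begin

section \<open>Categories, functors, linear categories\<close>

text \<open>Arrows do not carry their source and target: \<open>f \<in> Hom C x y\<close> may also lie in other hom-sets,
  so composition takes the three objects as arguments; \<open>Cmp C x y z g f\<close> is \<open>g \<circ> f\<close> for
  \<open>f : x \<rightarrow> y\<close>, \<open>g : y \<rightarrow> z\<close>.\<close>

record ('o, 'a) cat =
  Ob  :: "'o set"
  Hom :: "'o \<Rightarrow> 'o \<Rightarrow> 'a set"
  Idn :: "'o \<Rightarrow> 'a"
  Cmp :: "'o \<Rightarrow> 'o \<Rightarrow> 'o \<Rightarrow> 'a \<Rightarrow> 'a \<Rightarrow> 'a"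

locale category =
  fixes C :: "('o, 'a, 'z) cat_scheme"
  assumes Idn_hom: "x \<in> Ob C \<Longrightarrow> Idn C x \<in> Hom C x x"
    and Cmp_hom: "\<lbrakk>x \<in> Ob C; y \<in> Ob C; z \<in> Ob C; f \<in> Hom C x y; g \<in> Hom C y z\<rbrakk>
      \<Longrightarrow> Cmp C x y z g f \<in> Hom C x z"
    and Idn_left: "\<lbrakk>x \<in> Ob C; y \<in> Ob C; f \<in> Hom C x y\<rbrakk> \<Longrightarrow> Cmp C x y y (Idn C y) f = f"
    and Idn_right: "\<lbrakk>x \<in> Ob C; y \<in> Ob C; f \<in> Hom C x y\<rbrakk> \<Longrightarrow> Cmp C x x y f (Idn C x) = f"
    and Cmp_assoc: "\<lbrakk>w \<in> Ob C; x \<in> Ob C; y \<in> Ob C; z \<in> Ob C;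
        f \<in> Hom C w x; g \<in> Hom C x y; h \<in> Hom C y z\<rbrakk>
      \<Longrightarrow> Cmp C w x z (Cmp C x y z h g) f = Cmp C w y z h (Cmp C w x y g f)"

definition is_iso :: "('o, 'a, 'z) cat_scheme \<Rightarrow> 'o \<Rightarrow> 'o \<Rightarrow> 'a \<Rightarrow> bool" where
  "is_iso C x y f \<longleftrightarrow> f \<in> Hom C x y \<and>
     (\<exists>g\<in>Hom C y x. Cmp C x y x g f = Idn C x \<and> Cmp C y x y f g = Idn C y)"

definition inv_arrow :: "('o, 'a, 'z) cat_scheme \<Rightarrow> 'o \<Rightarrow> 'o \<Rightarrow> 'a \<Rightarrow> 'a" where
  "inv_arrow C x y f =
     (THE g. g \<in> Hom C y x \<and> Cmp C x y x g f = Idn C x \<and> Cmp C y x y f g = Idn C y)"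

definition aut_group :: "('o, 'a, 'z) cat_scheme \<Rightarrow> 'o \<Rightarrow> 'a monoid" where
  "aut_group C x = \<lparr>carrier = {f. is_iso C x x f}, monoid.mult = Cmp C x x x, one = Idn C x\<rparr>"

record ('o, 'a, 'p, 'b) func =
  FO :: "'o \<Rightarrow> 'p"
  FA :: "'o \<Rightarrow> 'o \<Rightarrow> 'a \<Rightarrow> 'b"

locale cat_functor = C: category C + D: category D
  for C :: "('o, 'a, 'z) cat_scheme" and D :: "('p, 'b, 'y) cat_scheme" +
  fixes F :: "('o, 'a, 'p, 'b, 'w) func_scheme"
  assumes FO_ob: "x \<in> Ob C \<Longrightarrow> FO F x \<in> Ob D"
    and FA_hom: "\<lbrakk>x \<in> Ob C; y \<in> Ob C; f \<in> Hom C x y\<rbrakk> \<Longrightarrow> FA F x y f \<in> Hom D (FO F x) (FO F y)"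
    and FA_id: "x \<in> Ob C \<Longrightarrow> FA F x x (Idn C x) = Idn D (FO F x)"
    and FA_cmp: "\<lbrakk>x \<in> Ob C; y \<in> Ob C; z \<in> Ob C; f \<in> Hom C x y; g \<in> Hom C y z\<rbrakk>
      \<Longrightarrow> FA F x z (Cmp C x y z g f) =
          Cmp D (FO F x) (FO F y) (FO F z) (FA F y z g) (FA F x y f)"

text \<open>Functors that occur as objects of a functor category are undefined off their domain, so that
  equality of functors is literal equality.\<close>

definition ext_func :: "('o, 'a, 'z) cat_scheme \<Rightarrow> ('o, 'a, 'p, 'b) func \<Rightarrow> bool" where
  "ext_func C F \<longleftrightarrow> (\<forall>x. x \<notin> Ob C \<longrightarrow> FO F x = undefined) \<and>
     (\<forall>x y f. \<not> (x \<in> Ob C \<and> y \<in> Ob C \<and> f \<in> Hom C x y) \<longrightarrow> FA F x y f = undefined)"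

definition mk_func :: "('o, 'a, 'z) cat_scheme \<Rightarrow> ('o \<Rightarrow> 'p) \<Rightarrow> ('o \<Rightarrow> 'o \<Rightarrow> 'a \<Rightarrow> 'b)
    \<Rightarrow> ('o, 'a, 'p, 'b) func" where
  "mk_func C fo fa = \<lparr>FO = (\<lambda>x. if x \<in> Ob C then fo x else undefined),
     FA = (\<lambda>x y f. if x \<in> Ob C \<and> y \<in> Ob C \<and> f \<in> Hom C x y then fa x y f else undefined)\<rparr>"

definition id_func :: "('o, 'a, 'z) cat_scheme \<Rightarrow> ('o, 'a, 'o, 'a) func" where
  "id_func C = mk_func C (\<lambda>x. x) (\<lambda>x y f. f)"

definition comp_func :: "('o, 'a, 'z) cat_scheme \<Rightarrow> ('p, 'b, 'q, 'c, 'v) func_scheme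
    \<Rightarrow> ('o, 'a, 'p, 'b, 'w) func_scheme \<Rightarrow> ('o, 'a, 'q, 'c) func" where
  "comp_func C G F = mk_func C (\<lambda>x. FO G (FO F x))
     (\<lambda>x y f. FA G (FO F x) (FO F y) (FA F x y f))"

definition nat_iso :: "('o, 'a, 'z) cat_scheme \<Rightarrow> ('p, 'b, 'y) cat_scheme
    \<Rightarrow> ('o, 'a, 'p, 'b, 'v) func_scheme \<Rightarrow> ('o, 'a, 'p, 'b, 'w) func_scheme
    \<Rightarrow> ('o \<Rightarrow> 'b) \<Rightarrow> bool" where
  "nat_iso C D F G \<eta> \<longleftrightarrow>
     (\<forall>x\<in>Ob C. is_iso D (FO F x) (FO G x) (\<eta> x)) \<and>
     (\<forall>x\<in>Ob C. \<forall>y\<in>Ob C. \<forall>f\<in>Hom C x y.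
        Cmp D (FO F x) (FO G x) (FO G y) (FA G x y f) (\<eta> x) =
        Cmp D (FO F x) (FO F y) (FO G y) (\<eta> y) (FA F x y f))"

definition equivalence :: "('o, 'a, 'z) cat_scheme \<Rightarrow> ('p, 'b, 'y) cat_scheme
    \<Rightarrow> ('o, 'a, 'p, 'b, 'w) func_scheme \<Rightarrow> bool" where
  "equivalence C D F \<longleftrightarrow> cat_functor C D F \<and>
     (\<exists>(G :: ('p, 'b, 'o, 'a) func) \<eta> \<theta>. cat_functor D C G \<and>
        nat_iso C C (id_func C) (comp_func C G F) \<eta> \<and>
        nat_iso D D (comp_func D F G) (id_func D) \<theta>)"

record ('o, 'a, 's) lincat = "('o, 'a) cat" +
  AAdd :: "'o \<Rightarrow> 'o \<Rightarrow> 'a \<Rightarrow> 'a \<Rightarrow> 'a"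
  AScl :: "'o \<Rightarrow> 'o \<Rightarrow> 's \<Rightarrow> 'a \<Rightarrow> 'a"

definition linear_func :: "('o, 'a, 's, 'z) lincat_scheme \<Rightarrow> ('p, 'b, 's, 'y) lincat_scheme
    \<Rightarrow> ('o, 'a, 'p, 'b, 'w) func_scheme \<Rightarrow> bool" where
  "linear_func C D F \<longleftrightarrow> (\<forall>x\<in>Ob C. \<forall>y\<in>Ob C. \<forall>f\<in>Hom C x y.
     (\<forall>g\<in>Hom C x y. FA F x y (AAdd C x y f g) = AAdd D (FO F x) (FO F y) (FA F x y f) (FA F x y g)) \<and>
     (\<forall>c. FA F x y (AScl C x y c f) = AScl D (FO F x) (FO F y) c (FA F x y f)))"

definition zero_arrow :: "('o, 'a, 's::zero, 'z) lincat_scheme \<Rightarrow> 'o \<Rightarrow> 'o \<Rightarrow> 'a \<Rightarrow> bool" where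
  "zero_arrow C x y f \<longleftrightarrow> f \<in> Hom C x y \<and> AScl C x y 0 f = f"

definition is_kernel :: "('o, 'a, 's::zero, 'z) lincat_scheme
    \<Rightarrow> 'o \<Rightarrow> 'o \<Rightarrow> 'o \<Rightarrow> 'a \<Rightarrow> 'a \<Rightarrow> bool" where
  "is_kernel C x y z f g \<longleftrightarrow> f \<in> Hom C x y \<and> g \<in> Hom C y z \<and> zero_arrow C x z (Cmp C x y z g f) \<and>
     (\<forall>w\<in>Ob C. \<forall>h\<in>Hom C w y. zero_arrow C w z (Cmp C w y z g h) \<longrightarrow>
        (\<exists>!u. u \<in> Hom C w x \<and> Cmp C w x y f u = h))"

definition is_cokernel :: "('o, 'a, 's::zero, 'z) lincat_scheme
    \<Rightarrow> 'o \<Rightarrow> 'o \<Rightarrow> 'o \<Rightarrow> 'a \<Rightarrow> 'a \<Rightarrow> bool" where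
  "is_cokernel C x y z f g \<longleftrightarrow> f \<in> Hom C x y \<and> g \<in> Hom C y z \<and> zero_arrow C x z (Cmp C x y z g f) \<and>
     (\<forall>w\<in>Ob C. \<forall>h\<in>Hom C y w. zero_arrow C x w (Cmp C x y w h f) \<longrightarrow>
        (\<exists>!u. u \<in> Hom C z w \<and> Cmp C y z w u g = h))"

definition short_exact :: "('o, 'a, 's::zero, 'z) lincat_scheme
    \<Rightarrow> 'o \<Rightarrow> 'o \<Rightarrow> 'o \<Rightarrow> 'a \<Rightarrow> 'a \<Rightarrow> bool" where
  "short_exact C x y z f g \<longleftrightarrow> is_kernel C x y z f g \<and> is_cokernel C x y z f g"

definition exact_func :: "('o, 'a, 's::zero, 'z) lincat_scheme \<Rightarrow> ('p, 'b, 's, 'y) lincat_scheme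
    \<Rightarrow> ('o, 'a, 'p, 'b, 'w) func_scheme \<Rightarrow> bool" where
  "exact_func C D F \<longleftrightarrow> (\<forall>x\<in>Ob C. \<forall>y\<in>Ob C. \<forall>z\<in>Ob C. \<forall>f g. short_exact C x y z f g \<longrightarrow>
     short_exact D (FO F x) (FO F y) (FO F z) (FA F x y f) (FA F y z g))"


section \<open>Monoidal categories and 2-groups\<close>

text \<open>A typed arrow \<open>(x, f, y)\<close> is an arrow \<open>f\<close> together with its source \<open>x\<close> and target \<open>y\<close>.
  \<open>comps C [f, g, h]\<close> composes typed arrows in diagrammatic order.\<close>

type_synonym ('o, 'a) tarr = "'o \<times> 'a \<times> 'o"

definition tid :: "('o, 'a, 'z) cat_scheme \<Rightarrow> 'o \<Rightarrow> ('o, 'a) tarr" where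
  "tid C x = (x, Idn C x, x)"

fun tcomp :: "('o, 'a, 'z) cat_scheme \<Rightarrow> ('o, 'a) tarr \<Rightarrow> ('o, 'a) tarr \<Rightarrow> ('o, 'a) tarr" where
  "tcomp C (x, f, y) (y', g, z) = (x, Cmp C x y z g f, z)"

fun comps :: "('o, 'a, 'z) cat_scheme \<Rightarrow> ('o, 'a) tarr list \<Rightarrow> ('o, 'a) tarr" where
  "comps C [] = undefined"
| "comps C [f] = f"
| "comps C (f # g # fs) = comps C (tcomp C f g # fs)"

fun tinv :: "('o, 'a, 'z) cat_scheme \<Rightarrow> ('o, 'a) tarr \<Rightarrow> ('o, 'a) tarr" where
  "tinv C (x, f, y) = (y, inv_arrow C x y f, x)"

fun tmap :: "('o, 'a, 'p, 'b, 'w) func_scheme \<Rightarrow> ('o, 'a) tarr \<Rightarrow> ('p, 'b) tarr" where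
  "tmap F (x, f, y) = (FO F x, FA F x y f, FO F y)"

abbreviation arrow_of :: "('o, 'a) tarr \<Rightarrow> 'a" where
  "arrow_of t \<equiv> fst (snd t)"

definition tarrs :: "('o, 'a, 'z) cat_scheme \<Rightarrow> ('o, 'a) tarr set" where
  "tarrs C = {(x, f, y). x \<in> Ob C \<and> y \<in> Ob C \<and> f \<in> Hom C x y}"

definition tisos :: "('o, 'a, 'z) cat_scheme \<Rightarrow> ('o, 'a) tarr set" where
  "tisos C = {(x, f, y). x \<in> Ob C \<and> y \<in> Ob C \<and> is_iso C x y f}"

text \<open>\<open>Asc M x y z : (x \<otimes> y) \<otimes> z \<rightarrow> x \<otimes> (y \<otimes> z)\<close>, \<open>LUn M x : 1 \<otimes> x \<rightarrow> x\<close>,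
  \<open>RUn M x : x \<otimes> 1 \<rightarrow> x\<close>.\<close>

record ('o, 'a) moncat = "('o, 'a) cat" +
  UnO  :: 'o
  TenO :: "'o \<Rightarrow> 'o \<Rightarrow> 'o"
  TenA :: "('o, 'a) tarr \<Rightarrow> ('o, 'a) tarr \<Rightarrow> 'a"
  Asc  :: "'o \<Rightarrow> 'o \<Rightarrow> 'o \<Rightarrow> 'a"
  LUn  :: "'o \<Rightarrow> 'a"
  RUn  :: "'o \<Rightarrow> 'a"

definition ten :: "('o, 'a, 'z) moncat_scheme \<Rightarrow> ('o, 'a) tarr \<Rightarrow> ('o, 'a) tarr \<Rightarrow> ('o, 'a) tarr" where
  "ten M s t = (TenO M (fst s) (fst t), TenA M s t, TenO M (snd (snd s)) (snd (snd t)))"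

definition tasc :: "('o, 'a, 'z) moncat_scheme \<Rightarrow> 'o \<Rightarrow> 'o \<Rightarrow> 'o \<Rightarrow> ('o, 'a) tarr" where
  "tasc M x y z = (TenO M (TenO M x y) z, Asc M x y z, TenO M x (TenO M y z))"

definition tlun :: "('o, 'a, 'z) moncat_scheme \<Rightarrow> 'o \<Rightarrow> ('o, 'a) tarr" where
  "tlun M x = (TenO M (UnO M) x, LUn M x, x)"

definition trun :: "('o, 'a, 'z) moncat_scheme \<Rightarrow> 'o \<Rightarrow> ('o, 'a) tarr" where
  "trun M x = (TenO M x (UnO M), RUn M x, x)"

locale monoidal_category = category M for M :: "('o, 'a, 'z) moncat_scheme" +
  assumes UnO_ob: "UnO M \<in> Ob M"
    and TenO_ob: "\<lbrakk>x \<in> Ob M; y \<in> Ob M\<rbrakk> \<Longrightarrow> TenO M x y \<in> Ob M"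
    and ten_arr: "\<lbrakk>s \<in> tarrs M; t \<in> tarrs M\<rbrakk> \<Longrightarrow> ten M s t \<in> tarrs M"
    and ten_id: "\<lbrakk>x \<in> Ob M; y \<in> Ob M\<rbrakk> \<Longrightarrow> ten M (tid M x) (tid M y) = tid M (TenO M x y)"
    and ten_comp: "\<lbrakk>(x, f, y) \<in> tarrs M; (y, g, z) \<in> tarrs M; (x', f', y') \<in> tarrs M;
        (y', g', z') \<in> tarrs M\<rbrakk> \<Longrightarrow>
      ten M (tcomp M (x, f, y) (y, g, z)) (tcomp M (x', f', y') (y', g', z')) =
      tcomp M (ten M (x, f, y) (x', f', y')) (ten M (y, g, z) (y', g', z'))"
    and asc_iso: "\<lbrakk>x \<in> Ob M; y \<in> Ob M; z \<in> Ob M\<rbrakk> \<Longrightarrow> tasc M x y z \<in> tisos M"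
    and lun_iso: "x \<in> Ob M \<Longrightarrow> tlun M x \<in> tisos M"
    and run_iso: "x \<in> Ob M \<Longrightarrow> trun M x \<in> tisos M"
    and asc_nat: "\<lbrakk>(x, f, x') \<in> tarrs M; (y, g, y') \<in> tarrs M; (z, h, z') \<in> tarrs M\<rbrakk> \<Longrightarrow>
      comps M [ten M (ten M (x, f, x') (y, g, y')) (z, h, z'), tasc M x' y' z'] =
      comps M [tasc M x y z, ten M (x, f, x') (ten M (y, g, y') (z, h, z'))]"
    and lun_nat: "(x, f, y) \<in> tarrs M \<Longrightarrow>
      comps M [ten M (tid M (UnO M)) (x, f, y), tlun M y] = comps M [tlun M x, (x, f, y)]"
    and run_nat: "(x, f, y) \<in> tarrs M \<Longrightarrow>
      comps M [ten M (x, f, y) (tid M (UnO M)), trun M y] = comps M [trun M x, (x, f, y)]"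
    and pentagon: "\<lbrakk>w \<in> Ob M; x \<in> Ob M; y \<in> Ob M; z \<in> Ob M\<rbrakk> \<Longrightarrow>
      comps M [ten M (tasc M w x y) (tid M z), tasc M w (TenO M x y) z,
               ten M (tid M w) (tasc M x y z)] =
      comps M [tasc M (TenO M w x) y z, tasc M w x (TenO M y z)]"
    and triangle: "\<lbrakk>x \<in> Ob M; y \<in> Ob M\<rbrakk> \<Longrightarrow>
      comps M [tasc M x (UnO M) y, ten M (tid M x) (tlun M y)] = ten M (trun M x) (tid M y)"

text \<open>A coherent choice of weak inverses makes every object part of an adjoint equivalence:
  \<open>iu x : 1 \<rightarrow> x \<otimes> iv x\<close> and \<open>ec x : iv x \<otimes> x \<rightarrow> 1\<close> satisfy both zig-zag identities.\<close>

definition coherent_inverses :: "('o, 'a, 'z) moncat_scheme \<Rightarrow> ('o \<Rightarrow> 'o) \<Rightarrow> ('o \<Rightarrow> 'a) \<Rightarrow> ('o \<Rightarrow> 'a)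
    \<Rightarrow> bool" where
  "coherent_inverses M iv iu ec \<longleftrightarrow> (\<forall>x\<in>Ob M. iv x \<in> Ob M \<and>
     (let i = (UnO M, iu x, TenO M x (iv x)); e = (TenO M (iv x) x, ec x, UnO M) in
       i \<in> tisos M \<and> e \<in> tisos M \<and>
       comps M [tinv M (tlun M x), ten M i (tid M x), tasc M x (iv x) x, ten M (tid M x) e, trun M x]
         = tid M x \<and>
       comps M [tinv M (trun M (iv x)), ten M (tid M (iv x)) i, tinv M (tasc M (iv x) x (iv x)),
                ten M e (tid M (iv x)), tlun M (iv x)] = tid M (iv x)))"

definition coherent_2group :: "('o, 'a, 'z) moncat_scheme \<Rightarrow> bool" where
  "coherent_2group M \<longleftrightarrow> monoidal_category M \<and>
     (\<forall>x\<in>Ob M. \<forall>y\<in>Ob M. \<forall>f\<in>Hom M x y. is_iso M x y f) \<and>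
     (\<exists>iv iu ec. coherent_inverses M iv iu ec)"

text \<open>\<open>FMu F x y : F x \<otimes> F y \<rightarrow> F (x \<otimes> y)\<close> and \<open>FEp F : 1 \<rightarrow> F 1\<close>.\<close>

record ('o, 'a, 'p, 'b) mfunc = "('o, 'a, 'p, 'b) func" +
  FMu :: "'o \<Rightarrow> 'o \<Rightarrow> 'b"
  FEp :: 'b

definition tmu :: "('o, 'a, 'z) moncat_scheme \<Rightarrow> ('p, 'b, 'y) moncat_scheme
    \<Rightarrow> ('o, 'a, 'p, 'b, 'w) mfunc_scheme \<Rightarrow> 'o \<Rightarrow> 'o \<Rightarrow> ('p, 'b) tarr" where
  "tmu M N F x y = (TenO N (FO F x) (FO F y), FMu F x y, FO F (TenO M x y))"

definition tep :: "('o, 'a, 'z) moncat_scheme \<Rightarrow> ('p, 'b, 'y) moncat_scheme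
    \<Rightarrow> ('o, 'a, 'p, 'b, 'w) mfunc_scheme \<Rightarrow> ('p, 'b) tarr" where
  "tep M N F = (UnO N, FEp F, FO F (UnO M))"

locale strong_monoidal_functor =
  M: monoidal_category M + N: monoidal_category N + cat_functor M N F
  for M :: "('o, 'a, 'z) moncat_scheme" and N :: "('p, 'b, 'y) moncat_scheme"
    and F :: "('o, 'a, 'p, 'b, 'w) mfunc_scheme" +
  assumes mu_iso: "\<lbrakk>x \<in> Ob M; y \<in> Ob M\<rbrakk> \<Longrightarrow> tmu M N F x y \<in> tisos N"
    and ep_iso: "tep M N F \<in> tisos N"
    and mu_nat: "\<lbrakk>(x, f, x') \<in> tarrs M; (y, g, y') \<in> tarrs M\<rbrakk> \<Longrightarrow>
      comps N [ten N (tmap F (x, f, x')) (tmap F (y, g, y')), tmu M N F x' y'] =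
      comps N [tmu M N F x y, tmap F (ten M (x, f, x') (y, g, y'))]"
    and mu_assoc: "\<lbrakk>x \<in> Ob M; y \<in> Ob M; z \<in> Ob M\<rbrakk> \<Longrightarrow>
      comps N [ten N (tmu M N F x y) (tid N (FO F z)), tmu M N F (TenO M x y) z, tmap F (tasc M x y z)] =
      comps N [tasc N (FO F x) (FO F y) (FO F z), ten N (tid N (FO F x)) (tmu M N F y z),
               tmu M N F x (TenO M y z)]"
    and mu_lun: "x \<in> Ob M \<Longrightarrow>
      comps N [ten N (tep M N F) (tid N (FO F x)), tmu M N F (UnO M) x, tmap F (tlun M x)] =
      tlun N (FO F x)"
    and mu_run: "x \<in> Ob M \<Longrightarrow>
      comps N [ten N (tid N (FO F x)) (tep M N F), tmu M N F x (UnO M), tmap F (trun M x)] =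
      trun N (FO F x)"

text \<open>\<open>comp_mfunc M N L G F\<close> is \<open>G \<circ> F\<close> for \<open>F : M \<rightarrow> N\<close>, \<open>G : N \<rightarrow> L\<close>.\<close>

definition comp_mfunc :: "('o, 'a, 'z) moncat_scheme \<Rightarrow> ('p, 'b, 'y) moncat_scheme
    \<Rightarrow> ('q, 'c, 'x) moncat_scheme \<Rightarrow> ('p, 'b, 'q, 'c) mfunc \<Rightarrow> ('o, 'a, 'p, 'b) mfunc
    \<Rightarrow> ('o, 'a, 'q, 'c) mfunc" where
  "comp_mfunc M N L G F = \<lparr>
     FO = (\<lambda>x. FO G (FO F x)),
     FA = (\<lambda>x y f. FA G (FO F x) (FO F y) (FA F x y f)),
     FMu = (\<lambda>x y. arrow_of (comps L [tmu N L G (FO F x) (FO F y), tmap G (tmu M N F x y)])),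
     FEp = arrow_of (comps L [tep N L G, tmap G (tep M N F)])\<rparr>"

definition mfunc_eq_on :: "('o, 'a, 'z) moncat_scheme \<Rightarrow> ('o, 'a, 'p, 'b) mfunc
    \<Rightarrow> ('o, 'a, 'p, 'b) mfunc \<Rightarrow> bool" where
  "mfunc_eq_on M F G \<longleftrightarrow> (\<forall>x\<in>Ob M. FO F x = FO G x) \<and>
     (\<forall>x\<in>Ob M. \<forall>y\<in>Ob M. \<forall>f\<in>Hom M x y. FA F x y f = FA G x y f) \<and>
     (\<forall>x\<in>Ob M. \<forall>y\<in>Ob M. FMu F x y = FMu G x y) \<and> FEp F = FEp G"

definition monoidal_equivalence :: "('o, 'a, 'z) moncat_scheme \<Rightarrow> ('p, 'b, 'y) moncat_scheme
    \<Rightarrow> ('o, 'a, 'p, 'b, 'w) mfunc_scheme \<Rightarrow> bool" where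
  "monoidal_equivalence M N F \<longleftrightarrow> strong_monoidal_functor M N F \<and> equivalence M N F"

definition monoidally_equivalent :: "('o, 'a, 'z) moncat_scheme \<Rightarrow> ('p, 'b, 'y) moncat_scheme \<Rightarrow> bool" where
  "monoidally_equivalent M N \<longleftrightarrow>
     (\<exists>F :: ('o, 'a, 'p, 'b) mfunc. monoidal_equivalence M N F)"

text \<open>The discrete 2-group of a group and the 2-group map of a group homomorphism.\<close>

definition disc :: "('g, 'z) monoid_scheme \<Rightarrow> ('g, unit) moncat" where
  "disc Q = \<lparr>Ob = carrier Q, Hom = (\<lambda>x y. {_. x = y}), Idn = (\<lambda>_. ()), Cmp = (\<lambda>_ _ _ _ _. ()),
     UnO = one Q, TenO = monoid.mult Q, TenA = (\<lambda>_ _. ()), Asc = (\<lambda>_ _ _. ()), LUn = (\<lambda>_. ()),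
     RUn = (\<lambda>_. ())\<rparr>"

definition disc_map :: "('g \<Rightarrow> 'h) \<Rightarrow> ('g, unit, 'h, unit) mfunc" where
  "disc_map \<phi> = \<lparr>FO = \<phi>, FA = (\<lambda>_ _ _. ()), FMu = (\<lambda>_ _. ()), FEp = ()\<rparr>"

text \<open>Homotopy pullback of \<open>P : M \<rightarrow> K\<close> and \<open>Q : N \<rightarrow> K\<close>: objects are triples
  \<open>(x, y, f : P x \<cong> Q y)\<close>.\<close>

definition hpullback :: "('o, 'a, 'z) moncat_scheme \<Rightarrow> ('p, 'b, 'y) moncat_scheme
    \<Rightarrow> ('q, 'c, 'x) moncat_scheme \<Rightarrow> ('o, 'a, 'q, 'c) mfunc \<Rightarrow> ('p, 'b, 'q, 'c) mfunc
    \<Rightarrow> ('o \<times> 'p \<times> 'c, 'a \<times> 'b) moncat" where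
  "hpullback M N K P Q = \<lparr>
     Ob = {(x, y, f). x \<in> Ob M \<and> y \<in> Ob N \<and> is_iso K (FO P x) (FO Q y) f},
     Hom = (\<lambda>(x, y, f) (x', y', f'). {(a, b). a \<in> Hom M x x' \<and> b \<in> Hom N y y' \<and>
        comps K [(FO P x, f, FO Q y), tmap Q (y, b, y')] =
        comps K [tmap P (x, a, x'), (FO P x', f', FO Q y')]}),
     Idn = (\<lambda>(x, y, f). (Idn M x, Idn N y)),
     Cmp = (\<lambda>(x, y, f) (x', y', f') (x'', y'', f'') (a', b') (a, b).
        (Cmp M x x' x'' a' a, Cmp N y y' y'' b' b)),
     UnO = (UnO M, UnO N, arrow_of (comps K [tinv K (tep M K P), tep N K Q])),
     TenO = (\<lambda>(x, y, f) (x', y', f'). (TenO M x x', TenO N y y',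
        arrow_of (comps K [tinv K (tmu M K P x x'),
          ten K (FO P x, f, FO Q y) (FO P x', f', FO Q y'), tmu N K Q y y']))),
     TenA = (\<lambda>((x, y, f), (a, b), (z, w, g)) ((x', y', f'), (a', b'), (z', w', g')).
        (TenA M (x, a, z) (x', a', z'), TenA N (y, b, w) (y', b', w'))),
     Asc = (\<lambda>(x, y, f) (x', y', f') (x'', y'', f''). (Asc M x x' x'', Asc N y y' y'')),
     LUn = (\<lambda>(x, y, f). (LUn M x, LUn N y)),
     RUn = (\<lambda>(x, y, f). (RUn M x, RUn N y))\<rparr>"

definition hpullback_fst :: "('o, 'a, 'z) moncat_scheme
    \<Rightarrow> ('o \<times> 'p \<times> 'c, 'a \<times> 'b, 'o, 'a) mfunc" where
  "hpullback_fst M = \<lparr>FO = (\<lambda>X. fst X), FA = (\<lambda>X Y u. fst u),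
     FMu = (\<lambda>X Y. Idn M (TenO M (fst X) (fst Y))), FEp = Idn M (UnO M)\<rparr>"

text \<open>Homotopy fibre of \<open>Q : M \<rightarrow> K\<close> over the unit: objects are pairs \<open>(x, f : Q x \<cong> 1)\<close>.\<close>

definition hfiber :: "('o, 'a, 'z) moncat_scheme \<Rightarrow> ('q, 'c, 'x) moncat_scheme
    \<Rightarrow> ('o, 'a, 'q, 'c) mfunc \<Rightarrow> ('o \<times> 'c, 'a) moncat" where
  "hfiber M K Q = \<lparr>
     Ob = {(x, f). x \<in> Ob M \<and> is_iso K (FO Q x) (UnO K) f},
     Hom = (\<lambda>(x, f) (y, g). {a \<in> Hom M x y.
        comps K [tmap Q (x, a, y), (FO Q y, g, UnO K)] = (FO Q x, f, UnO K)}),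
     Idn = (\<lambda>(x, f). Idn M x),
     Cmp = (\<lambda>(x, f) (y, g) (z, h). Cmp M x y z),
     UnO = (UnO M, arrow_of (tinv K (tep M K Q))),
     TenO = (\<lambda>(x, f) (y, g). (TenO M x y,
        arrow_of (comps K [tinv K (tmu M K Q x y), ten K (FO Q x, f, UnO K) (FO Q y, g, UnO K),
          tlun K (UnO K)]))),
     TenA = (\<lambda>((x, f), a, (y, g)) ((x', f'), a', (y', g')). TenA M (x, a, y) (x', a', y')),
     Asc = (\<lambda>(x, f) (y, g) (z, h). Asc M x y z),
     LUn = (\<lambda>(x, f). LUn M x),
     RUn = (\<lambda>(x, f). RUn M x)\<rparr>"

definition hfiber_forget :: "('o, 'a, 'z) moncat_scheme \<Rightarrow> ('o \<times> 'c, 'a, 'o, 'a) mfunc" where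
  "hfiber_forget M = \<lparr>FO = (\<lambda>X. fst X), FA = (\<lambda>X Y u. u),
     FMu = (\<lambda>X Y. Idn M (TenO M (fst X) (fst Y))), FEp = Idn M (UnO M)\<rparr>"

record ('o, 'a) symmoncat = "('o, 'a) moncat" +
  Sym :: "'o \<Rightarrow> 'o \<Rightarrow> 'a"

definition tsym :: "('o, 'a, 'z) symmoncat_scheme \<Rightarrow> 'o \<Rightarrow> 'o \<Rightarrow> ('o, 'a) tarr" where
  "tsym P x y = (TenO P x y, Sym P x y, TenO P y x)"

locale picard_groupoid =
  fixes P :: "('o, 'a, 'z) symmoncat_scheme"
  assumes two_group: "coherent_2group P"
    and sym_arr: "\<lbrakk>x \<in> Ob P; y \<in> Ob P\<rbrakk> \<Longrightarrow> tsym P x y \<in> tarrs P"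
    and sym_nat: "\<lbrakk>(x, f, x') \<in> tarrs P; (y, g, y') \<in> tarrs P\<rbrakk> \<Longrightarrow>
      comps P [ten P (x, f, x') (y, g, y'), tsym P x' y'] =
      comps P [tsym P x y, ten P (y, g, y') (x, f, x')]"
    and sym_sym: "\<lbrakk>x \<in> Ob P; y \<in> Ob P\<rbrakk> \<Longrightarrow> comps P [tsym P x y, tsym P y x] = tid P (TenO P x y)"
    and hexagon: "\<lbrakk>x \<in> Ob P; y \<in> Ob P; z \<in> Ob P\<rbrakk> \<Longrightarrow>
      comps P [tasc P x y z, tsym P x (TenO P y z), tasc P y z x] =
      comps P [ten P (tsym P x y) (tid P z), tasc P y x z, ten P (tid P y) (tsym P x z)]"

text \<open>Centrality datum: \<open>c a g : i a \<otimes> g \<rightarrow> g \<otimes> i a\<close> lifts \<open>i : P \<rightarrow> E\<close> to a braided functor from the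
  Picard groupoid \<open>P\<close> to the Drinfeld centre of \<open>E\<close>.\<close>

definition central_structure :: "('o, 'a, 'z) symmoncat_scheme \<Rightarrow> ('p, 'b, 'y) moncat_scheme
    \<Rightarrow> ('o, 'a, 'p, 'b) mfunc \<Rightarrow> ('o \<Rightarrow> 'p \<Rightarrow> 'b) \<Rightarrow> bool" where
  "central_structure P E i c \<longleftrightarrow>
    (let tc = (\<lambda>a g. (TenO E (FO i a) g, c a g, TenO E g (FO i a))) in
     (\<forall>a\<in>Ob P. \<forall>g\<in>Ob E. tc a g \<in> tisos E) \<and>
     (\<forall>(a, s, a')\<in>tarrs P. \<forall>(g, t, g')\<in>tarrs E.
        comps E [ten E (tmap i (a, s, a')) (g, t, g'), tc a' g'] =
        comps E [tc a g, ten E (g, t, g') (tmap i (a, s, a'))]) \<and>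
     (\<forall>a\<in>Ob P. \<forall>g\<in>Ob E. \<forall>g'\<in>Ob E.
        comps E [tasc E (FO i a) g g', tc a (TenO E g g'), tasc E g g' (FO i a)] =
        comps E [ten E (tc a g) (tid E g'), tasc E g (FO i a) g', ten E (tid E g) (tc a g')]) \<and>
     (\<forall>a\<in>Ob P. \<forall>b\<in>Ob P. \<forall>g\<in>Ob E.
        comps E [ten E (tmu P E i a b) (tid E g), tc (TenO P a b) g] =
        comps E [tasc E (FO i a) (FO i b) g, ten E (tid E (FO i a)) (tc b g),
                 tinv E (tasc E (FO i a) g (FO i b)), ten E (tc a g) (tid E (FO i b)),
                 tasc E g (FO i a) (FO i b), ten E (tid E g) (tmu P E i a b)]) \<and>
     (\<forall>a\<in>Ob P. \<forall>b\<in>Ob P.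
        comps E [tmu P E i a b, tmap i (tsym P a b)] =
        comps E [tc a (FO i b), tmu P E i b a]))"

text \<open>A central extension \<open>P \<rightarrow> E \<rightarrow> Q\<^sub>d\<^sub>i\<^sub>s\<^sub>c\<close> of 2-groups: \<open>q\<close> is essentially surjective, \<open>i\<close> is the
  composite of an equivalence of \<open>P\<close> with the homotopy fibre of \<open>q\<close> and the forgetful functor
  of the fibre, and \<open>i\<close> is central.\<close>

definition central_extension :: "('o, 'a, 'z) symmoncat_scheme \<Rightarrow> ('p, 'b) moncat
    \<Rightarrow> 'g monoid \<Rightarrow> ('o, 'a, 'p, 'b) mfunc \<Rightarrow> ('p, 'b, 'g, unit) mfunc \<Rightarrow> bool" where
  "central_extension P E Q i q \<longleftrightarrow>
     picard_groupoid P \<and> coherent_2group E \<and> coherent_2group (disc Q) \<and>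
     strong_monoidal_functor P E i \<and> strong_monoidal_functor E (disc Q) q \<and>
     (\<forall>z\<in>Ob (disc Q). \<exists>x\<in>Ob E. \<exists>f. is_iso (disc Q) (FO q x) z f) \<and>
     (\<exists>\<kappa>. monoidal_equivalence P (hfiber E (disc Q) q) \<kappa> \<and>
        mfunc_eq_on P i (comp_mfunc P (hfiber E (disc Q) q) E (hfiber_forget E) \<kappa>)) \<and>
     (\<exists>c. central_structure P E i c)"


section \<open>2-representations\<close>

type_synonym ('o, 'a) endo = "('o, 'a, 'o, 'a) func"

text \<open>For a set \<open>S\<close> of endofunctors of \<open>A\<close>: the (strict) monoidal category with objects \<open>S\<close>, natural
  isomorphisms as arrows and composition of functors as tensor product.\<close>

definition endo_moncat :: "('o, 'a, 's, 'z) lincat_scheme \<Rightarrow> ('o, 'a) endo set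
    \<Rightarrow> (('o, 'a) endo, 'o \<Rightarrow> 'a) moncat" where
  "endo_moncat A S =
    (let idt = (\<lambda>F. \<lambda>x\<in>Ob A. Idn A (FO F x)) in \<lparr>
     Ob = S,
     Hom = (\<lambda>F G. {\<eta> \<in> extensional (Ob A). nat_iso A A F G \<eta>}),
     Idn = idt,
     Cmp = (\<lambda>F G H \<theta> \<eta>. \<lambda>x\<in>Ob A. Cmp A (FO F x) (FO G x) (FO H x) (\<theta> x) (\<eta> x)),
     UnO = id_func A,
     TenO = comp_func A,
     TenA = (\<lambda>(F, \<eta>, F') (G, \<theta>, G'). \<lambda>x\<in>Ob A.
        Cmp A (FO F (FO G x)) (FO F (FO G' x)) (FO F' (FO G' x))
          (\<eta> (FO G' x)) (FA F (FO G x) (FO G' x) (\<theta> x))),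
     Asc = (\<lambda>F G H. idt (comp_func A F (comp_func A G H))),
     LUn = idt,
     RUn = idt\<rparr>)"

definition lin_aut :: "('o, 'a, 's, 'z) lincat_scheme \<Rightarrow> (('o, 'a) endo, 'o \<Rightarrow> 'a) moncat" where
  "lin_aut A = endo_moncat A {F. ext_func A F \<and> equivalence A A F \<and> linear_func A A F}"

definition exact_aut :: "('o, 'a, 's::zero, 'z) lincat_scheme
    \<Rightarrow> (('o, 'a) endo, 'o \<Rightarrow> 'a) moncat" where
  "exact_aut A = endo_moncat A {F. ext_func A F \<and> equivalence A A F \<and> linear_func A A F \<and>
     exact_func A A F}"

definition two_rep :: "('p, 'b, 'z) moncat_scheme \<Rightarrow> ('o, 'a, 's) lincat
    \<Rightarrow> ('p, 'b, ('o, 'a) endo, 'o \<Rightarrow> 'a) mfunc \<Rightarrow> bool" where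
  "two_rep G A \<Phi> \<longleftrightarrow> coherent_2group G \<and> strong_monoidal_functor G (lin_aut A) \<Phi>"

definition exact_two_rep :: "('p, 'b, 'z) moncat_scheme \<Rightarrow> ('o, 'a, 's::zero) lincat
    \<Rightarrow> ('p, 'b, ('o, 'a) endo, 'o \<Rightarrow> 'a) mfunc \<Rightarrow> bool" where
  "exact_two_rep G A \<Phi> \<longleftrightarrow> two_rep G A \<Phi> \<and> strong_monoidal_functor G (exact_aut A) \<Phi>"

definition strict_two_rep :: "('g, 'z) monoid_scheme \<Rightarrow> ('o, 'a, 's) lincat
    \<Rightarrow> ('g \<Rightarrow> ('o, 'a) endo) \<Rightarrow> ('g, unit, ('o, 'a) endo, 'o \<Rightarrow> 'a) mfunc" where
  "strict_two_rep Q A R =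
    (let idt = (\<lambda>h. \<lambda>x\<in>Ob A. Idn A (FO (R h) x)) in
     \<lparr>FO = R, FA = (\<lambda>h _ _. idt h), FMu = (\<lambda>h h'. idt (h \<otimes>\<^bsub>Q\<^esub> h')), FEp = idt \<one>\<^bsub>Q\<^esub>\<rparr>)"

definition exact_strict_action :: "('g, 'z) monoid_scheme \<Rightarrow> ('o, 'a, 's::zero) lincat
    \<Rightarrow> ('g \<Rightarrow> ('o, 'a) endo) \<Rightarrow> bool" where
  "exact_strict_action Q A R \<longleftrightarrow> (\<forall>h\<in>carrier Q. R h \<in> Ob (exact_aut A)) \<and> R \<one>\<^bsub>Q\<^esub> = id_func A \<and>
     (\<forall>h\<in>carrier Q. \<forall>h'\<in>carrier Q. R (h \<otimes>\<^bsub>Q\<^esub> h') = comp_func A (R h) (R h'))"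

definition uniformly_smooth :: "'g set set \<Rightarrow> ('o, 'a, 's) lincat \<Rightarrow> ('g \<Rightarrow> ('o, 'a) endo) \<Rightarrow> bool" where
  "uniformly_smooth \<C> A R \<longleftrightarrow>
     (\<forall>x\<in>Ob A. \<exists>C\<in>\<C>. \<forall>h\<in>C. FO (R h) x = x) \<and>
     (\<forall>t\<in>tarrs A. \<exists>C\<in>\<C>. \<forall>h\<in>C. tmap (R h) t = t)"

definition p_uniformly_smooth :: "('p, 'b, 'z) moncat_scheme \<Rightarrow> ('g, 'y) monoid_scheme \<Rightarrow> 'g set set
    \<Rightarrow> ('o, 'a, 's::zero) lincat \<Rightarrow> ('p, 'b, 'g, unit) mfunc
    \<Rightarrow> ('p, 'b, ('o, 'a) endo, 'o \<Rightarrow> 'a) mfunc \<Rightarrow> bool" where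
  "p_uniformly_smooth G Q \<C> A p \<Phi> \<longleftrightarrow> strong_monoidal_functor G (disc Q) p \<and>
     (\<exists>R. exact_strict_action Q A R \<and> uniformly_smooth \<C> A R \<and>
        \<Phi> = comp_mfunc G (disc Q) (exact_aut A) (strict_two_rep Q A R) p)"


section \<open>Filtered colimits of sets\<close>

definition colim_rel :: "'i set \<Rightarrow> ('i \<Rightarrow> 'i \<Rightarrow> bool) \<Rightarrow> ('i \<Rightarrow> 'a set) \<Rightarrow> ('i \<Rightarrow> 'i \<Rightarrow> 'a \<Rightarrow> 'a)
    \<Rightarrow> (('i \<times> 'a) \<times> ('i \<times> 'a)) set" where
  "colim_rel I leq X \<tau> = {((i, a), (j, b)). i \<in> I \<and> j \<in> I \<and> a \<in> X i \<and> b \<in> X j \<and>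
     (\<exists>l\<in>I. leq i l \<and> leq j l \<and> \<tau> i l a = \<tau> j l b)}"

definition dir_colim :: "'i set \<Rightarrow> ('i \<Rightarrow> 'i \<Rightarrow> bool) \<Rightarrow> ('i \<Rightarrow> 'a set) \<Rightarrow> ('i \<Rightarrow> 'i \<Rightarrow> 'a \<Rightarrow> 'a)
    \<Rightarrow> ('i \<times> 'a) set set" where
  "dir_colim I leq X \<tau> = (SIGMA i:I. X i) // colim_rel I leq X \<tau>"


section \<open>Vector spaces with explicit carrier\<close>

record ('s, 'v) vspace =
  Vcar  :: "'v set"
  Vadd  :: "'v \<Rightarrow> 'v \<Rightarrow> 'v"
  Vzero :: 'v
  Vscl  :: "'s \<Rightarrow> 'v \<Rightarrow> 'v"

locale vec_space =
  fixes V :: "('s::field, 'v) vspace"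
  assumes add_closed: "\<lbrakk>x \<in> Vcar V; y \<in> Vcar V\<rbrakk> \<Longrightarrow> Vadd V x y \<in> Vcar V"
    and zero_closed: "Vzero V \<in> Vcar V"
    and scl_closed: "x \<in> Vcar V \<Longrightarrow> Vscl V c x \<in> Vcar V"
    and add_assoc: "\<lbrakk>x \<in> Vcar V; y \<in> Vcar V; z \<in> Vcar V\<rbrakk>
      \<Longrightarrow> Vadd V (Vadd V x y) z = Vadd V x (Vadd V y z)"
    and add_comm: "\<lbrakk>x \<in> Vcar V; y \<in> Vcar V\<rbrakk> \<Longrightarrow> Vadd V x y = Vadd V y x"
    and add_zero: "x \<in> Vcar V \<Longrightarrow> Vadd V x (Vzero V) = x"
    and add_inverse: "x \<in> Vcar V \<Longrightarrow> \<exists>y\<in>Vcar V. Vadd V x y = Vzero V"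
    and scl_one: "x \<in> Vcar V \<Longrightarrow> Vscl V 1 x = x"
    and scl_mult: "x \<in> Vcar V \<Longrightarrow> Vscl V (c * d) x = Vscl V c (Vscl V d x)"
    and scl_add_left: "x \<in> Vcar V \<Longrightarrow> Vscl V (c + d) x = Vadd V (Vscl V c x) (Vscl V d x)"
    and scl_add_right: "\<lbrakk>x \<in> Vcar V; y \<in> Vcar V\<rbrakk>
      \<Longrightarrow> Vscl V c (Vadd V x y) = Vadd V (Vscl V c x) (Vscl V c y)"
    and add_ext: "\<not> (x \<in> Vcar V \<and> y \<in> Vcar V) \<Longrightarrow> Vadd V x y = undefined"
    and scl_ext: "x \<notin> Vcar V \<Longrightarrow> Vscl V c x = undefined"

definition lin_maps :: "('s, 'v) vspace \<Rightarrow> ('s, 'w) vspace \<Rightarrow> ('v \<Rightarrow> 'w) set" where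
  "lin_maps V W = {f \<in> Vcar V \<rightarrow>\<^sub>E Vcar W.
     (\<forall>x\<in>Vcar V. \<forall>y\<in>Vcar V. f (Vadd V x y) = Vadd W (f x) (f y)) \<and>
     (\<forall>c. \<forall>x\<in>Vcar V. f (Vscl V c x) = Vscl W c (f x))}"

definition fin_dim :: "('s, 'v) vspace \<Rightarrow> bool" where
  "fin_dim V \<longleftrightarrow> (\<exists>B. finite B \<and> B \<subseteq> Vcar V \<and>
     (\<forall>S. B \<subseteq> S \<and> S \<subseteq> Vcar V \<and> Vzero V \<in> S \<and> (\<forall>x\<in>S. \<forall>y\<in>S. Vadd V x y \<in> S) \<and>
        (\<forall>c. \<forall>x\<in>S. Vscl V c x \<in> S) \<longrightarrow> S = Vcar V))"

definition field_space :: "('s::field, 's) vspace" where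
  "field_space = \<lparr>Vcar = UNIV, Vadd = (+), Vzero = 0, Vscl = (*)\<rparr>"

definition bilin :: "('s, 'u) vspace \<Rightarrow> ('s, 'v) vspace \<Rightarrow> ('s, 'w) vspace \<Rightarrow> ('u \<Rightarrow> 'v \<Rightarrow> 'w) \<Rightarrow> bool" where
  "bilin U V W \<beta> \<longleftrightarrow> (\<forall>x\<in>Vcar U. \<forall>y\<in>Vcar V. \<beta> x y \<in> Vcar W \<and>
     (\<forall>x'\<in>Vcar U. \<beta> (Vadd U x x') y = Vadd W (\<beta> x y) (\<beta> x' y)) \<and>
     (\<forall>y'\<in>Vcar V. \<beta> x (Vadd V y y') = Vadd W (\<beta> x y) (\<beta> x y')) \<and>
     (\<forall>c. \<beta> (Vscl U c x) y = Vscl W c (\<beta> x y) \<and> \<beta> x (Vscl V c y) = Vscl W c (\<beta> x y)))"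

definition is_tensor :: "('s::field, 'u) vspace \<Rightarrow> ('s, 'v) vspace \<Rightarrow> ('s, 'w) vspace
    \<Rightarrow> ('u \<Rightarrow> 'v \<Rightarrow> 'w) \<Rightarrow> bool" where
  "is_tensor U V T \<beta> \<longleftrightarrow> vec_space T \<and> bilin U V T \<beta> \<and>
     (\<forall>(Z :: ('s, 'w) vspace) \<gamma>. vec_space Z \<and> bilin U V Z \<gamma> \<longrightarrow>
        (\<exists>!f. f \<in> lin_maps T Z \<and> (\<forall>x\<in>Vcar U. \<forall>y\<in>Vcar V. f (\<beta> x y) = \<gamma> x y)))"

text \<open>A free rank-one space with a chosen basis vector \<open>e\<close> (here \<open>field_space\<close> with \<open>c\<close> for \<open>c e\<close>)
  tensored with \<open>V\<close> may be taken to be \<open>V\<close> itself, with \<open>c e \<otimes> v = c v\<close>.\<close>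

lemma line_tensor_self:
  fixes V :: "('s::field, 'v) vspace"
  assumes "vec_space V"
  shows "is_tensor field_space V V (Vscl V)"
proof -
  interpret vec_space V by fact
  have fs: "Vcar field_space = (UNIV :: 's set)" "Vadd field_space = ((+) :: 's \<Rightarrow> 's \<Rightarrow> 's)"
    "Vscl field_space = ((*) :: 's \<Rightarrow> 's \<Rightarrow> 's)"
    by (simp_all add: field_space_def)
  have comm: "Vscl V c (Vscl V d x) = Vscl V d (Vscl V c x)" if "x \<in> Vcar V" for c d x
    using scl_mult[OF that, of c d] scl_mult[OF that, of d c] by (simp add: mult.commute)
  have b: "bilin field_space V V (Vscl V)"
    unfolding bilin_def fs by (intro ballI conjI allI)
      (rule scl_closed scl_add_left scl_add_right scl_mult comm; assumption)+
  have u: "\<exists>!f. f \<in> lin_maps V Z \<and> (\<forall>x\<in>Vcar field_space. \<forall>y\<in>Vcar V. f (Vscl V x y) = \<gamma> x y)"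
    if Z: "vec_space Z" and \<gamma>: "bilin field_space V Z \<gamma>" for Z :: "('s, 'v) vspace" and \<gamma>
  proof (rule ex1I[of _ "\<lambda>v\<in>Vcar V. \<gamma> 1 v"])
    have g: "\<gamma> (c * d) v = Vscl Z c (\<gamma> d v)" "\<gamma> c (Vscl V d v) = Vscl Z d (\<gamma> c v)"
      "\<gamma> c v \<in> Vcar Z" if "v \<in> Vcar V" for c d v
      using \<gamma> that unfolding bilin_def fs by blast+
    have ga: "\<gamma> c (Vadd V v w) = Vadd Z (\<gamma> c v) (\<gamma> c w)" if "v \<in> Vcar V" "w \<in> Vcar V" for c v w
      using \<gamma> that unfolding bilin_def fs by blast
    have "\<gamma> 1 (Vscl V x y) = \<gamma> x y" if "y \<in> Vcar V" for x y
      using g(1)[OF that, of x 1] g(2)[OF that, of 1 x] by simp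
    then show "(\<lambda>v\<in>Vcar V. \<gamma> 1 v) \<in> lin_maps V Z \<and>
      (\<forall>x\<in>Vcar field_space. \<forall>y\<in>Vcar V. (\<lambda>v\<in>Vcar V. \<gamma> 1 v) (Vscl V x y) = \<gamma> x y)"
      using g(2,3) ga by (simp add: lin_maps_def add_closed scl_closed)
    fix f assume f: "f \<in> lin_maps V Z \<and>
      (\<forall>x\<in>Vcar field_space. \<forall>y\<in>Vcar V. f (Vscl V x y) = \<gamma> x y)"
    show "f = (\<lambda>v\<in>Vcar V. \<gamma> 1 v)"
    proof (rule extensionalityI[of _ "Vcar V"])
      show "f \<in> extensional (Vcar V)" using f by (simp add: lin_maps_def PiE_def)
      show "f v = (\<lambda>v\<in>Vcar V. \<gamma> 1 v) v" if "v \<in> Vcar V" for v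
      proof -
        have "f (Vscl V 1 v) = \<gamma> 1 v" using conjunct2[OF f] that unfolding fs by blast
        then show ?thesis using that by (simp add: scl_one)
      qed
    qed (rule restrict_extensional)
  qed
  show ?thesis unfolding is_tensor_def by (intro conjI allI impI assms b; elim conjE; rule u)
qed

text \<open>Spaces whose carrier belongs to \<open>\<U>\<close>.\<close>

definition vect :: "'v set set \<Rightarrow> (('s::field, 'v) vspace, 'v \<Rightarrow> 'v, 's) lincat" where
  "vect \<U> = \<lparr>Ob = {V. vec_space V \<and> Vcar V \<in> \<U>}, Hom = lin_maps, Idn = (\<lambda>V. \<lambda>x\<in>Vcar V. x),
     Cmp = (\<lambda>U V W g f. compose (Vcar U) g f),
     AAdd = (\<lambda>V W f g. \<lambda>x\<in>Vcar V. Vadd W (f x) (g x)),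
     AScl = (\<lambda>V W c f. \<lambda>x\<in>Vcar V. Vscl W c (f x))\<rparr>"

text \<open>What is used of the universe whose elements are the small sets: closure under subsets and
  images, closure (up to bijection) under binary products, and smallness of the scalar field
  \<open>'s\<close>. The members of a Grothendieck universe containing the field satisfy this, and so do all
  subsets of any type at least as large as an infinite field \<open>'s\<close>.\<close>

definition small_universe :: "'s itself \<Rightarrow> 'v set set \<Rightarrow> bool" where
  "small_universe _ \<U> \<longleftrightarrow>
     (\<forall>A\<in>\<U>. \<forall>f B. B \<subseteq> f ` A \<longrightarrow> B \<in> \<U>) \<and>
     (\<forall>A\<in>\<U>. \<forall>B\<in>\<U>. \<exists>f :: 'v \<times> 'v \<Rightarrow> 'v. inj_on f (A \<times> B) \<and> f ` (A \<times> B) \<in> \<U>) \<and>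
     (\<exists>f :: 's \<Rightarrow> 'v. inj f \<and> range f \<in> \<U>)"


section \<open>The two-dimensional local field, the group and its levels\<close>

text \<open>\<open>'k fls\<close> is \<open>E = k((u))\<close> and \<open>'k fls fls\<close> is \<open>F = E((t))\<close>.\<close>

type_synonym 'k F2 = "'k fls fls"
type_synonym ('k, 'n) hmat = "('k F2 ^ 'n ^ 'n) \<times> ('k F2 ^ 'n ^ 'n)"

definition uF :: "'k::field F2" where "uF = fls_const fls_X"
definition tF :: "'k::field F2" where "tF = fls_X"

definition O2 :: "'k::field F2 set" where
  "O2 = {fls_const (fps_to_fls a) + tF * fps_to_fls b | a b. True}"

definition tame :: "'k::field F2 \<Rightarrow> 'k F2 \<Rightarrow> 'k fls" where
  "tame a b = (let m = fls_subdegree a; n = fls_subdegree b in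
     (- 1) powi (m * n) * fls_nth (a powi n * b powi (- m)) 0)"

definition nuF :: "'k::field F2 \<Rightarrow> 'k F2 \<Rightarrow> int" where
  "nuF a b = fls_subdegree (tame a b)"

definition GL :: "('f::field ^ 'n ^ 'n) monoid" where
  "GL = \<lparr>carrier = {g. invertible g}, monoid.mult = (**), one = mat 1\<rparr>"

definition HG :: "('k::field, 'n::finite) hmat monoid" where
  "HG = GL \<times>\<times> GL"

definition upper_triangular :: "(('f::zero, 'n::{finite,linorder}) vec, 'n) vec \<Rightarrow> bool" where
  "upper_triangular g \<longleftrightarrow> (\<forall>r s. s < r \<longrightarrow> g $ r $ s = 0)"

definition BH :: "('k::field, 'n::{finite,linorder}) hmat set" where
  "BH = {b \<in> carrier HG. upper_triangular (fst b) \<and> upper_triangular (snd b)}"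

definition sigmaH :: "('n::{finite,linorder} \<Rightarrow> 's::field) \<Rightarrow> ('k::field, 'n) hmat \<Rightarrow> ('k, 'n) hmat \<Rightarrow> 's" where
  "sigmaH \<alpha> b b' = (\<Prod>r\<in>UNIV. \<alpha> r powi (- nuF (fst b $ r $ r) (snd b' $ r $ r)))"

definition Klevel :: "nat \<Rightarrow> nat \<Rightarrow> ('k::field F2 ^ 'n::finite ^ 'n) set" where
  "Klevel i j = {mat 1 + M | M. \<forall>r s. M $ r $ s \<in> (\<lambda>x. uF ^ i * tF ^ j * x) ` O2}"

definition Cdbl :: "nat \<Rightarrow> nat \<Rightarrow> ('k::field, 'n::finite) hmat set" where
  "Cdbl i j = Klevel i j \<times> Klevel i j"

definition conjH :: "('k::field, 'n::finite) hmat \<Rightarrow> ('k, 'n) hmat set \<Rightarrow> ('k, 'n) hmat set" where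
  "conjH h C = (h <#\<^bsub>HG\<^esub> C) #>\<^bsub>HG\<^esub> (inv\<^bsub>HG\<^esub> h)"

definition CH :: "('k::field, 'n::finite) hmat set set" where
  "CH = {\<Inter>\<D> | \<D>. finite \<D> \<and> \<D> \<noteq> {} \<and>
     \<D> \<subseteq> {conjH h (Cdbl i j) | h i j. h \<in> carrier HG \<and> 1 \<le> i \<and> 1 \<le> j}}"

abbreviation SH :: "('k::field, 'n::finite) hmat set \<Rightarrow> ('k, 'n) hmat set set" where
  "SH C \<equiv> lcosets\<^bsub>HG\<^esub> C"


section \<open>The principal series category\<close>

definition fun_lincat :: "'i set \<Rightarrow> ('o, 'a, 's) lincat \<Rightarrow> ('i \<Rightarrow> 'o, 'i \<Rightarrow> 'a, 's) lincat" where
  "fun_lincat S A = \<lparr>Ob = S \<rightarrow>\<^sub>E Ob A, Hom = (\<lambda>V W. \<Pi>\<^sub>E s\<in>S. Hom A (V s) (W s)),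
     Idn = (\<lambda>V. \<lambda>s\<in>S. Idn A (V s)),
     Cmp = (\<lambda>U V W g f. \<lambda>s\<in>S. Cmp A (U s) (V s) (W s) (g s) (f s)),
     AAdd = (\<lambda>V W f g. \<lambda>s\<in>S. AAdd A (V s) (W s) (f s) (g s)),
     AScl = (\<lambda>V W c f. \<lambda>s\<in>S. AScl A (V s) (W s) c (f s))\<rparr>"

type_synonym Lam = "complex fls"

type_synonym ('k, 'n, 'v) vfam = "('k, 'n) hmat set \<Rightarrow> (Lam, 'v) vspace"
type_synonym ('k, 'n, 'v) varr = "('k, 'n) hmat set \<Rightarrow> 'v \<Rightarrow> 'v"

definition VC :: "'v set set \<Rightarrow> ('k::field, 'n::finite) hmat set
    \<Rightarrow> (('k, 'n, 'v) vfam, ('k, 'n, 'v) varr, Lam) lincat" where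
  "VC \<U> C = fun_lincat (SH C) (vect \<U>)"

text \<open>By lemma \<open>line_tensor_self\<close>, the tensor product of \<open>L\<^sub>\<alpha>(b) = \<Lambda> e\<^sub>b\<close> with a space \<open>X\<close> is taken to be
  \<open>X\<close>, with \<open>e\<^sub>b \<otimes> v = v\<close>. Thus \<open>(T\<^sub>b V) s\<close> is \<open>V (b\<^sup>-\<^sup>1 s)\<close>, the transformation
  \<open>\<mu>\<^sub>b\<^sub>,\<^sub>b\<^sub>' : T\<^sub>b T\<^sub>b\<^sub>' V \<rightarrow> T\<^sub>b\<^sub>b\<^sub>' V\<close>, that is \<open>e\<^sub>b \<otimes> e\<^sub>b\<^sub>' \<otimes> v \<mapsto> \<sigma>\<^sub>\<alpha>(b, b') e\<^sub>b\<^sub>b\<^sub>' \<otimes> v\<close>, is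
  multiplication by \<open>\<sigma>\<^sub>\<alpha>(b, b')\<close>, and \<open>u\<^sub>V : e\<^sub>1 \<otimes> v \<mapsto> v\<close> is the identity.\<close>

definition shift :: "('k::field, 'n::finite) hmat set \<Rightarrow> ('k, 'n) hmat
    \<Rightarrow> (('k, 'n) hmat set \<Rightarrow> 'x) \<Rightarrow> ('k, 'n) hmat set \<Rightarrow> 'x" where
  "shift C b V = (\<lambda>s\<in>SH C. V ((inv\<^bsub>HG\<^esub> b) <#\<^bsub>HG\<^esub> s))"

abbreviation Tob :: "('k::field, 'n::finite) hmat set \<Rightarrow> ('k, 'n) hmat
    \<Rightarrow> ('k, 'n, 'v) vfam \<Rightarrow> ('k, 'n, 'v) vfam" where
  "Tob C b V \<equiv> shift C b V"

abbreviation Tar :: "('k::field, 'n::finite) hmat set \<Rightarrow> ('k, 'n) hmat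
    \<Rightarrow> ('k, 'n, 'v) varr \<Rightarrow> ('k, 'n, 'v) varr" where
  "Tar C b f \<equiv> shift C b f"

definition muT :: "('n::{finite,linorder} \<Rightarrow> Lam) \<Rightarrow> ('k::field, 'n) hmat set \<Rightarrow> ('k, 'n) hmat
    \<Rightarrow> ('k, 'n) hmat \<Rightarrow> ('k, 'n, 'v) vfam \<Rightarrow> ('k, 'n, 'v) varr" where
  "muT \<alpha> C b b' V = (\<lambda>s\<in>SH C. \<lambda>v\<in>Vcar (Tob C b (Tob C b' V) s).
     Vscl (Tob C (b \<otimes>\<^bsub>HG\<^esub> b') V s) (sigmaH \<alpha> b b') v)"

definition unitT :: "('k::field, 'n::finite) hmat set \<Rightarrow> ('k, 'n, 'v) vfam \<Rightarrow> ('k, 'n, 'v) varr" where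
  "unitT C V = (\<lambda>s\<in>SH C. \<lambda>v\<in>Vcar (Tob C \<one>\<^bsub>HG\<^esub> V s). v)"

type_synonym ('k, 'n, 'v) psob =
  "('k, 'n, 'v) vfam \<times> (('k, 'n) hmat \<Rightarrow> ('k, 'n, 'v) varr)"

definition is_psob :: "('n::{finite,linorder} \<Rightarrow> Lam) \<Rightarrow> 'v set set \<Rightarrow> ('k::field, 'n) hmat set
    \<Rightarrow> ('k, 'n, 'v) psob \<Rightarrow> bool" where
  "is_psob \<alpha> \<U> C X \<longleftrightarrow> (case X of (V, \<epsilon>) \<Rightarrow>
     V \<in> Ob (VC \<U> C) \<and> \<epsilon> \<in> extensional BH \<and>
     (\<forall>b\<in>BH. is_iso (VC \<U> C) (Tob C b V) V (\<epsilon> b)) \<and>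
     (\<forall>b\<in>BH. \<forall>b'\<in>BH.
        Cmp (VC \<U> C) (Tob C b (Tob C b' V)) (Tob C (b \<otimes>\<^bsub>HG\<^esub> b') V) V
          (\<epsilon> (b \<otimes>\<^bsub>HG\<^esub> b')) (muT \<alpha> C b b' V) =
        Cmp (VC \<U> C) (Tob C b (Tob C b' V)) (Tob C b V) V (\<epsilon> b) (Tar C b (\<epsilon> b'))) \<and>
     \<epsilon> \<one>\<^bsub>HG\<^esub> = unitT C V)"

text \<open>The category \<open>\<I>\<^sub>C(\<alpha>)\<close>.\<close>

definition ps_cat :: "('n::{finite,linorder} \<Rightarrow> Lam) \<Rightarrow> 'v set set \<Rightarrow> ('k::field, 'n) hmat set
    \<Rightarrow> (('k, 'n, 'v) psob, ('k, 'n, 'v) varr, Lam) lincat" where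
  "ps_cat \<alpha> \<U> C = \<lparr>Ob = {X. is_psob \<alpha> \<U> C X},
     Hom = (\<lambda>(V, \<epsilon>) (W, \<delta>). {f \<in> Hom (VC \<U> C) V W. \<forall>b\<in>BH.
        Cmp (VC \<U> C) (Tob C b V) V W f (\<epsilon> b) =
        Cmp (VC \<U> C) (Tob C b V) (Tob C b W) W (\<delta> b) (Tar C b f)}),
     Idn = (\<lambda>X. Idn (VC \<U> C) (fst X)),
     Cmp = (\<lambda>X Y Z. Cmp (VC \<U> C) (fst X) (fst Y) (fst Z)),
     AAdd = (\<lambda>X Y. AAdd (VC \<U> C) (fst X) (fst Y)),
     AScl = (\<lambda>X Y. AScl (VC \<U> C) (fst X) (fst Y))\<rparr>"

text \<open>Refinement \<open>\<pi>\<^sup>*\<^sub>D\<^sub>,\<^sub>C\<close> and right translation: \<open>s <#> C\<close> is the coset \<open>gC\<close> for \<open>s = gD\<close>, and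
  \<open>s #> h\<close> is \<open>ghC\<close> for \<open>s = g(hCh\<^sup>-\<^sup>1)\<close>.\<close>

definition refine :: "('k::field, 'n::finite) hmat set \<Rightarrow> ('k, 'n) hmat set
    \<Rightarrow> (('k, 'n) hmat set \<Rightarrow> 'x) \<Rightarrow> ('k, 'n) hmat set \<Rightarrow> 'x" where
  "refine D C V = (\<lambda>s\<in>SH D. V (s <#>\<^bsub>HG\<^esub> C))"

definition refine_ob :: "('k::field, 'n::{finite,linorder}) hmat set \<Rightarrow> ('k, 'n) hmat set
    \<Rightarrow> ('k, 'n, 'v) psob \<Rightarrow> ('k, 'n, 'v) psob" where
  "refine_ob D C X = (refine D C (fst X), \<lambda>b\<in>BH. refine D C (snd X b))"

definition rtrans :: "('k::field, 'n::finite) hmat \<Rightarrow> ('k, 'n) hmat set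
    \<Rightarrow> (('k, 'n) hmat set \<Rightarrow> 'x) \<Rightarrow> ('k, 'n) hmat set \<Rightarrow> 'x" where
  "rtrans h C V = (\<lambda>s\<in>SH (conjH h C). V (s #>\<^bsub>HG\<^esub> h))"

definition rtrans_ob :: "('k::field, 'n::{finite,linorder}) hmat \<Rightarrow> ('k, 'n) hmat set
    \<Rightarrow> ('k, 'n, 'v) psob \<Rightarrow> ('k, 'n, 'v) psob" where
  "rtrans_ob h C X = (rtrans h C (fst X), \<lambda>b\<in>BH. rtrans h C (snd X b))"

text \<open>The category \<open>\<I>\<^sub>F\<^sup>u\<^sup>-\<^sup>s\<^sup>m(\<alpha>)\<close>; its arrows are elements of the filtered colimit, that is,
  equivalence classes of pairs \<open>(D, f)\<close>.\<close>

type_synonym ('k, 'n, 'v) usm_ob = "('k, 'n) hmat set \<times> ('k, 'n, 'v) psob"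
type_synonym ('k, 'n, 'v) usm_ar = "(('k, 'n) hmat set \<times> ('k, 'n, 'v) varr) set"

definition levels :: "('k::field, 'n::finite) hmat set \<Rightarrow> ('k, 'n) hmat set \<Rightarrow> ('k, 'n) hmat set set" where
  "levels C C' = {D \<in> CH. D \<subseteq> C \<inter> C'}"

definition level_homs :: "('n::{finite,linorder} \<Rightarrow> Lam) \<Rightarrow> 'v set set
    \<Rightarrow> ('k::field, 'n, 'v) usm_ob \<Rightarrow> ('k, 'n, 'v) usm_ob
    \<Rightarrow> ('k, 'n) hmat set \<Rightarrow> ('k, 'n, 'v) varr set" where
  "level_homs \<alpha> \<U> X Y D =
     Hom (ps_cat \<alpha> \<U> D) (refine_ob D (fst X) (snd X)) (refine_ob D (fst Y) (snd Y))"

definition usm_rel :: "('n::{finite,linorder} \<Rightarrow> Lam) \<Rightarrow> 'v set set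
    \<Rightarrow> ('k::field, 'n, 'v) usm_ob \<Rightarrow> ('k, 'n, 'v) usm_ob
    \<Rightarrow> ((('k, 'n) hmat set \<times> ('k, 'n, 'v) varr) \<times> (('k, 'n) hmat set \<times> ('k, 'n, 'v) varr)) set" where
  "usm_rel \<alpha> \<U> X Y = colim_rel (levels (fst X) (fst Y)) (\<lambda>D D'. D' \<subseteq> D) (level_homs \<alpha> \<U> X Y)
     (\<lambda>D D' f. refine D' D f)"

definition usm_cat :: "('n::{finite,linorder} \<Rightarrow> Lam) \<Rightarrow> 'v set set
    \<Rightarrow> (('k::field, 'n, 'v) usm_ob, ('k, 'n, 'v) usm_ar, Lam) lincat" where
  "usm_cat \<alpha> \<U> = \<lparr>
     Ob = {(C, X). C \<in> CH \<and> X \<in> Ob (ps_cat \<alpha> \<U> C)},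
     Hom = (\<lambda>X Y. dir_colim (levels (fst X) (fst Y)) (\<lambda>D D'. D' \<subseteq> D) (level_homs \<alpha> \<U> X Y)
        (\<lambda>D D' f. refine D' D f)),
     Idn = (\<lambda>X. usm_rel \<alpha> \<U> X X ``
        {(fst X, Idn (ps_cat \<alpha> \<U> (fst X)) (refine_ob (fst X) (fst X) (snd X)))}),
     Cmp = (\<lambda>X Y Z \<delta> \<gamma>. usm_rel \<alpha> \<U> X Z `` {(D \<inter> D', Cmp (ps_cat \<alpha> \<U> (D \<inter> D'))
          (refine_ob (D \<inter> D') (fst X) (snd X)) (refine_ob (D \<inter> D') (fst Y) (snd Y))
          (refine_ob (D \<inter> D') (fst Z) (snd Z)) (refine (D \<inter> D') D' g) (refine (D \<inter> D') D f))
        | D f D' g. (D, f) \<in> \<gamma> \<and> (D', g) \<in> \<delta>}),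
     AAdd = (\<lambda>X Y \<gamma> \<delta>. usm_rel \<alpha> \<U> X Y `` {(D \<inter> D', AAdd (ps_cat \<alpha> \<U> (D \<inter> D'))
          (refine_ob (D \<inter> D') (fst X) (snd X)) (refine_ob (D \<inter> D') (fst Y) (snd Y))
          (refine (D \<inter> D') D f) (refine (D \<inter> D') D' g))
        | D f D' g. (D, f) \<in> \<gamma> \<and> (D', g) \<in> \<delta>}),
     AScl = (\<lambda>X Y c \<gamma>. usm_rel \<alpha> \<U> X Y `` {(D, AScl (ps_cat \<alpha> \<U> D)
          (refine_ob D (fst X) (snd X)) (refine_ob D (fst Y) (snd Y)) c f) | D f. (D, f) \<in> \<gamma>})\<rparr>"

definition Rfun :: "('n::{finite,linorder} \<Rightarrow> Lam) \<Rightarrow> 'v set set \<Rightarrow> ('k::field, 'n) hmat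
    \<Rightarrow> (('k, 'n, 'v) usm_ob, ('k, 'n, 'v) usm_ar) endo" where
  "Rfun \<alpha> \<U> h = mk_func (usm_cat \<alpha> \<U>)
     (\<lambda>(C, X). (conjH h C, rtrans_ob h C X))
     (\<lambda>X Y \<gamma>. (\<lambda>(D, f). (conjH h D, rtrans h D f)) ` \<gamma>)"

definition rho :: "('n::{finite,linorder} \<Rightarrow> Lam) \<Rightarrow> 'v set set
    \<Rightarrow> (('k::field, 'n) hmat, unit, (('k, 'n, 'v) usm_ob, ('k, 'n, 'v) usm_ar) endo,
        ('k, 'n, 'v) usm_ob \<Rightarrow> ('k, 'n, 'v) usm_ar) mfunc" where
  "rho \<alpha> \<U> = strict_two_rep HG (usm_cat \<alpha> \<U>) (Rfun \<alpha> \<U>)"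


section \<open>Exact categories, Ind- and Pro-objects, Tate objects\<close>

text \<open>\<open>Confl C\<close> is the class of admissible short exact sequences \<open>x \<rightarrow> y \<rightarrow> z\<close>, listed as
  \<open>(x, y, z, f, g)\<close>. The additive structure plays no role in the constructions below.\<close>

record ('o, 'a) excat = "('o, 'a) cat" +
  Confl :: "('o \<times> 'o \<times> 'o \<times> 'a \<times> 'a) set"

definition op_ex :: "('o, 'a) excat \<Rightarrow> ('o, 'a) excat" where
  "op_ex C = \<lparr>Ob = Ob C, Hom = (\<lambda>x y. Hom C y x), Idn = Idn C,
     Cmp = (\<lambda>x y z g f. Cmp C z y x f g),
     Confl = {(z, y, x, g, f) | x y z f g. (x, y, z, f, g) \<in> Confl C}\<rparr>"

definition full_sub :: "('o, 'a) excat \<Rightarrow> 'o set \<Rightarrow> ('o, 'a) excat" where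
  "full_sub C S = C\<lparr>Ob := Ob C \<inter> S,
     Confl := {(x, y, z, f, g). (x, y, z, f, g) \<in> Confl C \<and> x \<in> S \<and> y \<in> S \<and> z \<in> S}\<rparr>"

definition adm_mono :: "('o, 'a) excat \<Rightarrow> 'o \<Rightarrow> 'o \<Rightarrow> 'a \<Rightarrow> bool" where
  "adm_mono C x y f \<longleftrightarrow> (\<exists>z g. (x, y, z, f, g) \<in> Confl C)"

text \<open>Finite-dimensional spaces over \<open>'s\<close>; the type \<open>'w\<close> only serves as a supply of carriers.\<close>

definition vect_fd :: "(('s::field, 'w) vspace, 'w \<Rightarrow> 'w) excat" where
  "vect_fd = \<lparr>Ob = {V. vec_space V \<and> fin_dim V}, Hom = lin_maps, Idn = (\<lambda>V. \<lambda>x\<in>Vcar V. x),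
     Cmp = (\<lambda>U V W g f. compose (Vcar U) g f),
     Confl = {(U, V, W, f, g). vec_space U \<and> fin_dim U \<and> vec_space V \<and> fin_dim V \<and>
        vec_space W \<and> fin_dim W \<and> f \<in> lin_maps U V \<and> g \<in> lin_maps V W \<and> inj_on f (Vcar U) \<and>
        g ` Vcar V = Vcar W \<and> f ` Vcar U = {v \<in> Vcar V. g v = Vzero W}}\<rparr>"

text \<open>Ind-objects are admissible Ind-diagrams indexed by countable directed posets (realised on
  subsets of \<open>nat\<close>), with \<open>Hom(X, Y) = lim\<^sub>i colim\<^sub>j Hom(X\<^sub>i, Y\<^sub>j)\<close>.\<close>

record ('o, 'a) iob =
  Idx :: "nat set"
  Le  :: "nat \<Rightarrow> nat \<Rightarrow> bool"
  IO  :: "nat \<Rightarrow> 'o"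
  IA  :: "nat \<Rightarrow> nat \<Rightarrow> 'a"

type_synonym 'a iar = "nat \<Rightarrow> (nat \<times> 'a) set"

definition directed_poset :: "nat set \<Rightarrow> (nat \<Rightarrow> nat \<Rightarrow> bool) \<Rightarrow> bool" where
  "directed_poset I leq \<longleftrightarrow> I \<noteq> {} \<and> (\<forall>i\<in>I. leq i i) \<and>
     (\<forall>i\<in>I. \<forall>j\<in>I. leq i j \<and> leq j i \<longrightarrow> i = j) \<and>
     (\<forall>i\<in>I. \<forall>j\<in>I. \<forall>l\<in>I. leq i j \<and> leq j l \<longrightarrow> leq i l) \<and>
     (\<forall>i\<in>I. \<forall>j\<in>I. \<exists>l\<in>I. leq i l \<and> leq j l)"

definition is_iob :: "('o, 'a) excat \<Rightarrow> ('o, 'a) iob \<Rightarrow> bool" where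
  "is_iob C X \<longleftrightarrow> directed_poset (Idx X) (Le X) \<and> (\<forall>i\<in>Idx X. IO X i \<in> Ob C) \<and>
     (\<forall>i\<in>Idx X. IA X i i = Idn C (IO X i)) \<and>
     (\<forall>i\<in>Idx X. \<forall>j\<in>Idx X. Le X i j \<longrightarrow>
        IA X i j \<in> Hom C (IO X i) (IO X j) \<and> adm_mono C (IO X i) (IO X j) (IA X i j)) \<and>
     (\<forall>i\<in>Idx X. \<forall>j\<in>Idx X. \<forall>l\<in>Idx X. Le X i j \<and> Le X j l \<longrightarrow>
        IA X i l = Cmp C (IO X i) (IO X j) (IO X l) (IA X j l) (IA X i j))"

definition germ_rel :: "('o, 'a) excat \<Rightarrow> 'o \<Rightarrow> ('o, 'a) iob \<Rightarrow> ((nat \<times> 'a) \<times> (nat \<times> 'a)) set" where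
  "germ_rel C x Y = colim_rel (Idx Y) (Le Y) (\<lambda>j. Hom C x (IO Y j))
     (\<lambda>j l f. Cmp C x (IO Y j) (IO Y l) (IA Y j l) f)"

definition germs :: "('o, 'a) excat \<Rightarrow> 'o \<Rightarrow> ('o, 'a) iob \<Rightarrow> (nat \<times> 'a) set set" where
  "germs C x Y = dir_colim (Idx Y) (Le Y) (\<lambda>j. Hom C x (IO Y j))
     (\<lambda>j l f. Cmp C x (IO Y j) (IO Y l) (IA Y j l) f)"

definition ind_hom :: "('o, 'a) excat \<Rightarrow> ('o, 'a) iob \<Rightarrow> ('o, 'a) iob \<Rightarrow> 'a iar set" where
  "ind_hom C X Y = {\<phi> \<in> (\<Pi>\<^sub>E i\<in>Idx X. germs C (IO X i) Y).
     \<forall>i\<in>Idx X. \<forall>i'\<in>Idx X. Le X i i' \<longrightarrow> (\<forall>(j, f)\<in>\<phi> i'.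
        (j, Cmp C (IO X i) (IO X i') (IO Y j) f (IA X i i')) \<in> \<phi> i)}"

definition ind_id :: "('o, 'a) excat \<Rightarrow> ('o, 'a) iob \<Rightarrow> 'a iar" where
  "ind_id C X = (\<lambda>i\<in>Idx X. germ_rel C (IO X i) X `` {(i, Idn C (IO X i))})"

definition ind_cmp :: "('o, 'a) excat \<Rightarrow> ('o, 'a) iob \<Rightarrow> ('o, 'a) iob \<Rightarrow> ('o, 'a) iob
    \<Rightarrow> 'a iar \<Rightarrow> 'a iar \<Rightarrow> 'a iar" where
  "ind_cmp C X Y Z \<psi> \<phi> = (\<lambda>i\<in>Idx X. germ_rel C (IO X i) Z ``
     {(l, Cmp C (IO X i) (IO Y j) (IO Z l) g f) | j f l g. (j, f) \<in> \<phi> i \<and> (l, g) \<in> \<psi> j})"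

text \<open>The arrow of Ind-objects given by a levelwise morphism of diagrams over a common poset.\<close>

definition ind_level :: "('o, 'a) excat \<Rightarrow> ('o, 'a) iob \<Rightarrow> ('o, 'a) iob \<Rightarrow> (nat \<Rightarrow> 'a) \<Rightarrow> 'a iar" where
  "ind_level C X Y f = (\<lambda>k\<in>Idx X. germ_rel C (IO X k) Y `` {(k, f k)})"

definition level_map :: "('o, 'a) excat \<Rightarrow> ('o, 'a) iob \<Rightarrow> ('o, 'a) iob \<Rightarrow> (nat \<Rightarrow> 'a) \<Rightarrow> bool" where
  "level_map C X Y f \<longleftrightarrow> Idx X = Idx Y \<and> (\<forall>k\<in>Idx X. \<forall>l\<in>Idx X. Le X k l = Le Y k l) \<and>
     (\<forall>k\<in>Idx X. f k \<in> Hom C (IO X k) (IO Y k)) \<and>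
     (\<forall>k\<in>Idx X. \<forall>l\<in>Idx X. Le X k l \<longrightarrow>
        Cmp C (IO X k) (IO Y k) (IO Y l) (IA Y k l) (f k) =
        Cmp C (IO X k) (IO X l) (IO Y l) (f l) (IA X k l))"

definition ind_plain :: "('o, 'a) excat \<Rightarrow> (('o, 'a) iob, 'a iar) cat" where
  "ind_plain C = \<lparr>Ob = {X. is_iob C X}, Hom = ind_hom C, Idn = ind_id C, Cmp = ind_cmp C\<rparr>"

text \<open>A sequence of Ind-objects is admissible if it is isomorphic to a diagram of admissible
  sequences.\<close>

definition ind_confl :: "('o, 'a) excat
    \<Rightarrow> (('o, 'a) iob \<times> ('o, 'a) iob \<times> ('o, 'a) iob \<times> 'a iar \<times> 'a iar) set" where
  "ind_confl C = {(X, Y, Z, f, g). is_iob C X \<and> is_iob C Y \<and> is_iob C Z \<and>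
     f \<in> ind_hom C X Y \<and> g \<in> ind_hom C Y Z \<and>
     (\<exists>X' Y' Z' f' g' a b c. is_iob C X' \<and> is_iob C Y' \<and> is_iob C Z' \<and>
        level_map C X' Y' f' \<and> level_map C Y' Z' g' \<and>
        (\<forall>k\<in>Idx Y'. (IO X' k, IO Y' k, IO Z' k, f' k, g' k) \<in> Confl C) \<and>
        is_iso (ind_plain C) X X' a \<and> is_iso (ind_plain C) Y Y' b \<and> is_iso (ind_plain C) Z Z' c \<and>
        ind_cmp C X Y Y' b f = ind_cmp C X X' Y' (ind_level C X' Y' f') a \<and>
        ind_cmp C Y Z Z' c g = ind_cmp C Y Y' Z' (ind_level C Y' Z' g') b)}"

definition ind_cat :: "('o, 'a) excat \<Rightarrow> (('o, 'a) iob, 'a iar) excat" where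
  "ind_cat C = \<lparr>Ob = {X. is_iob C X}, Hom = ind_hom C, Idn = ind_id C, Cmp = ind_cmp C,
     Confl = ind_confl C\<rparr>"

definition pro_cat :: "('o, 'a) excat \<Rightarrow> (('o, 'a) iob, 'a iar) excat" where
  "pro_cat C = op_ex (ind_cat (op_ex C))"

definition ind_const :: "('o, 'a) excat \<Rightarrow> 'o \<Rightarrow> ('o, 'a) iob" where
  "ind_const C x = \<lparr>Idx = {0}, Le = (\<le>), IO = (\<lambda>_. x), IA = (\<lambda>_ _. Idn C x)\<rparr>"

definition pro_const :: "('o, 'a) excat \<Rightarrow> 'o \<Rightarrow> ('o, 'a) iob" where
  "pro_const C x = ind_const (op_ex C) x"

definition pro_const_arr :: "('o, 'a) excat \<Rightarrow> 'o \<Rightarrow> 'o \<Rightarrow> 'a \<Rightarrow> 'a iar" where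
  "pro_const_arr C x y f =
     ind_level (op_ex C) (ind_const (op_ex C) y) (ind_const (op_ex C) x) (\<lambda>_. f)"

text \<open>The embedding \<open>Ind\<^sup>a(C) \<rightarrow> Ind\<^sup>a(Pro\<^sup>a(C))\<close> on objects.\<close>

definition ind_to_indpro :: "('o, 'a) excat \<Rightarrow> ('o, 'a) iob \<Rightarrow> (('o, 'a) iob, 'a iar) iob" where
  "ind_to_indpro C Z = \<lparr>Idx = Idx Z, Le = Le Z, IO = (\<lambda>k. pro_const C (IO Z k)),
     IA = (\<lambda>k l. pro_const_arr C (IO Z k) (IO Z l) (IA Z k l))\<rparr>"

definition has_lattice :: "('o, 'a) excat \<Rightarrow> (('o, 'a) iob, 'a iar) iob \<Rightarrow> bool" where
  "has_lattice C V \<longleftrightarrow> (\<exists>L\<in>Ob (pro_cat C). \<exists>Z\<in>Ob (ind_cat C). \<exists>j r.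
     (ind_const (pro_cat C) L, V, ind_to_indpro C Z, j, r) \<in> Confl (ind_cat (pro_cat C)))"

definition tate_el :: "('o, 'a) excat \<Rightarrow> ((('o, 'a) iob, 'a iar) iob, 'a iar iar) excat" where
  "tate_el C = full_sub (ind_cat (pro_cat C)) {V. has_lattice C V}"

text \<open>Idempotent completion. Its admissible sequences are the retracts (equivalently, the direct
  summands) of admissible sequences of \<open>C\<close>.\<close>

definition kar_plain :: "('o, 'a) excat \<Rightarrow> ('o \<times> 'a, 'a) cat" where
  "kar_plain C = \<lparr>Ob = {(x, e). x \<in> Ob C \<and> e \<in> Hom C x x \<and> Cmp C x x x e e = e},
     Hom = (\<lambda>(x, e) (y, d). {f \<in> Hom C x y. Cmp C x y y d f = f \<and> Cmp C x x y f e = f}),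
     Idn = (\<lambda>(x, e). e),
     Cmp = (\<lambda>X Y Z. Cmp C (fst X) (fst Y) (fst Z))\<rparr>"

definition kar_retract :: "('o, 'a) excat \<Rightarrow> 'o \<times> 'a \<Rightarrow> 'o \<Rightarrow> 'a \<Rightarrow> 'a \<Rightarrow> bool" where
  "kar_retract C X x s r \<longleftrightarrow> s \<in> Hom (kar_plain C) X (x, Idn C x) \<and>
     r \<in> Hom (kar_plain C) (x, Idn C x) X \<and> Cmp C (fst X) x (fst X) r s = Idn (kar_plain C) X"

definition kar_confl :: "('o, 'a) excat
    \<Rightarrow> (('o \<times> 'a) \<times> ('o \<times> 'a) \<times> ('o \<times> 'a) \<times> 'a \<times> 'a) set" where
  "kar_confl C = {(X, Y, Z, f, g). X \<in> Ob (kar_plain C) \<and> Y \<in> Ob (kar_plain C) \<and> Z \<in> Ob (kar_plain C) \<and>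
     f \<in> Hom (kar_plain C) X Y \<and> g \<in> Hom (kar_plain C) Y Z \<and>
     (\<exists>x y z f' g' s1 r1 s2 r2 s3 r3. (x, y, z, f', g') \<in> Confl C \<and>
        kar_retract C X x s1 r1 \<and> kar_retract C Y y s2 r2 \<and> kar_retract C Z z s3 r3 \<and>
        Cmp C (fst X) (fst Y) y s2 f = Cmp C (fst X) x y f' s1 \<and>
        Cmp C (fst Y) (fst Z) z s3 g = Cmp C (fst Y) y z g' s2 \<and>
        Cmp C x (fst X) (fst Y) f r1 = Cmp C x y (fst Y) r2 f' \<and>
        Cmp C y (fst Y) (fst Z) g r2 = Cmp C y z (fst Z) r3 g')}"

definition kar :: "('o, 'a) excat \<Rightarrow> ('o \<times> 'a, 'a) excat" where
  "kar C = \<lparr>Ob = Ob (kar_plain C), Hom = Hom (kar_plain C), Idn = Idn (kar_plain C),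
     Cmp = Cmp (kar_plain C), Confl = kar_confl C\<rparr>"

definition tate :: "('o, 'a) excat \<Rightarrow> ((('o, 'a) iob, 'a iar) iob \<times> 'a iar iar, 'a iar iar) excat" where
  "tate C = kar (tate_el C)"


section \<open>The elementary 2-Tate object \<open>W = F\<^sup>n \<oplus> F\<^sup>n\<close>\<close>

text \<open>\<open>W = colim\<^sub>i lim\<^sub>m (\<Lambda>\<^sub>i / \<Lambda>\<^sub>-\<^sub>m)\<close> with \<open>\<Lambda>\<^sub>i = t\<^sup>-\<^sup>i E[[t]]\<^sup>2\<^sup>n\<close>, and the \<open>E\<close>-space \<open>\<Lambda>\<^sub>i / \<Lambda>\<^sub>-\<^sub>m\<close> is in turn
  \<open>colim\<^sub>a lim\<^sub>b lat i m a / lat i m (- b)\<close>, where \<open>lat i m a \<subseteq> \<Lambda>\<^sub>i\<close> is the preimage of the lattice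
  \<open>u\<^sup>-\<^sup>a k[[u]]\<close> in all coordinates \<open>t\<^sup>l\<close>, \<open>-i \<le> l < m\<close>. All four indices range over \<open>nat\<close>.\<close>

type_synonym ('k, 'n) wvec = "('k F2 ^ 'n) \<times> ('k F2 ^ 'n)"

definition in_lat :: "int \<Rightarrow> int \<Rightarrow> int \<Rightarrow> 'k::field F2 \<Rightarrow> bool" where
  "in_lat i m a f \<longleftrightarrow> (\<forall>l < - i. fls_nth f l = 0) \<and>
     (\<forall>l < m. \<forall>c < - a. fls_nth (fls_nth f l) c = 0)"

definition lat :: "int \<Rightarrow> int \<Rightarrow> int \<Rightarrow> ('k::field, 'n::finite) wvec set" where
  "lat i m a = {(x, y). \<forall>r. in_lat i m a (x $ r) \<and> in_lat i m a (y $ r)}"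

definition wscale :: "'k::field \<Rightarrow> ('k, 'n::finite) wvec \<Rightarrow> ('k, 'n) wvec" where
  "wscale c w = ((\<chi> r. fls_const (fls_const c) * fst w $ r), (\<chi> r. fls_const (fls_const c) * snd w $ r))"

definition wcoset :: "('k::field, 'n::finite) wvec \<Rightarrow> ('k, 'n) wvec set \<Rightarrow> ('k, 'n) wvec set" where
  "wcoset w B = (\<lambda>b. w + b) ` B"

definition quot_space :: "('k::field, 'n::finite) wvec set \<Rightarrow> ('k, 'n) wvec set
    \<Rightarrow> ('k, ('k, 'n) wvec set) vspace" where
  "quot_space A B = (let car = (\<lambda>w. wcoset w B) ` A in
     \<lparr>Vcar = car,
      Vadd = (\<lambda>S T. if S \<in> car \<and> T \<in> car then {s + t | s t. s \<in> S \<and> t \<in> T} else undefined),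
      Vzero = B,
      Vscl = (\<lambda>c S. if S \<in> car then (\<Union>s\<in>S. wcoset (wscale c s) B) else undefined)\<rparr>)"

text \<open>The category \<open>Vect\<^sub>k\<^sup>f\<^sup>d\<close> used here, with carriers among the subsets of the type of cosets.\<close>

abbreviation vectW :: "(('k::field, ('k, 'n::finite) wvec set) vspace,
    ('k, 'n) wvec set \<Rightarrow> ('k, 'n) wvec set) excat" where
  "vectW \<equiv> vect_fd"

type_synonym ('k, 'n) o0 = "('k, ('k, 'n) wvec set) vspace"
type_synonym ('k, 'n) a0 = "('k, 'n) wvec set \<Rightarrow> ('k, 'n) wvec set"
type_synonym ('k, 'n) o1 = "(('k, 'n) o0, ('k, 'n) a0) iob"
type_synonym ('k, 'n) a1 = "('k, 'n) a0 iar"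
type_synonym ('k, 'n) o2 = "(('k, 'n) o1, ('k, 'n) a1) iob"
type_synonym ('k, 'n) a2 = "('k, 'n) a1 iar"
type_synonym ('k, 'n) o3 = "(('k, 'n) o2 \<times> ('k, 'n) a2, ('k, 'n) a2) iob"
type_synonym ('k, 'n) a3 = "('k, 'n) a2 iar"
type_synonym ('k, 'n) o4 = "(('k, 'n) o3, ('k, 'n) a3) iob"
type_synonym ('k, 'n) a4 = "('k, 'n) a3 iar"

definition two_tate :: "(('k::field, 'n::finite) o4, ('k, 'n) a4) excat" where
  "two_tate = tate_el (tate vectW)"

text \<open>An operator \<open>\<phi>\<close> on \<open>W\<close> induces arrows between the constituents of \<open>W\<close>, one level after the
  other. Each of the sets below is empty or contains exactly the arrow induced by \<open>\<phi>\<close>: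
  \<open>ind_lift C X Y \<rho>\<close> is the family whose germ at \<open>i\<close> is represented by the induced arrows
  \<open>X\<^sub>i \<rightarrow> Y\<^sub>j\<close> in \<open>\<rho> i j\<close>, provided that this family is an arrow of Ind-objects.\<close>

definition ind_lift :: "('o, 'a) excat \<Rightarrow> ('o, 'a) iob \<Rightarrow> ('o, 'a) iob \<Rightarrow> (nat \<Rightarrow> nat \<Rightarrow> 'a set)
    \<Rightarrow> 'a iar set" where
  "ind_lift C X Y \<rho> = {\<psi> \<in> ind_hom C X Y. \<psi> = (\<lambda>i\<in>Idx X. germ_rel C (IO X i) Y ``
     {(j, f). j \<in> Idx Y \<and> f \<in> \<rho> i j})}"

definition W0 :: "nat \<Rightarrow> nat \<Rightarrow> nat \<Rightarrow> nat \<Rightarrow> ('k::field, 'n::finite) o0" where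
  "W0 i m a b = quot_space (lat (int i) (int m) (int a)) (lat (int i) (int m) (- int b))"

definition induced0 :: "(('k::field, 'n::finite) wvec \<Rightarrow> ('k, 'n) wvec)
    \<Rightarrow> nat \<times> nat \<times> nat \<times> nat \<Rightarrow> nat \<times> nat \<times> nat \<times> nat \<Rightarrow> ('k, 'n) a0 set" where
  "induced0 \<phi> = (\<lambda>(i, m, a, b) (i', m', a', b').
     if \<phi> ` lat (int i) (int m) (int a) \<subseteq> lat (int i') (int m') (int a') \<and>
        \<phi> ` lat (int i) (int m) (- int b) \<subseteq> lat (int i') (int m') (- int b')
     then {\<lambda>S\<in>Vcar (W0 i m a b). \<Union>w\<in>S. wcoset (\<phi> w) (lat (int i') (int m') (- int b'))}
     else {})"

definition W1 :: "nat \<Rightarrow> nat \<Rightarrow> nat \<Rightarrow> ('k::field, 'n::finite) o1" where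
  "W1 i m a = \<lparr>Idx = UNIV, Le = (\<le>), IO = W0 i m a,
     IA = (\<lambda>b b'. the_elem (induced0 id (i, m, a, b') (i, m, a, b)))\<rparr>"

definition induced1 :: "(('k::field, 'n::finite) wvec \<Rightarrow> ('k, 'n) wvec)
    \<Rightarrow> nat \<times> nat \<times> nat \<Rightarrow> nat \<times> nat \<times> nat \<Rightarrow> ('k, 'n) a1 set" where
  "induced1 \<phi> = (\<lambda>(i, m, a) (i', m', a').
     ind_lift (op_ex vectW) (W1 i' m' a') (W1 i m a)
       (\<lambda>b' b. induced0 \<phi> (i, m, a, b) (i', m', a', b')))"

definition W2 :: "nat \<Rightarrow> nat \<Rightarrow> ('k::field, 'n::finite) o2" where
  "W2 i m = \<lparr>Idx = UNIV, Le = (\<le>), IO = W1 i m,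
     IA = (\<lambda>a a'. the_elem (induced1 id (i, m, a) (i, m, a')))\<rparr>"

definition induced2 :: "(('k::field, 'n::finite) wvec \<Rightarrow> ('k, 'n) wvec)
    \<Rightarrow> nat \<times> nat \<Rightarrow> nat \<times> nat \<Rightarrow> ('k, 'n) a2 set" where
  "induced2 \<phi> = (\<lambda>(i, m) (i', m').
     ind_lift (pro_cat vectW) (W2 i m) (W2 i' m') (\<lambda>a a'. induced1 \<phi> (i, m, a) (i', m', a')))"

definition W3 :: "nat \<Rightarrow> ('k::field, 'n::finite) o3" where
  "W3 i = \<lparr>Idx = UNIV, Le = (\<le>), IO = (\<lambda>m. (W2 i m, Idn (tate_el vectW) (W2 i m))),
     IA = (\<lambda>m m'. the_elem (induced2 id (i, m') (i, m)))\<rparr>"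

definition induced3 :: "(('k::field, 'n::finite) wvec \<Rightarrow> ('k, 'n) wvec)
    \<Rightarrow> nat \<Rightarrow> nat \<Rightarrow> ('k, 'n) a3 set" where
  "induced3 \<phi> i i' =
     ind_lift (op_ex (tate vectW)) (W3 i') (W3 i) (\<lambda>m' m. induced2 \<phi> (i, m) (i', m'))"

definition W4 :: "('k::field, 'n::finite) o4" where
  "W4 = \<lparr>Idx = UNIV, Le = (\<le>), IO = W3, IA = (\<lambda>i i'. the_elem (induced3 id i i'))\<rparr>"

definition induced4 :: "(('k::field, 'n::finite) wvec \<Rightarrow> ('k, 'n) wvec) \<Rightarrow> ('k, 'n) a4 set" where
  "induced4 \<phi> = ind_lift (pro_cat (tate vectW)) W4 W4 (induced3 \<phi>)"

definition AutW :: "('k::field, 'n::finite) a4 monoid" where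
  "AutW = aut_group two_tate W4"

definition iotaH :: "('k::field, 'n::finite) hmat \<Rightarrow> ('k, 'n) a4" where
  "iotaH h = the_elem (induced4 (\<lambda>(x, y). (fst h *v x, snd h *v y)))"


section \<open>Graded lines and the determinant 2-group\<close>

definition is_line :: "('s::field, 'v) vspace \<Rightarrow> bool" where
  "is_line L \<longleftrightarrow> vec_space L \<and> (\<exists>b\<in>Vcar L. b \<noteq> Vzero L \<and> Vcar L = range (\<lambda>c. Vscl L c b))"

text \<open>A chosen tensor product of lines and its universal bilinear map.\<close>

definition line_ten :: "('k::field, 'k) vspace \<Rightarrow> ('k, 'k) vspace
    \<Rightarrow> ('k, 'k) vspace \<times> ('k \<Rightarrow> 'k \<Rightarrow> 'k)" where
  "line_ten L M = (SOME (T, \<beta>). is_line T \<and> is_tensor L M T \<beta>)"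

abbreviation lten :: "('k::field, 'k) vspace \<Rightarrow> ('k, 'k) vspace \<Rightarrow> ('k, 'k) vspace" where
  "lten L M \<equiv> fst (line_ten L M)"

abbreviation lbil :: "('k::field, 'k) vspace \<Rightarrow> ('k, 'k) vspace \<Rightarrow> 'k \<Rightarrow> 'k \<Rightarrow> 'k" where
  "lbil L M \<equiv> snd (line_ten L M)"

text \<open>Graded one-dimensional \<open>k\<close>-spaces \<open>(L, d)\<close> with the Koszul sign in the symmetry. The carriers
  are taken from the type \<open>'k\<close>, which supplies lines of every isomorphism class.\<close>

definition picZ :: "(('k::field, 'k) vspace \<times> int, 'k \<Rightarrow> 'k) symmoncat" where
  "picZ = \<lparr>
     Ob = {(L, d). is_line L},
     Hom = (\<lambda>(L, d) (M, e). {f \<in> lin_maps L M. d = e \<and> bij_betw f (Vcar L) (Vcar M)}),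
     Idn = (\<lambda>(L, d). \<lambda>x\<in>Vcar L. x),
     Cmp = (\<lambda>X Y Z g f. compose (Vcar (fst X)) g f),
     UnO = (field_space, 0),
     TenO = (\<lambda>(L, d) (M, e). (lten L M, d + e)),
     TenA = (\<lambda>((L, _), f, (L', _)) ((M, _), g, (M', _)).
        THE h. h \<in> lin_maps (lten L M) (lten L' M') \<and>
          (\<forall>x\<in>Vcar L. \<forall>y\<in>Vcar M. h (lbil L M x y) = lbil L' M' (f x) (g y))),
     Asc = (\<lambda>(L, _) (M, _) (N, _).
        THE h. h \<in> lin_maps (lten (lten L M) N) (lten L (lten M N)) \<and>
          (\<forall>x\<in>Vcar L. \<forall>y\<in>Vcar M. \<forall>z\<in>Vcar N.
             h (lbil (lten L M) N (lbil L M x y) z) = lbil L (lten M N) x (lbil M N y z))),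
     LUn = (\<lambda>(L, _). THE h. h \<in> lin_maps (lten field_space L) L \<and>
        (\<forall>c. \<forall>x\<in>Vcar L. h (lbil field_space L c x) = Vscl L c x)),
     RUn = (\<lambda>(L, _). THE h. h \<in> lin_maps (lten L field_space) L \<and>
        (\<forall>c. \<forall>x\<in>Vcar L. h (lbil L field_space x c) = Vscl L c x)),
     Sym = (\<lambda>(L, d) (M, e). THE h. h \<in> lin_maps (lten L M) (lten M L) \<and>
        (\<forall>x\<in>Vcar L. \<forall>y\<in>Vcar M. h (lbil L M x y) = Vscl (lten M L) ((- 1) powi (d * e)) (lbil M L y x)))\<rparr>"

text \<open>For a central extension with projection \<open>q : E \<rightarrow> Aut(W)\<^sub>d\<^sub>i\<^sub>s\<^sub>c\<close>: its homotopy pullback along \<open>\<iota>\<^sub>H\<close>.\<close>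

definition Hdet :: "('p, 'b) moncat \<Rightarrow> ('p, 'b, ('k::field, 'n::finite) a4, unit) mfunc
    \<Rightarrow> (('k, 'n) hmat \<times> 'p \<times> unit, unit \<times> 'b) moncat" where
  "Hdet E q = hpullback (disc HG) E (disc AutW) (disc_map iotaH) q"

definition pdet :: "(('k::field, 'n::finite) hmat \<times> 'p \<times> unit, unit \<times> 'b, ('k, 'n) hmat, unit) mfunc" where
  "pdet = hpullback_fst (disc HG)"

definition rho_det :: "('n::{finite,linorder} \<Rightarrow> Lam) \<Rightarrow> 'v set set \<Rightarrow> ('p, 'b) moncat
    \<Rightarrow> ('p, 'b, ('k::field, 'n) a4, unit) mfunc
    \<Rightarrow> (('k, 'n) hmat \<times> 'p \<times> unit, unit \<times> 'b, (('k, 'n, 'v) usm_ob, ('k, 'n, 'v) usm_ar) endo,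
        ('k, 'n, 'v) usm_ob \<Rightarrow> ('k, 'n, 'v) usm_ar) mfunc" where
  "rho_det \<alpha> \<U> E q =
     comp_mfunc (Hdet E q) (disc HG) (exact_aut (usm_cat \<alpha> \<U>)) (rho \<alpha> \<U>) pdet"

end

theory Submission
  imports Defs
begin

text \<open>The representation \<open>\<rho>\<^sup>d\<^sup>e\<^sup>t\<close> is inflated along \<open>p\<close> from an action that is strict, and this is why the
  determinant kernel acts trivially: its objects lie over the unit \<open>\<one>\<close> of \<open>H\<close>, which acts by the identity
  functor on the nose, and every arrow of \<open>H\<^sup>d\<^sup>e\<^sup>t\<close> lies over an identity arrow of the discrete 2-group
  \<open>H\<^sub>d\<^sub>i\<^sub>s\<^sub>c\<close>. This formal part is \<open>exact_two_rep_inflation\<close>, \<open>kernel_object_trivial\<close> and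
  \<open>kernel_arrow_trivial\<close>. It rests on three other bodies of facts.

  First, the 2-groups. Since every arrow of a discrete 2-group is an identity, a homotopy pullback or fibre
  over it is a full subcategory of a product, respectively of the total 2-group, and inherits all coherence
  diagrams (\<open>pulled_back\<close>). Hence \<open>H\<^sup>d\<^sup>e\<^sup>t\<close> is a coherent 2-group, and the fibre of \<open>p\<close> is the fibre of the given
  determinant extension (\<open>hfiber_hpullback\<close>), which is equivalent to the graded lines by hypothesis.

  Second, the pullback is formed along \<open>\<iota>\<^sub>H\<close>, so that block-diagonal matrices have to act on the 2-Tate object
  \<open>W\<close> (\<open>iotaH_hom\<close>). An operator induces at most one arrow between any two finite-dimensional
  subquotients of \<open>W\<close>, compatibly with products; \<open>induced_family\<close> states this, and the property is inherited by
  each of the layers (Pro, Ind, idempotent completion, Pro, Ind). That the induced arrow exists is an estimate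
  of orders in \<open>t\<close> and \<open>u\<close> (\<open>act_lat\<close>).

  Third, the action on the principal series category. The congruence subgroups are subgroups, and \<open>\<C>\<^sub>H\<close> is
  closed under intersections and conjugation, so the filtered colimits of the morphism spaces form a linear
  category (\<open>category_usm\<close>). Refinement of levels and right translation are both pullbacks along maps of coset
  spaces that commute with left translation; pullback along such a map preserves the whole structure of the
  category at a level (\<open>is_psob_pull\<close>, \<open>ps_hom_pull\<close>, \<open>ps_ops_pull\<close>). Therefore the right translations \<open>R\<^sub>h\<close> are
  linear functors with \<open>R\<^sub>g R\<^sub>h = R\<^sub>g\<^sub>h\<close> and \<open>R\<^sub>1 = 1\<close>; being invertible, they are exact equivalences. Finally,
  \<open>g C h = g C\<close> for \<open>h \<in> C\<close>, so that an object of level \<open>C\<close> and an arrow represented at level \<open>C\<close> are fixed by the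
  elements of \<open>C\<close> (\<open>uniformly_smooth_Rfun\<close>).\<close>

section \<open>Functors and equivalences\<close>

context category
begin

lemma is_isoD:
  assumes "is_iso C x y f" shows "f \<in> Hom C x y"
  using assms by (simp add: is_iso_def)

lemma inv_arrow_eq:
  assumes "x \<in> Ob C" "y \<in> Ob C" "f \<in> Hom C x y" "g \<in> Hom C y x"
    and "Cmp C x y x g f = Idn C x" "Cmp C y x y f g = Idn C y"
  shows "inv_arrow C x y f = g"
  unfolding inv_arrow_def
proof (rule the_equality)
  show "g \<in> Hom C y x \<and> Cmp C x y x g f = Idn C x \<and> Cmp C y x y f g = Idn C y"
    using assms by simp
  fix g' assume g': "g' \<in> Hom C y x \<and> Cmp C x y x g' f = Idn C x \<and> Cmp C y x y f g' = Idn C y"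
  have "g' = Cmp C y x x (Cmp C x y x g f) g'" using g' assms by (simp add: Idn_left)
  also have "\<dots> = Cmp C y y x g (Cmp C y x y f g')" using g' assms by (intro Cmp_assoc) auto
  also have "\<dots> = g" using g' assms by (simp add: Idn_right)
  finally show "g' = g" .
qed

lemma inv_arrow:
  assumes "x \<in> Ob C" "y \<in> Ob C" "is_iso C x y f"
  shows "inv_arrow C x y f \<in> Hom C y x"
    and "Cmp C x y x (inv_arrow C x y f) f = Idn C x"
    and "Cmp C y x y f (inv_arrow C x y f) = Idn C y"
proof -
  obtain g where g: "f \<in> Hom C x y" "g \<in> Hom C y x" "Cmp C x y x g f = Idn C x" "Cmp C y x y f g = Idn C y"
    using assms(3) by (auto simp: is_iso_def)
  then have "inv_arrow C x y f = g" using assms by (intro inv_arrow_eq)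
  with g show "inv_arrow C x y f \<in> Hom C y x" "Cmp C x y x (inv_arrow C x y f) f = Idn C x"
    "Cmp C y x y f (inv_arrow C x y f) = Idn C y" by auto
qed

lemma is_iso_Idn: "x \<in> Ob C \<Longrightarrow> is_iso C x x (Idn C x)"
  unfolding is_iso_def using Idn_hom Idn_left by blast

lemma inv_arrow_Idn: "x \<in> Ob C \<Longrightarrow> inv_arrow C x x (Idn C x) = Idn C x"
  by (intro inv_arrow_eq) (auto simp: Idn_hom Idn_left)

lemma is_iso_Cmp:
  assumes o: "x \<in> Ob C" "y \<in> Ob C" "z \<in> Ob C" and "is_iso C x y f" "is_iso C y z g"
  shows "is_iso C x z (Cmp C x y z g f)"
proof -
  obtain f' g' where f: "f \<in> Hom C x y" "f' \<in> Hom C y x" "Cmp C x y x f' f = Idn C x" "Cmp C y x y f f' = Idn C y"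
    and g: "g \<in> Hom C y z" "g' \<in> Hom C z y" "Cmp C y z y g' g = Idn C y" "Cmp C z y z g g' = Idn C z"
    using assms(4,5) by (auto simp: is_iso_def)
  have a: "Cmp C x z y g' (Cmp C x y z g f) = f"
    using Cmp_assoc[of x y z y f g g'] o f g by (simp add: Idn_left)
  have b: "Cmp C z x y f (Cmp C z y x f' g') = g'"
    using Cmp_assoc[of z y x y g' f' f] o f g by (simp add: Idn_left)
  show ?thesis unfolding is_iso_def
    using o f g a b Cmp_hom Cmp_assoc[of x z y x "Cmp C x y z g f" g' f']
      Cmp_assoc[of z x y z "Cmp C z y x f' g'" f g]
    by (intro conjI bexI[of _ "Cmp C z y x f' g'"]) (simp_all add: Idn_left)
qed

end

lemma (in cat_functor) FA_iso:
  assumes "x \<in> Ob C" "y \<in> Ob C" "is_iso C x y f"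
  shows "is_iso D (FO F x) (FO F y) (FA F x y f)"
proof -
  obtain g where f: "f \<in> Hom C x y" "g \<in> Hom C y x" "Cmp C x y x g f = Idn C x" "Cmp C y x y f g = Idn C y"
    using assms(3) by (auto simp: is_iso_def)
  show ?thesis unfolding is_iso_def
    using assms f FA_hom FA_cmp[of x y x f g] FA_cmp[of y x y g f] FA_id by force
qed

text \<open>Composites are described by a predicate, because \<open>comp_func\<close> and \<open>comp_mfunc\<close> both produce composites,
  as records of different types.\<close>

definition is_composite :: "('o, 'a, 'z) cat_scheme \<Rightarrow> ('o, 'a, 'p, 'b, 'w) func_scheme
    \<Rightarrow> ('p, 'b, 'q, 'c, 'v) func_scheme \<Rightarrow> ('o, 'a, 'q, 'c, 'u) func_scheme \<Rightarrow> bool" where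
  "is_composite C F F' H \<longleftrightarrow> (\<forall>x\<in>Ob C. FO H x = FO F' (FO F x)) \<and>
     (\<forall>x\<in>Ob C. \<forall>y\<in>Ob C. \<forall>f\<in>Hom C x y. FA H x y f = FA F' (FO F x) (FO F y) (FA F x y f))"

lemma is_compositeD:
  assumes "is_composite C F F' H"
  shows "x \<in> Ob C \<Longrightarrow> FO H x = FO F' (FO F x)"
    and "\<lbrakk>x \<in> Ob C; y \<in> Ob C; f \<in> Hom C x y\<rbrakk> \<Longrightarrow> FA H x y f = FA F' (FO F x) (FO F y) (FA F x y f)"
  using assms by (auto simp: is_composite_def)

lemma cat_functor_composite:
  assumes "cat_functor C D F" "cat_functor D E F'" "is_composite C F F' H"
  shows "cat_functor C E H"
proof -
  interpret F: cat_functor C D F by fact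
  interpret F': cat_functor D E F' by fact
  note H = is_compositeD[OF assms(3)]
  show ?thesis
    by unfold_locales
      (simp_all add: H F.FO_ob F.FA_hom F.FA_id F.FA_cmp F'.FO_ob F'.FA_hom F'.FA_id F'.FA_cmp
        F.C.Idn_hom F.C.Cmp_hom)
qed

lemma mk_func_sel [simp]:
  "x \<in> Ob C \<Longrightarrow> FO (mk_func C a b) x = a x"
  "\<lbrakk>x \<in> Ob C; y \<in> Ob C; f \<in> Hom C x y\<rbrakk> \<Longrightarrow> FA (mk_func C a b) x y f = b x y f"
  by (simp_all add: mk_func_def)

lemma ext_mk_func: "ext_func C (mk_func C a b)"
  by (simp add: ext_func_def mk_func_def)

lemma ext_func_eqI:
  assumes "ext_func C F" "ext_func C G" "\<And>x. x \<in> Ob C \<Longrightarrow> FO F x = FO G x"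
    and "\<And>x y f. \<lbrakk>x \<in> Ob C; y \<in> Ob C; f \<in> Hom C x y\<rbrakk> \<Longrightarrow> FA F x y f = FA G x y f"
  shows "F = (G :: ('o, 'a, 'p, 'b) func)"
proof -
  have "FO F x = FO G x" for x using assms by (cases "x \<in> Ob C") (auto simp: ext_func_def)
  moreover have "FA F x y f = FA G x y f" for x y f
    using assms by (cases "x \<in> Ob C \<and> y \<in> Ob C \<and> f \<in> Hom C x y") (auto simp: ext_func_def)
  ultimately show ?thesis by (intro func.equality ext) simp_all
qed

lemma is_composite_comp_func: "is_composite C F G (comp_func C G F)"
  by (simp add: is_composite_def comp_func_def)

lemma cat_functor_id: "category C \<Longrightarrow> cat_functor C C (id_func C)"
  unfolding cat_functor_def cat_functor_axioms_def
  by (simp add: id_func_def category.Idn_hom category.Cmp_hom)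

text \<open>The unit of the composite is \<open>x \<rightarrow> G F x \<rightarrow> G G' F' F x\<close>, the image of the unit of \<open>F'\<close> following that of
  \<open>F\<close>; the counit is formed likewise. Naturality is obtained by pasting the naturality squares of the factors.\<close>

lemma equivalence_composite:
  fixes C :: "('o, 'a, 'z) cat_scheme" and D :: "('p, 'b, 'y) cat_scheme" and E :: "('q, 'c, 'x) cat_scheme"
  assumes "equivalence C D F" "equivalence D E F'" and H: "is_composite C F F' H"
  shows "equivalence C E H"
proof -
  from assms(1) obtain G :: "('p, 'b, 'o, 'a) func" and \<eta> \<theta> where
    "cat_functor C D F" "cat_functor D C G"
    and n: "nat_iso C C (id_func C) (comp_func C G F) \<eta>" "nat_iso D D (comp_func D F G) (id_func D) \<theta>"
    unfolding equivalence_def by blast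
  from assms(2) obtain G' :: "('q, 'c, 'p, 'b) func" and \<eta>' \<theta>' where
    "cat_functor D E F'" "cat_functor E D G'"
    and n': "nat_iso D D (id_func D) (comp_func D G' F') \<eta>'" "nat_iso E E (comp_func E F' G') (id_func E) \<theta>'"
    unfolding equivalence_def by blast
  interpret F: cat_functor C D F by fact
  interpret F': cat_functor D E F' by fact
  interpret G: cat_functor D C G by fact
  interpret G': cat_functor E D G' by fact
  interpret H: cat_functor C E H
    using cat_functor_composite[OF \<open>cat_functor C D F\<close> \<open>cat_functor D E F'\<close> H] .
  let ?K = "comp_func E G G'"
  have K: "is_composite E G' G ?K" by (rule is_composite_comp_func)
  interpret K: cat_functor E C ?K
    using cat_functor_composite[OF \<open>cat_functor E D G'\<close> \<open>cat_functor D C G\<close> K] .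
  note h = is_compositeD[OF H] is_compositeD[OF K]
  note obs = F.FO_ob G.FO_ob F'.FO_ob G'.FO_ob and homs = F.FA_hom G.FA_hom F'.FA_hom G'.FA_hom
  have i: "is_iso C x (FO G (FO F x)) (\<eta> x)" if "x \<in> Ob C" for x
    using n(1) that by (simp add: nat_iso_def id_func_def comp_func_def)
  have nat: "Cmp C x (FO G (FO F x)) (FO G (FO F y)) (FA G (FO F x) (FO F y) (FA F x y f)) (\<eta> x)
      = Cmp C x y (FO G (FO F y)) (\<eta> y) f" if "x \<in> Ob C" "y \<in> Ob C" "f \<in> Hom C x y" for x y f
    using n(1) that by (simp add: nat_iso_def id_func_def comp_func_def)
  have i': "is_iso D x (FO G' (FO F' x)) (\<eta>' x)" if "x \<in> Ob D" for x
    using n'(1) that by (simp add: nat_iso_def id_func_def comp_func_def)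
  have nat': "Cmp D x (FO G' (FO F' x)) (FO G' (FO F' y)) (FA G' (FO F' x) (FO F' y) (FA F' x y f)) (\<eta>' x)
      = Cmp D x y (FO G' (FO F' y)) (\<eta>' y) f" if "x \<in> Ob D" "y \<in> Ob D" "f \<in> Hom D x y" for x y f
    using n'(1) that by (simp add: nat_iso_def id_func_def comp_func_def)
  have j: "is_iso D (FO F (FO G x)) x (\<theta> x)" if "x \<in> Ob D" for x
    using n(2) that by (simp add: nat_iso_def id_func_def comp_func_def)
  have natj: "Cmp D (FO F (FO G x)) x y f (\<theta> x) =
      Cmp D (FO F (FO G x)) (FO F (FO G y)) y (\<theta> y) (FA F (FO G x) (FO G y) (FA G x y f))"
    if "x \<in> Ob D" "y \<in> Ob D" "f \<in> Hom D x y" for x y f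
    using n(2) that by (simp add: nat_iso_def id_func_def comp_func_def)
  have j': "is_iso E (FO F' (FO G' x)) x (\<theta>' x)" if "x \<in> Ob E" for x
    using n'(2) that by (simp add: nat_iso_def id_func_def comp_func_def)
  have natj': "Cmp E (FO F' (FO G' x)) x y f (\<theta>' x) =
      Cmp E (FO F' (FO G' x)) (FO F' (FO G' y)) y (\<theta>' y) (FA F' (FO G' x) (FO G' y) (FA G' x y f))"
    if "x \<in> Ob E" "y \<in> Ob E" "f \<in> Hom E x y" for x y f
    using n'(2) that by (simp add: nat_iso_def id_func_def comp_func_def)
  note ih = i[THEN F.C.is_isoD] i'[THEN F.D.is_isoD] j[THEN F.D.is_isoD] j'[THEN F'.D.is_isoD]
  let ?\<eta> = "\<lambda>x. Cmp C x (FO G (FO F x)) (FO G (FO G' (FO F' (FO F x))))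
     (FA G (FO F x) (FO G' (FO F' (FO F x))) (\<eta>' (FO F x))) (\<eta> x)"
  let ?\<theta> = "\<lambda>z. Cmp E (FO F' (FO F (FO G (FO G' z)))) (FO F' (FO G' z)) z
     (\<theta>' z) (FA F' (FO F (FO G (FO G' z))) (FO G' z) (\<theta> (FO G' z)))"
  have "nat_iso C C (id_func C) (comp_func C ?K H) ?\<eta>"
    unfolding nat_iso_def
  proof (intro conjI ballI)
    fix x assume x: "x \<in> Ob C"
    then show "is_iso C (FO (id_func C) x) (FO (comp_func C ?K H) x) (?\<eta> x)"
      by (simp add: id_func_def comp_func_def h obs i i' F.C.is_iso_Cmp G.FA_iso)
    fix y f assume y: "y \<in> Ob C" and f: "f \<in> Hom C x y"
    let ?f = "FA F x y f"
    let ?f' = "FA G' (FO F' (FO F x)) (FO F' (FO F y)) (FA F' (FO F x) (FO F y) ?f)"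
    have 1: "Cmp C (FO G (FO F x)) (FO G (FO G' (FO F' (FO F x)))) (FO G (FO G' (FO F' (FO F y))))
        (FA G (FO G' (FO F' (FO F x))) (FO G' (FO F' (FO F y))) ?f') (FA G (FO F x) (FO G' (FO F' (FO F x))) (\<eta>' (FO F x)))
      = Cmp C (FO G (FO F x)) (FO G (FO F y)) (FO G (FO G' (FO F' (FO F y))))
        (FA G (FO F y) (FO G' (FO F' (FO F y))) (\<eta>' (FO F y))) (FA G (FO F x) (FO F y) ?f)"
      using x y f nat'[of "FO F x" "FO F y" ?f]
      by (simp add: obs homs ih flip: G.FA_cmp)
    let ?e = "FA G (FO F y) (FO G' (FO F' (FO F y))) (\<eta>' (FO F y))"
    have 2: "Cmp C x (FO G (FO F x)) (FO G (FO G' (FO F' (FO F y))))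
        (Cmp C (FO G (FO F x)) (FO G (FO F y)) (FO G (FO G' (FO F' (FO F y)))) ?e (FA G (FO F x) (FO F y) ?f)) (\<eta> x)
      = Cmp C x (FO G (FO F y)) (FO G (FO G' (FO F' (FO F y)))) ?e
         (Cmp C x (FO G (FO F x)) (FO G (FO F y)) (FA G (FO F x) (FO F y) ?f) (\<eta> x))"
      using x y f by (intro F.C.Cmp_assoc) (simp_all add: obs homs ih)
    show "Cmp C (FO (id_func C) x) (FO (comp_func C ?K H) x) (FO (comp_func C ?K H) y)
            (FA (comp_func C ?K H) x y f) (?\<eta> x) =
          Cmp C (FO (id_func C) x) (FO (id_func C) y) (FO (comp_func C ?K H) y)
            (?\<eta> y) (FA (id_func C) x y f)"
      using x y f
      apply (simp add: id_func_def comp_func_def[of C] h obs homs ih)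
      apply (subst F.C.Cmp_assoc[symmetric]; (simp add: obs homs ih)?)
      apply (simp add: 1 2 nat)
      apply (subst F.C.Cmp_assoc[symmetric]; (simp add: obs homs ih)?)
      done
  qed
  moreover have "nat_iso E E (comp_func E H ?K) (id_func E) ?\<theta>"
    unfolding nat_iso_def
  proof (intro conjI ballI)
    fix x assume x: "x \<in> Ob E"
    then show "is_iso E (FO (comp_func E H ?K) x) (FO (id_func E) x) (?\<theta> x)"
      by (simp add: id_func_def comp_func_def[of E H] h obs j j' F'.D.is_iso_Cmp F'.FA_iso)
    fix y f assume y: "y \<in> Ob E" and f: "f \<in> Hom E x y"
    let ?g = "FA G' x y f"
    let ?g' = "FA F (FO G (FO G' x)) (FO G (FO G' y)) (FA G (FO G' x) (FO G' y) ?g)"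
    have 1: "Cmp E (FO F' (FO F (FO G (FO G' x)))) (FO F' (FO G' x)) (FO F' (FO G' y))
          (FA F' (FO G' x) (FO G' y) ?g) (FA F' (FO F (FO G (FO G' x))) (FO G' x) (\<theta> (FO G' x)))
       = Cmp E (FO F' (FO F (FO G (FO G' x)))) (FO F' (FO F (FO G (FO G' y)))) (FO F' (FO G' y))
          (FA F' (FO F (FO G (FO G' y))) (FO G' y) (\<theta> (FO G' y))) (FA F' (FO F (FO G (FO G' x))) (FO F (FO G (FO G' y))) ?g')"
      using x y f natj[of "FO G' x" "FO G' y" ?g]
      by (simp add: obs homs ih flip: F'.FA_cmp)
    show "Cmp E (FO (comp_func E H ?K) x) (FO (id_func E) x) (FO (id_func E) y)
            (FA (id_func E) x y f) (?\<theta> x) =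
          Cmp E (FO (comp_func E H ?K) x) (FO (comp_func E H ?K) y) (FO (id_func E) y)
            (?\<theta> y) (FA (comp_func E H ?K) x y f)"
      using x y f
      apply (simp add: id_func_def comp_func_def[of E H] h obs homs ih)
      apply (subst F'.D.Cmp_assoc[symmetric]; (simp add: obs homs ih)?)
      apply (simp add: natj')
      apply (subst F'.D.Cmp_assoc; (simp add: obs homs ih)?)
      apply (subst F'.D.Cmp_assoc; (simp add: obs homs ih)?)
      apply (simp add: 1)
      done
  qed
  ultimately show ?thesis
    unfolding equivalence_def using H.cat_functor_axioms K.cat_functor_axioms by blast
qed

text \<open>One-sided: \<open>G\<close> is a left inverse of \<open>F\<close>.\<close>

definition strictly_inverse :: "('o, 'a, 'z) cat_scheme \<Rightarrow> ('o, 'a, 'p, 'b, 'w) func_scheme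
    \<Rightarrow> ('p, 'b, 'o, 'a, 'v) func_scheme \<Rightarrow> bool" where
  "strictly_inverse C F G \<longleftrightarrow> (\<forall>x\<in>Ob C. FO G (FO F x) = x) \<and>
     (\<forall>x\<in>Ob C. \<forall>y\<in>Ob C. \<forall>f\<in>Hom C x y. FA G (FO F x) (FO F y) (FA F x y f) = f)"

lemma equivalence_strict:
  fixes G :: "('p, 'b, 'o, 'a) func"
  assumes F: "cat_functor C D F" and G: "cat_functor D C G"
    and GF: "strictly_inverse C F G" and FG: "strictly_inverse D G F"
  shows "equivalence C D F"
proof -
  interpret F: cat_functor C D F by fact
  interpret G: cat_functor D C G by fact
  have "nat_iso C C (id_func C) (comp_func C G F) (Idn C)"
    using GF by (auto simp: nat_iso_def strictly_inverse_def id_func_def comp_func_def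
        F.C.is_iso_Idn F.C.Idn_left F.C.Idn_right)
  moreover have "nat_iso D D (comp_func D F G) (id_func D) (Idn D)"
    using FG by (auto simp: nat_iso_def strictly_inverse_def id_func_def comp_func_def
        F.D.is_iso_Idn F.D.Idn_left F.D.Idn_right)
  ultimately show ?thesis unfolding equivalence_def using F G by blast
qed

lemma zero_arrow_linear:
  assumes "cat_functor C D F" "linear_func C D F" "x \<in> Ob C" "y \<in> Ob C" "zero_arrow C x y f"
  shows "zero_arrow D (FO F x) (FO F y) (FA F x y f)"
  using assms cat_functor.FA_hom[OF assms(1), of x y f]
  unfolding zero_arrow_def linear_func_def by metis

text \<open>Kernels and cokernels are defined by universal properties, so an isomorphism of linear
  categories preserves them.\<close>

lemma exact_strict:
  assumes F: "cat_functor C D F" and G: "cat_functor D C G"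
    and lF: "linear_func C D F" and lG: "linear_func D C G"
    and GF: "strictly_inverse C F G" and FG: "strictly_inverse D G F"
  shows "exact_func C D F"
proof -
  interpret F: cat_functor C D F by fact
  interpret G: cat_functor D C G by fact
  have gf: "FO G (FO F x) = x" if "x \<in> Ob C" for x using GF that by (simp add: strictly_inverse_def)
  have gfa: "FA G (FO F x) (FO F y) (FA F x y f) = f" if "x \<in> Ob C" "y \<in> Ob C" "f \<in> Hom C x y" for x y f
    using GF that by (simp add: strictly_inverse_def)
  have fg: "FO F (FO G x) = x" if "x \<in> Ob D" for x using FG that by (simp add: strictly_inverse_def)
  have fga: "FA F (FO G x) (FO G y) (FA G x y f) = f" if "x \<in> Ob D" "y \<in> Ob D" "f \<in> Hom D x y" for x y f
    using FG that by (simp add: strictly_inverse_def)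
  have zero: "zero_arrow C (FO G x) (FO G y) (FA G x y f)" if "x \<in> Ob D" "y \<in> Ob D" "zero_arrow D x y f" for x y f
    using zero_arrow_linear[OF G lG that] .
  note [simp] = F.FO_ob G.FO_ob F.FA_hom G.FA_hom
  have ker: "is_kernel D (FO F x) (FO F y) (FO F z) (FA F x y f) (FA F y z g)"
    if o: "x \<in> Ob C" "y \<in> Ob C" "z \<in> Ob C" and k: "is_kernel C x y z f g" for x y z f g
  proof -
    have h: "f \<in> Hom C x y" "g \<in> Hom C y z" "zero_arrow C x z (Cmp C x y z g f)"
      using k by (auto simp: is_kernel_def)
    have "\<exists>!u. u \<in> Hom D w (FO F x) \<and> Cmp D w (FO F x) (FO F y) (FA F x y f) u = e"
      if w: "w \<in> Ob D" and e: "e \<in> Hom D w (FO F y)"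
        and z: "zero_arrow D w (FO F z) (Cmp D w (FO F y) (FO F z) (FA F y z g) e)" for w e
    proof -
      let ?e = "FA G w (FO F y) e"
      have e': "?e \<in> Hom C (FO G w) y" using G.FA_hom[of w "FO F y" e] w e o by (simp add: gf)
      have "zero_arrow C (FO G w) z (Cmp C (FO G w) y z g ?e)"
        using zero[OF _ _ z] w o h e G.FA_cmp[of w "FO F y" "FO F z" e "FA F y z g"] by (simp add: gf gfa)
      then obtain u where u: "u \<in> Hom C (FO G w) x" "Cmp C (FO G w) x y f u = ?e"
        and uniq: "\<And>v. v \<in> Hom C (FO G w) x \<Longrightarrow> Cmp C (FO G w) x y f v = ?e \<Longrightarrow> v = u"
        using k w e' unfolding is_kernel_def by (metis G.FO_ob)
      show ?thesis
      proof (rule ex1I[of _ "FA F (FO G w) x u"])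
        show "FA F (FO G w) x u \<in> Hom D w (FO F x) \<and>
           Cmp D w (FO F x) (FO F y) (FA F x y f) (FA F (FO G w) x u) = e"
          using F.FA_hom[of "FO G w" x u] F.FA_cmp[of "FO G w" x y u f] u w o h fga[of w "FO F y" e] e
          by (simp add: fg gf)
        fix v assume v: "v \<in> Hom D w (FO F x) \<and> Cmp D w (FO F x) (FO F y) (FA F x y f) v = e"
        have "FA G w (FO F x) v = u"
          using uniq[of "FA G w (FO F x) v"] v G.FA_hom[of w "FO F x" v] w o h
            G.FA_cmp[of w "FO F x" "FO F y" v "FA F x y f"] by (simp add: gf gfa)
        then show "v = FA F (FO G w) x u" using fga[of w "FO F x" v] v w o by (simp add: gf)
      qed
    qed
    then show ?thesis
      unfolding is_kernel_def using o h zero_arrow_linear[OF F lF _ _ h(3)] F.FA_cmp[of x y z f g] by simp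
  qed
  have coker: "is_cokernel D (FO F x) (FO F y) (FO F z) (FA F x y f) (FA F y z g)"
    if o: "x \<in> Ob C" "y \<in> Ob C" "z \<in> Ob C" and k: "is_cokernel C x y z f g" for x y z f g
  proof -
    have h: "f \<in> Hom C x y" "g \<in> Hom C y z" "zero_arrow C x z (Cmp C x y z g f)"
      using k by (auto simp: is_cokernel_def)
    have "\<exists>!u. u \<in> Hom D (FO F z) w \<and> Cmp D (FO F y) (FO F z) w u (FA F y z g) = e"
      if w: "w \<in> Ob D" and e: "e \<in> Hom D (FO F y) w"
        and z: "zero_arrow D (FO F x) w (Cmp D (FO F x) (FO F y) w e (FA F x y f))" for w e
    proof -
      let ?e = "FA G (FO F y) w e"
      have e': "?e \<in> Hom C y (FO G w)" using G.FA_hom[of "FO F y" w e] w e o by (simp add: gf)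
      have "zero_arrow C x (FO G w) (Cmp C x y (FO G w) ?e f)"
        using zero[OF _ _ z] w o h e G.FA_cmp[of "FO F x" "FO F y" w "FA F x y f" e] by (simp add: gf gfa)
      then obtain u where u: "u \<in> Hom C z (FO G w)" "Cmp C y z (FO G w) u g = ?e"
        and uniq: "\<And>v. v \<in> Hom C z (FO G w) \<Longrightarrow> Cmp C y z (FO G w) v g = ?e \<Longrightarrow> v = u"
        using k w e' unfolding is_cokernel_def by (metis G.FO_ob)
      show ?thesis
      proof (rule ex1I[of _ "FA F z (FO G w) u"])
        show "FA F z (FO G w) u \<in> Hom D (FO F z) w \<and>
           Cmp D (FO F y) (FO F z) w (FA F z (FO G w) u) (FA F y z g) = e"
          using F.FA_hom[of z "FO G w" u] F.FA_cmp[of y z "FO G w" g u] u w o h fga[of "FO F y" w e] e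
          by (simp add: fg gf)
        fix v assume v: "v \<in> Hom D (FO F z) w \<and> Cmp D (FO F y) (FO F z) w v (FA F y z g) = e"
        have "FA G (FO F z) w v = u"
          using uniq[of "FA G (FO F z) w v"] v G.FA_hom[of "FO F z" w v] w o h
            G.FA_cmp[of "FO F y" "FO F z" w "FA F y z g" v] by (simp add: gf gfa)
        then show "v = FA F z (FO G w) u" using fga[of "FO F z" w v] v w o by (simp add: gf)
      qed
    qed
    then show ?thesis
      unfolding is_cokernel_def using o h zero_arrow_linear[OF F lF _ _ h(3)] F.FA_cmp[of x y z f g] by simp
  qed
  show ?thesis unfolding exact_func_def short_exact_def using ker coker by blast
qed

lemma linear_composite:
  assumes "cat_functor C D F" "linear_func C D F" "linear_func D E G" "is_composite C F G H"
    and "\<And>x y f g. \<lbrakk>x \<in> Ob C; y \<in> Ob C; f \<in> Hom C x y; g \<in> Hom C x y\<rbrakk> \<Longrightarrow> AAdd C x y f g \<in> Hom C x y"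
    and "\<And>x y c f. \<lbrakk>x \<in> Ob C; y \<in> Ob C; f \<in> Hom C x y\<rbrakk> \<Longrightarrow> AScl C x y c f \<in> Hom C x y"
  shows "linear_func C E H"
  using assms(2,3) is_compositeD[OF assms(4)] assms(5,6)
    cat_functor.FO_ob[OF assms(1)] cat_functor.FA_hom[OF assms(1)]
  unfolding linear_func_def by simp

lemma exact_composite:
  assumes F: "cat_functor C D F" "exact_func C D F" "exact_func D E G" "is_composite C F G H"
  shows "exact_func C E H"
  unfolding exact_func_def
proof (intro ballI allI impI)
  fix x y z f g assume o: "x \<in> Ob C" "y \<in> Ob C" "z \<in> Ob C" and s: "short_exact C x y z f g"
  then have h: "f \<in> Hom C x y" "g \<in> Hom C y z" by (auto simp: short_exact_def is_kernel_def)
  show "short_exact E (FO H x) (FO H y) (FO H z) (FA H x y f) (FA H y z g)"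
    using F(2,3) o h s cat_functor.FO_ob[OF F(1)] unfolding exact_func_def
    by (simp add: is_compositeD[OF F(4)])
qed

section \<open>Typed arrows and monoidal functors\<close>

abbreviation tgt :: "('o, 'a) tarr \<Rightarrow> 'o" where
  "tgt t \<equiv> snd (snd t)"

lemma tcomp_ends [simp]: "fst (tcomp C s t) = fst s" "tgt (tcomp C s t) = tgt t"
  by (cases s; cases t; simp)+

lemma tmap_ends [simp]: "fst (tmap F s) = FO F (fst s)" "tgt (tmap F s) = FO F (tgt s)"
  by (cases s; simp)+

lemma tid_ends [simp]: "fst (tid C x) = x" "tgt (tid C x) = x"
  by (simp_all add: tid_def)

lemma ten_ends [simp]: "fst (ten M s t) = TenO M (fst s) (fst t)" "tgt (ten M s t) = TenO M (tgt s) (tgt t)"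
  by (simp_all add: ten_def)

lemma structure_ends [simp]:
  "fst (tasc M x y z) = TenO M (TenO M x y) z" "tgt (tasc M x y z) = TenO M x (TenO M y z)"
  "fst (tlun M x) = TenO M (UnO M) x" "tgt (tlun M x) = x"
  "fst (trun M x) = TenO M x (UnO M)" "tgt (trun M x) = x"
  "fst (tmu M N F x y) = TenO N (FO F x) (FO F y)" "tgt (tmu M N F x y) = FO F (TenO M x y)"
  "fst (tep M N F) = UnO N" "tgt (tep M N F) = FO F (UnO M)"
  by (simp_all add: tasc_def tlun_def trun_def tmu_def tep_def)

lemma tarrs_ends: "s \<in> tarrs C \<Longrightarrow> fst s \<in> Ob C" "s \<in> tarrs C \<Longrightarrow> tgt s \<in> Ob C"
  by (auto simp: tarrs_def)

lemma tisos_tarrs: "s \<in> tisos C \<Longrightarrow> s \<in> tarrs C"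
  by (auto simp: tisos_def tarrs_def is_iso_def)

context category
begin

lemma tid_tarr: "x \<in> Ob C \<Longrightarrow> tid C x \<in> tarrs C"
  by (simp add: tarrs_def tid_def Idn_hom)

lemma tid_tiso: "x \<in> Ob C \<Longrightarrow> tid C x \<in> tisos C"
  by (simp add: tisos_def tid_def is_iso_Idn)

lemma tcomp_tarr: "\<lbrakk>s \<in> tarrs C; t \<in> tarrs C; tgt s = fst t\<rbrakk> \<Longrightarrow> tcomp C s t \<in> tarrs C"
  by (cases s; cases t) (auto simp: tarrs_def Cmp_hom)

lemma tcomp_tiso: "\<lbrakk>s \<in> tisos C; t \<in> tisos C; tgt s = fst t\<rbrakk> \<Longrightarrow> tcomp C s t \<in> tisos C"
  by (cases s; cases t) (auto simp: tisos_def is_iso_Cmp)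

lemma tcomp_assoc:
  "\<lbrakk>s \<in> tarrs C; t \<in> tarrs C; u \<in> tarrs C; tgt s = fst t; tgt t = fst u\<rbrakk>
    \<Longrightarrow> tcomp C (tcomp C s t) u = tcomp C s (tcomp C t u)"
  by (cases s; cases t; cases u) (auto simp: tarrs_def Cmp_assoc)

lemma tcomp_tid: "s \<in> tarrs C \<Longrightarrow> tcomp C (tid C (fst s)) s = s" "s \<in> tarrs C \<Longrightarrow> tcomp C s (tid C (tgt s)) = s"
  by (cases s; auto simp: tarrs_def tid_def Idn_left Idn_right)+

lemma tcomp_tid_tid: "x \<in> Ob C \<Longrightarrow> tcomp C (tid C x) (tid C x) = tid C x"
  by (simp add: tid_def Idn_left Idn_hom)

lemma tinv_tid: "x \<in> Ob C \<Longrightarrow> tinv C (tid C x) = tid C x"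
  by (simp add: tid_def inv_arrow_Idn)

end

context cat_functor
begin

lemma tmap_tarr: "s \<in> tarrs C \<Longrightarrow> tmap F s \<in> tarrs D"
  by (cases s) (auto simp: tarrs_def FO_ob FA_hom)

lemma tmap_tiso: "s \<in> tisos C \<Longrightarrow> tmap F s \<in> tisos D"
  by (cases s) (auto simp: tisos_def FO_ob FA_iso)

lemma tmap_tcomp:
  "\<lbrakk>s \<in> tarrs C; t \<in> tarrs C; tgt s = fst t\<rbrakk> \<Longrightarrow> tmap F (tcomp C s t) = tcomp D (tmap F s) (tmap F t)"
  by (cases s; cases t) (auto simp: tarrs_def FA_cmp)

lemma tmap_tid: "x \<in> Ob C \<Longrightarrow> tmap F (tid C x) = tid D (FO F x)"
  by (simp add: tid_def FA_id)

end

context monoidal_category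
begin

lemma ten_tcomp:
  assumes "s \<in> tarrs M" "t \<in> tarrs M" "s' \<in> tarrs M" "t' \<in> tarrs M" "tgt s = fst t" "tgt s' = fst t'"
  shows "ten M (tcomp M s t) (tcomp M s' t') = tcomp M (ten M s s') (ten M t t')"
proof -
  obtain x f y z g x' f' y' z' g' where "s = (x, f, y)" "t = (y, g, z)" "s' = (x', f', y')" "t' = (y', g', z')"
    using assms by (cases s; cases t; cases s'; cases t') auto
  then show ?thesis using ten_comp assms(1-4) by simp
qed

lemmas structure_tarr = asc_iso[THEN tisos_tarrs] lun_iso[THEN tisos_tarrs] run_iso[THEN tisos_tarrs]

end

context strong_monoidal_functor
begin

lemmas coherence_tarr = mu_iso[THEN tisos_tarrs] ep_iso[THEN tisos_tarrs]

lemma mu_nat':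
  assumes "s \<in> tarrs M" "t \<in> tarrs M"
  shows "tcomp N (ten N (tmap F s) (tmap F t)) (tmu M N F (tgt s) (tgt t)) =
         tcomp N (tmu M N F (fst s) (fst t)) (tmap F (ten M s t))"
  using assms mu_nat[of "fst s" "arrow_of s" "tgt s" "fst t" "arrow_of t" "tgt t"] by simp

end

lemma tmu_comp_mfunc: "tmu M L (comp_mfunc M N L G F) x y =
    tcomp L (tmu N L G (FO F x) (FO F y)) (tmap G (tmu M N F x y))"
  by (simp add: tmu_def comp_mfunc_def)

lemma tep_comp_mfunc: "tep M L (comp_mfunc M N L G F) = tcomp L (tep N L G) (tmap G (tep M N F))"
  by (simp add: tep_def comp_mfunc_def)

lemma tmap_comp_mfunc: "tmap (comp_mfunc M N L G F) s = tmap G (tmap F s)"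
  by (cases s) (simp add: comp_mfunc_def)

lemma is_composite_comp_mfunc: "is_composite M F G (comp_mfunc M N L G F)"
  by (simp add: is_composite_def comp_mfunc_def)

text \<open>Each coherence diagram of \<open>G \<circ> F\<close> is composed of the diagram for \<open>F\<close>, transported by \<open>G\<close>, and the diagram for
  \<open>G\<close>; naturality of the coherence isomorphisms of \<open>G\<close> joins the two.\<close>

lemma strong_monoidal_composite:
  assumes F: "strong_monoidal_functor M N F" and G: "strong_monoidal_functor N L G"
  shows "strong_monoidal_functor M L (comp_mfunc M N L G F)"
proof -
  interpret F: strong_monoidal_functor M N F by fact
  interpret G: strong_monoidal_functor N L G by fact
  let ?H = "comp_mfunc M N L G F"
  interpret H: cat_functor M L ?H
    by (rule cat_functor_composite[OF F.cat_functor_axioms G.cat_functor_axioms is_composite_comp_mfunc])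
  have [simp]: "FO ?H x = FO G (FO F x)" for x by (simp add: comp_mfunc_def)
  note eqs = tmu_comp_mfunc tep_comp_mfunc tmap_comp_mfunc
  note arr = F.coherence_tarr G.coherence_tarr F.FO_ob G.FO_ob F.tmap_tarr G.tmap_tarr F.M.TenO_ob F.N.TenO_ob
    G.N.TenO_ob F.M.UnO_ob F.N.UnO_ob F.M.ten_arr F.N.ten_arr G.N.ten_arr F.N.tid_tarr F.M.tid_tarr G.N.tid_tarr
    F.M.structure_tarr F.N.structure_tarr G.N.structure_tarr F.N.tcomp_tarr G.N.tcomp_tarr tarrs_ends
  show ?thesis
  proof unfold_locales
    fix x y assume o: "x \<in> Ob M" "y \<in> Ob M"
    then show "tmu M L ?H x y \<in> tisos L"
      unfolding eqs by (intro G.N.tcomp_tiso G.mu_iso G.tmap_tiso F.mu_iso) (simp_all add: arr)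
  next
    show "tep M L ?H \<in> tisos L"
      unfolding eqs by (intro G.N.tcomp_tiso G.ep_iso G.tmap_tiso F.ep_iso) (simp_all add: arr)
  next
    fix x f x' y g y' assume s: "(x, f, x') \<in> tarrs M" "(y, g, y') \<in> tarrs M"
    let ?s = "(x, f, x')" and ?t = "(y, g, y')"
    have o: "x \<in> Ob M" "x' \<in> Ob M" "y \<in> Ob M" "y' \<in> Ob M" using s by (auto simp: tarrs_def)
    have "tcomp L (ten L (tmap ?H ?s) (tmap ?H ?t)) (tmu M L ?H x' y') =
        tcomp L (tcomp L (ten L (tmap G (tmap F ?s)) (tmap G (tmap F ?t))) (tmu N L G (FO F x') (FO F y')))
          (tmap G (tmu M N F x' y'))"
      unfolding eqs using s o by (subst G.N.tcomp_assoc) (simp_all add: arr del: tmap.simps)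
    also have "\<dots> = tcomp L (tcomp L (tmu N L G (FO F x) (FO F y)) (tmap G (ten N (tmap F ?s) (tmap F ?t))))
          (tmap G (tmu M N F x' y'))"
      using G.mu_nat'[of "tmap F ?s" "tmap F ?t"] s by (simp add: F.tmap_tarr del: tmap.simps)
    also have "\<dots> = tcomp L (tmu N L G (FO F x) (FO F y))
        (tmap G (tcomp N (ten N (tmap F ?s) (tmap F ?t)) (tmu M N F x' y')))"
      using s o by (simp add: G.N.tcomp_assoc G.tmap_tcomp arr del: tmap.simps)
    also have "\<dots> = tcomp L (tmu N L G (FO F x) (FO F y))
        (tmap G (tcomp N (tmu M N F x y) (tmap F (ten M ?s ?t))))"
      using F.mu_nat'[of ?s ?t] s by simp
    also have "\<dots> = tcomp L (tmu M L ?H x y) (tmap ?H (ten M ?s ?t))"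
      unfolding eqs using s o by (simp add: G.N.tcomp_assoc G.tmap_tcomp arr del: tmap.simps)
    finally show "comps L [ten L (tmap ?H ?s) (tmap ?H ?t), tmu M L ?H x' y'] =
      comps L [tmu M L ?H x y, tmap ?H (ten M ?s ?t)]" by simp
  next
    fix x y z assume o: "x \<in> Ob M" "y \<in> Ob M" "z \<in> Ob M"
    let ?x = "FO F x" and ?y = "FO F y" and ?z = "FO F z"
    let ?m = "tmu M N F" and ?n = "tmu N L G"
    let ?i = "tid L (FO G ?z)" and ?j = "tid L (FO G ?x)"
    have "ten L (tmu M L ?H x y) ?i = tcomp L (ten L (?n ?x ?y) ?i) (ten L (tmap G (?m x y)) ?i)"
      unfolding eqs
      using G.N.ten_tcomp[of "?n ?x ?y" "tmap G (?m x y)" ?i ?i] o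
      by (simp add: arr G.N.tcomp_tid_tid)
    then have "tcomp L (tcomp L (ten L (tmu M L ?H x y) ?i) (tmu M L ?H (TenO M x y) z)) (tmap ?H (tasc M x y z))
      = tcomp L (ten L (?n ?x ?y) ?i) (tcomp L (tcomp L (ten L (tmap G (?m x y)) ?i) (?n (FO F (TenO M x y)) ?z))
          (tcomp L (tmap G (?m (TenO M x y) z)) (tmap G (tmap F (tasc M x y z)))))"
      using o by (simp add: eqs G.N.tcomp_assoc arr)
    also have "tcomp L (ten L (tmap G (?m x y)) ?i) (?n (FO F (TenO M x y)) ?z) =
        tcomp L (?n (TenO N ?x ?y) ?z) (tmap G (ten N (?m x y) (tid N ?z)))"
      using G.mu_nat'[of "?m x y" "tid N ?z"] o by (simp add: arr G.tmap_tid)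
    also have "tcomp L (ten L (?n ?x ?y) ?i) (tcomp L (tcomp L (?n (TenO N ?x ?y) ?z) (tmap G (ten N (?m x y) (tid N ?z))))
          (tcomp L (tmap G (?m (TenO M x y) z)) (tmap G (tmap F (tasc M x y z)))))
      = tcomp L (ten L (?n ?x ?y) ?i) (tcomp L (?n (TenO N ?x ?y) ?z)
          (tmap G (tcomp N (tcomp N (ten N (?m x y) (tid N ?z)) (?m (TenO M x y) z)) (tmap F (tasc M x y z)))))"
      using o by (simp add: G.tmap_tcomp G.N.tcomp_assoc F.N.tcomp_assoc arr)
    also have "tcomp N (tcomp N (ten N (?m x y) (tid N ?z)) (?m (TenO M x y) z)) (tmap F (tasc M x y z)) =
       tcomp N (tcomp N (tasc N ?x ?y ?z) (ten N (tid N ?x) (?m y z))) (?m x (TenO M y z))"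
      using F.mu_assoc[OF o] by simp
    also have "tcomp L (ten L (?n ?x ?y) ?i) (tcomp L (?n (TenO N ?x ?y) ?z) (tmap G \<dots>))
      = tcomp L (tcomp L (tcomp L (ten L (?n ?x ?y) ?i) (?n (TenO N ?x ?y) ?z)) (tmap G (tasc N ?x ?y ?z)))
          (tcomp L (tmap G (ten N (tid N ?x) (?m y z))) (tmap G (?m x (TenO M y z))))"
      using o by (simp add: G.tmap_tcomp G.N.tcomp_assoc F.N.tcomp_assoc arr)
    also have "tcomp L (tcomp L (ten L (?n ?x ?y) ?i) (?n (TenO N ?x ?y) ?z)) (tmap G (tasc N ?x ?y ?z)) =
       tcomp L (tcomp L (tasc L (FO G ?x) (FO G ?y) (FO G ?z)) (ten L ?j (?n ?y ?z))) (?n ?x (TenO N ?y ?z))"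
      using G.mu_assoc[of ?x ?y ?z] o by (simp add: arr)
    also have "tcomp L \<dots> (tcomp L (tmap G (ten N (tid N ?x) (?m y z))) (tmap G (?m x (TenO M y z))))
      = tcomp L (tcomp L (tasc L (FO G ?x) (FO G ?y) (FO G ?z)) (ten L ?j (?n ?y ?z)))
         (tcomp L (tcomp L (?n ?x (TenO N ?y ?z)) (tmap G (ten N (tid N ?x) (?m y z)))) (tmap G (?m x (TenO M y z))))"
      using o by (simp add: G.N.tcomp_assoc arr)
    also have "tcomp L (?n ?x (TenO N ?y ?z)) (tmap G (ten N (tid N ?x) (?m y z))) =
       tcomp L (ten L ?j (tmap G (?m y z))) (?n ?x (FO F (TenO M y z)))"
      using G.mu_nat'[of "tid N ?x" "?m y z"] o by (simp add: arr G.tmap_tid)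
    also have "tcomp L (tcomp L (tasc L (FO G ?x) (FO G ?y) (FO G ?z)) (ten L ?j (?n ?y ?z)))
         (tcomp L (tcomp L (ten L ?j (tmap G (?m y z))) (?n ?x (FO F (TenO M y z)))) (tmap G (?m x (TenO M y z))))
      = tcomp L (tcomp L (tasc L (FO G ?x) (FO G ?y) (FO G ?z)) (tcomp L (ten L ?j (?n ?y ?z)) (ten L ?j (tmap G (?m y z)))))
          (tmu M L ?H x (TenO M y z))"
      using o by (simp add: eqs G.N.tcomp_assoc arr)
    also have "tcomp L (ten L ?j (?n ?y ?z)) (ten L ?j (tmap G (?m y z))) = ten L ?j (tmu M L ?H y z)"
      unfolding eqs
      using G.N.ten_tcomp[of ?j ?j "?n ?y ?z" "tmap G (?m y z)"] o
      by (simp add: arr G.N.tcomp_tid_tid)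
    finally show "comps L [ten L (tmu M L ?H x y) (tid L (FO ?H z)), tmu M L ?H (TenO M x y) z, tmap ?H (tasc M x y z)] =
      comps L [tasc L (FO ?H x) (FO ?H y) (FO ?H z), ten L (tid L (FO ?H x)) (tmu M L ?H y z), tmu M L ?H x (TenO M y z)]"
      by simp
  next
    fix x assume o: "x \<in> Ob M"
    let ?x = "FO F x" and ?e = "tep M N F" and ?d = "tep N L G" and ?i = "tid L (FO G (FO F x))"
    have "tcomp L (tcomp L (ten L (tep M L ?H) ?i) (tmu M L ?H (UnO M) x)) (tmap ?H (tlun M x))
      = tcomp L (ten L ?d ?i) (tcomp L (tcomp L (ten L (tmap G ?e) ?i) (tmu N L G (FO F (UnO M)) ?x))
          (tcomp L (tmap G (tmu M N F (UnO M) x)) (tmap G (tmap F (tlun M x)))))"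
      using o G.N.ten_tcomp[of ?d "tmap G ?e" ?i ?i] by (simp add: eqs arr G.N.tcomp_tid_tid G.N.tcomp_assoc)
    also have "tcomp L (ten L (tmap G ?e) ?i) (tmu N L G (FO F (UnO M)) ?x) =
        tcomp L (tmu N L G (UnO N) ?x) (tmap G (ten N ?e (tid N ?x)))"
      using G.mu_nat'[of ?e "tid N ?x"] o by (simp add: arr G.tmap_tid)
    also have "tcomp L (ten L ?d ?i) (tcomp L (tcomp L (tmu N L G (UnO N) ?x) (tmap G (ten N ?e (tid N ?x))))
          (tcomp L (tmap G (tmu M N F (UnO M) x)) (tmap G (tmap F (tlun M x)))))
       = tcomp L (tcomp L (ten L ?d ?i) (tmu N L G (UnO N) ?x)) (tmap G
          (tcomp N (tcomp N (ten N ?e (tid N ?x)) (tmu M N F (UnO M) x)) (tmap F (tlun M x))))"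
      using o by (simp add: G.tmap_tcomp G.N.tcomp_assoc F.N.tcomp_assoc arr)
    also have "tcomp N (tcomp N (ten N ?e (tid N ?x)) (tmu M N F (UnO M) x)) (tmap F (tlun M x)) = tlun N ?x"
      using F.mu_lun[OF o] by simp
    also have "tcomp L (tcomp L (ten L ?d ?i) (tmu N L G (UnO N) ?x)) (tmap G (tlun N ?x)) = tlun L (FO G ?x)"
      using G.mu_lun[of ?x] o by (simp add: arr)
    finally show "comps L [ten L (tep M L ?H) (tid L (FO ?H x)), tmu M L ?H (UnO M) x, tmap ?H (tlun M x)] =
      tlun L (FO ?H x)" by simp
  next
    fix x assume o: "x \<in> Ob M"
    let ?x = "FO F x" and ?e = "tep M N F" and ?d = "tep N L G" and ?i = "tid L (FO G (FO F x))"
    have "tcomp L (tcomp L (ten L ?i (tep M L ?H)) (tmu M L ?H x (UnO M))) (tmap ?H (trun M x))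
      = tcomp L (ten L ?i ?d) (tcomp L (tcomp L (ten L ?i (tmap G ?e)) (tmu N L G ?x (FO F (UnO M))))
          (tcomp L (tmap G (tmu M N F x (UnO M))) (tmap G (tmap F (trun M x)))))"
      using o G.N.ten_tcomp[of ?i ?i ?d "tmap G ?e"] by (simp add: eqs arr G.N.tcomp_tid_tid G.N.tcomp_assoc)
    also have "tcomp L (ten L ?i (tmap G ?e)) (tmu N L G ?x (FO F (UnO M))) =
        tcomp L (tmu N L G ?x (UnO N)) (tmap G (ten N (tid N ?x) ?e))"
      using G.mu_nat'[of "tid N ?x" ?e] o by (simp add: arr G.tmap_tid)
    also have "tcomp L (ten L ?i ?d) (tcomp L (tcomp L (tmu N L G ?x (UnO N)) (tmap G (ten N (tid N ?x) ?e)))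
          (tcomp L (tmap G (tmu M N F x (UnO M))) (tmap G (tmap F (trun M x)))))
       = tcomp L (tcomp L (ten L ?i ?d) (tmu N L G ?x (UnO N))) (tmap G
          (tcomp N (tcomp N (ten N (tid N ?x) ?e) (tmu M N F x (UnO M))) (tmap F (trun M x))))"
      using o by (simp add: G.tmap_tcomp G.N.tcomp_assoc F.N.tcomp_assoc arr)
    also have "tcomp N (tcomp N (ten N (tid N ?x) ?e) (tmu M N F x (UnO M))) (tmap F (trun M x)) = trun N ?x"
      using F.mu_run[OF o] by simp
    also have "tcomp L (tcomp L (ten L ?i ?d) (tmu N L G ?x (UnO N))) (tmap G (trun N ?x)) = trun L (FO G ?x)"
      using G.mu_run[of ?x] o by (simp add: arr)
    finally show "comps L [ten L (tid L (FO ?H x)) (tep M L ?H), tmu M L ?H x (UnO M), tmap ?H (trun M x)] =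
      trun L (FO ?H x)" by simp
  qed
qed

text \<open>When the structure is preserved on the nose, the coherence isomorphisms can be taken to be identities, and
  the coherence diagrams then hold by the unit laws. Strict actions and the comparison of homotopy fibres are
  of this kind.\<close>

lemma strict_strong_monoidal:
  assumes "monoidal_category M" "monoidal_category N" "cat_functor M N F"
    and t: "\<And>x y. \<lbrakk>x \<in> Ob M; y \<in> Ob M\<rbrakk> \<Longrightarrow> FO F (TenO M x y) = TenO N (FO F x) (FO F y)"
    and u: "FO F (UnO M) = UnO N"
    and mu: "\<And>x y. \<lbrakk>x \<in> Ob M; y \<in> Ob M\<rbrakk> \<Longrightarrow> FMu F x y = Idn N (TenO N (FO F x) (FO F y))"
    and ep: "FEp F = Idn N (UnO N)"
    and ta: "\<And>s t. \<lbrakk>s \<in> tarrs M; t \<in> tarrs M\<rbrakk> \<Longrightarrow> tmap F (ten M s t) = ten N (tmap F s) (tmap F t)"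
    and as: "\<And>x y z. \<lbrakk>x \<in> Ob M; y \<in> Ob M; z \<in> Ob M\<rbrakk> \<Longrightarrow> tmap F (tasc M x y z) = tasc N (FO F x) (FO F y) (FO F z)"
    and l: "\<And>x. x \<in> Ob M \<Longrightarrow> tmap F (tlun M x) = tlun N (FO F x)"
    and r: "\<And>x. x \<in> Ob M \<Longrightarrow> tmap F (trun M x) = trun N (FO F x)"
  shows "strong_monoidal_functor M N F"
proof -
  interpret M: monoidal_category M by fact
  interpret N: monoidal_category N by fact
  interpret F: cat_functor M N F by fact
  have m: "tmu M N F x y = tid N (TenO N (FO F x) (FO F y))" if "x \<in> Ob M" "y \<in> Ob M" for x y
    using that by (simp add: tmu_def tid_def t mu)
  have e: "tep M N F = tid N (UnO N)" by (simp add: tep_def tid_def u ep)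
  have idl: "tcomp N (tid N x) s = s" if "s \<in> tarrs N" "fst s = x" for s x
    using N.tcomp_tid(1)[OF that(1)] that(2) by simp
  have idr: "tcomp N s (tid N x) = s" if "s \<in> tarrs N" "tgt s = x" for s x
    using N.tcomp_tid(2)[OF that(1)] that(2) by simp
  note arr = F.FO_ob M.TenO_ob N.TenO_ob M.UnO_ob N.UnO_ob N.tid_tarr N.structure_tarr N.ten_arr F.tmap_tarr tarrs_ends
  show ?thesis
  proof unfold_locales
    fix x f x' y g y' assume s: "(x, f, x') \<in> tarrs M" "(y, g, y') \<in> tarrs M"
    then have o: "x \<in> Ob M" "x' \<in> Ob M" "y \<in> Ob M" "y' \<in> Ob M" by (auto simp: tarrs_def)
    show "comps N [ten N (tmap F (x, f, x')) (tmap F (y, g, y')), tmu M N F x' y'] =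
       comps N [tmu M N F x y, tmap F (ten M (x, f, x') (y, g, y'))]"
      using s o by (simp add: m ta idl idr arr del: tmap.simps)
  qed (simp_all add: m e N.tid_tiso arr as l r N.ten_id t u idl idr)
qed

section \<open>Discrete 2-groups\<close>

lemma disc_sel [simp]:
  "Ob (disc Q) = carrier Q" "f \<in> Hom (disc Q) x y \<longleftrightarrow> x = y" "UnO (disc Q) = \<one>\<^bsub>Q\<^esub>"
  "TenO (disc Q) x y = x \<otimes>\<^bsub>Q\<^esub> y" "is_iso (disc Q) x y f \<longleftrightarrow> x = y"
  by (auto simp: disc_def is_iso_def)

text \<open>An arrow of a discrete 2-group is determined by its ends, so that a diagram commutes as soon as its ends
  match.\<close>

lemma disc_tarr_eq: "(s :: ('g, unit) tarr) = t \<longleftrightarrow> fst s = fst t \<and> tgt s = tgt t"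
  by (cases s; cases t) auto

lemma disc_tarrs: "s \<in> tarrs (disc Q) \<longleftrightarrow> fst s \<in> carrier Q \<and> tgt s = fst s"
  by (cases s) (auto simp: tarrs_def)

lemma disc_tisos: "s \<in> tisos (disc Q) \<longleftrightarrow> fst s \<in> carrier Q \<and> tgt s = fst s"
  by (cases s) (auto simp: tisos_def)

lemma comps_ends:
  "fst (comps C (s # l)) = fst s" "tgt (comps C (s # l)) = tgt (last (s # l))"
proof -
  have "fst (comps C (s # l)) = fst s \<and> tgt (comps C (s # l)) = tgt (last (s # l))"
    by (induction l arbitrary: s) auto
  then show "fst (comps C (s # l)) = fst s" "tgt (comps C (s # l)) = tgt (last (s # l))" by auto
qed

lemma tinv_ends [simp]: "fst (tinv C s) = tgt s" "tgt (tinv C s) = fst s"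
  by (cases s; simp)+

lemma monoidal_disc:
  assumes "monoid Q" shows "monoidal_category (disc Q)"
proof -
  interpret monoid Q by fact
  show ?thesis
    by unfold_locales
      (simp_all add: disc_tarr_eq disc_tarrs disc_tisos m_assoc)
qed

lemma coherent_2group_disc:
  assumes "group Q" shows "coherent_2group (disc Q)"
proof -
  interpret group Q by fact
  have "coherent_inverses (disc Q) (\<lambda>x. inv\<^bsub>Q\<^esub> x) (\<lambda>_. ()) (\<lambda>_. ())"
    by (simp add: coherent_inverses_def Let_def disc_tisos disc_tarr_eq comps_ends)
  then show ?thesis
    unfolding coherent_2group_def by (auto intro: monoidal_disc)
qed

text \<open>Isomorphic objects of a discrete 2-group are equal, so that weak inverses are inverses in \<open>Q\<close>, and
  associators and unitors are the associative and unit laws.\<close>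

lemma group_if_coherent_2group:
  assumes "coherent_2group (disc Q)" shows "group Q"
proof -
  interpret monoidal_category "disc Q" using assms by (simp add: coherent_2group_def)
  obtain iv iu ec where c: "coherent_inverses (disc Q) iv iu ec"
    using assms by (auto simp: coherent_2group_def)
  show ?thesis
  proof (rule groupI)
    fix x assume x: "x \<in> carrier Q"
    with c have "iv x \<in> carrier Q" "\<one>\<^bsub>Q\<^esub> = iv x \<otimes>\<^bsub>Q\<^esub> x"
      by (auto simp: coherent_inverses_def Let_def disc_tisos)
    then show "\<exists>y\<in>carrier Q. y \<otimes>\<^bsub>Q\<^esub> x = \<one>\<^bsub>Q\<^esub>" by metis
    show "\<one>\<^bsub>Q\<^esub> \<otimes>\<^bsub>Q\<^esub> x = x" using lun_iso[of x] x by (simp add: disc_tisos)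
    fix y assume y: "y \<in> carrier Q"
    show "x \<otimes>\<^bsub>Q\<^esub> y \<in> carrier Q" using TenO_ob[of x y] x y by simp
    fix z assume z: "z \<in> carrier Q"
    show "x \<otimes>\<^bsub>Q\<^esub> y \<otimes>\<^bsub>Q\<^esub> z = x \<otimes>\<^bsub>Q\<^esub> (y \<otimes>\<^bsub>Q\<^esub> z)"
      using asc_iso[of x y z] x y z by (simp add: disc_tisos)
  next
    show "\<one>\<^bsub>Q\<^esub> \<in> carrier Q" using UnO_ob by simp
  qed
qed

text \<open>The coherence isomorphisms of a functor to a discrete 2-group are equalities, so that the functor amounts to a
  multiplicative isomorphism invariant of objects.\<close>

lemma to_disc:
  assumes "strong_monoidal_functor M (disc Q) F"
  shows "x \<in> Ob M \<Longrightarrow> FO F x \<in> carrier Q"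
    and "\<lbrakk>x \<in> Ob M; y \<in> Ob M; f \<in> Hom M x y\<rbrakk> \<Longrightarrow> FO F x = FO F y"
    and "\<lbrakk>x \<in> Ob M; y \<in> Ob M\<rbrakk> \<Longrightarrow> FO F (TenO M x y) = FO F x \<otimes>\<^bsub>Q\<^esub> FO F y"
    and "FO F (UnO M) = \<one>\<^bsub>Q\<^esub>"
proof -
  interpret strong_monoidal_functor M "disc Q" F by fact
  show "x \<in> Ob M \<Longrightarrow> FO F x \<in> carrier Q" using FO_ob by simp
  show "\<lbrakk>x \<in> Ob M; y \<in> Ob M; f \<in> Hom M x y\<rbrakk> \<Longrightarrow> FO F x = FO F y" using FA_hom by simp
  show "\<lbrakk>x \<in> Ob M; y \<in> Ob M\<rbrakk> \<Longrightarrow> FO F (TenO M x y) = FO F x \<otimes>\<^bsub>Q\<^esub> FO F y"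
    using mu_iso[of x y] by (simp add: disc_tisos)
  show "FO F (UnO M) = \<one>\<^bsub>Q\<^esub>" using ep_iso by (simp add: disc_tisos)
qed

lemma to_discI:
  assumes "monoidal_category M" "monoid Q"
    and o: "\<And>x. x \<in> Ob M \<Longrightarrow> FO F x \<in> carrier Q"
    and a: "\<And>x y f. \<lbrakk>x \<in> Ob M; y \<in> Ob M; f \<in> Hom M x y\<rbrakk> \<Longrightarrow> FO F x = FO F y"
    and t: "\<And>x y. \<lbrakk>x \<in> Ob M; y \<in> Ob M\<rbrakk> \<Longrightarrow> FO F (TenO M x y) = FO F x \<otimes>\<^bsub>Q\<^esub> FO F y"
    and u: "FO F (UnO M) = \<one>\<^bsub>Q\<^esub>"
  shows "strong_monoidal_functor M (disc Q) F"
proof -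
  interpret M: monoidal_category M by fact
  interpret N: monoidal_category "disc Q" by (rule monoidal_disc) fact
  interpret monoid Q by fact
  show ?thesis
  proof unfold_locales
    fix x f x' y g y' assume s: "(x, f, x') \<in> tarrs M" "(y, g, y') \<in> tarrs M"
    then have h: "x \<in> Ob M" "x' \<in> Ob M" "y \<in> Ob M" "y' \<in> Ob M" "f \<in> Hom M x x'" "g \<in> Hom M y y'"
      by (auto simp: tarrs_def)
    then show "comps (disc Q) [ten (disc Q) (tmap F (x, f, x')) (tmap F (y, g, y')), tmu M (disc Q) F x' y'] =
       comps (disc Q) [tmu M (disc Q) F x y, tmap F (ten M (x, f, x') (y, g, y'))]"
      using a[of x x' f] a[of y y' g] by (simp add: disc_tarr_eq t M.TenO_ob del: tmap.simps)
  qed (auto simp: disc_tarr_eq disc_tisos o a t u M.TenO_ob M.UnO_ob m_assoc)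
qed

lemma strong_monoidal_disc_map:
  assumes "monoid G" "monoid Q" "\<And>x. x \<in> carrier G \<Longrightarrow> h x \<in> carrier Q"
    and "\<And>x y. \<lbrakk>x \<in> carrier G; y \<in> carrier G\<rbrakk> \<Longrightarrow> h (x \<otimes>\<^bsub>G\<^esub> y) = h x \<otimes>\<^bsub>Q\<^esub> h y" "h \<one>\<^bsub>G\<^esub> = \<one>\<^bsub>Q\<^esub>"
  shows "strong_monoidal_functor (disc G) (disc Q) (disc_map h)"
  by (rule to_discI) (auto simp: assms monoidal_disc disc_map_def)

section \<open>Homotopy pullbacks and fibres over a discrete 2-group\<close>

text \<open>\<open>M\<close> has the arrows of \<open>N\<close>, pulled back along a map \<open>\<pi>\<close> of objects that is compatible with the
  tensor structure; all axioms of \<open>M\<close> are then instances of those of \<open>N\<close>.\<close>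

definition pulled_back :: "('o, 'a, 'z) moncat_scheme \<Rightarrow> ('p, 'a, 'y) moncat_scheme \<Rightarrow> ('o \<Rightarrow> 'p) \<Rightarrow> bool" where
  "pulled_back M N \<pi> \<longleftrightarrow> (\<forall>x\<in>Ob M. \<pi> x \<in> Ob N) \<and>
     (\<forall>x\<in>Ob M. \<forall>y\<in>Ob M. Hom M x y = Hom N (\<pi> x) (\<pi> y)) \<and> (\<forall>x\<in>Ob M. Idn M x = Idn N (\<pi> x)) \<and>
     (\<forall>x\<in>Ob M. \<forall>y\<in>Ob M. \<forall>z\<in>Ob M. \<forall>g f. Cmp M x y z g f = Cmp N (\<pi> x) (\<pi> y) (\<pi> z) g f) \<and>
     UnO M \<in> Ob M \<and> \<pi> (UnO M) = UnO N \<and>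
     (\<forall>x\<in>Ob M. \<forall>y\<in>Ob M. TenO M x y \<in> Ob M \<and> \<pi> (TenO M x y) = TenO N (\<pi> x) (\<pi> y)) \<and>
     (\<forall>x\<in>Ob M. \<forall>y\<in>Ob M. \<forall>x'\<in>Ob M. \<forall>y'\<in>Ob M. \<forall>f g.
        TenA M (x, f, x') (y, g, y') = TenA N (\<pi> x, f, \<pi> x') (\<pi> y, g, \<pi> y')) \<and>
     (\<forall>x\<in>Ob M. \<forall>y\<in>Ob M. \<forall>z\<in>Ob M. Asc M x y z = Asc N (\<pi> x) (\<pi> y) (\<pi> z)) \<and>
     (\<forall>x\<in>Ob M. LUn M x = LUn N (\<pi> x) \<and> RUn M x = RUn N (\<pi> x))"

context
  fixes M :: "('o, 'a, 'z) moncat_scheme" and N :: "('p, 'a, 'y) moncat_scheme" and \<pi> :: "'o \<Rightarrow> 'p"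
  assumes pb: "pulled_back M N \<pi>" and mN: "monoidal_category N"
begin

interpretation N: monoidal_category N by (rule mN)

lemma pb_simps:
  "x \<in> Ob M \<Longrightarrow> \<pi> x \<in> Ob N"
  "\<lbrakk>x \<in> Ob M; y \<in> Ob M\<rbrakk> \<Longrightarrow> Hom M x y = Hom N (\<pi> x) (\<pi> y)"
  "x \<in> Ob M \<Longrightarrow> Idn M x = Idn N (\<pi> x)"
  "\<lbrakk>x \<in> Ob M; y \<in> Ob M; z \<in> Ob M\<rbrakk> \<Longrightarrow> Cmp M x y z g f = Cmp N (\<pi> x) (\<pi> y) (\<pi> z) g f"
  "UnO M \<in> Ob M" "\<pi> (UnO M) = UnO N"
  "\<lbrakk>x \<in> Ob M; y \<in> Ob M\<rbrakk> \<Longrightarrow> TenO M x y \<in> Ob M"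
  "\<lbrakk>x \<in> Ob M; y \<in> Ob M\<rbrakk> \<Longrightarrow> \<pi> (TenO M x y) = TenO N (\<pi> x) (\<pi> y)"
  "\<lbrakk>x \<in> Ob M; y \<in> Ob M; x' \<in> Ob M; y' \<in> Ob M\<rbrakk> \<Longrightarrow>
    TenA M (x, f, x') (y, g, y') = TenA N (\<pi> x, f, \<pi> x') (\<pi> y, g, \<pi> y')"
  "\<lbrakk>x \<in> Ob M; y \<in> Ob M; z \<in> Ob M\<rbrakk> \<Longrightarrow> Asc M x y z = Asc N (\<pi> x) (\<pi> y) (\<pi> z)"
  "x \<in> Ob M \<Longrightarrow> LUn M x = LUn N (\<pi> x)" "x \<in> Ob M \<Longrightarrow> RUn M x = RUn N (\<pi> x)"
  using pb unfolding pulled_back_def by simp_all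

lemma pb_is_iso: "\<lbrakk>x \<in> Ob M; y \<in> Ob M\<rbrakk> \<Longrightarrow> is_iso M x y f = is_iso N (\<pi> x) (\<pi> y) f"
  by (simp add: is_iso_def pb_simps)

lemma pb_inv_arrow: "\<lbrakk>x \<in> Ob M; y \<in> Ob M\<rbrakk> \<Longrightarrow> inv_arrow M x y f = inv_arrow N (\<pi> x) (\<pi> y) f"
  by (simp add: inv_arrow_def pb_simps)

lemma monoidal_pulled_back: "monoidal_category M"
proof
  note s = pb_simps pb_is_iso tarrs_def tisos_def ten_def tid_def tasc_def tlun_def trun_def
  show "Cmp M x y z g f \<in> Hom M x z" if "x \<in> Ob M" "y \<in> Ob M" "z \<in> Ob M" "f \<in> Hom M x y" "g \<in> Hom M y z"
    for x y z f g
    using that N.Cmp_hom by (simp add: s)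
  show "Cmp M w x z (Cmp M x y z h g) f = Cmp M w y z h (Cmp M w x y g f)"
    if "w \<in> Ob M" "x \<in> Ob M" "y \<in> Ob M" "z \<in> Ob M" "f \<in> Hom M w x" "g \<in> Hom M x y" "h \<in> Hom M y z"
    for w x y z f g h
    using that N.Cmp_assoc by (simp add: s)
  show "ten M u t \<in> tarrs M" if "u \<in> tarrs M" "t \<in> tarrs M" for u t
    using that N.ten_arr[of "(\<pi> (fst u), arrow_of u, \<pi> (tgt u))" "(\<pi> (fst t), arrow_of t, \<pi> (tgt t))"]
    by (cases u; cases t) (auto simp: s)
  show "ten M (tcomp M (x, f, y) (y, g, z)) (tcomp M (x', f', y') (y', g', z')) =
      tcomp M (ten M (x, f, y) (x', f', y')) (ten M (y, g, z) (y', g', z'))"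
    if "(x, f, y) \<in> tarrs M" "(y, g, z) \<in> tarrs M" "(x', f', y') \<in> tarrs M" "(y', g', z') \<in> tarrs M"
    for x f y g z x' f' y' g' z'
    using that N.ten_comp[of "\<pi> x" f "\<pi> y" g "\<pi> z" "\<pi> x'" f' "\<pi> y'" g' "\<pi> z'"] by (auto simp: s)
  show "comps M [ten M (ten M (x, f, x') (y, g, y')) (z, h, z'), tasc M x' y' z'] =
      comps M [tasc M x y z, ten M (x, f, x') (ten M (y, g, y') (z, h, z'))]"
    if "(x, f, x') \<in> tarrs M" "(y, g, y') \<in> tarrs M" "(z, h, z') \<in> tarrs M" for x f x' y g y' z h z'
    using that N.asc_nat[of "\<pi> x" f "\<pi> x'" "\<pi> y" g "\<pi> y'" "\<pi> z" h "\<pi> z'"] by (auto simp: s)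
  show "comps M [ten M (tid M (UnO M)) (x, f, y), tlun M y] = comps M [tlun M x, (x, f, y)]"
    if "(x, f, y) \<in> tarrs M" for x f y
    using that N.lun_nat[of "\<pi> x" f "\<pi> y"] by (auto simp: s)
  show "comps M [ten M (x, f, y) (tid M (UnO M)), trun M y] = comps M [trun M x, (x, f, y)]"
    if "(x, f, y) \<in> tarrs M" for x f y
    using that N.run_nat[of "\<pi> x" f "\<pi> y"] by (auto simp: s)
  show "comps M [ten M (tasc M w x y) (tid M z), tasc M w (TenO M x y) z, ten M (tid M w) (tasc M x y z)] =
      comps M [tasc M (TenO M w x) y z, tasc M w x (TenO M y z)]"
    if "w \<in> Ob M" "x \<in> Ob M" "y \<in> Ob M" "z \<in> Ob M" for w x y z
    using that N.pentagon[of "\<pi> w" "\<pi> x" "\<pi> y" "\<pi> z"] by (simp add: s)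
  show "comps M [tasc M x (UnO M) y, ten M (tid M x) (tlun M y)] = ten M (trun M x) (tid M y)"
    if "x \<in> Ob M" "y \<in> Ob M" for x y
    using that N.triangle[of "\<pi> x" "\<pi> y"] by (simp add: s)
  show "ten M (tid M x) (tid M y) = tid M (TenO M x y)" if "x \<in> Ob M" "y \<in> Ob M" for x y
    using that N.ten_id[of "\<pi> x" "\<pi> y"] by (simp add: s)
  show "tasc M x y z \<in> tisos M" if "x \<in> Ob M" "y \<in> Ob M" "z \<in> Ob M" for x y z
    using that N.asc_iso[of "\<pi> x" "\<pi> y" "\<pi> z"] by (simp add: s)
  show "tlun M x \<in> tisos M" if "x \<in> Ob M" for x
    using that N.lun_iso[of "\<pi> x"] by (simp add: s)
  show "trun M x \<in> tisos M" if "x \<in> Ob M" for x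
    using that N.run_iso[of "\<pi> x"] by (simp add: s)
qed (simp_all add: pb_simps N.Idn_hom N.Idn_left N.Idn_right)

text \<open>The weak inverses of \<open>N\<close>, with their units and counits, serve for \<open>M\<close>; the assumption \<open>inv\<close> says that they lie
  in the image of \<open>\<pi>\<close>.\<close>

lemma coherent_2group_pulled_back:
  assumes N: "coherent_2group N"
    and inv: "\<And>x y i. \<lbrakk>x \<in> Ob M; y \<in> Ob N; is_iso N (UnO N) (TenO N (\<pi> x) y) i\<rbrakk> \<Longrightarrow> \<exists>x'\<in>Ob M. \<pi> x' = y"
  shows "coherent_2group M"
proof -
  obtain iv iu ec where c: "coherent_inverses N iv iu ec" using N by (auto simp: coherent_2group_def)
  have "\<exists>x'. x' \<in> Ob M \<and> \<pi> x' = iv (\<pi> x)" if x: "x \<in> Ob M" for x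
    using inv[OF x, of "iv (\<pi> x)" "iu (\<pi> x)"] c pb_simps(1)[OF x]
    by (auto simp: coherent_inverses_def Let_def tisos_def)
  then obtain iw where iw: "iw x \<in> Ob M" "\<pi> (iw x) = iv (\<pi> x)" if "x \<in> Ob M" for x by metis
  have "coherent_inverses M iw (\<lambda>x. iu (\<pi> x)) (\<lambda>x. ec (\<pi> x))"
    unfolding coherent_inverses_def Let_def
  proof (intro ballI conjI)
    fix x assume x: "x \<in> Ob M"
    note s = pb_simps pb_is_iso pb_inv_arrow iw tarrs_def tisos_def ten_def tid_def tasc_def tlun_def trun_def
    note c' = c[unfolded coherent_inverses_def Let_def, rule_format, OF pb_simps(1)[OF x]]
    show "iw x \<in> Ob M" using iw x by simp
    show "(UnO M, iu (\<pi> x), TenO M x (iw x)) \<in> tisos M" "(TenO M (iw x) x, ec (\<pi> x), UnO M) \<in> tisos M"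
      using c' x by (simp_all add: s)
    show "comps M [tinv M (tlun M x), ten M (UnO M, iu (\<pi> x), TenO M x (iw x)) (tid M x), tasc M x (iw x) x,
          ten M (tid M x) (TenO M (iw x) x, ec (\<pi> x), UnO M), trun M x] = tid M x"
      using c' x by (simp add: s)
    show "comps M [tinv M (trun M (iw x)), ten M (tid M (iw x)) (UnO M, iu (\<pi> x), TenO M x (iw x)),
          tinv M (tasc M (iw x) x (iw x)), ten M (TenO M (iw x) x, ec (\<pi> x), UnO M) (tid M (iw x)), tlun M (iw x)] =
         tid M (iw x)"
      using c' x by (simp add: s)
  qed
  moreover have "\<forall>x\<in>Ob M. \<forall>y\<in>Ob M. \<forall>f\<in>Hom M x y. is_iso M x y f"
    using N by (simp add: pb_is_iso pb_simps coherent_2group_def)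
  ultimately show ?thesis
    unfolding coherent_2group_def using monoidal_pulled_back by blast
qed

end

definition prod_moncat :: "('o, 'a, 'z) moncat_scheme \<Rightarrow> ('p, 'b, 'y) moncat_scheme \<Rightarrow> ('o \<times> 'p, 'a \<times> 'b) moncat" where
  "prod_moncat M N = \<lparr>Ob = Ob M \<times> Ob N, Hom = (\<lambda>x y. Hom M (fst x) (fst y) \<times> Hom N (snd x) (snd y)),
     Idn = (\<lambda>x. (Idn M (fst x), Idn N (snd x))),
     Cmp = (\<lambda>x y z g f. (Cmp M (fst x) (fst y) (fst z) (fst g) (fst f), Cmp N (snd x) (snd y) (snd z) (snd g) (snd f))),
     UnO = (UnO M, UnO N), TenO = (\<lambda>x y. (TenO M (fst x) (fst y), TenO N (snd x) (snd y))),
     TenA = (\<lambda>(x, f, x') (y, g, y'). (TenA M (fst x, fst f, fst x') (fst y, fst g, fst y'),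
        TenA N (snd x, snd f, snd x') (snd y, snd g, snd y'))),
     Asc = (\<lambda>x y z. (Asc M (fst x) (fst y) (fst z), Asc N (snd x) (snd y) (snd z))),
     LUn = (\<lambda>x. (LUn M (fst x), LUn N (snd x))), RUn = (\<lambda>x. (RUn M (fst x), RUn N (snd x)))\<rparr>"

context
  fixes M :: "('o, 'a, 'z) moncat_scheme" and N :: "('p, 'b, 'y) moncat_scheme"
  assumes M: "monoidal_category M" and N: "monoidal_category N"
begin

interpretation M: monoidal_category M by (rule M)
interpretation N: monoidal_category N by (rule N)

lemma prod_is_iso:
  "is_iso (prod_moncat M N) x y f \<longleftrightarrow> is_iso M (fst x) (fst y) (fst f) \<and> is_iso N (snd x) (snd y) (snd f)"
  by (cases f) (auto simp: is_iso_def prod_moncat_def)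

lemma category_prod: "category (prod_moncat M N)"
  by unfold_locales (auto simp: prod_moncat_def M.Idn_hom N.Idn_hom M.Cmp_hom N.Cmp_hom M.Idn_left N.Idn_left
    M.Idn_right N.Idn_right M.Cmp_assoc N.Cmp_assoc)

lemma prod_inv_arrow:
  assumes "x \<in> Ob M \<times> Ob N" "y \<in> Ob M \<times> Ob N" "is_iso (prod_moncat M N) x y f"
  shows "inv_arrow (prod_moncat M N) x y f =
    (inv_arrow M (fst x) (fst y) (fst f), inv_arrow N (snd x) (snd y) (snd f))"
proof -
  interpret P: category "prod_moncat M N" by (rule category_prod)
  have a: "fst x \<in> Ob M" "fst y \<in> Ob M" "snd x \<in> Ob N" "snd y \<in> Ob N"
    and i: "is_iso M (fst x) (fst y) (fst f)" "is_iso N (snd x) (snd y) (snd f)"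
    using assms by (auto simp: prod_is_iso)
  show ?thesis
    by (rule P.inv_arrow_eq)
      (use assms a M.inv_arrow[OF a(1,2) i(1)] N.inv_arrow[OF a(3,4) i(2)] in
        \<open>auto simp: prod_moncat_def is_iso_def mem_Times_iff\<close>)
qed

lemma monoidal_prod: "monoidal_category (prod_moncat M N)"
proof -
  let ?P = "prod_moncat M N"
  interpret P: category ?P by (rule category_prod)
  note s = prod_is_iso tarrs_def tisos_def ten_def tid_def tasc_def tlun_def trun_def
  have p: "Ob ?P = Ob M \<times> Ob N" "UnO ?P = (UnO M, UnO N)" "TenO ?P x y = (TenO M (fst x) (fst y), TenO N (snd x) (snd y))"
    "Hom ?P x y = Hom M (fst x) (fst y) \<times> Hom N (snd x) (snd y)"
    "Idn ?P x = (Idn M (fst x), Idn N (snd x))"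
    "Cmp ?P x y z g f = (Cmp M (fst x) (fst y) (fst z) (fst g) (fst f), Cmp N (snd x) (snd y) (snd z) (snd g) (snd f))"
    "TenA ?P (x, f, x') (y, g, y') = (TenA M (fst x, fst f, fst x') (fst y, fst g, fst y'),
        TenA N (snd x, snd f, snd x') (snd y, snd g, snd y'))"
    "Asc ?P x y z = (Asc M (fst x) (fst y) (fst z), Asc N (snd x) (snd y) (snd z))"
    "LUn ?P x = (LUn M (fst x), LUn N (snd x))" "RUn ?P x = (RUn M (fst x), RUn N (snd x))"
    for x y z f g x' y' by (simp_all add: prod_moncat_def)
  show ?thesis
  proof
    show "UnO ?P \<in> Ob ?P" by (simp add: p M.UnO_ob N.UnO_ob)
    show "TenO ?P x y \<in> Ob ?P" if "x \<in> Ob ?P" "y \<in> Ob ?P" for x y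
      using that by (auto simp: p M.TenO_ob N.TenO_ob)
    show "ten ?P u t \<in> tarrs ?P" if "u \<in> tarrs ?P" "t \<in> tarrs ?P" for u t
      using that
        M.ten_arr[of "(fst (fst u), fst (arrow_of u), fst (tgt u))" "(fst (fst t), fst (arrow_of t), fst (tgt t))"]
        N.ten_arr[of "(snd (fst u), snd (arrow_of u), snd (tgt u))" "(snd (fst t), snd (arrow_of t), snd (tgt t))"]
      by (cases u; cases t) (auto simp: s p)
    show "ten ?P (tcomp ?P (x, f, y) (y, g, z)) (tcomp ?P (x', f', y') (y', g', z')) =
      tcomp ?P (ten ?P (x, f, y) (x', f', y')) (ten ?P (y, g, z) (y', g', z'))"
      if "(x, f, y) \<in> tarrs ?P" "(y, g, z) \<in> tarrs ?P" "(x', f', y') \<in> tarrs ?P" "(y', g', z') \<in> tarrs ?P"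
      for x f y g z x' f' y' g' z'
      using that M.ten_comp[of "fst x" "fst f" "fst y" "fst g" "fst z" "fst x'" "fst f'" "fst y'" "fst g'" "fst z'"]
        N.ten_comp[of "snd x" "snd f" "snd y" "snd g" "snd z" "snd x'" "snd f'" "snd y'" "snd g'" "snd z'"]
      by (auto simp: s p)
    show "comps ?P [ten ?P (ten ?P (x, f, x') (y, g, y')) (z, h, z'), tasc ?P x' y' z'] =
      comps ?P [tasc ?P x y z, ten ?P (x, f, x') (ten ?P (y, g, y') (z, h, z'))]"
      if "(x, f, x') \<in> tarrs ?P" "(y, g, y') \<in> tarrs ?P" "(z, h, z') \<in> tarrs ?P" for x f x' y g y' z h z'
      using that M.asc_nat[of "fst x" "fst f" "fst x'" "fst y" "fst g" "fst y'" "fst z" "fst h" "fst z'"]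
        N.asc_nat[of "snd x" "snd f" "snd x'" "snd y" "snd g" "snd y'" "snd z" "snd h" "snd z'"] by (auto simp: s p)
    show "comps ?P [ten ?P (tid ?P (UnO ?P)) (x, f, y), tlun ?P y] = comps ?P [tlun ?P x, (x, f, y)]"
      if "(x, f, y) \<in> tarrs ?P" for x f y
      using that M.lun_nat[of "fst x" "fst f" "fst y"] N.lun_nat[of "snd x" "snd f" "snd y"] by (auto simp: s p)
    show "comps ?P [ten ?P (x, f, y) (tid ?P (UnO ?P)), trun ?P y] = comps ?P [trun ?P x, (x, f, y)]"
      if "(x, f, y) \<in> tarrs ?P" for x f y
      using that M.run_nat[of "fst x" "fst f" "fst y"] N.run_nat[of "snd x" "snd f" "snd y"] by (auto simp: s p)
    show "comps ?P [ten ?P (tasc ?P w x y) (tid ?P z), tasc ?P w (TenO ?P x y) z, ten ?P (tid ?P w) (tasc ?P x y z)] =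
      comps ?P [tasc ?P (TenO ?P w x) y z, tasc ?P w x (TenO ?P y z)]"
      if "w \<in> Ob ?P" "x \<in> Ob ?P" "y \<in> Ob ?P" "z \<in> Ob ?P" for w x y z
      using that M.pentagon[of "fst w" "fst x" "fst y" "fst z"] N.pentagon[of "snd w" "snd x" "snd y" "snd z"]
      by (auto simp: s p)
    show "comps ?P [tasc ?P x (UnO ?P) y, ten ?P (tid ?P x) (tlun ?P y)] = ten ?P (trun ?P x) (tid ?P y)"
      if "x \<in> Ob ?P" "y \<in> Ob ?P" for x y
      using that M.triangle[of "fst x" "fst y"] N.triangle[of "snd x" "snd y"] by (auto simp: s p)
    show "ten ?P (tid ?P x) (tid ?P y) = tid ?P (TenO ?P x y)" if "x \<in> Ob ?P" "y \<in> Ob ?P" for x y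
      using that M.ten_id[of "fst x" "fst y"] N.ten_id[of "snd x" "snd y"] by (auto simp: s p)
    show "tasc ?P x y z \<in> tisos ?P" if "x \<in> Ob ?P" "y \<in> Ob ?P" "z \<in> Ob ?P" for x y z
      using that M.asc_iso[of "fst x" "fst y" "fst z"] N.asc_iso[of "snd x" "snd y" "snd z"] by (auto simp: s p)
    show "tlun ?P x \<in> tisos ?P" if "x \<in> Ob ?P" for x
      using that M.lun_iso[of "fst x"] N.lun_iso[of "snd x"] by (auto simp: s p)
    show "trun ?P x \<in> tisos ?P" if "x \<in> Ob ?P" for x
      using that M.run_iso[of "fst x"] N.run_iso[of "snd x"] by (auto simp: s p)
  qed
qed

end

lemma coherent_2group_prod:
  assumes M: "coherent_2group M" and N: "coherent_2group N"
  shows "coherent_2group (prod_moncat M N)"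
proof -
  let ?P = "prod_moncat M N"
  have m: "monoidal_category M" "monoidal_category N" using M N by (simp_all add: coherent_2group_def)
  interpret M: monoidal_category M by (rule m)
  interpret N: monoidal_category N by (rule m)
  interpret P: monoidal_category ?P by (rule monoidal_prod[OF m])
  obtain iv iu ec where c: "coherent_inverses M iv iu ec" using M by (auto simp: coherent_2group_def)
  obtain iv' iu' ec' where c': "coherent_inverses N iv' iu' ec'" using N by (auto simp: coherent_2group_def)
  let ?iv = "\<lambda>x. (iv (fst x), iv' (snd x))" and ?iu = "\<lambda>x. (iu (fst x), iu' (snd x))"
    and ?ec = "\<lambda>x. (ec (fst x), ec' (snd x))"
  have "coherent_inverses ?P ?iv ?iu ?ec"
    unfolding coherent_inverses_def Let_def
  proof (intro ballI)
    fix x assume x: "x \<in> Ob ?P"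
    then have x': "fst x \<in> Ob M" "snd x \<in> Ob N" by (auto simp: prod_moncat_def)
    note c1 = c[unfolded coherent_inverses_def Let_def, rule_format, OF x'(1)]
    note c2 = c'[unfolded coherent_inverses_def Let_def, rule_format, OF x'(2)]
    have v: "?iv x \<in> Ob ?P" using c1 c2 by (simp add: prod_moncat_def)
    note l = P.lun_iso[OF x] P.run_iso[OF v] P.asc_iso[OF v x v]
    have inv: "tinv ?P t = (tgt t, (inv_arrow M (fst (fst t)) (fst (tgt t)) (fst (arrow_of t)),
        inv_arrow N (snd (fst t)) (snd (tgt t)) (snd (arrow_of t))), fst t)" if "t \<in> tisos ?P" for t
      using that prod_inv_arrow[OF m, of "fst t" "tgt t" "arrow_of t"]
      by (cases t) (auto simp: tisos_def prod_moncat_def)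
    note s = prod_is_iso tarrs_def tisos_def ten_def tid_def tasc_def tlun_def trun_def
    show "?iv x \<in> Ob ?P \<and> (UnO ?P, ?iu x, TenO ?P x (?iv x)) \<in> tisos ?P \<and>
       (TenO ?P (?iv x) x, ?ec x, UnO ?P) \<in> tisos ?P \<and>
       comps ?P [tinv ?P (tlun ?P x), ten ?P (UnO ?P, ?iu x, TenO ?P x (?iv x)) (tid ?P x), tasc ?P x (?iv x) x,
          ten ?P (tid ?P x) (TenO ?P (?iv x) x, ?ec x, UnO ?P), trun ?P x] = tid ?P x \<and>
       comps ?P [tinv ?P (trun ?P (?iv x)), ten ?P (tid ?P (?iv x)) (UnO ?P, ?iu x, TenO ?P x (?iv x)),
          tinv ?P (tasc ?P (?iv x) x (?iv x)), ten ?P (TenO ?P (?iv x) x, ?ec x, UnO ?P) (tid ?P (?iv x)),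
          tlun ?P (?iv x)] = tid ?P (?iv x)"
      unfolding inv[OF l(1)] inv[OF l(2)] inv[OF l(3)]
      using c1 c2 x by (simp add: s prod_is_iso[OF m]) (simp add: prod_moncat_def mem_Times_iff)
  qed
  moreover have "\<forall>x\<in>Ob ?P. \<forall>y\<in>Ob ?P. \<forall>f\<in>Hom ?P x y. is_iso ?P x y f"
    using M N by (auto simp: prod_is_iso[OF m] coherent_2group_def) (auto simp: prod_moncat_def)
  ultimately show ?thesis
    unfolding coherent_2group_def using P.monoidal_category_axioms by blast
qed

context
  fixes M :: "('o, 'a, 'z) moncat_scheme" and E :: "('p, 'b, 'y) moncat_scheme" and Q :: "('g, 'w) monoid_scheme"
    and P :: "('o, 'a, 'g, unit) mfunc" and R :: "('p, 'b, 'g, unit) mfunc"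
  assumes P: "strong_monoidal_functor M (disc Q) P" and R: "strong_monoidal_functor E (disc Q) R"
begin

interpretation P: strong_monoidal_functor M "disc Q" P by (rule P)
interpretation R: strong_monoidal_functor E "disc Q" R by (rule R)

text \<open>In an object \<open>(x, y, f)\<close> over a discrete 2-group, \<open>f\<close> only records that \<open>x\<close> and \<open>y\<close> have the same image, and the
  condition on arrows holds automatically: the pullback is a full subcategory of the product.\<close>

lemma hpullback_pulled_back:
  "pulled_back (hpullback M E (disc Q) P R) (prod_moncat M E) (\<lambda>(x, y, f). (x, y))"
proof -
  note p = to_disc[OF P] and r = to_disc[OF R]
  have h: "a \<in> Hom M x x' \<Longrightarrow> x \<in> Ob M \<Longrightarrow> x' \<in> Ob M \<Longrightarrow> FO P x = FO P x'" for a x x' using p(2) .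
  show ?thesis
    unfolding pulled_back_def hpullback_def prod_moncat_def
    using p r P.M.UnO_ob R.M.UnO_ob
    by (auto simp: P.M.TenO_ob R.M.TenO_ob disc_tarr_eq comps_ends)
qed

lemma monoidal_hpullback: "monoidal_category (hpullback M E (disc Q) P R)"
  by (rule monoidal_pulled_back[OF hpullback_pulled_back monoidal_prod])
    (rule P.M.monoidal_category_axioms R.M.monoidal_category_axioms)+

text \<open>An inverse of \<open>(x, y)\<close> in \<open>M \<times> E\<close> lies in the pullback, because both its components are mapped
  to the inverse of the common image of \<open>x\<close> and \<open>y\<close> in \<open>Q\<close>.\<close>

lemma coherent_2group_hpullback:
  assumes M: "coherent_2group M" and E: "coherent_2group E" and "group Q"
  shows "coherent_2group (hpullback M E (disc Q) P R)"
proof (rule coherent_2group_pulled_back[OF hpullback_pulled_back _ coherent_2group_prod[OF M E]])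
  interpret group Q by fact
  note p = to_disc[OF P] and r = to_disc[OF R]
  show "monoidal_category (prod_moncat M E)"
    by (rule monoidal_prod) (rule P.M.monoidal_category_axioms R.M.monoidal_category_axioms)+
  fix X Y i assume X: "X \<in> Ob (hpullback M E (disc Q) P R)" and Y: "Y \<in> Ob (prod_moncat M E)"
    and iso: "is_iso (prod_moncat M E) (UnO (prod_moncat M E))
      (TenO (prod_moncat M E) (case X of (x, y, f) \<Rightarrow> (x, y)) Y) i"
  obtain x y where X': "X = (x, y, ())" "x \<in> Ob M" "y \<in> Ob E" "FO P x = FO R y"
    using X by (auto simp: hpullback_def)
  obtain x' y' where Y': "Y = (x', y')" "x' \<in> Ob M" "y' \<in> Ob E"
    using Y by (auto simp: prod_moncat_def)
  have "fst i \<in> Hom M (UnO M) (TenO M x x')" "snd i \<in> Hom E (UnO E) (TenO E y y')"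
    using iso by (auto simp: is_iso_def prod_moncat_def X' Y')
  then have "FO P (UnO M) = FO P (TenO M x x')" "FO R (UnO E) = FO R (TenO E y y')"
    using p(2)[of "UnO M" "TenO M x x'" "fst i"] r(2)[of "UnO E" "TenO E y y'" "snd i"] X' Y'
    by (simp_all add: P.M.UnO_ob R.M.UnO_ob P.M.TenO_ob R.M.TenO_ob)
  then have "FO P x \<otimes>\<^bsub>Q\<^esub> FO P x' = FO P x \<otimes>\<^bsub>Q\<^esub> FO R y'"
    using p r X' Y' by metis
  then have "FO P x' = FO R y'" using p(1)[OF X'(2)] p(1)[OF Y'(2)] r(1)[OF Y'(3)] by simp
  then show "\<exists>X'\<in>Ob (hpullback M E (disc Q) P R). (case X' of (x, y, f) \<Rightarrow> (x, y)) = Y"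
    using Y' by (intro bexI[of _ "(x', y', ())"]) (auto simp: hpullback_def)
qed

end

lemma strong_monoidal_hpullback_fst:
  assumes P: "strong_monoidal_functor (disc G) (disc Q) P" and R: "strong_monoidal_functor E (disc Q) R" and "monoid G"
  shows "strong_monoidal_functor (hpullback (disc G) E (disc Q) P R) (disc G) (hpullback_fst (disc G))"
  by (rule to_discI[OF monoidal_hpullback[OF P R] assms(3)]) (auto simp: hpullback_fst_def hpullback_def)

lemma hfiber_pulled_back:
  assumes R: "strong_monoidal_functor E (disc Q) R" and "monoid Q"
  shows "pulled_back (hfiber E (disc Q) R) E fst"
proof -
  interpret R: strong_monoidal_functor E "disc Q" R by (rule R)
  interpret monoid Q by fact
  show ?thesis
    unfolding pulled_back_def hfiber_def
    using to_disc[OF R] by (auto simp: R.M.TenO_ob R.M.UnO_ob disc_tarr_eq comps_ends)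
qed

lemma monoidal_hfiber:
  assumes R: "strong_monoidal_functor E (disc Q) R" and "monoid Q"
  shows "monoidal_category (hfiber E (disc Q) R)"
  by (rule monoidal_pulled_back[OF hfiber_pulled_back[OF assms]])
    (use R in \<open>simp add: strong_monoidal_functor_def\<close>)

text \<open>An object of the fibre of the projection is \<open>(\<one>, y)\<close> with \<open>R y = \<one>\<close>, that is, an object \<open>y\<close> of the fibre of \<open>R\<close>.
  So the usual comparison of the fibres of a pullback is an isomorphism here.\<close>

lemma hfiber_hpullback:
  fixes E :: "('p, 'b) moncat" and Q :: "'g monoid" and G :: "('h, 'w) monoid_scheme"
    and R :: "('p, 'b, 'g, unit) mfunc" and P :: "('h, unit, 'g, unit) mfunc"
  assumes P: "strong_monoidal_functor (disc G) (disc Q) P" and R: "strong_monoidal_functor E (disc Q) R"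
    and "monoid G" "monoid Q"
  shows "monoidally_equivalent (hfiber E (disc Q) R)
     (hfiber (hpullback (disc G) E (disc Q) P R) (disc G) (hpullback_fst (disc G)))"
proof -
  let ?H = "hpullback (disc G) E (disc Q) P R"
  let ?p = "hpullback_fst (disc G) :: ('h \<times> 'p \<times> unit, unit \<times> 'b, 'h, unit) mfunc"
  let ?K = "hfiber E (disc Q) R" and ?L = "hfiber ?H (disc G) ?p"
  interpret G: monoid G by fact
  interpret Q: monoid Q by fact
  have p: "strong_monoidal_functor ?H (disc G) ?p" by (rule strong_monoidal_hpullback_fst[OF P R assms(3)])
  interpret R: strong_monoidal_functor E "disc Q" R by (rule R)
  interpret K: monoidal_category ?K by (rule monoidal_hfiber[OF R assms(4)])
  interpret L: monoidal_category ?L by (rule monoidal_hfiber[OF p assms(3)])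
  note pp = to_disc[OF P] and rr = to_disc[OF R]
  define J :: "('p \<times> unit, 'b, ('h \<times> 'p \<times> unit) \<times> unit, unit \<times> 'b) mfunc" where
    "J = \<lparr>FO = (\<lambda>(y, f). ((\<one>\<^bsub>G\<^esub>, y, ()), ())), FA = (\<lambda>_ _ b. ((), b)),
       FMu = (\<lambda>x y. Idn ?L ((\<one>\<^bsub>G\<^esub>, TenO E (fst x) (fst y), ()), ())), FEp = Idn ?L (UnO ?L)\<rparr>"
  define J' :: "(('h \<times> 'p \<times> unit) \<times> unit, unit \<times> 'b, 'p \<times> unit, 'b) func" where
    "J' = \<lparr>FO = (\<lambda>((h, y, f), g). (y, ())), FA = (\<lambda>_ _ u. snd u)\<rparr>"
  note sel = J_def J'_def hfiber_def hpullback_def hpullback_fst_def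
  have ob: "X \<in> Ob ?L \<longleftrightarrow> (\<exists>y\<in>Ob E. X = ((\<one>\<^bsub>G\<^esub>, y, ()), ()) \<and> FO R y = \<one>\<^bsub>Q\<^esub>)" for X
    using pp(4) by (cases X) (auto simp: hfiber_def hpullback_def hpullback_fst_def)
  have obK: "X \<in> Ob ?K \<longleftrightarrow> (\<exists>y\<in>Ob E. X = (y, ()) \<and> FO R y = \<one>\<^bsub>Q\<^esub>)" for X
    by (cases X) (auto simp: hfiber_def)
  have hom: "Hom ?L ((\<one>\<^bsub>G\<^esub>, y, ()), ()) ((\<one>\<^bsub>G\<^esub>, y', ()), ()) = {((), b) | b. b \<in> Hom E y y'}"
    if "y \<in> Ob E" "y' \<in> Ob E" for y y'
    using that rr(2) by (auto simp: hfiber_def hpullback_def hpullback_fst_def disc_tarr_eq comps_ends)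
  have homK: "Hom ?K (y, ()) (y', ()) = Hom E y y'" if "y \<in> Ob E" "y' \<in> Ob E" for y y'
    using that rr(2) by (auto simp: hfiber_def disc_tarr_eq comps_ends)
  interpret J: cat_functor ?K ?L J
    by unfold_locales (auto simp: ob obK hom homK J_def, auto simp: hfiber_def hpullback_def disc_def)
  interpret J': cat_functor ?L ?K J'
    by unfold_locales (auto simp: ob obK hom homK J'_def, auto simp: hfiber_def hpullback_def disc_def)
  have "strong_monoidal_functor ?K ?L J"
  proof (rule strict_strong_monoidal)
    show "monoidal_category ?K" "monoidal_category ?L" "cat_functor ?K ?L J"
      by (rule K.monoidal_category_axioms L.monoidal_category_axioms J.cat_functor_axioms)+
  qed (auto simp: obK tarrs_def ten_def tasc_def tlun_def trun_def, auto simp: sel)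
  moreover have "equivalence ?K ?L J"
    by (rule equivalence_strict[OF J.cat_functor_axioms J'.cat_functor_axioms])
      (auto simp: strictly_inverse_def ob obK hom homK, auto simp: J_def J'_def)
  ultimately show ?thesis
    unfolding monoidally_equivalent_def monoidal_equivalence_def by blast
qed

lemma monoidally_equivalent_trans:
  fixes M :: "('o, 'a, 'z) moncat_scheme" and N :: "('p, 'b, 'y) moncat_scheme" and L :: "('q, 'c, 'x) moncat_scheme"
  assumes MN: "monoidally_equivalent M N" and NL: "monoidally_equivalent N L"
  shows "monoidally_equivalent M L"
proof -
  obtain F :: "('o, 'a, 'p, 'b) mfunc" where F: "strong_monoidal_functor M N F" "equivalence M N F"
    using MN by (auto simp: monoidally_equivalent_def monoidal_equivalence_def)
  obtain G :: "('p, 'b, 'q, 'c) mfunc" where G: "strong_monoidal_functor N L G" "equivalence N L G"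
    using NL by (auto simp: monoidally_equivalent_def monoidal_equivalence_def)
  show ?thesis
    unfolding monoidally_equivalent_def monoidal_equivalence_def
    using strong_monoidal_composite[OF F(1) G(1)]
      equivalence_composite[OF F(2) G(2) is_composite_comp_mfunc[of M F G N L]] by blast
qed

section \<open>The 2-group of autoequivalences and strict actions\<close>

lemma comp_func_sel [simp]:
  "x \<in> Ob C \<Longrightarrow> FO (comp_func C G F) x = FO G (FO F x)"
  "\<lbrakk>x \<in> Ob C; y \<in> Ob C; f \<in> Hom C x y\<rbrakk>
    \<Longrightarrow> FA (comp_func C G F) x y f = FA G (FO F x) (FO F y) (FA F x y f)"
  by (simp_all add: comp_func_def)

lemma id_func_sel [simp]:
  "x \<in> Ob C \<Longrightarrow> FO (id_func C) x = x"
  "\<lbrakk>x \<in> Ob C; y \<in> Ob C; f \<in> Hom C x y\<rbrakk> \<Longrightarrow> FA (id_func C) x y f = f"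
  by (simp_all add: id_func_def)

lemma ext_comp_func: "ext_func C (comp_func C G F)" and ext_id_func: "ext_func C (id_func C)"
  unfolding comp_func_def id_func_def by (rule ext_mk_func)+

text \<open>A submonoid \<open>S\<close> of the endofunctors of \<open>A\<close>. The linear autoequivalences and the exact ones are the two
  instances of interest.\<close>

locale endofunctors = category A for A :: "('o, 'a, 's) lincat" +
  fixes S :: "('o, 'a) endo set"
  assumes functors: "F \<in> S \<Longrightarrow> cat_functor A A F" and ext: "F \<in> S \<Longrightarrow> ext_func A F"
    and id_in: "id_func A \<in> S" and comp_in: "\<lbrakk>F \<in> S; G \<in> S\<rbrakk> \<Longrightarrow> comp_func A F G \<in> S"
begin

abbreviation "EM \<equiv> endo_moncat A S"

lemma S_ob: "F \<in> S \<Longrightarrow> x \<in> Ob A \<Longrightarrow> FO F x \<in> Ob A"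
  and S_hom: "\<lbrakk>F \<in> S; x \<in> Ob A; y \<in> Ob A; f \<in> Hom A x y\<rbrakk> \<Longrightarrow> FA F x y f \<in> Hom A (FO F x) (FO F y)"
  and S_id: "F \<in> S \<Longrightarrow> x \<in> Ob A \<Longrightarrow> FA F x x (Idn A x) = Idn A (FO F x)"
  and S_cmp: "\<lbrakk>F \<in> S; x \<in> Ob A; y \<in> Ob A; z \<in> Ob A; f \<in> Hom A x y; g \<in> Hom A y z\<rbrakk>
      \<Longrightarrow> FA F x z (Cmp A x y z g f) = Cmp A (FO F x) (FO F y) (FO F z) (FA F y z g) (FA F x y f)"
  using functors by (blast intro: cat_functor.FO_ob cat_functor.FA_hom cat_functor.FA_id cat_functor.FA_cmp)+

lemma EM_sel:
  "Ob EM = S" "UnO EM = id_func A" "TenO EM F G = comp_func A F G"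
  "Hom EM F G = {\<eta> \<in> extensional (Ob A). nat_iso A A F G \<eta>}"
  "Idn EM F = (\<lambda>x\<in>Ob A. Idn A (FO F x))"
  "Cmp EM F G H \<theta> \<eta> = (\<lambda>x\<in>Ob A. Cmp A (FO F x) (FO G x) (FO H x) (\<theta> x) (\<eta> x))"
  "TenA EM (F, \<eta>, F') (G, \<theta>, G') = (\<lambda>x\<in>Ob A. Cmp A (FO F (FO G x)) (FO F (FO G' x)) (FO F' (FO G' x))
     (\<eta> (FO G' x)) (FA F (FO G x) (FO G' x) (\<theta> x)))"
  "Asc EM F G H = (\<lambda>x\<in>Ob A. Idn A (FO (comp_func A F (comp_func A G H)) x))"
  "LUn EM F = (\<lambda>x\<in>Ob A. Idn A (FO F x))" "RUn EM F = (\<lambda>x\<in>Ob A. Idn A (FO F x))"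
  by (simp_all add: endo_moncat_def Let_def)

lemma nat_isoD:
  assumes "nat_iso A A F G \<eta>" "x \<in> Ob A"
  shows "is_iso A (FO F x) (FO G x) (\<eta> x)" and "\<eta> x \<in> Hom A (FO F x) (FO G x)"
    and "\<lbrakk>y \<in> Ob A; f \<in> Hom A x y\<rbrakk> \<Longrightarrow> Cmp A (FO F x) (FO G x) (FO G y) (FA G x y f) (\<eta> x) =
        Cmp A (FO F x) (FO F y) (FO G y) (\<eta> y) (FA F x y f)"
  using assms by (auto simp: nat_iso_def is_iso_def)

lemma nat_iso_Idn: "F \<in> S \<Longrightarrow> nat_iso A A F F (\<lambda>x\<in>Ob A. Idn A (FO F x))"
  by (simp add: nat_iso_def S_ob is_iso_Idn S_hom Idn_left Idn_right)

lemma nat_iso_Cmp: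
  assumes "F \<in> S" "G \<in> S" "H \<in> S" and n: "nat_iso A A F G \<eta>" "nat_iso A A G H \<theta>"
  shows "nat_iso A A F H (\<lambda>x\<in>Ob A. Cmp A (FO F x) (FO G x) (FO H x) (\<theta> x) (\<eta> x))"
  unfolding nat_iso_def
proof (intro conjI ballI)
  fix x assume x: "x \<in> Ob A"
  then show "is_iso A (FO F x) (FO H x) ((\<lambda>x\<in>Ob A. Cmp A (FO F x) (FO G x) (FO H x) (\<theta> x) (\<eta> x)) x)"
    using assms by (simp add: is_iso_Cmp[of _ "FO G x"] S_ob nat_isoD)
  fix y f assume y: "y \<in> Ob A" and f: "f \<in> Hom A x y"
  note h = S_ob S_hom nat_isoD(2)
  have "Cmp A (FO F x) (FO H x) (FO H y) (FA H x y f) (Cmp A (FO F x) (FO G x) (FO H x) (\<theta> x) (\<eta> x))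
     = Cmp A (FO F x) (FO G x) (FO H y) (Cmp A (FO G x) (FO H x) (FO H y) (FA H x y f) (\<theta> x)) (\<eta> x)"
    using assms x y f by (simp add: Cmp_assoc h)
  also have "\<dots> = Cmp A (FO F x) (FO G x) (FO H y) (Cmp A (FO G x) (FO G y) (FO H y) (\<theta> y) (FA G x y f)) (\<eta> x)"
    using nat_isoD(3)[OF n(2) x y f] by simp
  also have "\<dots> = Cmp A (FO F x) (FO G y) (FO H y) (\<theta> y) (Cmp A (FO F x) (FO G x) (FO G y) (FA G x y f) (\<eta> x))"
    using assms x y f by (simp add: Cmp_assoc h)
  also have "\<dots> = Cmp A (FO F x) (FO G y) (FO H y) (\<theta> y) (Cmp A (FO F x) (FO F y) (FO G y) (\<eta> y) (FA F x y f))"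
    using nat_isoD(3)[OF n(1) x y f] by simp
  also have "\<dots> = Cmp A (FO F x) (FO F y) (FO H y) (Cmp A (FO F y) (FO G y) (FO H y) (\<theta> y) (\<eta> y)) (FA F x y f)"
    using assms x y f by (simp add: Cmp_assoc h)
  finally show "Cmp A (FO F x) (FO H x) (FO H y) (FA H x y f) ((\<lambda>x\<in>Ob A. Cmp A (FO F x) (FO G x) (FO H x) (\<theta> x) (\<eta> x)) x) =
     Cmp A (FO F x) (FO F y) (FO H y) ((\<lambda>x\<in>Ob A. Cmp A (FO F x) (FO G x) (FO H x) (\<theta> x) (\<eta> x)) y) (FA F x y f)"
    using x y by simp
qed

lemma category_EM: "category EM"
proof
  fix F G H K \<eta> \<theta> \<kappa>
  assume S: "F \<in> Ob EM" "G \<in> Ob EM" "H \<in> Ob EM" "K \<in> Ob EM"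
    and h: "\<eta> \<in> Hom EM F G" "\<theta> \<in> Hom EM G H" "\<kappa> \<in> Hom EM H K"
  show "Cmp EM F G K (Cmp EM G H K \<kappa> \<theta>) \<eta> = Cmp EM F H K \<kappa> (Cmp EM F G H \<theta> \<eta>)"
    using S h by (auto simp: EM_sel restrict_def fun_eq_iff nat_isoD S_ob Cmp_assoc)
next
  fix F assume "F \<in> Ob EM"
  then show "Idn EM F \<in> Hom EM F F" by (simp add: EM_sel nat_iso_Idn)
next
  fix F G \<eta> assume h: "F \<in> Ob EM" "G \<in> Ob EM" "\<eta> \<in> Hom EM F G"
  show "Cmp EM F G G (Idn EM G) \<eta> = \<eta>" "Cmp EM F F G \<eta> (Idn EM F) = \<eta>"
    using h by (auto simp: EM_sel nat_isoD S_ob Idn_left Idn_right intro!: extensionalityI[of _ "Ob A"])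
next
  fix F G H \<eta> \<theta> assume "F \<in> Ob EM" "G \<in> Ob EM" "H \<in> Ob EM" "\<eta> \<in> Hom EM F G" "\<theta> \<in> Hom EM G H"
  then show "Cmp EM F G H \<theta> \<eta> \<in> Hom EM F H" by (simp add: EM_sel nat_iso_Cmp)
qed

lemma comp_func_assoc:
  assumes "F \<in> S" "G \<in> S" "H \<in> S"
  shows "comp_func A (comp_func A F G) H = comp_func A F (comp_func A G H)"
  by (rule ext_func_eqI[OF ext_comp_func ext_comp_func]) (use assms in \<open>simp_all add: S_ob S_hom\<close>)

lemma comp_func_id:
  assumes "F \<in> S" shows "comp_func A (id_func A) F = F" "comp_func A F (id_func A) = F"
  by (rule ext_func_eqI[OF ext_comp_func ext[OF assms]]; use assms in \<open>simp add: S_ob S_hom\<close>)+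

lemma EM_structure_id:
  "\<lbrakk>F \<in> S; G \<in> S; H \<in> S\<rbrakk> \<Longrightarrow> tasc EM F G H = tid EM (comp_func A F (comp_func A G H))"
  "F \<in> S \<Longrightarrow> tlun EM F = tid EM F" "F \<in> S \<Longrightarrow> trun EM F = tid EM F"
  by (simp_all add: tasc_def tlun_def trun_def tid_def EM_sel comp_func_assoc comp_func_id)

lemma EM_tarrs: "(F, \<eta>, G) \<in> tarrs EM \<longleftrightarrow> F \<in> S \<and> G \<in> S \<and> \<eta> \<in> extensional (Ob A) \<and> nat_iso A A F G \<eta>"
  by (auto simp: tarrs_def EM_sel)

lemma nat_iso_horizontal:
  assumes S: "F \<in> S" "F' \<in> S" "G \<in> S" "G' \<in> S" and n: "nat_iso A A F F' \<eta>" "nat_iso A A G G' \<theta>"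
  shows "nat_iso A A (comp_func A F G) (comp_func A F' G')
     (\<lambda>x\<in>Ob A. Cmp A (FO F (FO G x)) (FO F (FO G' x)) (FO F' (FO G' x)) (\<eta> (FO G' x)) (FA F (FO G x) (FO G' x) (\<theta> x)))"
    (is "nat_iso A A _ _ ?h")
  unfolding nat_iso_def
proof (intro conjI ballI)
  fix x assume x: "x \<in> Ob A"
  note h = S_ob S_hom nat_isoD(1,2)[OF n(1)] nat_isoD(1,2)[OF n(2)] cat_functor.FA_iso[OF functors]
  show "is_iso A (FO (comp_func A F G) x) (FO (comp_func A F' G') x) (?h x)"
    using x S by (simp add: is_iso_Cmp[of _ "FO F (FO G' x)"] h)
  fix y f assume y: "y \<in> Ob A" and f: "f \<in> Hom A x y"
  let ?Fg = "FA F (FO G x) (FO G' x) (\<theta> x)" and ?Fg' = "FA F (FO G y) (FO G' y) (\<theta> y)"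
  let ?f' = "FA G' x y f"
  have "Cmp A (FO F (FO G x)) (FO F' (FO G' x)) (FO F' (FO G' y)) (FA F' (FO G' x) (FO G' y) ?f')
          (Cmp A (FO F (FO G x)) (FO F (FO G' x)) (FO F' (FO G' x)) (\<eta> (FO G' x)) ?Fg)
     = Cmp A (FO F (FO G x)) (FO F (FO G' x)) (FO F' (FO G' y))
         (Cmp A (FO F (FO G' x)) (FO F' (FO G' x)) (FO F' (FO G' y)) (FA F' (FO G' x) (FO G' y) ?f') (\<eta> (FO G' x))) ?Fg"
    using x y f S by (simp add: Cmp_assoc h)
  also have "\<dots> = Cmp A (FO F (FO G x)) (FO F (FO G' x)) (FO F' (FO G' y))
         (Cmp A (FO F (FO G' x)) (FO F (FO G' y)) (FO F' (FO G' y)) (\<eta> (FO G' y)) (FA F (FO G' x) (FO G' y) ?f')) ?Fg"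
    using nat_isoD(3)[OF n(1), of "FO G' x" "FO G' y" ?f'] x y f S by (simp add: h)
  also have "\<dots> = Cmp A (FO F (FO G x)) (FO F (FO G' y)) (FO F' (FO G' y)) (\<eta> (FO G' y))
         (FA F (FO G x) (FO G' y) (Cmp A (FO G x) (FO G' x) (FO G' y) ?f' (\<theta> x)))"
    using x y f S by (simp add: Cmp_assoc h S_cmp)
  also have "Cmp A (FO G x) (FO G' x) (FO G' y) ?f' (\<theta> x) = Cmp A (FO G x) (FO G y) (FO G' y) (\<theta> y) (FA G x y f)"
    by (rule nat_isoD(3)[OF n(2) x y f])
  also have "Cmp A (FO F (FO G x)) (FO F (FO G' y)) (FO F' (FO G' y)) (\<eta> (FO G' y)) (FA F (FO G x) (FO G' y) \<dots>)
     = Cmp A (FO F (FO G x)) (FO F (FO G y)) (FO F' (FO G' y))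
         (Cmp A (FO F (FO G y)) (FO F (FO G' y)) (FO F' (FO G' y)) (\<eta> (FO G' y)) ?Fg') (FA F (FO G x) (FO G y) (FA G x y f))"
    using x y f S by (simp add: Cmp_assoc h S_cmp)
  finally show "Cmp A (FO (comp_func A F G) x) (FO (comp_func A F' G') x) (FO (comp_func A F' G') y)
        (FA (comp_func A F' G') x y f) (?h x) =
      Cmp A (FO (comp_func A F G) x) (FO (comp_func A F G) y) (FO (comp_func A F' G') y) (?h y)
        (FA (comp_func A F G) x y f)"
    using x y f by simp
qed

text \<open>Composition of extensional functors is strictly associative and unital. Hence all associators and unitors
  are identities, and the substance is the functoriality of horizontal composition, an instance of
  naturality.\<close>

lemma monoidal_EM: "monoidal_category EM"
proof -
  interpret EM: category EM by (rule category_EM)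
  note h = S_ob S_hom nat_isoD(1,2) comp_in
  have idl: "tcomp EM (tid EM F) s = s" if "s \<in> tarrs EM" "fst s = F" for s F
    using EM.tcomp_tid(1)[OF that(1)] that(2) by simp
  have idr: "tcomp EM s (tid EM F) = s" if "s \<in> tarrs EM" "tgt s = F" for s F
    using EM.tcomp_tid(2)[OF that(1)] that(2) by simp
  have arr: "ten EM s t \<in> tarrs EM" if "s \<in> tarrs EM" "t \<in> tarrs EM" for s t
    using that by (cases s; cases t) (simp add: EM_tarrs ten_def EM_sel comp_in nat_iso_horizontal)
  have ids: "ten EM (tid EM F) (tid EM G) = tid EM (comp_func A F G)" if "F \<in> S" "G \<in> S" for F G
    using that by (auto simp: ten_def tid_def EM_sel S_ob S_id Idn_left Idn_hom intro!: restrict_ext)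
  show ?thesis
  proof
    show "UnO EM \<in> Ob EM" by (simp add: EM_sel id_in)
    show "TenO EM F G \<in> Ob EM" if "F \<in> Ob EM" "G \<in> Ob EM" for F G using that by (simp add: EM_sel comp_in)
    show "ten EM s t \<in> tarrs EM" if "s \<in> tarrs EM" "t \<in> tarrs EM" for s t by (rule arr[OF that])
    show "ten EM (tid EM F) (tid EM G) = tid EM (TenO EM F G)" if "F \<in> Ob EM" "G \<in> Ob EM" for F G
      using ids that by (simp add: EM_sel)
    show "tasc EM F G H \<in> tisos EM" if "F \<in> Ob EM" "G \<in> Ob EM" "H \<in> Ob EM" for F G H
      using that by (simp add: EM_sel EM_structure_id comp_in EM.tid_tiso)
    show "tlun EM F \<in> tisos EM" if "F \<in> Ob EM" for F
      using that by (simp add: EM_sel EM_structure_id EM.tid_tiso)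
    show "trun EM F \<in> tisos EM" if "F \<in> Ob EM" for F
      using that by (simp add: EM_sel EM_structure_id EM.tid_tiso)
    show "ten EM (tcomp EM (F, \<eta>, F') (F', \<eta>', F'')) (tcomp EM (G, \<theta>, G') (G', \<theta>', G'')) =
        tcomp EM (ten EM (F, \<eta>, F') (G, \<theta>, G')) (ten EM (F', \<eta>', F'') (G', \<theta>', G''))"
      if t: "(F, \<eta>, F') \<in> tarrs EM" "(F', \<eta>', F'') \<in> tarrs EM" "(G, \<theta>, G') \<in> tarrs EM" "(G', \<theta>', G'') \<in> tarrs EM"
      for F \<eta> F' \<eta>' F'' G \<theta> G' \<theta>' G''
    proof -
      have S: "F \<in> S" "F' \<in> S" "F'' \<in> S" "G \<in> S" "G' \<in> S" "G'' \<in> S"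
        and n: "nat_iso A A F F' \<eta>" "nat_iso A A F' F'' \<eta>'" "nat_iso A A G G' \<theta>" "nat_iso A A G' G'' \<theta>'"
        using t by (auto simp: EM_tarrs)
      note h = S_ob S_hom nat_isoD(1,2)[OF n(1)] nat_isoD(1,2)[OF n(2)] nat_isoD(1,2)[OF n(3)] nat_isoD(1,2)[OF n(4)]
      have "Cmp A (FO F (FO G x)) (FO F (FO G'' x)) (FO F'' (FO G'' x))
            (Cmp A (FO F (FO G'' x)) (FO F' (FO G'' x)) (FO F'' (FO G'' x)) (\<eta>' (FO G'' x)) (\<eta> (FO G'' x)))
            (FA F (FO G x) (FO G'' x) (Cmp A (FO G x) (FO G' x) (FO G'' x) (\<theta>' x) (\<theta> x))) =
          Cmp A (FO F (FO G x)) (FO F' (FO G' x)) (FO F'' (FO G'' x))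
            (Cmp A (FO F' (FO G' x)) (FO F' (FO G'' x)) (FO F'' (FO G'' x)) (\<eta>' (FO G'' x)) (FA F' (FO G' x) (FO G'' x) (\<theta>' x)))
            (Cmp A (FO F (FO G x)) (FO F (FO G' x)) (FO F' (FO G' x)) (\<eta> (FO G' x)) (FA F (FO G x) (FO G' x) (\<theta> x)))"
        if x: "x \<in> Ob A" for x
      proof -
        let ?g = "FA F (FO G x) (FO G' x) (\<theta> x)" and ?g' = "FA F (FO G' x) (FO G'' x) (\<theta>' x)"
          and ?g'' = "FA F' (FO G' x) (FO G'' x) (\<theta>' x)"
        let ?e = "\<eta> (FO G'' x)" and ?e' = "\<eta>' (FO G'' x)" and ?k = "\<eta> (FO G' x)"
        let ?a = "FO F (FO G x)" and ?b = "FO F (FO G' x)" and ?c = "FO F (FO G'' x)"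
          and ?d = "FO F' (FO G'' x)" and ?d' = "FO F' (FO G' x)" and ?z = "FO F'' (FO G'' x)"
        have "Cmp A ?a ?c ?z (Cmp A ?c ?d ?z ?e' ?e) (FA F (FO G x) (FO G'' x) (Cmp A (FO G x) (FO G' x) (FO G'' x) (\<theta>' x) (\<theta> x)))
          = Cmp A ?a ?b ?z (Cmp A ?b ?d ?z ?e' (Cmp A ?b ?c ?d ?e ?g')) ?g"
          using x S by (simp add: h S_cmp Cmp_assoc Cmp_hom)
        also have "Cmp A ?b ?c ?d ?e ?g' = Cmp A ?b ?d' ?d ?g'' ?k"
          using nat_isoD(3)[OF n(1), of "FO G' x" "FO G'' x" "\<theta>' x"] x S by (simp add: h)
        also have "Cmp A ?a ?b ?z (Cmp A ?b ?d ?z ?e' (Cmp A ?b ?d' ?d ?g'' ?k)) ?g =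
            Cmp A ?a ?d' ?z (Cmp A ?d' ?d ?z ?e' ?g'') (Cmp A ?a ?b ?d' ?k ?g)"
          using x S by (simp add: h Cmp_assoc Cmp_hom)
        finally show ?thesis .
      qed
      then show ?thesis using S by (auto simp: ten_def EM_sel S_ob intro!: restrict_ext)
    qed
    show "comps EM [ten EM (ten EM (F, \<eta>, F') (G, \<theta>, G')) (H, \<kappa>, H'), tasc EM F' G' H'] =
        comps EM [tasc EM F G H, ten EM (F, \<eta>, F') (ten EM (G, \<theta>, G') (H, \<kappa>, H'))]"
      if t: "(F, \<eta>, F') \<in> tarrs EM" "(G, \<theta>, G') \<in> tarrs EM" "(H, \<kappa>, H') \<in> tarrs EM" for F \<eta> F' G \<theta> G' H \<kappa> H'
    proof -
      have S: "F \<in> S" "F' \<in> S" "G \<in> S" "G' \<in> S" "H \<in> S" "H' \<in> S"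
        and n: "nat_iso A A F F' \<eta>" "nat_iso A A G G' \<theta>" "nat_iso A A H H' \<kappa>"
        using t by (auto simp: EM_tarrs)
      note h = S_ob S_hom nat_isoD(1,2)[OF n(1)] nat_isoD(1,2)[OF n(2)] nat_isoD(1,2)[OF n(3)]
      have "ten EM (ten EM (F, \<eta>, F') (G, \<theta>, G')) (H, \<kappa>, H') = ten EM (F, \<eta>, F') (ten EM (G, \<theta>, G') (H, \<kappa>, H'))"
        using S by (auto simp: ten_def EM_sel comp_func_assoc h S_cmp Cmp_assoc intro!: restrict_ext)
      then show ?thesis
        using t S by (simp add: EM_structure_id idl idr arr EM_sel comp_func_assoc)
    qed
    show "comps EM [ten EM (tid EM (UnO EM)) (F, \<eta>, G), tlun EM G] = comps EM [tlun EM F, (F, \<eta>, G)]"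
      if t: "(F, \<eta>, G) \<in> tarrs EM" for F \<eta> G
    proof -
      have S: "F \<in> S" "G \<in> S" "\<eta> \<in> extensional (Ob A)" and n: "nat_iso A A F G \<eta>" using t by (auto simp: EM_tarrs)
      have "ten EM (tid EM (UnO EM)) (F, \<eta>, G) = (F, \<eta>, G)"
        using S nat_isoD(2)[OF n] by (auto simp: ten_def tid_def EM_sel comp_func_id S_ob Idn_left
            intro!: extensionalityI[of _ "Ob A"])
      then show ?thesis using t S by (simp add: EM_structure_id idl idr)
    qed
    show "comps EM [ten EM (F, \<eta>, G) (tid EM (UnO EM)), trun EM G] = comps EM [trun EM F, (F, \<eta>, G)]"
      if t: "(F, \<eta>, G) \<in> tarrs EM" for F \<eta> G
    proof -
      have S: "F \<in> S" "G \<in> S" "\<eta> \<in> extensional (Ob A)" and n: "nat_iso A A F G \<eta>" using t by (auto simp: EM_tarrs)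
      have "ten EM (F, \<eta>, G) (tid EM (UnO EM)) = (F, \<eta>, G)"
        using S nat_isoD(2)[OF n] by (auto simp: ten_def tid_def EM_sel comp_func_id S_ob S_id Idn_right
            intro!: extensionalityI[of _ "Ob A"])
      then show ?thesis using t S by (simp add: EM_structure_id idl idr)
    qed
    show "comps EM [ten EM (tasc EM F G H) (tid EM K), tasc EM F (TenO EM G H) K, ten EM (tid EM F) (tasc EM G H K)] =
        comps EM [tasc EM (TenO EM F G) H K, tasc EM F G (TenO EM H K)]"
      if "F \<in> Ob EM" "G \<in> Ob EM" "H \<in> Ob EM" "K \<in> Ob EM" for F G H K
      using that by (simp add: EM_sel EM_structure_id ids comp_in comp_func_assoc EM.tcomp_tid_tid)
    show "comps EM [tasc EM F (UnO EM) G, ten EM (tid EM F) (tlun EM G)] = ten EM (trun EM F) (tid EM G)"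
      if "F \<in> Ob EM" "G \<in> Ob EM" for F G
      using that by (simp add: EM_sel EM_structure_id ids comp_in comp_func_id id_in EM.tcomp_tid_tid)
  qed
qed

text \<open>A strict action is a monoidal functor whose structure isomorphisms are identities.\<close>

lemma strong_monoidal_strict_two_rep:
  fixes Q :: "('g, 'w) monoid_scheme"
  assumes "monoid Q" and R: "\<And>h. h \<in> carrier Q \<Longrightarrow> R h \<in> S" and one: "R \<one>\<^bsub>Q\<^esub> = id_func A"
    and mult: "\<And>h h'. \<lbrakk>h \<in> carrier Q; h' \<in> carrier Q\<rbrakk> \<Longrightarrow> R (h \<otimes>\<^bsub>Q\<^esub> h') = comp_func A (R h) (R h')"
  shows "strong_monoidal_functor (disc Q) EM (strict_two_rep Q A R)"
proof -
  interpret monoid Q by fact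
  interpret EM: monoidal_category EM by (rule monoidal_EM)
  let ?F = "strict_two_rep Q A R"
  have sel: "FO ?F h = R h" "FA ?F h h' f = Idn EM (R h)" "FMu ?F h h' = Idn EM (R (h \<otimes>\<^bsub>Q\<^esub> h'))"
    "FEp ?F = Idn EM (R \<one>\<^bsub>Q\<^esub>)" for h h' f
    by (simp_all add: strict_two_rep_def Let_def EM_sel)
  have tm: "tmap ?F s = tid EM (R (fst s))" if "s \<in> tarrs (disc Q)" for s
    using that by (cases s) (simp add: sel tid_def disc_tarrs)
  have ids: "ten EM (tid EM F) (tid EM G) = tid EM (comp_func A F G)" if "F \<in> S" "G \<in> S" for F G
    using EM.ten_id[of F G] that by (simp add: EM_sel)
  note str = monoidal_category.structure_tarr[OF monoidal_disc[OF assms(1)]] monoidal_category.ten_arr[OF monoidal_disc[OF assms(1)]]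
  show ?thesis
  proof (rule strict_strong_monoidal[OF monoidal_disc[OF assms(1)] monoidal_EM])
    show "cat_functor (disc Q) EM ?F"
    proof unfold_locales
      fix x y z f g assume "x \<in> Ob (disc Q)" "y \<in> Ob (disc Q)" "z \<in> Ob (disc Q)"
        "f \<in> Hom (disc Q) x y" "g \<in> Hom (disc Q) y z"
      then show "FA ?F x z (Cmp (disc Q) x y z g f) = Cmp EM (FO ?F x) (FO ?F y) (FO ?F z) (FA ?F y z g) (FA ?F x y f)"
        using R[of x] EM.tcomp_tid_tid[of "R x"] by (simp add: sel tid_def EM_sel(1))
    qed (use R EM.Idn_hom monoidal_disc[OF assms(1)] in \<open>auto simp: sel EM_sel(1) monoidal_category_def category_def\<close>)
  next
    fix s t assume s: "s \<in> tarrs (disc Q)" "t \<in> tarrs (disc Q)"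
    then show "tmap ?F (ten (disc Q) s t) = ten EM (tmap ?F s) (tmap ?F t)"
      using R by (simp add: tm str ids mult disc_tarrs)
  qed (auto simp: tm str sel EM_sel(1-3) EM_structure_id one mult R m_assoc)
qed

end

section \<open>Inflation of a strict action along a monoidal functor\<close>

text \<open>The two 2-groups of autoequivalences differ in their objects only, and not in the operations that enter a
  composite of monoidal functors.\<close>

lemma comp_mfunc_exact_aut: "comp_mfunc M N (exact_aut A) G F = comp_mfunc M N (lin_aut A) G F"
  by (simp add: comp_mfunc_def tmu_def tep_def exact_aut_def lin_aut_def endo_moncat_def Let_def)

locale closed_lincat = category A for A :: "('o, 'a, 's::zero) lincat" +
  assumes add_hom: "\<lbrakk>x \<in> Ob A; y \<in> Ob A; f \<in> Hom A x y; g \<in> Hom A x y\<rbrakk> \<Longrightarrow> AAdd A x y f g \<in> Hom A x y"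
    and scl_hom: "\<lbrakk>x \<in> Ob A; y \<in> Ob A; f \<in> Hom A x y\<rbrakk> \<Longrightarrow> AScl A x y c f \<in> Hom A x y"
begin

lemma equivalence_functor: "equivalence A A F \<Longrightarrow> cat_functor A A F"
  by (simp add: equivalence_def)

lemma equivalence_id: "equivalence A A (id_func A)"
  by (rule equivalence_strict[of _ _ _ "id_func A"])
    (simp_all add: cat_functor_id category_axioms strictly_inverse_def)

lemma linear_id: "linear_func A A (id_func A)"
  by (simp add: linear_func_def add_hom scl_hom)

lemma exact_id: "exact_func A A (id_func A)"
  by (auto simp: exact_func_def short_exact_def is_kernel_def)

lemma endofunctors_linear:
  "endofunctors A {F. ext_func A F \<and> equivalence A A F \<and> linear_func A A F}"
proof (intro endofunctors.intro endofunctors_axioms.intro category_axioms; (elim CollectE conjE)?)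
  fix F :: "('o, 'a) endo" assume "equivalence A A F"
  then show "cat_functor A A F" by (rule equivalence_functor)
next
  fix F :: "('o, 'a) endo" assume "ext_func A F" then show "ext_func A F" .
next
  show "id_func A \<in> {F. ext_func A F \<and> equivalence A A F \<and> linear_func A A F}"
    by (simp add: ext_id_func equivalence_id linear_id)
next
  fix F G :: "('o, 'a) endo" assume e: "equivalence A A G" "equivalence A A F"
    and l: "linear_func A A G" "linear_func A A F"
  show "comp_func A F G \<in> {F. ext_func A F \<and> equivalence A A F \<and> linear_func A A F}"
    using equivalence_composite[OF e is_composite_comp_func]
      linear_composite[OF equivalence_functor[OF e(1)] l is_composite_comp_func add_hom scl_hom]
    by (simp add: ext_comp_func)
qed

lemma endofunctors_exact:
  "endofunctors A {F. ext_func A F \<and> equivalence A A F \<and> linear_func A A F \<and> exact_func A A F}"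
proof (intro endofunctors.intro endofunctors_axioms.intro category_axioms; (elim CollectE conjE)?)
  interpret L: endofunctors A "{F. ext_func A F \<and> equivalence A A F \<and> linear_func A A F}"
    by (rule endofunctors_linear)
  {
    fix F :: "('o, 'a) endo" assume "equivalence A A F"
    then show "cat_functor A A F" by (rule equivalence_functor)
  next
    fix F :: "('o, 'a) endo" assume "ext_func A F" then show "ext_func A F" .
  next
    show "id_func A \<in> {F. ext_func A F \<and> equivalence A A F \<and> linear_func A A F \<and> exact_func A A F}"
      by (simp add: ext_id_func equivalence_id linear_id exact_id)
  next
    fix F G :: "('o, 'a) endo" assume "ext_func A F" "equivalence A A F" "linear_func A A F" and F: "exact_func A A F"
      and "ext_func A G" "linear_func A A G" and G: "equivalence A A G" "exact_func A A G"
    then show "comp_func A F G \<in> {F. ext_func A F \<and> equivalence A A F \<and> linear_func A A F \<and> exact_func A A F}"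
      using L.comp_in[of F G] exact_composite[OF equivalence_functor[OF G(1)] G(2) F is_composite_comp_func] by simp
  }
qed

context
  fixes Q :: "('g, 'w) monoid_scheme" and R :: "'g \<Rightarrow> ('o, 'a) endo"
    and G :: "('p, 'b) moncat" and p :: "('p, 'b, 'g, unit) mfunc"
  assumes R: "exact_strict_action Q A R" and Q: "group Q"
    and G: "coherent_2group G" and p: "strong_monoidal_functor G (disc Q) p"
begin

interpretation X: endofunctors A "{F. ext_func A F \<and> equivalence A A F \<and> linear_func A A F \<and> exact_func A A F}"
  rewrites "endo_moncat A {F. ext_func A F \<and> equivalence A A F \<and> linear_func A A F \<and> exact_func A A F} = exact_aut A"
  by (rule endofunctors_exact) (rule exact_aut_def[symmetric])

lemma exact_two_rep_inflation:
  "exact_two_rep G A (comp_mfunc G (disc Q) (exact_aut A) (strict_two_rep Q A R) p)"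
proof -
  interpret L: endofunctors A "{F. ext_func A F \<and> equivalence A A F \<and> linear_func A A F}"
    by (rule endofunctors_linear)
  interpret group Q by (rule Q)
  have R': "ext_func A (R h) \<and> equivalence A A (R h) \<and> linear_func A A (R h) \<and> exact_func A A (R h)"
    if "h \<in> carrier Q" for h
    using R that by (simp add: exact_strict_action_def X.EM_sel)
  have one: "R \<one>\<^bsub>Q\<^esub> = id_func A"
    and mult: "\<And>h h'. \<lbrakk>h \<in> carrier Q; h' \<in> carrier Q\<rbrakk> \<Longrightarrow> R (h \<otimes>\<^bsub>Q\<^esub> h') = comp_func A (R h) (R h')"
    using R by (simp_all add: exact_strict_action_def)
  have "strong_monoidal_functor (disc Q) (exact_aut A) (strict_two_rep Q A R)"
    by (rule X.strong_monoidal_strict_two_rep) (use R' one mult monoid_axioms in auto)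
  moreover have "strong_monoidal_functor (disc Q) (lin_aut A) (strict_two_rep Q A R)"
    unfolding lin_aut_def
    by (rule L.strong_monoidal_strict_two_rep) (use R' one mult monoid_axioms in auto)
  ultimately show ?thesis
    unfolding exact_two_rep_def two_rep_def
    using G strong_monoidal_composite[OF p] comp_mfunc_exact_aut by metis
qed

text \<open>An object of the homotopy fibre lies over an object of \<open>Q\<^sub>d\<^sub>i\<^sub>s\<^sub>c\<close> that is isomorphic, hence equal, to the unit. The
  unit acts by the identity functor, and the comparison arrows are identities, since the action is strict.\<close>

lemma kernel_object_trivial:
  assumes x: "(x, f) \<in> Ob (hfiber G (disc Q) p)"
  shows "FO (comp_mfunc G (disc Q) (exact_aut A) (strict_two_rep Q A R) p) x = id_func A"
    and "comps (exact_aut A) [tmap (strict_two_rep Q A R) (FO p x, f, \<one>\<^bsub>Q\<^esub>),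
       tinv (exact_aut A) (tep (disc Q) (exact_aut A) (strict_two_rep Q A R))] = tid (exact_aut A) (id_func A)"
proof -
  interpret EM: monoidal_category "exact_aut A" by (rule X.monoidal_EM)
  have id: "id_func A \<in> Ob (exact_aut A)" using X.id_in by (simp add: X.EM_sel)
  have one: "R \<one>\<^bsub>Q\<^esub> = id_func A" using R by (simp add: exact_strict_action_def)
  have px: "FO p x = \<one>\<^bsub>Q\<^esub>" using x by (simp add: hfiber_def)
  show "FO (comp_mfunc G (disc Q) (exact_aut A) (strict_two_rep Q A R) p) x = id_func A"
    by (simp add: comp_mfunc_def px strict_two_rep_def Let_def one)
  have 1: "tmap (strict_two_rep Q A R) (FO p x, f, \<one>\<^bsub>Q\<^esub>) = tid (exact_aut A) (id_func A)"
    "tep (disc Q) (exact_aut A) (strict_two_rep Q A R) = tid (exact_aut A) (id_func A)"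
    by (simp_all add: px strict_two_rep_def Let_def one tid_def tep_def X.EM_sel)
  show "comps (exact_aut A) [tmap (strict_two_rep Q A R) (FO p x, f, \<one>\<^bsub>Q\<^esub>),
       tinv (exact_aut A) (tep (disc Q) (exact_aut A) (strict_two_rep Q A R))] = tid (exact_aut A) (id_func A)"
    unfolding 1 EM.tinv_tid[OF id] by (simp add: EM.tcomp_tid_tid[OF id])
qed

text \<open>The arrow \<open>a\<close> lies over the identity arrow of the unit of \<open>Q\<close>.\<close>

lemma kernel_arrow_trivial:
  assumes "((x, f), a, (y, g)) \<in> tarrs (hfiber G (disc Q) p)"
  shows "tmap (comp_mfunc G (disc Q) (exact_aut A) (strict_two_rep Q A R) p) (x, a, y) = tid (exact_aut A) (id_func A)"
proof -
  have one: "R \<one>\<^bsub>Q\<^esub> = id_func A" using R by (simp add: exact_strict_action_def)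
  have p: "FO p x = \<one>\<^bsub>Q\<^esub>" "FO p y = \<one>\<^bsub>Q\<^esub>" using assms by (simp_all add: tarrs_def hfiber_def)
  show ?thesis by (simp add: comp_mfunc_def strict_two_rep_def Let_def tid_def X.EM_sel(5) one p)
qed

end

end

section \<open>Filtered colimits of sets\<close>

locale direct_system =
  fixes I :: "'i set" and leq :: "'i \<Rightarrow> 'i \<Rightarrow> bool" and X :: "'i \<Rightarrow> 'a set" and \<tau> :: "'i \<Rightarrow> 'i \<Rightarrow> 'a \<Rightarrow> 'a"
  assumes leq_refl: "i \<in> I \<Longrightarrow> leq i i"
    and leq_trans: "\<lbrakk>i \<in> I; j \<in> I; l \<in> I; leq i j; leq j l\<rbrakk> \<Longrightarrow> leq i l"
    and directed: "\<lbrakk>i \<in> I; j \<in> I\<rbrakk> \<Longrightarrow> \<exists>l\<in>I. leq i l \<and> leq j l"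
    and \<tau>_in: "\<lbrakk>i \<in> I; j \<in> I; leq i j; a \<in> X i\<rbrakk> \<Longrightarrow> \<tau> i j a \<in> X j"
    and \<tau>_comp: "\<lbrakk>i \<in> I; j \<in> I; l \<in> I; leq i j; leq j l; a \<in> X i\<rbrakk> \<Longrightarrow> \<tau> j l (\<tau> i j a) = \<tau> i l a"
begin

abbreviation "rel \<equiv> colim_rel I leq X \<tau>"
abbreviation "cls i a \<equiv> rel `` {(i, a)}"
abbreviation "colim \<equiv> dir_colim I leq X \<tau>"

lemma rel_iff: "((i, a), (j, b)) \<in> rel \<longleftrightarrow> i \<in> I \<and> j \<in> I \<and> a \<in> X i \<and> b \<in> X j \<and>
    (\<exists>l\<in>I. leq i l \<and> leq j l \<and> \<tau> i l a = \<tau> j l b)"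
  by (simp add: colim_rel_def)

lemma equiv_rel: "equiv (SIGMA i:I. X i) rel"
proof (rule equivI)
  show "rel \<subseteq> (SIGMA i:I. X i) \<times> (SIGMA i:I. X i)" by (auto simp: colim_rel_def)
  show "refl_on (SIGMA i:I. X i) rel"
    using leq_refl by (auto simp: refl_on_def colim_rel_def)
  show "sym rel" unfolding sym_def colim_rel_def by auto
  show "trans rel"
  proof (rule transI)
    fix p q r assume "(p, q) \<in> rel" "(q, r) \<in> rel"
    then obtain i a j b k c l m where p: "p = (i, a)" "q = (j, b)" "r = (k, c)"
      and h: "i \<in> I" "j \<in> I" "k \<in> I" "a \<in> X i" "b \<in> X j" "c \<in> X k"
      and l: "l \<in> I" "leq i l" "leq j l" "\<tau> i l a = \<tau> j l b"
      and m: "m \<in> I" "leq j m" "leq k m" "\<tau> j m b = \<tau> k m c"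
      by (cases p; cases q; cases r) (auto simp: rel_iff)
    obtain n where n: "n \<in> I" "leq l n" "leq m n" using directed[OF l(1) m(1)] by blast
    have "\<tau> i n a = \<tau> l n (\<tau> i l a)" by (rule \<tau>_comp[symmetric]) (use h l n in auto)
    also have "\<dots> = \<tau> l n (\<tau> j l b)" using l by simp
    also have "\<dots> = \<tau> j n b" by (rule \<tau>_comp) (use h l n in auto)
    also have "\<dots> = \<tau> m n (\<tau> j m b)" by (rule \<tau>_comp[symmetric]) (use h m n in auto)
    also have "\<dots> = \<tau> m n (\<tau> k m c)" using m by simp
    also have "\<dots> = \<tau> k n c" by (rule \<tau>_comp) (use h m n in auto)
    finally have "\<tau> i n a = \<tau> k n c" .
    moreover have "leq i n" "leq k n" using leq_trans[of _ l n] leq_trans[of _ m n] h l m n by blast+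
    ultimately show "(p, r) \<in> rel" using p h n by (auto simp: rel_iff)
  qed
qed

lemma cls_in: "\<lbrakk>i \<in> I; a \<in> X i\<rbrakk> \<Longrightarrow> cls i a \<in> colim"
  unfolding dir_colim_def by (rule quotientI) auto

lemma mem_cls: "\<lbrakk>i \<in> I; a \<in> X i\<rbrakk> \<Longrightarrow> (i, a) \<in> cls i a"
  using equiv_class_self[OF equiv_rel] by auto

lemma colimE:
  assumes "\<gamma> \<in> colim"
  obtains i a where "i \<in> I" "a \<in> X i" "\<gamma> = cls i a"
  using assms unfolding dir_colim_def by (auto elim!: quotientE)

lemma cls_eqI: "((i, a), (j, b)) \<in> rel \<Longrightarrow> cls i a = cls j b"
  by (rule equiv_class_eq[OF equiv_rel])

lemma mem_colim:
  assumes "\<gamma> \<in> colim" "(i, a) \<in> \<gamma>"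
  shows "i \<in> I" "a \<in> X i" "\<gamma> = cls i a"
proof -
  obtain j b where j: "\<gamma> = cls j b" using assms(1) by (rule colimE)
  then have r: "((j, b), (i, a)) \<in> rel" using assms(2) by auto
  then show "i \<in> I" "a \<in> X i" by (auto simp: rel_iff)
  show "\<gamma> = cls i a" using cls_eqI[OF r] j by simp
qed

lemma colim_nonempty: "\<gamma> \<in> colim \<Longrightarrow> \<exists>i a. (i, a) \<in> \<gamma>"
  using mem_cls by (metis colimE)

lemma colim_eqI: "\<lbrakk>\<gamma> \<in> colim; \<delta> \<in> colim; (i, a) \<in> \<gamma>; (i, a) \<in> \<delta>\<rbrakk> \<Longrightarrow> \<gamma> = \<delta>"
  using mem_colim(3) by metis

lemma push: "\<lbrakk>i \<in> I; l \<in> I; leq i l; a \<in> X i\<rbrakk> \<Longrightarrow> cls i a = cls l (\<tau> i l a)"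
  by (rule cls_eqI) (auto simp: rel_iff \<tau>_in \<tau>_comp leq_refl intro!: bexI[of _ l])

lemma related:
  assumes "\<gamma> \<in> colim" "(i, a) \<in> \<gamma>" "(j, b) \<in> \<gamma>"
  shows "\<exists>l\<in>I. leq i l \<and> leq j l \<and> \<tau> i l a = \<tau> j l b"
proof -
  have "(j, b) \<in> cls i a" using mem_colim(3)[OF assms(1,2)] assms(3) by simp
  then show ?thesis by (auto simp: rel_iff)
qed

lemma Image_eq_cls:
  assumes "A \<subseteq> cls i a" "A \<noteq> {}"
  shows "rel `` A = cls i a"
proof -
  have "rel `` {p} = cls i a" if "p \<in> A" for p
    using that assms equiv_class_eq[OF equiv_rel, of "(i, a)" p] by auto
  then show ?thesis using assms(2) by blast
qed

end

section \<open>Categories of Ind-objects\<close>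

text \<open>Diagrams with values in an arbitrary set \<open>S\<close> of objects. The set is a parameter in order that the
  construction can be iterated: the objects of one layer are the diagrams in the layer below.\<close>

definition ind_diagram :: "'o set \<Rightarrow> ('o, 'a) excat \<Rightarrow> ('o, 'a) iob \<Rightarrow> bool" where
  "ind_diagram S C X \<longleftrightarrow> directed_poset (Idx X) (Le X) \<and> (\<forall>i\<in>Idx X. IO X i \<in> S) \<and>
     (\<forall>i\<in>Idx X. \<forall>j\<in>Idx X. Le X i j \<longrightarrow> IA X i j \<in> Hom C (IO X i) (IO X j)) \<and>
     (\<forall>i\<in>Idx X. IA X i i = Idn C (IO X i)) \<and>
     (\<forall>i\<in>Idx X. \<forall>j\<in>Idx X. \<forall>l\<in>Idx X. Le X i j \<and> Le X j l \<longrightarrow>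
        IA X i l = Cmp C (IO X i) (IO X j) (IO X l) (IA X j l) (IA X i j))"

text \<open>The operations of \<open>C\<close> on the set \<open>S\<close> of objects, which takes the place of \<open>Ob C\<close>.\<close>

locale category_on =
  fixes S :: "'o set" and C :: "('o, 'a) excat"
  assumes category: "category (C\<lparr>Ob := S\<rparr>)"
begin

lemma Idn_hom: "x \<in> S \<Longrightarrow> Idn C x \<in> Hom C x x"
  and Cmp_hom: "\<lbrakk>x \<in> S; y \<in> S; z \<in> S; f \<in> Hom C x y; g \<in> Hom C y z\<rbrakk> \<Longrightarrow> Cmp C x y z g f \<in> Hom C x z"
  and Idn_left: "\<lbrakk>x \<in> S; y \<in> S; f \<in> Hom C x y\<rbrakk> \<Longrightarrow> Cmp C x y y (Idn C y) f = f"
  and Idn_right: "\<lbrakk>x \<in> S; y \<in> S; f \<in> Hom C x y\<rbrakk> \<Longrightarrow> Cmp C x x y f (Idn C x) = f"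
  and Cmp_assoc: "\<lbrakk>w \<in> S; x \<in> S; y \<in> S; z \<in> S; f \<in> Hom C w x; g \<in> Hom C x y; h \<in> Hom C y z\<rbrakk>
      \<Longrightarrow> Cmp C w x z (Cmp C x y z h g) f = Cmp C w y z h (Cmp C w x y g f)"
  using category by (simp_all add: category_def)

abbreviation "diagrams \<equiv> {X. ind_diagram S C X}"

lemma diagramD:
  assumes "ind_diagram S C X"
  shows "i \<in> Idx X \<Longrightarrow> IO X i \<in> S" "i \<in> Idx X \<Longrightarrow> Le X i i"
    and "\<lbrakk>i \<in> Idx X; j \<in> Idx X; Le X i j\<rbrakk> \<Longrightarrow> IA X i j \<in> Hom C (IO X i) (IO X j)"
    and "\<lbrakk>i \<in> Idx X; j \<in> Idx X; l \<in> Idx X; Le X i j; Le X j l\<rbrakk>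
      \<Longrightarrow> Cmp C (IO X i) (IO X j) (IO X l) (IA X j l) (IA X i j) = IA X i l"
    and "\<lbrakk>i \<in> Idx X; j \<in> Idx X\<rbrakk> \<Longrightarrow> \<exists>l\<in>Idx X. Le X i l \<and> Le X j l"
  using assms unfolding ind_diagram_def directed_poset_def by metis+

lemma germ_system:
  assumes "ind_diagram S C Y" "x \<in> S"
  shows "direct_system (Idx Y) (Le Y) (\<lambda>j. Hom C x (IO Y j)) (\<lambda>j l f. Cmp C x (IO Y j) (IO Y l) (IA Y j l) f)"
proof
  show "Le Y i l" if "i \<in> Idx Y" "j \<in> Idx Y" "l \<in> Idx Y" "Le Y i j" "Le Y j l" for i j l
    using that assms(1) unfolding ind_diagram_def directed_poset_def by blast
qed (use assms diagramD[OF assms(1)] in \<open>auto simp: Cmp_hom simp flip: Cmp_assoc\<close>)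

lemma germs_eq: "germs C x Y = dir_colim (Idx Y) (Le Y) (\<lambda>j. Hom C x (IO Y j)) (\<lambda>j l f. Cmp C x (IO Y j) (IO Y l) (IA Y j l) f)"
  and germ_rel_eq: "germ_rel C x Y = colim_rel (Idx Y) (Le Y) (\<lambda>j. Hom C x (IO Y j)) (\<lambda>j l f. Cmp C x (IO Y j) (IO Y l) (IA Y j l) f)"
  by (simp_all add: germs_def germ_rel_def)

lemmas germ_lemmas = germ_system[THEN direct_system.mem_colim(1), folded germs_eq germ_rel_eq]
  germ_system[THEN direct_system.mem_colim(2), folded germs_eq germ_rel_eq]
lemmas germ_eq = germ_system[THEN direct_system.mem_colim(3), folded germs_eq germ_rel_eq]
lemmas germ_nonempty = germ_system[THEN direct_system.colim_nonempty, folded germs_eq]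
lemmas germ_related = germ_system[THEN direct_system.related, folded germs_eq]
lemmas germ_in = germ_system[THEN direct_system.cls_in, folded germs_eq germ_rel_eq]
lemmas germ_mem = germ_system[THEN direct_system.mem_cls, folded germ_rel_eq]
lemmas germ_eqI = germ_system[THEN direct_system.colim_eqI, folded germs_eq]
lemmas germ_cls_eqI = germ_system[THEN direct_system.cls_eqI, folded germ_rel_eq]
lemmas germ_rel_iff = germ_system[THEN direct_system.rel_iff, folded germ_rel_eq]
lemmas germ_Image = germ_system[THEN direct_system.Image_eq_cls, folded germ_rel_eq]

lemma ind_homD:
  assumes "\<phi> \<in> ind_hom C X Y"
  shows "i \<in> Idx X \<Longrightarrow> \<phi> i \<in> germs C (IO X i) Y" "\<phi> \<in> extensional (Idx X)"
    and "\<lbrakk>i \<in> Idx X; i' \<in> Idx X; Le X i i'; (j, f) \<in> \<phi> i'\<rbrakk> \<Longrightarrow> (j, Cmp C (IO X i) (IO X i') (IO Y j) f (IA X i i')) \<in> \<phi> i"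
  using assms unfolding ind_hom_def by (auto simp: PiE_def) fastforce?

lemma germ_precomp:
  assumes Y: "ind_diagram S C Y" and x: "x \<in> S" "x' \<in> S" "p \<in> Hom C x x'"
    and r: "(j, f) \<in> germ_rel C x' Y `` {(l, g)}"
  shows "(j, Cmp C x x' (IO Y j) f p) \<in> germ_rel C x Y `` {(l, Cmp C x x' (IO Y l) g p)}"
proof -
  obtain k where k: "k \<in> Idx Y" "Le Y j k" "Le Y l k"
    and e: "Cmp C x' (IO Y j) (IO Y k) (IA Y j k) f = Cmp C x' (IO Y l) (IO Y k) (IA Y l k) g"
    and h: "j \<in> Idx Y" "l \<in> Idx Y" "f \<in> Hom C x' (IO Y j)" "g \<in> Hom C x' (IO Y l)"
    using r by (auto simp: germ_rel_iff[OF Y x(2)])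
  have "Cmp C x (IO Y j) (IO Y k) (IA Y j k) (Cmp C x x' (IO Y j) f p) =
      Cmp C x (IO Y l) (IO Y k) (IA Y l k) (Cmp C x x' (IO Y l) g p)"
    using e h k x diagramD[OF Y] by (simp flip: Cmp_assoc)
  then show ?thesis
    using h k x diagramD(1)[OF Y] by (auto simp: germ_rel_iff[OF Y x(1)] Cmp_hom intro!: bexI[of _ k])
qed

text \<open>Moving \<open>f\<close> along a transition map of \<open>Y\<close> does not change the germ of \<open>\<psi> \<circ> f\<close>, because the components of \<open>\<psi>\<close> are
  compatible with the transition maps.\<close>

lemma germ_of_composite:
  assumes X: "ind_diagram S C X" and Y: "ind_diagram S C Y" and Z: "ind_diagram S C Z"
    and \<psi>: "\<psi> \<in> ind_hom C Y Z" and x: "x \<in> S"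
    and f: "j \<in> Idx Y" "f \<in> Hom C x (IO Y j)" and g: "(l, g) \<in> \<psi> j"
    and k: "k \<in> Idx Y" "Le Y j k" and h: "(m, h) \<in> \<psi> k"
  shows "germ_rel C x Z `` {(l, Cmp C x (IO Y j) (IO Z l) g f)} =
    germ_rel C x Z `` {(m, Cmp C x (IO Y k) (IO Z m) h (Cmp C x (IO Y j) (IO Y k) (IA Y j k) f))}"
proof (rule germ_cls_eqI[OF Z x])
  note y = diagramD(1)[OF Y] and z = diagramD(1)[OF Z]
  have "(m, Cmp C (IO Y j) (IO Y k) (IO Z m) h (IA Y j k)) \<in> \<psi> j"
    by (rule ind_homD(3)[OF \<psi> f(1) k h])
  then have r: "(m, Cmp C (IO Y j) (IO Y k) (IO Z m) h (IA Y j k)) \<in> germ_rel C (IO Y j) Z `` {(l, g)}"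
    using germ_eq[OF Z y[OF f(1)] ind_homD(1)[OF \<psi> f(1)] g] by simp
  have hm: "m \<in> Idx Z" "h \<in> Hom C (IO Y k) (IO Z m)" "l \<in> Idx Z" "g \<in> Hom C (IO Y j) (IO Z l)"
    using germ_lemmas[OF Z y ind_homD(1)[OF \<psi>]] k h f g by blast+
  show "((l, Cmp C x (IO Y j) (IO Z l) g f), m, Cmp C x (IO Y k) (IO Z m) h (Cmp C x (IO Y j) (IO Y k) (IA Y j k) f))
       \<in> germ_rel C x Z"
    using germ_precomp[OF Z x y[OF f(1)] f(2) r] hm k f x y z diagramD(3)[OF Y f(1) k] by (simp add: Cmp_assoc)
qed

text \<open>The definition collects the composites of all representatives of \<open>\<phi>\<close> and \<open>\<psi>\<close>. They have the same germ, as
  two representatives of \<open>\<phi>\<close> agree further along \<open>Y\<close>; so one choice suffices.\<close>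

lemma ind_cmp_at:
  assumes X: "ind_diagram S C X" and Y: "ind_diagram S C Y" and Z: "ind_diagram S C Z"
    and \<phi>: "\<phi> \<in> ind_hom C X Y" and \<psi>: "\<psi> \<in> ind_hom C Y Z"
    and i: "i \<in> Idx X" and f: "(j, f) \<in> \<phi> i" and g: "(l, g) \<in> \<psi> j"
  shows "ind_cmp C X Y Z \<psi> \<phi> i = germ_rel C (IO X i) Z `` {(l, Cmp C (IO X i) (IO Y j) (IO Z l) g f)}"
proof -
  let ?x = "IO X i"
  note y = diagramD(1)[OF Y] and z = diagramD(1)[OF Z]
  have x: "?x \<in> S" using diagramD(1)[OF X i] .
  note gi = ind_homD(1)[OF \<phi> i]
  have fj: "j' \<in> Idx Y" "f' \<in> Hom C ?x (IO Y j')" if "(j', f') \<in> \<phi> i" for j' f'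
    using germ_lemmas[OF Y x gi that] .
  have gl: "l' \<in> Idx Z" "g' \<in> Hom C (IO Y j') (IO Z l')" if "j' \<in> Idx Y" "(l', g') \<in> \<psi> j'" for j' l' g'
    using germ_lemmas[OF Z y[OF that(1)] ind_homD(1)[OF \<psi> that(1)] that(2)] .
  have mem: "(l', Cmp C ?x (IO Y j') (IO Z l') g' f') \<in> germ_rel C ?x Z `` {(l, Cmp C ?x (IO Y j) (IO Z l) g f)}"
    if f': "(j', f') \<in> \<phi> i" and g': "(l', g') \<in> \<psi> j'" for j' f' l' g'
  proof -
    obtain k where k: "k \<in> Idx Y" "Le Y j k" "Le Y j' k"
      and e: "Cmp C ?x (IO Y j) (IO Y k) (IA Y j k) f = Cmp C ?x (IO Y j') (IO Y k) (IA Y j' k) f'"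
      using germ_related[OF Y x gi f f'] by blast
    obtain m h where h: "(m, h) \<in> \<psi> k"
      using germ_nonempty[OF Z y[OF k(1)] ind_homD(1)[OF \<psi> k(1)]] by blast
    have "germ_rel C ?x Z `` {(l, Cmp C ?x (IO Y j) (IO Z l) g f)} =
        germ_rel C ?x Z `` {(l', Cmp C ?x (IO Y j') (IO Z l') g' f')}"
      using germ_of_composite[OF X Y Z \<psi> x fj[OF f] g k(1,2) h]
        germ_of_composite[OF X Y Z \<psi> x fj[OF f'] g' k(1,3) h] e by simp
    then show ?thesis
      using germ_mem[OF Z x gl(1)[OF fj(1)[OF f'] g']] Cmp_hom x y z fj[OF f'] gl[OF fj(1)[OF f'] g'] by simp
  qed
  show ?thesis
    unfolding ind_cmp_def restrict_apply'[OF i]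
  proof (rule germ_Image[OF Z x])
    show "{(l, Cmp C ?x (IO Y j) (IO Z l) g f) |j f l g. (j, f) \<in> \<phi> i \<and> (l, g) \<in> \<psi> j}
      \<subseteq> germ_rel C ?x Z `` {(l, Cmp C ?x (IO Y j) (IO Z l) g f)}"
      using mem by blast
  qed (use f g in blast)
qed

text \<open>Germs are equivalence classes, so that a single common representative at each index identifies two
  morphisms.\<close>

lemma ind_hom_eqI:
  assumes X: "ind_diagram S C X" and Y: "ind_diagram S C Y"
    and \<phi>: "\<phi> \<in> ind_hom C X Y" and \<psi>: "\<psi> \<in> ind_hom C X Y"
    and e: "\<And>i. i \<in> Idx X \<Longrightarrow> \<exists>p. p \<in> \<phi> i \<and> p \<in> \<psi> i"
  shows "\<phi> = \<psi>"
proof (rule extensionalityI[OF ind_homD(2)[OF \<phi>] ind_homD(2)[OF \<psi>]])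
  fix i assume i: "i \<in> Idx X"
  obtain j f where "(j, f) \<in> \<phi> i" "(j, f) \<in> \<psi> i" using e[OF i] by auto
  then show "\<phi> i = \<psi> i"
    by (rule germ_eqI[OF Y diagramD(1)[OF X i] ind_homD(1)[OF \<phi> i] ind_homD(1)[OF \<psi> i]])
qed

lemma ind_cmp_hom:
  assumes X: "ind_diagram S C X" and Y: "ind_diagram S C Y" and Z: "ind_diagram S C Z"
    and \<phi>: "\<phi> \<in> ind_hom C X Y" and \<psi>: "\<psi> \<in> ind_hom C Y Z"
  shows "ind_cmp C X Y Z \<psi> \<phi> \<in> ind_hom C X Z"
    and "i \<in> Idx X \<Longrightarrow> \<exists>j f l g. (j, f) \<in> \<phi> i \<and> (l, g) \<in> \<psi> j \<and> j \<in> Idx Y \<and> f \<in> Hom C (IO X i) (IO Y j) \<and>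
      l \<in> Idx Z \<and> g \<in> Hom C (IO Y j) (IO Z l) \<and>
      (l, Cmp C (IO X i) (IO Y j) (IO Z l) g f) \<in> ind_cmp C X Y Z \<psi> \<phi> i"
proof -
  note x = diagramD(1)[OF X] and y = diagramD(1)[OF Y] and z = diagramD(1)[OF Z]
  have reps: "\<exists>j f l g. (j, f) \<in> \<phi> i \<and> (l, g) \<in> \<psi> j \<and> j \<in> Idx Y \<and> f \<in> Hom C (IO X i) (IO Y j) \<and>
      l \<in> Idx Z \<and> g \<in> Hom C (IO Y j) (IO Z l)" if i: "i \<in> Idx X" for i
  proof -
    obtain j f where f: "(j, f) \<in> \<phi> i" using germ_nonempty[OF Y x[OF i] ind_homD(1)[OF \<phi> i]] by blast
    note fj = germ_lemmas[OF Y x[OF i] ind_homD(1)[OF \<phi> i] f]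
    obtain l g where g: "(l, g) \<in> \<psi> j" using germ_nonempty[OF Z y[OF fj(1)] ind_homD(1)[OF \<psi> fj(1)]] by blast
    show ?thesis using f g fj germ_lemmas[OF Z y[OF fj(1)] ind_homD(1)[OF \<psi> fj(1)] g] by blast
  qed
  show "\<exists>j f l g. (j, f) \<in> \<phi> i \<and> (l, g) \<in> \<psi> j \<and> j \<in> Idx Y \<and> f \<in> Hom C (IO X i) (IO Y j) \<and>
      l \<in> Idx Z \<and> g \<in> Hom C (IO Y j) (IO Z l) \<and>
      (l, Cmp C (IO X i) (IO Y j) (IO Z l) g f) \<in> ind_cmp C X Y Z \<psi> \<phi> i" if i: "i \<in> Idx X"
  proof -
    obtain j f l g where f: "(j, f) \<in> \<phi> i" and g: "(l, g) \<in> \<psi> j" and h: "j \<in> Idx Y" "f \<in> Hom C (IO X i) (IO Y j)"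
      "l \<in> Idx Z" "g \<in> Hom C (IO Y j) (IO Z l)" using reps[OF i] by blast
    then have "(l, Cmp C (IO X i) (IO Y j) (IO Z l) g f) \<in> ind_cmp C X Y Z \<psi> \<phi> i"
      unfolding ind_cmp_at[OF X Y Z \<phi> \<psi> i f g] using i x y z by (intro germ_mem[OF Z]) (auto intro: Cmp_hom)
    then show ?thesis using f g h by blast
  qed
  show "ind_cmp C X Y Z \<psi> \<phi> \<in> ind_hom C X Z"
    unfolding ind_hom_def
  proof (intro CollectI conjI ballI impI)
    show "ind_cmp C X Y Z \<psi> \<phi> \<in> (\<Pi>\<^sub>E i\<in>Idx X. germs C (IO X i) Z)"
    proof (rule PiE_I)
      fix i assume i: "i \<in> Idx X"
      obtain j f l g where f: "(j, f) \<in> \<phi> i" and g: "(l, g) \<in> \<psi> j" and h: "j \<in> Idx Y" "f \<in> Hom C (IO X i) (IO Y j)"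
        "l \<in> Idx Z" "g \<in> Hom C (IO Y j) (IO Z l)" using reps[OF i] by blast
      then show "ind_cmp C X Y Z \<psi> \<phi> i \<in> germs C (IO X i) Z"
        unfolding ind_cmp_at[OF X Y Z \<phi> \<psi> i f g] using i x y z by (intro germ_in[OF Z]) (auto intro: Cmp_hom)
    qed (simp add: ind_cmp_def)
    fix i i' assume i: "i \<in> Idx X" "i' \<in> Idx X" and le: "Le X i i'"
    fix p assume p: "p \<in> ind_cmp C X Y Z \<psi> \<phi> i'"
    obtain k e where pe: "p = (k, e)" by (cases p)
    obtain j f l g where f: "(j, f) \<in> \<phi> i'" and g: "(l, g) \<in> \<psi> j" and h: "j \<in> Idx Y" "f \<in> Hom C (IO X i') (IO Y j)"
        "l \<in> Idx Z" "g \<in> Hom C (IO Y j) (IO Z l)" using reps[OF i(2)] by blast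
    have ia: "IA X i i' \<in> Hom C (IO X i) (IO X i')" using diagramD(3)[OF X i le] .
    have "(k, e) \<in> germ_rel C (IO X i') Z `` {(l, Cmp C (IO X i') (IO Y j) (IO Z l) g f)}"
      using p unfolding pe ind_cmp_at[OF X Y Z \<phi> \<psi> i(2) f g] .
    from germ_precomp[OF Z x[OF i(1)] x[OF i(2)] ia this]
    have "(k, Cmp C (IO X i) (IO X i') (IO Z k) e (IA X i i')) \<in> ind_cmp C X Y Z \<psi> \<phi> i"
      unfolding ind_cmp_at[OF X Y Z \<phi> \<psi> i(1) ind_homD(3)[OF \<phi> i le f] g]
      using h i ia x y z by (simp add: Cmp_assoc)
    then show "case p of (j, f) \<Rightarrow> (j, Cmp C (IO X i) (IO X i') (IO Z j) f (IA X i i')) \<in> ind_cmp C X Y Z \<psi> \<phi> i"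
      unfolding pe by simp
  qed
qed

lemma ind_id_at:
  assumes X: "ind_diagram S C X" and i: "i \<in> Idx X"
  shows "(i, Idn C (IO X i)) \<in> ind_id C X i"
  using germ_mem[OF X diagramD(1)[OF X i] i] Idn_hom diagramD(1)[OF X i] i by (simp add: ind_id_def)

lemma ind_id_hom:
  assumes X: "ind_diagram S C X" shows "ind_id C X \<in> ind_hom C X X"
  unfolding ind_hom_def
proof (intro CollectI conjI ballI impI)
  note x = diagramD(1)[OF X]
  show "ind_id C X \<in> (\<Pi>\<^sub>E i\<in>Idx X. germs C (IO X i) X)"
    using x by (auto simp: ind_id_def intro!: germ_in[OF X] Idn_hom)
  fix i i' p assume i: "i \<in> Idx X" "i' \<in> Idx X" and le: "Le X i i'" and p: "p \<in> ind_id C X i'"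
  obtain k e where pe: "p = (k, e)" by (cases p)
  have ia: "IA X i i' \<in> Hom C (IO X i) (IO X i')" using diagramD(3)[OF X i le] .
  have "(k, e) \<in> germ_rel C (IO X i') X `` {(i', Idn C (IO X i'))}"
    using p i unfolding pe ind_id_def by simp
  from germ_precomp[OF X x[OF i(1)] x[OF i(2)] ia this]
  have k: "(k, Cmp C (IO X i) (IO X i') (IO X k) e (IA X i i')) \<in> germ_rel C (IO X i) X `` {(i', IA X i i')}"
    using i x ia by (simp add: Idn_left)
  have "germ_rel C (IO X i) X `` {(i, Idn C (IO X i))} = germ_rel C (IO X i) X `` {(i', IA X i i')}"
    using i le ia x diagramD(2,3)[OF X]
    by (intro germ_cls_eqI[OF X]) (auto simp: germ_rel_iff[OF X] Idn_hom Idn_left Idn_right diagramD(4)[OF X]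
      intro!: bexI[of _ i'])
  then show "case p of (j, f) \<Rightarrow> (j, Cmp C (IO X i) (IO X i') (IO X j) f (IA X i i')) \<in> ind_id C X i"
    using k i unfolding pe ind_id_def by simp
qed

text \<open>On representatives, the laws are those of \<open>C\<close>.\<close>

lemma category_on_ind_cat: "category_on diagrams (ind_cat C)"
proof (unfold category_on_def, unfold_locales; simp add: ind_cat_def)
  fix X assume "ind_diagram S C X"
  then show "ind_id C X \<in> ind_hom C X X" by (rule ind_id_hom)
next
  fix X Y Z \<phi> \<psi> assume "ind_diagram S C X" "ind_diagram S C Y" "ind_diagram S C Z" "\<phi> \<in> ind_hom C X Y" "\<psi> \<in> ind_hom C Y Z"
  then show "ind_cmp C X Y Z \<psi> \<phi> \<in> ind_hom C X Z" by (rule ind_cmp_hom(1))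
next
  fix X Y \<phi> assume X: "ind_diagram S C X" and Y: "ind_diagram S C Y" and \<phi>: "\<phi> \<in> ind_hom C X Y"
  note x = diagramD(1)[OF X] and y = diagramD(1)[OF Y]
  show "ind_cmp C X Y Y (ind_id C Y) \<phi> = \<phi>"
  proof (rule ind_hom_eqI[OF X Y ind_cmp_hom(1)[OF X Y Y \<phi> ind_id_hom[OF Y]] \<phi>])
    fix i assume i: "i \<in> Idx X"
    obtain j f where f: "(j, f) \<in> \<phi> i" using germ_nonempty[OF Y x[OF i] ind_homD(1)[OF \<phi> i]] by blast
    note fj = germ_lemmas[OF Y x[OF i] ind_homD(1)[OF \<phi> i] f]
    have "ind_cmp C X Y Y (ind_id C Y) \<phi> i = germ_rel C (IO X i) Y `` {(j, f)}"
      using ind_cmp_at[OF X Y Y \<phi> ind_id_hom[OF Y] i f ind_id_at[OF Y fj(1)]] fj x y i by (simp add: Idn_left)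
    then show "\<exists>p. p \<in> ind_cmp C X Y Y (ind_id C Y) \<phi> i \<and> p \<in> \<phi> i"
      using f germ_mem[OF Y x[OF i] fj] by auto
  qed
  show "ind_cmp C X X Y \<phi> (ind_id C X) = \<phi>"
  proof (rule ind_hom_eqI[OF X Y ind_cmp_hom(1)[OF X X Y ind_id_hom[OF X] \<phi>] \<phi>])
    fix i assume i: "i \<in> Idx X"
    obtain j f where f: "(j, f) \<in> \<phi> i" using germ_nonempty[OF Y x[OF i] ind_homD(1)[OF \<phi> i]] by blast
    note fj = germ_lemmas[OF Y x[OF i] ind_homD(1)[OF \<phi> i] f]
    have "ind_cmp C X X Y \<phi> (ind_id C X) i = germ_rel C (IO X i) Y `` {(j, f)}"
      using ind_cmp_at[OF X X Y ind_id_hom[OF X] \<phi> i ind_id_at[OF X i] f] fj x y i by (simp add: Idn_right)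
    then show "\<exists>p. p \<in> ind_cmp C X X Y \<phi> (ind_id C X) i \<and> p \<in> \<phi> i"
      using f germ_mem[OF Y x[OF i] fj] by auto
  qed
next
  fix W X Y Z \<phi> \<psi> \<theta>
  assume W: "ind_diagram S C W" and X: "ind_diagram S C X" and Y: "ind_diagram S C Y" and Z: "ind_diagram S C Z"
    and \<phi>: "\<phi> \<in> ind_hom C W X" and \<psi>: "\<psi> \<in> ind_hom C X Y" and \<theta>: "\<theta> \<in> ind_hom C Y Z"
  note w = diagramD(1)[OF W] and x = diagramD(1)[OF X] and y = diagramD(1)[OF Y] and z = diagramD(1)[OF Z]
  note \<theta>\<psi> = ind_cmp_hom[OF X Y Z \<psi> \<theta>] and \<psi>\<phi> = ind_cmp_hom[OF W X Y \<phi> \<psi>]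
  show "ind_cmp C W X Z (ind_cmp C X Y Z \<theta> \<psi>) \<phi> = ind_cmp C W Y Z \<theta> (ind_cmp C W X Y \<psi> \<phi>)"
  proof (rule ind_hom_eqI[OF W Z ind_cmp_hom(1)[OF W X Z \<phi> \<theta>\<psi>(1)] ind_cmp_hom(1)[OF W Y Z \<psi>\<phi>(1) \<theta>]])
    fix i assume i: "i \<in> Idx W"
    obtain j f l g where f: "(j, f) \<in> \<phi> i" and g: "(l, g) \<in> \<psi> j"
      and h: "j \<in> Idx X" "f \<in> Hom C (IO W i) (IO X j)" "l \<in> Idx Y" "g \<in> Hom C (IO X j) (IO Y l)"
      and gf: "(l, Cmp C (IO W i) (IO X j) (IO Y l) g f) \<in> ind_cmp C W X Y \<psi> \<phi> i"
      using \<psi>\<phi>(2)[OF i] by blast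
    obtain m e where e: "(m, e) \<in> \<theta> l" using germ_nonempty[OF Z y[OF h(3)] ind_homD(1)[OF \<theta> h(3)]] by blast
    note em = germ_lemmas[OF Z y[OF h(3)] ind_homD(1)[OF \<theta> h(3)] e]
    have eg: "(m, Cmp C (IO X j) (IO Y l) (IO Z m) e g) \<in> ind_cmp C X Y Z \<theta> \<psi> j"
      unfolding ind_cmp_at[OF X Y Z \<psi> \<theta> h(1) g e] using h em x y z
      by (intro germ_mem[OF Z]) (auto intro: Cmp_hom)
    have "Cmp C (IO W i) (IO X j) (IO Z m) (Cmp C (IO X j) (IO Y l) (IO Z m) e g) f =
        Cmp C (IO W i) (IO Y l) (IO Z m) e (Cmp C (IO W i) (IO X j) (IO Y l) g f)"
      using h em w x y z i by (intro Cmp_assoc) auto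
    then show "\<exists>p. p \<in> ind_cmp C W X Z (ind_cmp C X Y Z \<theta> \<psi>) \<phi> i \<and> p \<in> ind_cmp C W Y Z \<theta> (ind_cmp C W X Y \<psi> \<phi>) i"
      unfolding ind_cmp_at[OF W X Z \<phi> \<theta>\<psi>(1) i f eg] ind_cmp_at[OF W Y Z \<psi>\<phi>(1) \<theta> i gf e]
      using h em w x y z i germ_mem[OF Z w[OF i] em(1)] by (metis Cmp_hom)
  qed
qed

end

lemma category_on_op_ex:
  assumes "category_on S C" shows "category_on S (op_ex C)"
proof -
  interpret category_on S C by fact
  show ?thesis
    by (unfold category_on_def, unfold_locales)
      (simp_all add: op_ex_def Idn_hom Cmp_hom Idn_left Idn_right Cmp_assoc)
qed

lemma category_on_cong:
  assumes "category_on S C" "Hom C' = Hom C" "Idn C' = Idn C" "Cmp C' = Cmp C"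
  shows "category_on S C'"
  using assms unfolding category_on_def category_def by simp

lemma category_on_kar:
  assumes "category_on S C" shows "category_on ((\<lambda>x. (x, Idn C x)) ` S) (kar C)"
proof -
  interpret category_on S C by fact
  show ?thesis
    by (unfold category_on_def, unfold_locales)
      (auto simp: kar_def kar_plain_def Idn_hom Cmp_hom Idn_left Idn_right Cmp_assoc)
qed

section \<open>Families of induced arrows\<close>

text \<open>Operators from a monoid \<open>L\<close> act partially between the objects of a family \<open>X\<close>: the set
  \<open>R \<phi> p q\<close> is empty or consists of the one arrow \<open>X p \<rightarrow> X q\<close> that \<open>\<phi>\<close> induces. Such a family
  passes to Ind-objects, Pro-objects and idempotent completions, so that functoriality need be
  checked for finite-dimensional spaces only.\<close>

locale induced_family = category_on S C for S :: "'o set" and C :: "('o, 'a) excat" +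
  fixes X :: "'p \<Rightarrow> 'o" and L :: "'m set" and mul :: "'m \<Rightarrow> 'm \<Rightarrow> 'm" and e :: 'm
    and R :: "'m \<Rightarrow> 'p \<Rightarrow> 'p \<Rightarrow> 'a set"
  assumes X_in: "X p \<in> S" and e_in: "e \<in> L" and mul_in: "\<lbrakk>\<phi> \<in> L; \<psi> \<in> L\<rbrakk> \<Longrightarrow> mul \<psi> \<phi> \<in> L"
    and mul_e: "\<phi> \<in> L \<Longrightarrow> mul \<phi> e = \<phi>" "\<phi> \<in> L \<Longrightarrow> mul e \<phi> = \<phi>"
    and R_hom: "\<lbrakk>\<phi> \<in> L; f \<in> R \<phi> p q\<rbrakk> \<Longrightarrow> f \<in> Hom C (X p) (X q)"
    and R_unique: "\<lbrakk>\<phi> \<in> L; f \<in> R \<phi> p q; g \<in> R \<phi> p q\<rbrakk> \<Longrightarrow> f = g"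
    and R_cmp: "\<lbrakk>\<phi> \<in> L; \<psi> \<in> L; f \<in> R \<phi> p q; g \<in> R \<psi> q r\<rbrakk> \<Longrightarrow> Cmp C (X p) (X q) (X r) g f \<in> R (mul \<psi> \<phi>) p r"
    and R_id: "Idn C (X p) \<in> R e p p"

lemma induced_family_op:
  assumes "induced_family S C X L mul e R"
  shows "induced_family S (op_ex C) X L (\<lambda>\<phi> \<psi>. mul \<psi> \<phi>) e (\<lambda>\<phi> p q. R \<phi> q p)"
proof -
  interpret induced_family S C X L mul e R by fact
  interpret op: category_on S "op_ex C" by (rule category_on_op_ex) (rule category_on_axioms)
  show ?thesis
    by unfold_locales (auto simp: op_ex_def X_in e_in mul_in mul_e R_hom R_cmp R_id intro: R_unique)
qed

lemma induced_family_cong: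
  assumes "induced_family S C X L mul e R" "Hom C' = Hom C" "Idn C' = Idn C" "Cmp C' = Cmp C"
  shows "induced_family S C' X L mul e R"
proof -
  interpret induced_family S C X L mul e R by fact
  interpret C': category_on S C' by (rule category_on_cong[OF category_on_axioms assms(2-4)])
  show ?thesis
    by unfold_locales (auto simp: assms(2-4) X_in e_in mul_in mul_e R_hom R_cmp R_id intro: R_unique)
qed

lemma induced_family_kar:
  assumes "induced_family S C X L mul e R"
  shows "induced_family ((\<lambda>x. (x, Idn C x)) ` S) (kar C) (\<lambda>p. (X p, Idn C (X p))) L mul e R"
proof -
  interpret induced_family S C X L mul e R by fact
  interpret k: category_on "(\<lambda>x. (x, Idn C x)) ` S" "kar C" by (rule category_on_kar) (rule category_on_axioms)
  show ?thesis
  proof unfold_locales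
    fix \<phi> f p q assume "\<phi> \<in> L" "f \<in> R \<phi> p q"
    then show "f \<in> Hom (kar C) (X p, Idn C (X p)) (X q, Idn C (X q))"
      using R_hom[of \<phi> f p q] X_in by (simp add: kar_def kar_plain_def Idn_left Idn_right)
  qed (auto simp: kar_def kar_plain_def X_in e_in mul_in mul_e R_cmp R_id intro: R_unique)
qed

text \<open>The diagrams \<open>Y q\<close> formed from members of the family, with the arrows induced by the neutral operator as
  transition maps.\<close>

locale induced_ind_family = induced_family S C X L mul e R
  for S :: "'o set" and C :: "('o, 'a) excat" and X :: "'p \<Rightarrow> 'o" and L :: "'m set" and mul e
    and R :: "'m \<Rightarrow> 'p \<Rightarrow> 'p \<Rightarrow> 'a set" +
  fixes c :: "'q \<Rightarrow> nat \<Rightarrow> 'p" and Y :: "'q \<Rightarrow> ('o, 'a) iob"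
  assumes step: "i \<le> j \<Longrightarrow> R e (c q i) (c q j) \<noteq> {}"
    and Y_eq: "Y q = \<lparr>Idx = UNIV, Le = (\<le>), IO = (\<lambda>i. X (c q i)), IA = (\<lambda>i j. the_elem (R e (c q i) (c q j)))\<rparr>"
begin

definition lift :: "'m \<Rightarrow> 'q \<Rightarrow> 'q \<Rightarrow> 'a iar set" where
  "lift \<phi> p q = ind_lift C (Y p) (Y q) (\<lambda>i j. R \<phi> (c p i) (c q j))"

lemma Y_sel: "Idx (Y q) = UNIV" "Le (Y q) = (\<le>)" "IO (Y q) i = X (c q i)"
  by (simp_all add: Y_eq)

lemma transition: "i \<le> j \<Longrightarrow> IA (Y q) i j \<in> R e (c q i) (c q j)"
proof -
  assume le: "i \<le> j"
  obtain f where f: "f \<in> R e (c q i) (c q j)" using step[OF le] by blast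
  then have "R e (c q i) (c q j) = {f}" using R_unique[OF e_in] by blast
  then show ?thesis by (simp add: Y_eq)
qed

lemma diagram: "ind_diagram S C (Y q)"
  unfolding ind_diagram_def
proof (intro conjI ballI impI)
  show "directed_poset (Idx (Y q)) (Le (Y q))"
    unfolding directed_poset_def Y_sel by (auto intro: le_trans) (meson le_cases)
  fix i show "IO (Y q) i \<in> S" by (simp add: Y_sel X_in)
  show "IA (Y q) i i = Idn C (IO (Y q) i)"
    using R_unique[OF e_in transition[OF order_refl] R_id] by (simp add: Y_sel)
  fix j show "Le (Y q) i j \<Longrightarrow> IA (Y q) i j \<in> Hom C (IO (Y q) i) (IO (Y q) j)"
    using R_hom[OF e_in transition[of i j q]] by (simp add: Y_sel)
  fix l assume "Le (Y q) i j \<and> Le (Y q) j l"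
  then have "i \<le> j" "j \<le> l" by (simp_all add: Y_sel)
  then show "IA (Y q) i l = Cmp C (IO (Y q) i) (IO (Y q) j) (IO (Y q) l) (IA (Y q) j l) (IA (Y q) i j)"
    using R_unique[OF e_in transition[of i l q] R_cmp[OF e_in e_in transition[of i j q] transition[of j l q], unfolded mul_e(1)[OF e_in]]]
    by (simp add: Y_sel)
qed

lemma postcomp: "\<lbrakk>\<phi> \<in> L; f \<in> R \<phi> p (c q j); j \<le> l\<rbrakk> \<Longrightarrow> Cmp C (X p) (X (c q j)) (X (c q l)) (IA (Y q) j l) f \<in> R \<phi> p (c q l)"
  using R_cmp[OF _ e_in _ transition[of j l q], of \<phi> f p] by (simp add: mul_e)

lemma precomp: "\<lbrakk>\<phi> \<in> L; f \<in> R \<phi> (c p j) q; i \<le> j\<rbrakk> \<Longrightarrow> Cmp C (X (c p i)) (X (c p j)) (X q) f (IA (Y p) i j) \<in> R \<phi> (c p i) q"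
  using R_cmp[OF e_in _ transition[of i j p], of \<phi> f q] by (simp add: mul_e)

definition fam :: "'m \<Rightarrow> 'q \<Rightarrow> 'q \<Rightarrow> 'a iar" where
  "fam \<phi> p q = (\<lambda>i\<in>Idx (Y p). germ_rel C (IO (Y p) i) (Y q) `` {(j, f). j \<in> Idx (Y q) \<and> f \<in> R \<phi> (c p i) (c q j)})"

lemma lift_eq: "lift \<phi> p q = (if fam \<phi> p q \<in> ind_hom C (Y p) (Y q) then {fam \<phi> p q} else {})"
  unfolding lift_def ind_lift_def fam_def by auto

text \<open>Any two representatives of the induced germ agree after a transition map, by uniqueness.\<close>

lemma fam_at:
  assumes \<phi>: "\<phi> \<in> L" and f: "f \<in> R \<phi> (c p i) (c q j)"
  shows "fam \<phi> p q i = germ_rel C (IO (Y p) i) (Y q) `` {(j, f)}"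
proof -
  have "germ_rel C (IO (Y p) i) (Y q) `` {(j, f). j \<in> Idx (Y q) \<and> f \<in> R \<phi> (c p i) (c q j)} =
     germ_rel C (IO (Y p) i) (Y q) `` {(j, f)}"
  proof (rule germ_Image[OF diagram])
    show "IO (Y p) i \<in> S" by (simp add: Y_sel X_in)
    show "{(j, f). j \<in> Idx (Y q) \<and> f \<in> R \<phi> (c p i) (c q j)} \<subseteq> germ_rel C (IO (Y p) i) (Y q) `` {(j, f)}"
    proof
      fix r assume "r \<in> {(j, f). j \<in> Idx (Y q) \<and> f \<in> R \<phi> (c p i) (c q j)}"
      then obtain l g where r: "r = (l, g)" and g: "g \<in> R \<phi> (c p i) (c q l)" by auto
      let ?m = "max j l"
      have "Cmp C (X (c p i)) (X (c q j)) (X (c q ?m)) (IA (Y q) j ?m) f =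
          Cmp C (X (c p i)) (X (c q l)) (X (c q ?m)) (IA (Y q) l ?m) g"
        using R_unique[OF \<phi> postcomp[OF \<phi> f] postcomp[OF \<phi> g]] by simp
      then show "r \<in> germ_rel C (IO (Y p) i) (Y q) `` {(j, f)}"
        unfolding r using R_hom[OF \<phi> f] R_hom[OF \<phi> g]
        by (auto simp: germ_rel_iff[OF diagram] Y_sel X_in intro!: exI[of _ ?m])
    qed
  qed (use f in \<open>auto simp: Y_sel\<close>)
  then show ?thesis by (simp add: fam_def Y_sel)
qed

lemma fam_mem:
  assumes "\<phi> \<in> L" "f \<in> R \<phi> (c p i) (c q j)" shows "(j, f) \<in> fam \<phi> p q i"
  unfolding fam_at[OF assms] using R_hom[OF assms] by (intro germ_mem[OF diagram]) (simp_all add: Y_sel X_in)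

text \<open>Only existence is at stake: compatibility of the induced arrows with the transition maps follows from
  uniqueness. So \<open>\<phi>\<close> induces a morphism if it maps each stage of the source into some stage of the target.\<close>

lemma fam_hom_iff:
  assumes \<phi>: "\<phi> \<in> L"
  shows "fam \<phi> p q \<in> ind_hom C (Y p) (Y q) \<longleftrightarrow> (\<forall>i. \<exists>j. R \<phi> (c p i) (c q j) \<noteq> {})"
proof
  assume h: "fam \<phi> p q \<in> ind_hom C (Y p) (Y q)"
  show "\<forall>i. \<exists>j. R \<phi> (c p i) (c q j) \<noteq> {}"
  proof
    fix i
    have "fam \<phi> p q i \<in> germs C (IO (Y p) i) (Y q)" using ind_homD(1)[OF h] by (simp add: Y_sel)
    then have "fam \<phi> p q i \<noteq> {}" using germ_nonempty[OF diagram, of "IO (Y p) i"] by (fastforce simp: Y_sel X_in)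
    then show "\<exists>j. R \<phi> (c p i) (c q j) \<noteq> {}" by (auto simp: fam_def Y_sel)
  qed
next
  assume ne: "\<forall>i. \<exists>j. R \<phi> (c p i) (c q j) \<noteq> {}"
  show "fam \<phi> p q \<in> ind_hom C (Y p) (Y q)"
    unfolding ind_hom_def
  proof (intro CollectI conjI ballI impI)
    show "fam \<phi> p q \<in> (\<Pi>\<^sub>E i\<in>Idx (Y p). germs C (IO (Y p) i) (Y q))"
    proof (rule PiE_I)
      fix i obtain j f where f: "f \<in> R \<phi> (c p i) (c q j)" using ne by blast
      show "fam \<phi> p q i \<in> germs C (IO (Y p) i) (Y q)"
        unfolding fam_at[OF \<phi> f] using R_hom[OF \<phi> f] by (intro germ_in[OF diagram]) (simp_all add: Y_sel X_in)
    qed (simp add: fam_def)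
    fix i i' r assume le: "Le (Y p) i i'" and r: "r \<in> fam \<phi> p q i'"
    obtain k g where rk: "r = (k, g)" by (cases r)
    obtain j f where f: "f \<in> R \<phi> (c p i') (c q j)" using ne by blast
    have le': "i \<le> i'" using le by (simp add: Y_sel)
    have "(k, g) \<in> germ_rel C (IO (Y p) i') (Y q) `` {(j, f)}" using r unfolding rk fam_at[OF \<phi> f] .
    from germ_precomp[OF diagram _ _ _ this, of "IO (Y p) i" "IA (Y p) i i'"]
    have "(k, Cmp C (IO (Y p) i) (IO (Y p) i') (IO (Y q) k) g (IA (Y p) i i')) \<in> fam \<phi> p q i"
      using fam_at[OF \<phi> precomp[OF \<phi> f le']] R_hom[OF e_in transition[OF le']] by (simp add: Y_sel X_in)
    then show "case r of (j, f) \<Rightarrow> (j, Cmp C (IO (Y p) i) (IO (Y p) i') (IO (Y q) j) f (IA (Y p) i i')) \<in> fam \<phi> p q i"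
      by (simp add: rk)
  qed
qed

lemma lift_nonempty: "\<lbrakk>\<phi> \<in> L; \<And>i. \<exists>j. R \<phi> (c p i) (c q j) \<noteq> {}\<rbrakk> \<Longrightarrow> lift \<phi> p q \<noteq> {}"
  unfolding lift_eq using fam_hom_iff[of \<phi> p q] by simp

text \<open>Composites of arrows induced by \<open>\<phi>\<close> and \<open>\<psi>\<close> are induced by \<open>\<psi> \<circ> \<phi>\<close>, and by uniqueness this determines the composite
  of the lifted families.\<close>

lemma induced_family_lift: "induced_family diagrams (ind_cat C) Y L mul e lift"
proof -
  interpret D: category_on diagrams "ind_cat C" by (rule category_on_ind_cat)
  have ic: "Hom (ind_cat C) = ind_hom C" "Cmp (ind_cat C) = ind_cmp C" "Idn (ind_cat C) = ind_id C"
    by (simp_all add: ind_cat_def)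
  show ?thesis
  proof unfold_locales
    show "Y p \<in> diagrams" for p by (simp add: diagram)
    show "f \<in> Hom (ind_cat C) (Y p) (Y q)" if "\<phi> \<in> L" "f \<in> lift \<phi> p q" for \<phi> f p q
      using that by (auto simp: lift_eq ic split: if_splits)
    show "f = g" if "\<phi> \<in> L" "f \<in> lift \<phi> p q" "g \<in> lift \<phi> p q" for \<phi> f g p q
      using that by (auto simp: lift_eq split: if_splits)
    show "Cmp (ind_cat C) (Y p) (Y q) (Y r) g f \<in> lift (mul \<psi> \<phi>) p r"
      if \<phi>: "\<phi> \<in> L" and \<psi>: "\<psi> \<in> L" and f: "f \<in> lift \<phi> p q" and g: "g \<in> lift \<psi> q r" for \<phi> \<psi> f g p q r
    proof -
      have fe: "f = fam \<phi> p q" "fam \<phi> p q \<in> ind_hom C (Y p) (Y q)" and ge: "g = fam \<psi> q r" "fam \<psi> q r \<in> ind_hom C (Y q) (Y r)"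
        using f g by (auto simp: lift_eq split: if_splits)
      have fr: "\<exists>j a. a \<in> R \<phi> (c p i) (c q j)" for i using fe(2) unfolding fam_hom_iff[OF \<phi>] by blast
      have gr: "\<exists>j a. a \<in> R \<psi> (c q i) (c r j)" for i using ge(2) unfolding fam_hom_iff[OF \<psi>] by blast
      note m = mul_in[OF \<phi> \<psi>]
      have ne: "\<exists>l. R (mul \<psi> \<phi>) (c p i) (c r l) \<noteq> {}" for i
        using fr[of i] gr R_cmp[OF \<phi> \<psi>] by blast
      then have h: "fam (mul \<psi> \<phi>) p r \<in> ind_hom C (Y p) (Y r)" by (simp add: fam_hom_iff[OF m])
      have "ind_cmp C (Y p) (Y q) (Y r) g f = fam (mul \<psi> \<phi>) p r"
      proof (rule ind_hom_eqI[OF diagram diagram _ h])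
        show "ind_cmp C (Y p) (Y q) (Y r) g f \<in> ind_hom C (Y p) (Y r)"
          unfolding fe(1) ge(1) by (rule ind_cmp_hom(1)[OF diagram diagram diagram fe(2) ge(2)])
        fix i
        obtain j a where a: "a \<in> R \<phi> (c p i) (c q j)" using fr by blast
        obtain l b where b: "b \<in> R \<psi> (c q j) (c r l)" using gr by blast
        have "ind_cmp C (Y p) (Y q) (Y r) g f i =
            germ_rel C (IO (Y p) i) (Y r) `` {(l, Cmp C (IO (Y p) i) (IO (Y q) j) (IO (Y r) l) b a)}"
          unfolding fe(1) ge(1)
          by (rule ind_cmp_at[OF diagram diagram diagram fe(2) ge(2) _ fam_mem[OF \<phi> a] fam_mem[OF \<psi> b]]) (simp add: Y_sel)
        also have "\<dots> = fam (mul \<psi> \<phi>) p r i"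
          using fam_at[OF m R_cmp[OF \<phi> \<psi> a b]] by (simp add: Y_sel)
        finally show "\<exists>x. x \<in> ind_cmp C (Y p) (Y q) (Y r) g f i \<and> x \<in> fam (mul \<psi> \<phi>) p r i"
          using fam_mem[OF m R_cmp[OF \<phi> \<psi> a b]] by auto
      qed
      then show ?thesis using h by (simp add: ic lift_eq)
    qed
    show "Idn (ind_cat C) (Y p) \<in> lift e p p" for p
    proof -
      have h: "fam e p p \<in> ind_hom C (Y p) (Y p)" using R_id by (auto simp: fam_hom_iff[OF e_in])
      have "ind_id C (Y p) = fam e p p"
      proof (rule ind_hom_eqI[OF diagram diagram ind_id_hom[OF diagram] h])
        fix i
        show "\<exists>x. x \<in> ind_id C (Y p) i \<and> x \<in> fam e p p i"
          using ind_id_at[OF diagram, of i p] fam_mem[OF e_in R_id[of "c p i"]] by (auto simp: Y_sel)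
      qed
      then show ?thesis using h by (simp add: ic lift_eq)
    qed
  qed (auto simp: e_in mul_in mul_e)
qed

end

(* the subscript notation for coefficients of power series clashes with that for components of vectors *)
unbundle no Formal_Power_Series.fps_syntax

section \<open>The group of block-diagonal matrices\<close>

lemma GL_sel [simp]: "carrier GL = {g. invertible g}" "g \<otimes>\<^bsub>GL\<^esub> h = g ** h" "\<one>\<^bsub>GL\<^esub> = mat 1"
  by (simp_all add: GL_def)

lemma group_GL: "group (GL :: ('f::field ^ 'n ^ 'n) monoid)"
proof (rule groupI)
  fix g :: "'f ^ 'n ^ 'n" assume "g \<in> carrier GL"
  then obtain h where "g ** h = mat 1" "h ** g = mat 1" by (auto simp: invertible_def)
  then show "\<exists>h\<in>carrier GL. h \<otimes>\<^bsub>GL\<^esub> g = \<one>\<^bsub>GL\<^esub>" by (auto simp: invertible_def intro!: bexI[of _ h])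
qed (auto simp: invertible_mult matrix_mul_assoc, auto simp: invertible_def)

lemma group_HG: "group (HG :: ('k::field, 'n::finite) hmat monoid)"
  unfolding HG_def by (intro DirProd_group group_GL)

lemma HG_sel [simp]: "g \<otimes>\<^bsub>HG\<^esub> h = (fst g ** fst h, snd g ** snd h)" "\<one>\<^bsub>HG\<^esub> = (mat 1, mat 1)"
  "g \<in> carrier HG \<longleftrightarrow> invertible (fst g) \<and> invertible (snd g)"
  by (simp_all add: HG_def mult_DirProd' mem_Times_iff)

section \<open>Quotients of lattices\<close>

lemma vanish_mult:
  fixes f g :: "'a::{comm_monoid_add, mult_zero} fls"
  assumes "\<And>l. l < p \<Longrightarrow> fls_nth f l = 0" "\<And>l. l < q \<Longrightarrow> fls_nth g l = 0" "n < p + q"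
  shows "fls_nth (f * g) n = 0"
proof (cases "f = 0 \<or> g = 0")
  case False
  then have "p \<le> fls_subdegree f" "q \<le> fls_subdegree g" using assms by (auto intro: fls_subdegree_geI)
  then show ?thesis using assms(3) by (intro fls_times_nth_eq0) simp
qed (auto simp: fls_times_def)

lemma in_lat_zero: "in_lat i m a 0"
  by (simp add: in_lat_def)

lemma in_lat_add: "\<lbrakk>in_lat i m a f; in_lat i m a g\<rbrakk> \<Longrightarrow> in_lat i m a (f + g)"
  by (simp add: in_lat_def)

lemma in_lat_sum: "(\<And>s. s \<in> A \<Longrightarrow> in_lat i m a (f s)) \<Longrightarrow> in_lat i m a (sum f A)"
  by (induction A rule: infinite_finite_induct) (auto simp: in_lat_zero in_lat_add)

lemma in_lat_scale: "in_lat i m a f \<Longrightarrow> in_lat i m a (fls_const (fls_const c) * f)"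
  by (simp add: in_lat_def)

lemma in_lat_mono: "\<lbrakk>in_lat i m a f; i \<le> i'; m' \<le> m; a \<le> a'\<rbrakk> \<Longrightarrow> in_lat i' m' a' f"
  by (simp add: in_lat_def)

lemma lat_mono: "\<lbrakk>i \<le> i'; m' \<le> m; a \<le> a'\<rbrakk> \<Longrightarrow> lat i m a \<subseteq> lat i' m' a'"
  using in_lat_mono by (fastforce simp: lat_def)

text \<open>Multiplication by \<open>g\<close> lowers the order in \<open>t\<close> by at most \<open>N\<close>. Only finitely many coefficients of
  \<open>g\<close> contribute to the coefficients of \<open>t\<^sup>l\<close> with \<open>l < m\<close> of a product \<open>g f\<close>, so it lowers the orders of
  these in \<open>u\<close> by a bounded amount.\<close>

lemma in_lat_mult:
  fixes g :: "'k::field F2"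
  assumes N: "- fls_subdegree g \<le> int N"
  shows "\<exists>K0. \<forall>K\<ge>K0. \<forall>a f. in_lat (int i) (int m + int N) a f \<longrightarrow> in_lat (int i + int N) (int m) (a + int K) (g * f)"
proof -
  let ?d = "fls_subdegree g"
  let ?J = "{?d..int m + int i}"
  \<comment> \<open>the coefficients of \<open>g\<close> in the degrees \<open>?J\<close> are the ones that can contribute; the sum bounds all of
    their pole orders in \<open>u\<close> at once\<close>
  define K0 where "K0 = (\<Sum>j\<in>?J. nat (- fls_subdegree (fls_nth g j)))"
  have K0: "- int K0 \<le> fls_subdegree (fls_nth g j)" if "j \<in> ?J" for j
    proof -
    have "nat (- fls_subdegree (fls_nth g j)) \<le> K0"
      unfolding K0_def by (rule member_le_sum[OF that, of "\<lambda>j. nat (- fls_subdegree (fls_nth g j))"]) auto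
    then show ?thesis by simp
  qed
  show ?thesis
  proof (rule exI[of _ K0], intro allI impI)
    fix K a and f :: "'k F2" assume K: "K0 \<le> K" and f: "in_lat (int i) (int m + int N) a f"
    show "in_lat (int i + int N) (int m) (a + int K) (g * f)"
    proof (cases "f = 0")
      case False
      have fi: "- int i \<le> fls_subdegree f" using False f by (intro fls_subdegree_geI) (auto simp: in_lat_def)
      have "fls_nth (g * f) l = 0" if "l < - (int i + int N)" for l
        using that N fi by (intro fls_times_nth_eq0) simp
      moreover have "fls_nth (fls_nth (g * f) l) c = 0" if l: "l < int m" and c: "c < - (a + int K)" for l c
      proof -
        have "fls_nth (fls_nth g j * fls_nth f (l - j)) c = 0" if j: "j \<in> {?d..l - fls_subdegree f}" for j
        proof (rule vanish_mult[of "- int K0" _ "- a"])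
          have "j \<in> ?J" using j l fi by simp
          then show "fls_nth (fls_nth g j) k = 0" if "k < - int K0" for k using K0[of j] that by simp
          show "fls_nth (fls_nth f (l - j)) k = 0" if "k < - a" for k
            using f that j l N by (simp add: in_lat_def)
          show "c < - int K0 + - a" using c K by simp
        qed
        then show ?thesis by (simp add: fls_times_nth(2)[of g f l] fls_nth_sum)
      qed
      ultimately show ?thesis by (simp add: in_lat_def)
    qed (simp add: in_lat_zero)
  qed
qed

text \<open>The sums of the bounds for the entries are bounds for the matrix. Here and in the previous lemma all larger
  bounds are admitted, too, so that finitely many bounds can be replaced by a common one.\<close>

lemma in_lat_matrix:
  fixes M :: "'k::field F2 ^ 'n ^ 'n::finite"
  shows "\<exists>N0. \<forall>N\<ge>N0. \<forall>i m. \<exists>K0. \<forall>K\<ge>K0. \<forall>a x. (\<forall>s. in_lat (int i) (int m + int N) a (x $ s)) \<longrightarrow>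
    (\<forall>r. in_lat (int i + int N) (int m) (a + int K) ((M *v x) $ r))"
proof -
  define N0 where "N0 = (\<Sum>r\<in>UNIV. \<Sum>s\<in>UNIV. nat (- fls_subdegree (M $ r $ s)))"
  have N0: "- fls_subdegree (M $ r $ s) \<le> int N" if "N0 \<le> N" for r s N
  proof -
    have "nat (- fls_subdegree (M $ r $ s)) \<le> (\<Sum>s\<in>UNIV. nat (- fls_subdegree (M $ r $ s)))"
      by (rule member_le_sum) auto
    also have "\<dots> \<le> N0" unfolding N0_def by (rule member_le_sum[of r UNIV "\<lambda>r. \<Sum>s\<in>UNIV. nat (- fls_subdegree (M $ r $ s))"]) auto
    finally show ?thesis using that by simp
  qed
  show ?thesis
  proof (rule exI[of _ N0], intro allI impI)
    fix N i m assume N: "N0 \<le> N"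
    obtain K1 where K1: "in_lat (int i + int N) (int m) (a + int K) (M $ r $ s * f)"
      if "K1 r s \<le> K" "in_lat (int i) (int m + int N) a f" for r s K a f
      using in_lat_mult[OF N0[OF N]] by metis
    let ?K = "\<Sum>r\<in>UNIV. \<Sum>s\<in>UNIV. K1 r s"
    have le: "K1 r s \<le> ?K" for r s
      using member_le_sum[of s UNIV "K1 r"] member_le_sum[of r UNIV "\<lambda>r. \<Sum>s\<in>UNIV. K1 r s"] by simp
    show "\<exists>K0. \<forall>K\<ge>K0. \<forall>a x. (\<forall>s. in_lat (int i) (int m + int N) a (x $ s)) \<longrightarrow>
      (\<forall>r. in_lat (int i + int N) (int m) (a + int K) ((M *v x) $ r))"
      using le by (intro exI[of _ ?K]) (auto simp: matrix_vector_mult_def intro!: in_lat_sum K1 intro: le_trans)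
  qed
qed

definition act :: "('k::field, 'n::finite) hmat \<Rightarrow> ('k, 'n) wvec \<Rightarrow> ('k, 'n) wvec" where
  "act h = (\<lambda>(x, y). (fst h *v x, snd h *v y))"

text \<open>The order of the quantifiers matters: the loss \<open>N\<close> in \<open>t\<close> is the same for all lattices, and the loss \<open>K\<close> in \<open>u\<close> depends
  on the range of degrees in \<open>t\<close>, but not on the lattice in \<open>E\<close>. The four layers of \<open>W\<close> require exactly this
  uniformity.\<close>

lemma act_lat: "\<exists>N. \<forall>i m. \<exists>K. \<forall>a. act h ` lat (int i) (int m + int N) a \<subseteq> lat (int i + int N) (int m) (a + int K)"
proof -
  obtain N1 where N1: "\<forall>N\<ge>N1. \<forall>i m. \<exists>K0. \<forall>K\<ge>K0. \<forall>a x. (\<forall>s. in_lat (int i) (int m + int N) a (x $ s)) \<longrightarrow>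
    (\<forall>r. in_lat (int i + int N) (int m) (a + int K) ((fst h *v x) $ r))" using in_lat_matrix by blast
  obtain N2 where N2: "\<forall>N\<ge>N2. \<forall>i m. \<exists>K0. \<forall>K\<ge>K0. \<forall>a x. (\<forall>s. in_lat (int i) (int m + int N) a (x $ s)) \<longrightarrow>
    (\<forall>r. in_lat (int i + int N) (int m) (a + int K) ((snd h *v x) $ r))" using in_lat_matrix by blast
  show ?thesis
  proof (rule exI[of _ "max N1 N2"], intro allI)
    fix i m
    let ?N = "max N1 N2"
    obtain K1 where K1: "\<forall>K\<ge>K1. \<forall>a x. (\<forall>s. in_lat (int i) (int m + int ?N) a (x $ s)) \<longrightarrow>
      (\<forall>r. in_lat (int i + int ?N) (int m) (a + int K) ((fst h *v x) $ r))"
      using N1[rule_format, of ?N i m] by (metis max.cobounded1)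
    obtain K2 where K2: "\<forall>K\<ge>K2. \<forall>a x. (\<forall>s. in_lat (int i) (int m + int ?N) a (x $ s)) \<longrightarrow>
      (\<forall>r. in_lat (int i + int ?N) (int m) (a + int K) ((snd h *v x) $ r))"
      using N2[rule_format, of ?N i m] by (metis max.cobounded2)
    show "\<exists>K. \<forall>a. act h ` lat (int i) (int m + int ?N) a \<subseteq> lat (int i + int ?N) (int m) (a + int K)"
      using K1[rule_format, of "max K1 K2"] K2[rule_format, of "max K1 K2"]
      by (intro exI[of _ "max K1 K2"]) (auto simp: lat_def act_def)
  qed
qed

definition wlinear :: "(('k::field, 'n::finite) wvec \<Rightarrow> ('k, 'n) wvec) set" where
  "wlinear = {\<phi>. (\<forall>v w. \<phi> (v + w) = \<phi> v + \<phi> w) \<and> (\<forall>c v. \<phi> (wscale c v) = wscale c (\<phi> v))}"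

lemma wscale_add: "wscale c (v + w) = wscale c v + wscale c w"
  by (simp add: wscale_def vec_eq_iff algebra_simps)

lemma act_wlinear: "act h \<in> wlinear"
  by (auto simp: wlinear_def act_def wscale_def matrix_vector_right_distrib vec_eq_iff
      matrix_vector_mult_def sum_distrib_left mult.left_commute distrib_left sum.distrib)

lemma act_mult: "act (g \<otimes>\<^bsub>HG\<^esub> h) = act g \<circ> act h"
  by (auto simp: act_def fun_eq_iff matrix_vector_mul_assoc)

lemma act_one: "act \<one>\<^bsub>HG\<^esub> = id"
  by (auto simp: act_def fun_eq_iff)

text \<open>Subspaces of \<open>W\<close>; these are the \<open>k\<close>-subspaces, closure under negation being scaling by \<open>-1\<close>.\<close>

definition wsub :: "('k::field, 'n::finite) wvec set \<Rightarrow> bool" where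
  "wsub A \<longleftrightarrow> 0 \<in> A \<and> (\<forall>v\<in>A. \<forall>w\<in>A. v + w \<in> A) \<and> (\<forall>c. \<forall>v\<in>A. wscale c v \<in> A)"

lemma wsub_lat: "wsub (lat i m a)"
  by (auto simp: wsub_def lat_def zero_prod_def in_lat_zero in_lat_add wscale_def in_lat_scale)

lemma wcosetI: "b \<in> B \<Longrightarrow> w + b \<in> wcoset w B"
  by (simp add: wcoset_def)

lemma wcosetE:
  assumes "x \<in> wcoset w B" obtains b where "b \<in> B" "x = w + b"
  using assms unfolding wcoset_def by blast

lemma wsubD:
  assumes "wsub B"
  shows "0 \<in> B" "\<lbrakk>v \<in> B; w \<in> B\<rbrakk> \<Longrightarrow> v + w \<in> B" "v \<in> B \<Longrightarrow> wscale c v \<in> B"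
  using assms unfolding wsub_def by blast+

lemma wcoset_sum:
  assumes "wsub B" shows "{s + t | s t. s \<in> wcoset v B \<and> t \<in> wcoset w B} = wcoset (v + w) B"
proof (rule equalityI; rule subsetI)
  fix x assume "x \<in> {s + t | s t. s \<in> wcoset v B \<and> t \<in> wcoset w B}"
  then obtain s t where x: "x = s + t" "s \<in> wcoset v B" "t \<in> wcoset w B" by blast
  then obtain b b' where b: "b \<in> B" "s = v + b" "b' \<in> B" "t = w + b'" by (meson wcosetE)
  have "x = (v + w) + (b + b')" using x b by (simp add: algebra_simps)
  then show "x \<in> wcoset (v + w) B" using wcosetI[OF wsubD(2)[OF assms b(1,3)]] by simp
next
  fix x assume "x \<in> wcoset (v + w) B"
  then obtain b where b: "b \<in> B" "x = v + w + b" by (rule wcosetE)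
  have "x = (v + 0) + (w + b)" using b by (simp add: add.assoc)
  moreover have "v + 0 \<in> wcoset v B" "w + b \<in> wcoset w B" using wcosetI wsubD(1)[OF assms] b(1) by blast+
  ultimately show "x \<in> {s + t | s t. s \<in> wcoset v B \<and> t \<in> wcoset w B}" by blast
qed

text \<open>The image of a coset under an additive map that respects the subspaces, in the form in which induced maps of
  quotients are defined; scaling by \<open>c\<close> is the case \<open>B = B'\<close>.\<close>

lemma wcoset_image:
  assumes B: "wsub B" and B': "wsub B'" and add: "\<And>v w. \<phi> (v + w) = \<phi> v + \<phi> w" and sub: "\<phi> ` B \<subseteq> B'"
  shows "(\<Union>x\<in>wcoset w B. wcoset (\<phi> x) B') = wcoset (\<phi> w) B'"
proof (rule equalityI; rule subsetI)
  fix y assume "y \<in> (\<Union>x\<in>wcoset w B. wcoset (\<phi> x) B')"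
  then obtain x where x: "x \<in> wcoset w B" "y \<in> wcoset (\<phi> x) B'" by blast
  then obtain b b' where b: "b \<in> B" "x = w + b" "b' \<in> B'" "y = \<phi> x + b'" by (meson wcosetE)
  have "y = \<phi> w + (\<phi> b + b')" using b add by (simp add: add.assoc)
  moreover have "\<phi> b + b' \<in> B'" using wsubD(2)[OF B'] b sub by blast
  ultimately show "y \<in> wcoset (\<phi> w) B'" using wcosetI by simp
next
  fix y assume "y \<in> wcoset (\<phi> w) B'"
  moreover have "w \<in> wcoset w B" using wcosetI[OF wsubD(1)[OF B], of w] by simp
  ultimately show "y \<in> (\<Union>x\<in>wcoset w B. wcoset (\<phi> x) B')" by blast
qed

lemma quot_space_car: "Vcar (quot_space A B) = (\<lambda>w. wcoset w B) ` A"
  by (simp add: quot_space_def Let_def)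

lemma quot_space_add:
  assumes "wsub B" "v \<in> A" "w \<in> A"
  shows "Vadd (quot_space A B) (wcoset v B) (wcoset w B) = wcoset (v + w) B"
  using assms wcoset_sum[OF assms(1), of v w] by (simp add: quot_space_def Let_def)

lemma quot_space_scl:
  assumes "wsub B" "v \<in> A"
  shows "Vscl (quot_space A B) c (wcoset v B) = wcoset (wscale c v) B"
proof -
  have "wscale c ` B \<subseteq> B" using wsubD(3)[OF assms(1)] by blast
  then have "(\<Union>s\<in>wcoset v B. wcoset (wscale c s) B) = wcoset (wscale c v) B"
    by (rule wcoset_image[where \<phi> = "wscale c", OF assms(1,1) wscale_add])
  then show ?thesis using assms(2) by (simp add: quot_space_def Let_def)
qed

section \<open>The operators induced by matrices\<close>

text \<open>Closure under addition and scaling is what makes linear maps a category.\<close>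

definition closed_spaces :: "('s, 'v) vspace set" where
  "closed_spaces = {V. (\<forall>x\<in>Vcar V. \<forall>y\<in>Vcar V. Vadd V x y \<in> Vcar V) \<and> (\<forall>c. \<forall>x\<in>Vcar V. Vscl V c x \<in> Vcar V)}"

lemma category_on_vect_fd: "category_on closed_spaces vect_fd"
proof (unfold category_on_def, unfold_locales; simp add: vect_fd_def)
  fix V :: "('a, 'b) vspace" assume "V \<in> closed_spaces"
  then show "(\<lambda>x\<in>Vcar V. x) \<in> lin_maps V V" by (auto simp: lin_maps_def closed_spaces_def)
next
  fix U V W :: "('a, 'b) vspace" and f g
  assume "U \<in> closed_spaces" "f \<in> lin_maps U V" "g \<in> lin_maps V W"
  then show "compose (Vcar U) g f \<in> lin_maps U W"
    by (auto simp: lin_maps_def closed_spaces_def compose_def PiE_def Pi_iff)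
next
  fix V W :: "('a, 'b) vspace" and f assume f: "f \<in> lin_maps V W"
  then show "compose (Vcar V) (\<lambda>x\<in>Vcar W. x) f = f" "compose (Vcar V) f (\<lambda>x\<in>Vcar V. x) = f"
    by (auto simp: lin_maps_def compose_def PiE_def Pi_iff intro!: extensionalityI[of _ "Vcar V"])
next
  fix U V W X :: "('a, 'b) vspace" and f g h :: "'b \<Rightarrow> 'b"
  assume "f \<in> lin_maps U V"
  then show "compose (Vcar U) (compose (Vcar V) h g) f = compose (Vcar U) h (compose (Vcar U) g f)"
    by (auto simp: lin_maps_def compose_def PiE_def Pi_iff intro!: restrict_ext)
qed

abbreviation WW0 :: "nat \<times> nat \<times> nat \<times> nat \<Rightarrow> ('k::field, 'n::finite) o0" where
  "WW0 \<equiv> \<lambda>(i, m, a, b). W0 i m a b"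

lemma WW0_car: "Vcar (W0 i m a b) = (\<lambda>w. wcoset w (lat (int i) (int m) (- int b))) ` lat (int i) (int m) (int a)"
  by (simp add: W0_def quot_space_car)

lemma WW0_ops:
  assumes "v \<in> lat (int i) (int m) (int a)"
  shows "w \<in> lat (int i) (int m) (int a) \<Longrightarrow> Vadd (W0 i m a b) (wcoset v (lat (int i) (int m) (- int b)))
      (wcoset w (lat (int i) (int m) (- int b))) = wcoset (v + w) (lat (int i) (int m) (- int b))"
    and "Vscl (W0 i m a b) c (wcoset v (lat (int i) (int m) (- int b))) = wcoset (wscale c v) (lat (int i) (int m) (- int b))"
  unfolding W0_def using assms by (simp_all add: quot_space_add quot_space_scl wsub_lat)

lemma induced0_iff:
  "f \<in> induced0 \<phi> (i, m, a, b) (i', m', a', b') \<longleftrightarrow>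
    \<phi> ` lat (int i) (int m) (int a) \<subseteq> lat (int i') (int m') (int a') \<and>
    \<phi> ` lat (int i) (int m) (- int b) \<subseteq> lat (int i') (int m') (- int b') \<and>
    f = (\<lambda>S\<in>Vcar (W0 i m a b). \<Union>w\<in>S. wcoset (\<phi> w) (lat (int i') (int m') (- int b')))"
  unfolding induced0_def by (simp only: prod.case) auto

lemma induced0_at:
  assumes "\<phi> \<in> wlinear" "f \<in> induced0 \<phi> (i, m, a, b) (i', m', a', b')" "w \<in> lat (int i) (int m) (int a)"
  shows "f (wcoset w (lat (int i) (int m) (- int b))) = wcoset (\<phi> w) (lat (int i') (int m') (- int b'))"
    and "\<phi> w \<in> lat (int i') (int m') (int a')"
proof -
  note f = assms(2)[unfolded induced0_iff]
  have "\<phi> (v + w) = \<phi> v + \<phi> w" for v w using assms(1) unfolding wlinear_def by blast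
  from wcoset_image[OF wsub_lat wsub_lat this f[THEN conjunct2, THEN conjunct1]]
  show "f (wcoset w (lat (int i) (int m) (- int b))) = wcoset (\<phi> w) (lat (int i') (int m') (- int b'))"
    using f assms(3) by (simp add: WW0_car)
  show "\<phi> w \<in> lat (int i') (int m') (int a')" using f assms(3) by blast
qed

text \<open>The induced maps of finite-dimensional quotients, from which the families on all layers are built.\<close>

lemma induced_family_0:
  "induced_family closed_spaces vectW (WW0 :: _ \<Rightarrow> ('k::field, 'n::finite) o0) wlinear (\<circ>) id induced0"
proof -
  interpret category_on closed_spaces "vectW :: (('k, 'n) o0, ('k, 'n) a0) excat" by (rule category_on_vect_fd)
  note sub = wsubD(2,3)[OF wsub_lat]
  show ?thesis
  proof unfold_locales
    fix p :: "nat \<times> nat \<times> nat \<times> nat"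
    obtain i m a b where p: "p = (i, m, a, b)" by (cases p)
    show "(WW0 p :: ('k, 'n) o0) \<in> closed_spaces"
      unfolding p closed_spaces_def by (simp add: WW0_car WW0_ops sub)
    show "Idn vectW (WW0 p :: ('k, 'n) o0) \<in> induced0 id p p"
    proof -
      have "(\<lambda>x\<in>Vcar (W0 i m a b :: ('k, 'n) o0). x) = (\<lambda>S\<in>Vcar (W0 i m a b). \<Union>w\<in>S. wcoset (id w) (lat (int i) (int m) (- int b)))"
      proof (rule restrict_ext)
        fix x assume "x \<in> Vcar (W0 i m a b :: ('k, 'n) o0)"
        then obtain w where w: "x = wcoset w (lat (int i) (int m) (- int b))" by (simp only: WW0_car) blast
        show "x = (\<Union>w\<in>x. wcoset (id w) (lat (int i) (int m) (- int b)))"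
          unfolding w
            using wcoset_image[OF wsub_lat wsub_lat, of "id :: ('k, 'n) wvec \<Rightarrow> _" "int i" "int m" "- int b" "int i" "int m" "- int b" w]
            by simp
      qed
      then show ?thesis unfolding p by (simp add: induced0_iff vect_fd_def)
    qed
    fix \<phi> :: "('k, 'n) wvec \<Rightarrow> ('k, 'n) wvec" and f q assume \<phi>: "\<phi> \<in> wlinear" and f: "f \<in> induced0 \<phi> p q"
    obtain i' m' a' b' where q: "q = (i', m', a', b')" by (cases q)
    note at = induced0_at[OF \<phi> f[unfolded p q]]
    have lin: "\<phi> (v + w) = \<phi> v + \<phi> w" "\<phi> (wscale c v) = wscale c (\<phi> v)" for v w c using \<phi> unfolding wlinear_def by blast+
    have "f \<in> extensional (Vcar (W0 i m a b))" using f by (simp add: p q induced0_iff)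
    then show "f \<in> Hom vectW (WW0 p) (WW0 q)"
      unfolding p q using at by (simp add: vect_fd_def lin_maps_def PiE_def Pi_iff WW0_car WW0_ops lin sub)
    fix \<psi> :: "('k, 'n) wvec \<Rightarrow> ('k, 'n) wvec" and g r assume \<psi>: "\<psi> \<in> wlinear" and g: "g \<in> induced0 \<psi> q r"
    obtain i'' m'' a'' b'' where r: "r = (i'', m'', a'', b'')" by (cases r)
    note at' = induced0_at[OF \<psi> g[unfolded q r]]
    have lin': "\<psi> (v + w) = \<psi> v + \<psi> w" for v w using \<psi> unfolding wlinear_def by blast
    have sub2: "(\<psi> \<circ> \<phi>) ` lat (int i) (int m) (- int b) \<subseteq> lat (int i'') (int m'') (- int b'')"
      "(\<psi> \<circ> \<phi>) ` lat (int i) (int m) (int a) \<subseteq> lat (int i'') (int m'') (int a'')"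
      using f g unfolding p q r induced0_iff image_comp[symmetric] by blast+
    have "compose (Vcar (W0 i m a b)) g f =
        (\<lambda>S\<in>Vcar (W0 i m a b). \<Union>w\<in>S. wcoset ((\<psi> \<circ> \<phi>) w) (lat (int i'') (int m'') (- int b'')))"
      unfolding compose_def
    proof (rule restrict_ext)
      fix x assume "x \<in> Vcar (W0 i m a b :: ('k, 'n) o0)"
      then obtain w where w: "x = wcoset w (lat (int i) (int m) (- int b))" "w \<in> lat (int i) (int m) (int a)"
        by (auto simp only: WW0_car)
      show "g (f x) = (\<Union>w\<in>x. wcoset ((\<psi> \<circ> \<phi>) w) (lat (int i'') (int m'') (- int b'')))"
        unfolding w(1) using wcoset_image[OF wsub_lat wsub_lat _ sub2(1), of w] at[OF w(2)] at'
        by (simp add: lin lin')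
    qed
    then show "Cmp vectW (WW0 p) (WW0 q) (WW0 r) g f \<in> induced0 (\<psi> \<circ> \<phi>) p r"
      unfolding p q r using sub2 by (simp add: induced0_iff vect_fd_def)
  next
    show "id \<in> (wlinear :: (('k, 'n) wvec \<Rightarrow> ('k, 'n) wvec) set)" by (simp add: wlinear_def)
    show "\<psi> \<circ> \<phi> \<in> wlinear" if "\<phi> \<in> wlinear" "\<psi> \<in> wlinear" for \<phi> \<psi> :: "('k, 'n) wvec \<Rightarrow> ('k, 'n) wvec"
      using that by (simp add: wlinear_def del: split_paired_All)
    show "f = g" if "\<phi> \<in> wlinear" "f \<in> induced0 \<phi> p q" "g \<in> induced0 \<phi> p q" for f g :: "('k, 'n) a0" and p q and \<phi> :: "('k, 'n) wvec \<Rightarrow> ('k, 'n) wvec"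
      using that by (cases p; cases q) (simp only: induced0_iff)
  qed simp_all
qed

declare HG_sel [simp del] GL_sel [simp del]

section \<open>The layers of the 2-Tate object\<close>

text \<open>The families of induced arrows are carried through the layers one after the other: Pro- and Ind-objects of
  finite-dimensional spaces, idempotent completion, and again Pro- and Ind-objects. In a Pro-layer, which is
  opposite to an Ind-layer, source and target are exchanged. A lemma \<open>..._nonempty\<close> reduces the existence of an
  induced arrow to that in the layer below.\<close>

abbreviation W1' :: "nat \<times> nat \<times> nat \<Rightarrow> ('k::field, 'n::finite) o1" where "W1' \<equiv> \<lambda>(i, m, a). W1 i m a"
abbreviation W2' :: "nat \<times> nat \<Rightarrow> ('k::field, 'n::finite) o2" where "W2' \<equiv> \<lambda>(i, m). W2 i m"

lemma induced0_nonempty: "induced0 \<phi> (i, m, a, b) (i', m', a', b') \<noteq> {} \<longleftrightarrow>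
    \<phi> ` lat (int i) (int m) (int a) \<subseteq> lat (int i') (int m') (int a') \<and>
    \<phi> ` lat (int i) (int m) (- int b) \<subseteq> lat (int i') (int m') (- int b')"
  unfolding induced0_def by (simp only: prod.case) auto

lemma induced_ind_family_1:
  "induced_ind_family closed_spaces (op_ex (vectW :: (('k::field, 'n::finite) o0, ('k, 'n) a0) excat)) WW0 wlinear
     (\<lambda>\<phi> \<psi>. \<psi> \<circ> \<phi>) id (\<lambda>\<phi> p q. induced0 \<phi> q p) (\<lambda>(i, m, a) b. (i, m, a, b)) W1'"
proof -
  interpret induced_family closed_spaces "op_ex (vectW :: (('k, 'n) o0, ('k, 'n) a0) excat)" WW0 wlinear
     "\<lambda>\<phi> \<psi>. \<psi> \<circ> \<phi>" id "\<lambda>\<phi> p q. induced0 \<phi> q p"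
    by (rule induced_family_op) (rule induced_family_0)
  show ?thesis
  proof unfold_locales
    fix b b' :: nat and q :: "nat \<times> nat \<times> nat" assume "b \<le> b'"
    then show "(induced0 id ((case q of (i, m, a) \<Rightarrow> \<lambda>b. (i, m, a, b)) b') ((case q of (i, m, a) \<Rightarrow> \<lambda>b. (i, m, a, b)) b)
        :: ('k, 'n) a0 set) \<noteq> {}"
      by (cases q) (simp add: induced0_nonempty lat_mono)
  qed (auto simp: W1_def)
qed

lemma induced_family_1:
  "induced_family {X. ind_diagram closed_spaces (op_ex vectW) X} (pro_cat vectW)
     (W1' :: _ \<Rightarrow> ('k::field, 'n::finite) o1) wlinear (\<circ>) id induced1"
proof -
  interpret induced_ind_family closed_spaces "op_ex (vectW :: (('k, 'n) o0, ('k, 'n) a0) excat)" WW0 wlinear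
     "\<lambda>\<phi> \<psi>. \<psi> \<circ> \<phi>" id "\<lambda>\<phi> p q. induced0 \<phi> q p" "\<lambda>(i, m, a) b. (i, m, a, b)" W1'
    by (rule induced_ind_family_1)
  have "lift \<phi> q p = induced1 \<phi> p q" for \<phi> p q
    by (cases p; cases q) (simp add: lift_def induced1_def)
  then show ?thesis using induced_family_op[OF induced_family_lift] by (simp add: pro_cat_def)
qed

lemma induced1_nonempty:
  assumes "\<phi> \<in> wlinear" "\<phi> ` lat (int i) (int m) (int a) \<subseteq> lat (int i') (int m') (int a')"
    and "\<And>b'. \<exists>b. \<phi> ` lat (int i) (int m) (- int b) \<subseteq> lat (int i') (int m') (- int b')"
  shows "(induced1 \<phi> (i, m, a) (i', m', a') :: ('k::field, 'n::finite) a1 set) \<noteq> {}"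
proof -
  interpret induced_ind_family closed_spaces "op_ex (vectW :: (('k, 'n) o0, ('k, 'n) a0) excat)" WW0 wlinear
     "\<lambda>\<phi> \<psi>. \<psi> \<circ> \<phi>" id "\<lambda>\<phi> p q. induced0 \<phi> q p" "\<lambda>(i, m, a) b. (i, m, a, b)" W1'
    by (rule induced_ind_family_1)
  show ?thesis
    using lift_nonempty[OF assms(1), of "(i, m, a)" "(i', m', a')"] assms(2,3)
    by (simp add: lift_def induced1_def induced0_nonempty)
qed

lemma induced1_id_nonempty:
  assumes "\<And>a. lat (int i) (int m) a \<subseteq> (lat (int i') (int m') a :: ('k::field, 'n::finite) wvec set)" "a \<le> a'"
  shows "(induced1 id (i, m, a) (i', m', a') :: ('k, 'n) a1 set) \<noteq> {}"
proof (rule induced1_nonempty)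
  show "id ` lat (int i) (int m) (int a) \<subseteq> (lat (int i') (int m') (int a') :: ('k, 'n) wvec set)"
    using assms(1)[of "int a"] lat_mono[of "int i'" "int i'" "int m'" "int m'" "int a" "int a'"] assms(2)
    by (simp only: image_id id_apply) (rule order_trans, simp_all)
  show "\<exists>b. id ` lat (int i) (int m) (- int b) \<subseteq> (lat (int i') (int m') (- int b') :: ('k, 'n) wvec set)" for b'
    using assms(1) by (intro exI[of _ b']) (simp only: image_id id_apply)
qed (simp add: wlinear_def)

lemma induced_ind_family_2:
  "induced_ind_family {X. ind_diagram closed_spaces (op_ex vectW) X} (pro_cat vectW)
     (W1' :: _ \<Rightarrow> ('k::field, 'n::finite) o1) wlinear (\<circ>) id induced1 (\<lambda>(i, m) a. (i, m, a)) W2'"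
proof -
  interpret induced_family "{X. ind_diagram closed_spaces (op_ex vectW) X}" "pro_cat vectW"
     "W1' :: _ \<Rightarrow> ('k, 'n) o1" wlinear "(\<circ>)" id induced1
    by (rule induced_family_1)
  show ?thesis
  proof unfold_locales
    fix a a' :: nat and q :: "nat \<times> nat" assume "a \<le> a'"
    then show "(induced1 id ((case q of (i, m) \<Rightarrow> \<lambda>a. (i, m, a)) a) ((case q of (i, m) \<Rightarrow> \<lambda>a. (i, m, a)) a')
        :: ('k, 'n) a1 set) \<noteq> {}"
      by (cases q) (simp add: induced1_id_nonempty)
  qed (auto simp: W2_def)
qed

lemma induced_family_2:
  "\<exists>S. induced_family S (tate_el vectW) (W2' :: _ \<Rightarrow> ('k::field, 'n::finite) o2) wlinear (\<circ>) id induced2"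
proof -
  interpret induced_ind_family "{X. ind_diagram closed_spaces (op_ex vectW) X}" "pro_cat vectW"
     "W1' :: _ \<Rightarrow> ('k, 'n) o1" wlinear "(\<circ>)" id induced1 "\<lambda>(i, m) a. (i, m, a)" W2'
    by (rule induced_ind_family_2)
  have "lift = induced2"
    by (intro ext) (auto simp: lift_def induced2_def split: prod.split)
  then show ?thesis
    using induced_family_cong[OF induced_family_lift, of "tate_el vectW"]
    by (auto simp: tate_el_def full_sub_def)
qed

lemma induced2_nonempty:
  assumes "\<phi> \<in> wlinear" "\<And>a. \<exists>a'. (induced1 \<phi> (i, m, a) (i', m', a') :: ('k::field, 'n::finite) a1 set) \<noteq> {}"
  shows "(induced2 \<phi> (i, m) (i', m') :: ('k, 'n) a2 set) \<noteq> {}"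
proof -
  interpret induced_ind_family "{X. ind_diagram closed_spaces (op_ex vectW) X}" "pro_cat vectW"
     "W1' :: _ \<Rightarrow> ('k, 'n) o1" wlinear "(\<circ>)" id induced1 "\<lambda>(i, m) a. (i, m, a)" W2'
    by (rule induced_ind_family_2)
  show ?thesis
    using lift_nonempty[OF assms(1), of "(i, m)" "(i', m')"] assms(2) by (simp add: lift_def induced2_def)
qed

lemma induced_ind_family_3:
  "\<exists>S. induced_ind_family S (op_ex (tate vectW)) (\<lambda>p. (W2' p, Idn (tate_el vectW) (W2' p)) :: ('k::field, 'n::finite) o2 \<times> ('k, 'n) a2)
     wlinear (\<lambda>\<phi> \<psi>. \<psi> \<circ> \<phi>) id (\<lambda>\<phi> p q. induced2 \<phi> q p) Pair W3"
proof -
  obtain S where S: "induced_family S (tate_el vectW) (W2' :: _ \<Rightarrow> ('k, 'n) o2) wlinear (\<circ>) id induced2"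
    using induced_family_2 by blast
  interpret induced_family "(\<lambda>x. (x, Idn (tate_el vectW) x)) ` S" "op_ex (tate vectW)"
    "\<lambda>p. (W2' p, Idn (tate_el vectW) (W2' p)) :: ('k::field, 'n::finite) o2 \<times> ('k, 'n) a2"
    wlinear "\<lambda>\<phi> \<psi>. \<psi> \<circ> \<phi>" id "\<lambda>\<phi> p q. induced2 \<phi> q p"
    unfolding tate_def by (rule induced_family_op[OF induced_family_kar[OF S]])
  show ?thesis
  proof (intro exI, unfold_locales)
    fix m m' i :: nat assume "m \<le> m'"
    then have l: "lat (int i) (int m') a \<subseteq> (lat (int i) (int m) a :: ('k, 'n) wvec set)" for a by (simp add: lat_mono)
    then have "\<exists>a'. (induced1 id (i, m', a) (i, m, a') :: ('k, 'n) a1 set) \<noteq> {}" for a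
      using induced1_id_nonempty[OF l order_refl] by blast
    then show "(induced2 id (i, m') (i, m) :: ('k, 'n) a2 set) \<noteq> {}"
      using e_in by (intro induced2_nonempty)
  qed (auto simp: W3_def)
qed

lemma induced_family_3:
  "\<exists>S. induced_family S (pro_cat (tate vectW)) (W3 :: _ \<Rightarrow> ('k::field, 'n::finite) o3) wlinear (\<circ>) id induced3"
proof -
  obtain S where S: "induced_ind_family S (op_ex (tate vectW))
     (\<lambda>p. (W2' p, Idn (tate_el vectW) (W2' p)) :: ('k::field, 'n::finite) o2 \<times> ('k, 'n) a2)
     wlinear (\<lambda>\<phi> \<psi>. \<psi> \<circ> \<phi>) id (\<lambda>\<phi> p q. induced2 \<phi> q p) Pair W3"
    using induced_ind_family_3 by blast
  interpret induced_ind_family S "op_ex (tate vectW)"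
    "\<lambda>p. (W2' p, Idn (tate_el vectW) (W2' p)) :: ('k::field, 'n::finite) o2 \<times> ('k, 'n) a2"
     wlinear "\<lambda>\<phi> \<psi>. \<psi> \<circ> \<phi>" id "\<lambda>\<phi> p q. induced2 \<phi> q p" Pair W3 by (rule S)
  have "(\<lambda>\<phi> p q. lift \<phi> q p) = induced3"
    by (intro ext) (simp add: lift_def induced3_def)
  then show ?thesis using induced_family_op[OF induced_family_lift] by (auto simp: pro_cat_def)
qed

lemma induced3_nonempty:
  assumes "\<phi> \<in> wlinear" "\<And>m'. \<exists>m. (induced2 \<phi> (i, m) (i', m') :: ('k::field, 'n::finite) a2 set) \<noteq> {}"
  shows "(induced3 \<phi> i i' :: ('k, 'n) a3 set) \<noteq> {}"
proof -
  obtain S where S: "induced_ind_family S (op_ex (tate vectW))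
     (\<lambda>p. (W2' p, Idn (tate_el vectW) (W2' p)) :: ('k::field, 'n::finite) o2 \<times> ('k, 'n) a2)
     wlinear (\<lambda>\<phi> \<psi>. \<psi> \<circ> \<phi>) id (\<lambda>\<phi> p q. induced2 \<phi> q p) Pair W3"
    using induced_ind_family_3 by blast
  interpret induced_ind_family S "op_ex (tate vectW)"
    "\<lambda>p. (W2' p, Idn (tate_el vectW) (W2' p)) :: ('k::field, 'n::finite) o2 \<times> ('k, 'n) a2"
     wlinear "\<lambda>\<phi> \<psi>. \<psi> \<circ> \<phi>" id "\<lambda>\<phi> p q. induced2 \<phi> q p" Pair W3 by (rule S)
  show ?thesis
    using lift_nonempty[OF assms(1), of i i'] assms(2) by (simp add: lift_def induced3_def)
qed

lemma induced_ind_family_4: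
  "\<exists>S. induced_ind_family S (pro_cat (tate vectW)) (W3 :: _ \<Rightarrow> ('k::field, 'n::finite) o3) wlinear (\<circ>) id induced3
     (\<lambda>(_ :: unit) i. i) (\<lambda>_. W4)"
proof -
  obtain S where S: "induced_family S (pro_cat (tate vectW)) (W3 :: _ \<Rightarrow> ('k::field, 'n::finite) o3) wlinear (\<circ>) id induced3"
    using induced_family_3 by blast
  interpret induced_family S "pro_cat (tate vectW)" "W3 :: _ \<Rightarrow> ('k::field, 'n::finite) o3" wlinear "(\<circ>)" id induced3
    by (rule S)
  show ?thesis
  proof (intro exI, unfold_locales)
    fix i i' :: nat assume "i \<le> i'"
    then have l: "lat (int i) (int m) a \<subseteq> (lat (int i') (int m) a :: ('k, 'n) wvec set)" for m a by (simp add: lat_mono)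
    then have "\<exists>a'. (induced1 id (i, m, a) (i', m, a') :: ('k, 'n) a1 set) \<noteq> {}" for m a
      using induced1_id_nonempty[OF l order_refl] by blast
    then have "(induced2 id (i, m) (i', m) :: ('k, 'n) a2 set) \<noteq> {}" for m
      using e_in by (intro induced2_nonempty)
    then show "(induced3 id i i' :: ('k, 'n) a3 set) \<noteq> {}"
      using e_in by (intro induced3_nonempty exI)
  qed (auto simp: W4_def)
qed

text \<open>The stage \<open>i\<close> is mapped to \<open>i + N\<close>; for the target stage \<open>m'\<close> the source stage \<open>m' + N\<close> is fine enough; and the lattice
  \<open>a\<close> is mapped into \<open>a + K\<close>, where \<open>K\<close> may depend on \<open>i\<close> and \<open>m'\<close>.\<close>

lemma induced4_act:
  "(induced4 (act h) :: ('k::field, 'n::finite) a4 set) \<noteq> {}"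
proof -
  obtain S where S: "induced_ind_family S (pro_cat (tate vectW)) (W3 :: _ \<Rightarrow> ('k::field, 'n::finite) o3) wlinear (\<circ>) id induced3
     (\<lambda>(_ :: unit) i. i) (\<lambda>_. W4)" using induced_ind_family_4 by blast
  interpret induced_ind_family S "pro_cat (tate vectW)" "W3 :: _ \<Rightarrow> ('k::field, 'n::finite) o3" wlinear "(\<circ>)" id induced3
     "\<lambda>(_ :: unit) i. i" "\<lambda>_. W4" by (rule S)
  obtain N where N: "\<forall>i m. \<exists>K. \<forall>a. act h ` lat (int i) (int m + int N) a \<subseteq> lat (int i + int N) (int m) (a + int K)"
    using act_lat by blast
  have "(induced3 (act h) i (i + N) :: ('k, 'n) a3 set) \<noteq> {}" for i
  proof (rule induced3_nonempty[OF act_wlinear])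
    fix m'
    obtain K where K: "\<And>a. act h ` lat (int i) (int m' + int N) a \<subseteq> lat (int i + int N) (int m') (a + int K)"
      using N by blast
    have "(induced1 (act h) (i, m' + N, a) (i + N, m', a + K) :: ('k, 'n) a1 set) \<noteq> {}" for a
    proof (rule induced1_nonempty[OF act_wlinear])
      show "\<exists>b. act h ` lat (int i) (int (m' + N)) (- int b) \<subseteq> lat (int (i + N)) (int m') (- int b')" for b'
        using K[of "- int (b' + K)"] by (intro exI[of _ "b' + K"]) simp
      show "act h ` lat (int i) (int (m' + N)) (int a) \<subseteq> lat (int (i + N)) (int m') (int (a + K))"
        using K[of "int a"] by simp
    qed
    then have "(induced2 (act h) (i, m' + N) (i + N, m') :: ('k, 'n) a2 set) \<noteq> {}"
      by (intro induced2_nonempty[OF act_wlinear]) blast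
    then show "\<exists>m. (induced2 (act h) (i, m) (i + N, m') :: ('k, 'n) a2 set) \<noteq> {}" by blast
  qed
  then have "\<exists>j. (induced3 (act h) i j :: ('k, 'n) a3 set) \<noteq> {}" for i by blast
  from lift_nonempty[OF act_wlinear this] show ?thesis by (simp add: lift_def induced4_def)
qed

text \<open>Uniqueness of induced arrows makes \<open>\<iota>\<^sub>H\<close> multiplicative, and invertible matrices then induce
  automorphisms.\<close>

lemma iotaH_hom:
  fixes h h' :: "('k::field, 'n::finite) hmat"
  shows "h \<in> carrier HG \<Longrightarrow> iotaH h \<in> carrier AutW"
    and "iotaH (h \<otimes>\<^bsub>HG\<^esub> h') = iotaH h \<otimes>\<^bsub>AutW\<^esub> iotaH h'"
    and "iotaH (\<one>\<^bsub>HG\<^esub> :: ('k, 'n) hmat) = \<one>\<^bsub>AutW\<^esub>"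
proof -
  obtain S where S: "induced_ind_family S (pro_cat (tate vectW)) (W3 :: _ \<Rightarrow> ('k::field, 'n::finite) o3) wlinear (\<circ>) id induced3
     (\<lambda>(_ :: unit) i. i) (\<lambda>_. W4)" using induced_ind_family_4 by blast
  interpret I: induced_ind_family S "pro_cat (tate vectW)" "W3 :: _ \<Rightarrow> ('k::field, 'n::finite) o3" wlinear "(\<circ>)" id induced3
     "\<lambda>(_ :: unit) i. i" "\<lambda>_. W4" by (rule S)
  have l: "I.lift = (\<lambda>\<phi> _ _. induced4 \<phi>)" by (intro ext) (simp add: I.lift_def induced4_def)
  interpret J: induced_family "I.diagrams" "two_tate :: (('k, 'n) o4, ('k, 'n) a4) excat" "\<lambda>_ :: unit. W4" wlinear "(\<circ>)" id
     "\<lambda>\<phi> _ _. induced4 \<phi>"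
    by (rule induced_family_cong[OF I.induced_family_lift[unfolded l]])
      (simp_all add: two_tate_def tate_el_def full_sub_def)
  have mem: "iotaH h \<in> induced4 (act h)" for h :: "('k, 'n) hmat"
  proof -
    obtain f :: "('k, 'n) a4" where "f \<in> induced4 (act h)" using induced4_act by blast
    then have "induced4 (act h) = {f}" using J.R_unique[OF act_wlinear] by blast
    then show ?thesis by (simp add: iotaH_def act_def[symmetric] split: prod.split)
  qed
  have sel: "carrier AutW = {f. is_iso two_tate W4 W4 f}" "f \<otimes>\<^bsub>AutW\<^esub> g = Cmp two_tate W4 W4 W4 f g"
    "\<one>\<^bsub>AutW\<^esub> = Idn two_tate W4" for f g :: "('k, 'n) a4"
    by (simp_all add: AutW_def aut_group_def)
  have mult: "iotaH (h \<otimes>\<^bsub>HG\<^esub> h') = iotaH h \<otimes>\<^bsub>AutW\<^esub> iotaH h'" for h h' :: "('k, 'n) hmat"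
  proof -
    have "Cmp two_tate W4 W4 W4 (iotaH h) (iotaH h') \<in> induced4 (act h \<circ> act h')"
      by (rule J.R_cmp[OF act_wlinear act_wlinear mem mem])
    then show ?thesis
      using J.R_unique[OF act_wlinear mem[of "h \<otimes>\<^bsub>HG\<^esub> h'"]] unfolding act_mult sel by blast
  qed
  then show "iotaH (h \<otimes>\<^bsub>HG\<^esub> h') = iotaH h \<otimes>\<^bsub>AutW\<^esub> iotaH h'" .
  have one: "iotaH (\<one>\<^bsub>HG\<^esub> :: ('k, 'n) hmat) = \<one>\<^bsub>AutW\<^esub>"
    using J.R_unique[OF act_wlinear mem[of "\<one>\<^bsub>HG\<^esub>"]] J.R_id unfolding act_one sel by blast
  then show "iotaH (\<one>\<^bsub>HG\<^esub> :: ('k, 'n) hmat) = \<one>\<^bsub>AutW\<^esub>" .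
  interpret group "HG :: ('k, 'n) hmat monoid" by (rule group_HG)
  assume h: "h \<in> carrier HG"
  have hom: "iotaH g \<in> Hom two_tate W4 W4" for g :: "('k, 'n) hmat" using J.R_hom[OF act_wlinear mem] by blast
  show "iotaH h \<in> carrier AutW"
  proof -
    have "Cmp two_tate W4 W4 W4 (iotaH (inv\<^bsub>HG\<^esub> h)) (iotaH h) = Idn two_tate W4"
      using mult[of "inv\<^bsub>HG\<^esub> h" h] one unfolding l_inv[OF h] sel by simp
    moreover have "Cmp two_tate W4 W4 W4 (iotaH h) (iotaH (inv\<^bsub>HG\<^esub> h)) = Idn two_tate W4"
      using mult[of h "inv\<^bsub>HG\<^esub> h"] one unfolding r_inv[OF h] sel by simp
    ultimately show ?thesis unfolding sel is_iso_def using hom by blast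
  qed
qed

section \<open>The congruence subgroups\<close>

lemma regular_fps:
  assumes "\<And>l. l < 0 \<Longrightarrow> fls_nth f l = 0" shows "fps_to_fls (fls_regpart f) = f"
proof (cases "f = 0")
  case False
  then have "0 \<le> fls_subdegree f" using assms by (intro fls_subdegree_geI) auto
  then show ?thesis by simp
qed simp

lemma mult_nth_0:
  fixes f g :: "'a::comm_ring_1 fls"
  assumes "\<And>l. l < 0 \<Longrightarrow> fls_nth f l = 0" "\<And>l. l < 0 \<Longrightarrow> fls_nth g l = 0"
  shows "fls_nth (f * g) 0 = fls_nth f 0 * fls_nth g 0"
proof -
  have "f * g = fps_to_fls (fls_regpart f * fls_regpart g)"
    by (simp only: fls_times_fps_to_fls regular_fps[OF assms(1)] regular_fps[OF assms(2)])
  then show ?thesis by (simp add: fps_mult_nth_0)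
qed

lemma O2_iff: "f \<in> O2 \<longleftrightarrow> (\<forall>l<0. fls_nth f l = 0) \<and> (\<forall>c<0. fls_nth (fls_nth f 0) c = 0)"
proof
  assume "f \<in> O2"
  then obtain a b where f: "f = fls_const (fps_to_fls a) + tF * fps_to_fls b" by (auto simp: O2_def)
  show "(\<forall>l<0. fls_nth f l = 0) \<and> (\<forall>c<0. fls_nth (fls_nth f 0) c = 0)"
    by (auto simp: f tF_def fls_X_times_conv_shift)
next
  assume f: "(\<forall>l<0. fls_nth f l = 0) \<and> (\<forall>c<0. fls_nth (fls_nth f 0) c = 0)"
  let ?g = "fls_shift 1 (f - fls_const (fls_nth f 0))"
  have "fps_to_fls (fls_regpart (fls_nth f 0)) = fls_nth f 0" using f by (intro regular_fps) auto
  moreover have "fps_to_fls (fls_regpart ?g) = ?g"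
  proof (rule regular_fps)
    show "fls_nth ?g l = 0" if "l < 0" for l using f that by (cases "l = - 1") simp_all
  qed
  moreover have "f = fls_const (fls_nth f 0) + tF * ?g" by (simp add: tF_def fls_X_times_conv_shift)
  ultimately show "f \<in> O2" unfolding O2_def by (metis (mono_tags, lifting) mem_Collect_eq)
qed

lemma O2_ring:
  "0 \<in> O2" "x \<in> O2 \<Longrightarrow> y \<in> O2 \<Longrightarrow> x + y \<in> O2" "x \<in> O2 \<Longrightarrow> - x \<in> O2"
  "x \<in> O2 \<Longrightarrow> y \<in> O2 \<Longrightarrow> x * y \<in> O2" "1 \<in> O2"
proof -
  show "x * y \<in> O2" if "x \<in> O2" "y \<in> O2"
    using that vanish_mult[of 0 x 0 y] vanish_mult[of 0 "fls_nth x 0" 0 "fls_nth y 0"]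
    by (auto simp: O2_iff mult_nth_0)
qed (auto simp: O2_iff)

lemma O2_uF_tF: "uF \<in> O2" "tF \<in> O2"
  by (auto simp: O2_iff uF_def tF_def)

lemma O2_power: "x \<in> O2 \<Longrightarrow> x ^ n \<in> O2"
  by (induction n) (auto simp: O2_ring)

definition uti :: "nat \<Rightarrow> nat \<Rightarrow> 'k::field F2 set" where
  "uti i j = (\<lambda>x. uF ^ i * tF ^ j * x) ` O2"

lemma uti_ideal:
  "0 \<in> uti i j" "x \<in> uti i j \<Longrightarrow> y \<in> uti i j \<Longrightarrow> x + y \<in> uti i j" "x \<in> uti i j \<Longrightarrow> - x \<in> uti i j"
  "x \<in> uti i j \<Longrightarrow> y \<in> O2 \<Longrightarrow> x * y \<in> uti i j" "x \<in> uti i j \<Longrightarrow> x \<in> O2"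
proof -
  show "0 \<in> uti i j" unfolding uti_def by (rule image_eqI[of _ _ 0]) (auto simp: O2_ring)
  show "x + y \<in> uti i j" if xy: "x \<in> uti i j" "y \<in> uti i j"
  proof -
    obtain z w where "x = uF ^ i * tF ^ j * z" "y = uF ^ i * tF ^ j * w" "z \<in> O2" "w \<in> O2"
      using xy unfolding uti_def by blast
    then show ?thesis
      unfolding uti_def using O2_ring(2) by (intro image_eqI[of _ _ "z + w"]) (auto simp: distrib_left)
  qed
  show "- x \<in> uti i j" if x: "x \<in> uti i j"
  proof -
    obtain z where "x = uF ^ i * tF ^ j * z" "z \<in> O2" using x by (auto simp: uti_def)
    then show ?thesis unfolding uti_def using O2_ring(3) by (intro image_eqI[of _ _ "- z"]) auto
  qed
  show "x * y \<in> uti i j" if x: "x \<in> uti i j" and y: "y \<in> O2"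
  proof -
    obtain z where "x = uF ^ i * tF ^ j * z" "z \<in> O2" using x unfolding uti_def by blast
    then show ?thesis
      unfolding uti_def using O2_ring(4)[OF _ y, of z] by (intro image_eqI[of _ _ "z * y"]) (auto simp: mult.assoc)
  qed
  show "x \<in> O2" if "x \<in> uti i j"
    using that unfolding uti_def by (auto intro!: O2_ring(4) O2_power O2_uF_tF)
qed

lemma uti_vanish:
  assumes "x \<in> uti i j" "1 \<le> j" "l < 1" shows "fls_nth x l = 0"
proof -
  obtain y where x: "x = uF ^ i * tF ^ j * y" and y: "y \<in> O2" using assms(1) by (auto simp: uti_def)
  have "fls_nth (tF ^ j * (uF ^ i * y)) l = 0"
  proof (rule vanish_mult[of 1 _ 0])
    show "fls_nth (tF ^ j :: 'a F2) l = 0" if "l < 1" for l using that assms(2) by (simp add: tF_def)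
    have "uF ^ i * y \<in> O2" using y by (intro O2_ring O2_power O2_uF_tF)
    then show "fls_nth (uF ^ i * y) l = 0" if "l < 0" for l using that by (simp add: O2_iff)
  qed (use assms in simp)
  then show ?thesis by (simp add: x mult.assoc mult.left_commute)
qed

lemma Klevel_iff: "A \<in> Klevel i j \<longleftrightarrow> (\<forall>r s. (A - mat 1) $ r $ s \<in> uti i j)"
proof
  assume "\<forall>r s. (A - mat 1) $ r $ s \<in> uti i j"
  then show "A \<in> Klevel i j" unfolding Klevel_def uti_def by (intro CollectI exI[of _ "A - mat 1"]) auto
qed (auto simp: Klevel_def uti_def)

lemma vanish_sum: "(\<And>s. s \<in> A \<Longrightarrow> fls_nth (f s) l = 0) \<Longrightarrow> fls_nth (sum f A) l = 0"
  by (induction A rule: infinite_finite_induct) auto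

lemma uti_sum: "(\<And>s. s \<in> A \<Longrightarrow> f s \<in> uti i j) \<Longrightarrow> sum f A \<in> uti i j"
  by (induction A rule: infinite_finite_induct) (auto simp: uti_ideal)

lemma matrix_add_rdistrib:
  fixes C :: "('a::semiring_1, 'n::finite) vec ^ 'm::finite"
  shows "(A + B) ** C = A ** C + B ** C"
  by (simp add: matrix_matrix_mult_def vec_eq_iff sum.distrib distrib_right)

text \<open>A matrix \<open>1 + M\<close> with \<open>M\<close> divisible by \<open>t\<close> is injective: \<open>(1 + M) x = 0\<close> gives \<open>x = - M x\<close>, so that
  \<open>x\<close> is divisible by every power of \<open>t\<close>.\<close>

lemma Klevel_invertible:
  fixes A :: "'k::field F2 ^ 'n ^ 'n::finite"
  assumes A: "A \<in> Klevel i j" and j: "1 \<le> j"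
  shows "invertible A"
proof -
  define M where "M = A - mat 1"
  have M: "fls_nth (M $ r $ s) l = 0" if "l < 1" for r s l
    using uti_vanish[OF _ j that] A unfolding Klevel_iff M_def by blast
  have "x = 0" if x: "A *v x = 0" for x
  proof -
    have eq: "x $ r = - (\<Sum>s\<in>UNIV. M $ r $ s * x $ s)" for r
    proof -
      have "x + M *v x = 0" using x by (simp add: M_def matrix_vector_mult_diff_rdistrib)
      then have "(x + M *v x) $ r = 0" by simp
      then show ?thesis by (simp add: matrix_vector_mult_def eq_neg_iff_add_eq_0)
    qed
    obtain p where p: "\<And>r l. l < p \<Longrightarrow> fls_nth (x $ r) l = 0"
    proof (rule that[of "Min ((\<lambda>r. fls_subdegree (x $ r)) ` UNIV)"])
      fix r l assume "l < Min ((\<lambda>r. fls_subdegree (x $ r)) ` UNIV)"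
      then show "fls_nth (x $ r) l = 0" by (intro fls_eq0_below_subdegree) auto
    qed
    \<comment> \<open>each application of \<open>x = - M x\<close> raises the order of \<open>x\<close> in \<open>t\<close> by one\<close>
    have all: "\<forall>r l. l < p + int k \<longrightarrow> fls_nth (x $ r) l = 0" for k
    proof (induction k)
      case (Suc k)
      have "fls_nth (M $ r $ s * x $ s) l = 0" if "l < p + int (Suc k)" for r s l
        using M Suc that by (intro vanish_mult[of 1 _ "p + int k"]) auto
      then show ?case by (subst eq) (auto intro: vanish_sum)
    qed (use p in simp)
    have "fls_nth (x $ r) l = 0" for r l
    proof -
      have "l < p + int (nat (l - p + 1))" by simp
      then show ?thesis using all by blast
    qed
    then show "x = 0" by (simp add: vec_eq_iff fls_eq_iff)
  qed
  then show ?thesis using matrix_left_invertible_ker[of A] unfolding invertible_left_inverse by blast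
qed

text \<open>The inverse \<open>B = 1 - M B\<close> has no denominators in \<open>t\<close>, because multiplication by \<open>M\<close> raises the order in
  \<open>t\<close>. Then \<open>B\<close> is congruent to \<open>1\<close> modulo \<open>t\<close>, so its entries are in \<open>O\<^sub>2\<close>.\<close>

lemma Klevel_inverse:
  fixes A B :: "'k::field F2 ^ 'n ^ 'n::finite"
  assumes A: "A \<in> Klevel i j" and j: "1 \<le> j" and AB: "A ** B = mat 1"
  shows "B \<in> Klevel i j"
proof -
  define M where "M = A - mat 1"
  have Mu: "M $ r $ s \<in> uti i j" for r s using A unfolding Klevel_iff M_def by blast
  have M: "fls_nth (M $ r $ s) l = 0" if "l < 1" for r s l using uti_vanish[OF Mu j that] .
  have "B + M ** B = mat 1" using AB matrix_add_rdistrib[of "mat 1" M B] by (simp add: M_def)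
  then have eq: "B - mat 1 = - (M ** B)" by (simp add: algebra_simps)
  have eq': "B $ r $ s = mat 1 $ r $ s - (\<Sum>k\<in>UNIV. M $ r $ k * B $ k $ s)" for r s
    using arg_cong[OF eq, of "\<lambda>X. X $ r $ s"] by (simp add: matrix_matrix_mult_def algebra_simps)
  have one: "fls_nth ((mat 1 :: 'k F2 ^ 'n ^ 'n) $ r $ s) l = 0" if "l < 0" for r s l
    using that by (simp add: mat_def)
  obtain p where p: "\<And>r s l. l < p \<Longrightarrow> fls_nth (B $ r $ s) l = 0"
  proof (rule that[of "Min (range (\<lambda>(r, s). fls_subdegree (B $ r $ s)))"])
    fix r s l assume "l < Min (range (\<lambda>(r, s). fls_subdegree (B $ r $ s)))"
    also have "\<dots> \<le> fls_subdegree (B $ r $ s)" by (intro Min_le) auto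
    finally show "fls_nth (B $ r $ s) l = 0" by (rule fls_eq0_below_subdegree)
  qed
  \<comment> \<open>each use of \<open>B = 1 - M B\<close> raises the lower bound \<open>p\<close> for the order in \<open>t\<close> by one, up to the order \<open>0\<close> of \<open>1\<close>\<close>
  have "\<forall>r s l. l < min 0 (p + int k) \<longrightarrow> fls_nth (B $ r $ s) l = 0" for k
  proof (induction k)
    case (Suc k)
    have "fls_nth (M $ r $ k' * B $ k' $ s) l = 0" if "l < min 0 (p + int (Suc k))" for r s k' l
      using M Suc that by (intro vanish_mult[of 1 _ "min 0 (p + int k)"]) auto
    then show ?case using one by (subst eq') (auto intro: vanish_sum)
  qed (use p in simp)
  from this[of "nat (- p)"] have B: "fls_nth (B $ r $ s) l = 0" if "l < 0" for r s l using that by simp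
  have MB: "fls_nth (M $ r $ k * B $ k $ s) l = 0" if "l < 1" for r k s l
    using M B that by (intro vanish_mult[of 1 _ 0]) auto
  have "fls_nth (B $ r $ s) 0 = fls_nth (mat 1 $ r $ s) 0" for r s
    by (subst eq') (simp add: vanish_sum[OF MB])
  then have "B $ r $ s \<in> O2" for r s
    using B by (auto simp: O2_iff mat_def)
  then have "M $ r $ k * B $ k $ s \<in> uti i j" for r k s using uti_ideal(4)[OF Mu] by blast
  then show ?thesis
    unfolding Klevel_iff eq by (auto simp: matrix_matrix_mult_def intro!: uti_ideal(3) uti_sum)
qed

lemma Klevel_mult:
  fixes A B :: "'k::field F2 ^ 'n ^ 'n::finite"
  assumes "A \<in> Klevel i j" "B \<in> Klevel i j" shows "A ** B \<in> Klevel i j"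
proof -
  have eq: "A ** B - mat 1 = (A - mat 1) + (B - mat 1) + (A - mat 1) ** (B - mat 1)"
    using matrix_add_rdistrib[of "mat 1" "A - mat 1" B] matrix_add_ldistrib[of "A - mat 1" "mat 1" "B - mat 1"]
    by simp
  have "(A - mat 1) $ r $ k * (B - mat 1) $ k $ s \<in> uti i j" for r k s
    using assms uti_ideal(4,5) unfolding Klevel_iff by blast
  then have "((A - mat 1) ** (B - mat 1)) $ r $ s \<in> uti i j" for r s
    by (auto simp: matrix_matrix_mult_def intro!: uti_sum)
  then show ?thesis
    using assms unfolding Klevel_iff eq vector_add_component by (intro allI uti_ideal(2)) auto
qed

lemma subgroup_Klevel:
  assumes "1 \<le> j" shows "subgroup (Klevel i j :: ('k::field F2 ^ 'n ^ 'n::finite) set) GL"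
proof -
  interpret group "GL :: ('k F2 ^ 'n ^ 'n) monoid" by (rule group_GL)
  have sub: "Klevel i j \<subseteq> carrier (GL :: ('k F2 ^ 'n ^ 'n) monoid)"
    using Klevel_invertible assms by (auto simp: GL_sel)
  show ?thesis
  proof (rule subgroupI[OF sub])
    show "Klevel i j \<noteq> ({} :: ('k F2 ^ 'n ^ 'n) set)"
      using Klevel_iff[of "mat 1" i j] by (auto simp: uti_ideal)
    fix A :: "'k F2 ^ 'n ^ 'n" assume A: "A \<in> Klevel i j"
    then have "A \<otimes>\<^bsub>GL\<^esub> inv\<^bsub>GL\<^esub> A = \<one>\<^bsub>GL\<^esub>" using sub by (intro r_inv) blast
    then show "inv\<^bsub>GL\<^esub> A \<in> Klevel i j" using Klevel_inverse[OF A assms] by (simp add: GL_sel)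
    fix B :: "'k F2 ^ 'n ^ 'n" assume "B \<in> Klevel i j"
    with A show "A \<otimes>\<^bsub>GL\<^esub> B \<in> Klevel i j" by (simp add: GL_sel Klevel_mult)
  qed
qed

lemma subgroup_Cdbl: "1 \<le> j \<Longrightarrow> subgroup (Cdbl i j) HG"
  unfolding Cdbl_def HG_def by (intro DirProd_subgroups subgroup_Klevel group_GL)

section \<open>Conjugation and cosets\<close>

context group
begin

text \<open>The operation \<open>conjH\<close> in an arbitrary group.\<close>

definition cnj :: "'a \<Rightarrow> 'a set \<Rightarrow> 'a set" where
  "cnj h C = (h <# C) #> inv h"

lemma cnj_iff: "x \<in> cnj h C \<longleftrightarrow> (\<exists>c\<in>C. x = h \<otimes> c \<otimes> inv h)"
  by (auto simp: cnj_def l_coset_def r_coset_def)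

lemma inv_cancel [simp]:
  assumes "h \<in> carrier G" "x \<in> carrier G"
  shows "inv h \<otimes> (h \<otimes> x) = x" "h \<otimes> (inv h \<otimes> x) = x"
  using assms by (simp_all add: m_assoc[symmetric])

lemma cnj_image: "cnj h C = (\<lambda>c. h \<otimes> c \<otimes> inv h) ` C"
  by (auto simp: cnj_iff)

lemma cnj_closed_iff:
  assumes "h \<in> carrier G" "C \<subseteq> carrier G" "x \<in> carrier G"
  shows "x \<in> cnj h C \<longleftrightarrow> inv h \<otimes> x \<otimes> h \<in> C"
proof
  assume "x \<in> cnj h C"
  then obtain c where c: "c \<in> C" "x = h \<otimes> c \<otimes> inv h" by (auto simp: cnj_iff)
  moreover have "c \<in> carrier G" using c assms(2) by blast
  ultimately have "inv h \<otimes> x \<otimes> h = c" using assms(1) by (simp add: m_assoc)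
  then show "inv h \<otimes> x \<otimes> h \<in> C" using c by simp
next
  assume "inv h \<otimes> x \<otimes> h \<in> C"
  moreover have "x = h \<otimes> (inv h \<otimes> x \<otimes> h) \<otimes> inv h" using assms by (simp add: m_assoc)
  ultimately show "x \<in> cnj h C" unfolding cnj_iff by blast
qed

lemma cnj_subset: "h \<in> carrier G \<Longrightarrow> C \<subseteq> carrier G \<Longrightarrow> cnj h C \<subseteq> carrier G"
  by (auto simp: cnj_iff subset_iff)

lemma cnj_one: "C \<subseteq> carrier G \<Longrightarrow> cnj \<one> C = C"
  by (auto simp: cnj_iff subset_iff)

lemma cnj_cnj:
  assumes "g \<in> carrier G" "h \<in> carrier G" "C \<subseteq> carrier G"
  shows "cnj g (cnj h C) = cnj (g \<otimes> h) C"
proof -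
  have "g \<otimes> (h \<otimes> c \<otimes> inv h) \<otimes> inv g = g \<otimes> h \<otimes> c \<otimes> inv (g \<otimes> h)" if "c \<in> C" for c
  proof -
    have "c \<in> carrier G" using that assms(3) by blast
    then show ?thesis using assms(1,2) by (simp add: m_assoc inv_mult_group)
  qed
  then show ?thesis unfolding cnj_image image_image by (rule image_cong[OF refl])
qed

lemma cnj_Inter:
  assumes "h \<in> carrier G" "\<D> \<noteq> {}" "\<And>D. D \<in> \<D> \<Longrightarrow> D \<subseteq> carrier G"
  shows "cnj h (\<Inter>\<D>) = \<Inter>(cnj h ` \<D>)"
proof -
  have sub: "\<Inter>\<D> \<subseteq> carrier G" using assms by blast
  have "x \<in> cnj h (\<Inter>\<D>) \<longleftrightarrow> x \<in> \<Inter>(cnj h ` \<D>)" for x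
  proof (cases "x \<in> carrier G")
    case True
    then show ?thesis using assms cnj_closed_iff[OF assms(1) sub True] cnj_closed_iff[OF assms(1) assms(3) True] by auto
  next
    case False
    then show ?thesis using cnj_subset[OF assms(1) sub] cnj_subset[OF assms(1,3)] assms(2) by blast
  qed
  then show ?thesis by blast
qed

lemma subgroup_cnj:
  assumes "h \<in> carrier G" "subgroup C G" shows "subgroup (cnj h C) G"
proof -
  interpret C: subgroup C G by fact
  show ?thesis
  proof (rule subgroupI)
    show "cnj h C \<subseteq> carrier G" by (rule cnj_subset[OF assms(1) C.subset])
    show "cnj h C \<noteq> {}" using C.one_closed cnj_iff by blast
    fix a assume "a \<in> cnj h C"
    then obtain c where c: "c \<in> C" "a = h \<otimes> c \<otimes> inv h" by (auto simp: cnj_iff)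
    then have "inv a = h \<otimes> inv c \<otimes> inv h" using assms(1) by (simp add: inv_mult_group m_assoc)
    then show "inv a \<in> cnj h C" using c by (auto simp: cnj_iff)
    fix b assume "b \<in> cnj h C"
    then obtain d where d: "d \<in> C" "b = h \<otimes> d \<otimes> inv h" by (auto simp: cnj_iff)
    have "a \<otimes> b = h \<otimes> (c \<otimes> d) \<otimes> inv h"
      using c d assms(1) by (simp add: m_assoc)
    then show "a \<otimes> b \<in> cnj h C" using c d by (auto simp: cnj_iff)
  qed
qed

lemma cnj_self:
  assumes "subgroup C G" "h \<in> C" shows "cnj h C = C"
proof -
  interpret C: subgroup C G by fact
  have h: "h \<in> carrier G" using assms(2) by simp
  have "x \<in> cnj h C \<longleftrightarrow> x \<in> C" if x: "x \<in> carrier G" for x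
  proof
    assume "x \<in> cnj h C"
    then show "x \<in> C" using assms(2) by (auto simp: cnj_iff)
  next
    assume "x \<in> C"
    then show "x \<in> cnj h C" using assms(2) h x by (simp add: cnj_closed_iff C.subset)
  qed
  then show ?thesis using cnj_subset[OF h C.subset] C.subset by blast
qed

lemma lcosetsE:
  assumes "s \<in> lcosets C" obtains g where "g \<in> carrier G" "s = g <# C"
  using assms by (auto simp: LCOSETS_def)

lemma lcosetsI: "g \<in> carrier G \<Longrightarrow> g <# C \<in> lcosets C"
  by (auto simp: LCOSETS_def)

lemma lcos_absorb:
  assumes D: "subgroup D G" and C: "subgroup C G" and "D \<subseteq> C" and g: "g \<in> carrier G"
  shows "(g <# D) <#> C = g <# C"
proof -
  have "D <#> C = C"
  proof
    show "D <#> C \<subseteq> C" using subgroup.m_closed[OF C] assms(3) unfolding set_mult_def by blast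
    show "C \<subseteq> D <#> C"
    proof
      fix c assume c: "c \<in> C"
      then have "\<one> \<otimes> c = c" using subgroup.mem_carrier[OF C] by simp
      then show "c \<in> D <#> C" using subgroup.one_closed[OF D] c unfolding set_mult_def by force
    qed
  qed
  then show ?thesis
    using setmult_lcos_assoc[of D C g] subgroup.subset[OF C] subgroup.subset[OF D] g by simp
qed

lemma lcos_translate:
  assumes "C \<subseteq> carrier G" "g \<in> carrier G" "h \<in> carrier G"
  shows "(g <# cnj h C) #> h = (g \<otimes> h) <# C"
proof -
  have "g \<otimes> (h \<otimes> c \<otimes> inv h) \<otimes> h = g \<otimes> h \<otimes> c" if "c \<in> C" for c
  proof -
    have "c \<in> carrier G" using that assms(1) by blast
    then show ?thesis using assms(2,3) by (simp add: m_assoc)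
  qed
  then show ?thesis
    unfolding l_coset_def r_coset_def cnj_image UNION_singleton_eq_range image_image by (rule image_cong[OF refl])
qed

end

section \<open>The family of levels\<close>

interpretation HG: group HG by (rule group_HG)

lemma conjH_eq: "conjH = HG.cnj"
  by (intro ext) (simp add: conjH_def HG.cnj_def)

definition basic_levels :: "('k::field, 'n::finite) hmat set set" where
  "basic_levels = {conjH h (Cdbl i j) | h i j. h \<in> carrier HG \<and> 1 \<le> i \<and> 1 \<le> j}"

lemma CH_eq: "CH = {\<Inter>\<D> | \<D>. finite \<D> \<and> \<D> \<noteq> {} \<and> \<D> \<subseteq> basic_levels}"
  by (simp only: CH_def basic_levels_def)

lemma CH_subgroup:
  assumes "C \<in> CH" shows "subgroup C HG"
proof -
  obtain \<D> where C: "C = \<Inter>\<D>" and D: "\<D> \<noteq> {}" "\<D> \<subseteq> basic_levels" using assms unfolding CH_eq by blast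
  have "subgroup E HG" if E: "E \<in> \<D>" for E
  proof -
    obtain h i j where h: "E = conjH h (Cdbl i j)" "h \<in> carrier HG" "1 \<le> j" using E D(2) unfolding basic_levels_def by blast
    show ?thesis unfolding h(1) conjH_eq by (rule HG.subgroup_cnj[OF h(2) subgroup_Cdbl[OF h(3)]])
  qed
  then show ?thesis unfolding C using D(1) by (intro HG.subgroups_Inter)
qed

lemma CH_carrier: "C \<in> CH \<Longrightarrow> C \<subseteq> carrier HG"
  by (rule subgroup.subset[OF CH_subgroup])

lemma CH_Int:
  assumes "C \<in> CH" "D \<in> CH" shows "C \<inter> D \<in> CH"
proof -
  obtain \<C> where C: "C = \<Inter>\<C>" "finite \<C>" "\<C> \<noteq> {}" "\<C> \<subseteq> basic_levels" using assms(1) unfolding CH_eq by blast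
  obtain \<D> where D: "D = \<Inter>\<D>" "finite \<D>" "\<D> \<subseteq> basic_levels" using assms(2) unfolding CH_eq by blast
  have "C \<inter> D = \<Inter>(\<C> \<union> \<D>)" unfolding C(1) D(1) by (rule Inter_Un_distrib[symmetric])
  moreover have "finite (\<C> \<union> \<D>)" "\<C> \<union> \<D> \<noteq> {}" "\<C> \<union> \<D> \<subseteq> basic_levels" using C D by simp_all
  ultimately show ?thesis unfolding CH_eq by blast
qed

lemma CH_conj:
  assumes "C \<in> CH" "h \<in> carrier HG" shows "conjH h C \<in> CH"
proof -
  obtain \<C> where C: "C = \<Inter>\<C>" "finite \<C>" "\<C> \<noteq> {}" "\<C> \<subseteq> basic_levels" using assms(1) unfolding CH_eq by blast
  have sub: "Cdbl i j \<subseteq> carrier HG" if "1 \<le> j" for i j using subgroup.subset[OF subgroup_Cdbl[OF that]] .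
  have *: "D \<subseteq> carrier HG \<and> conjH h D \<in> basic_levels" if D: "D \<in> \<C>" for D
  proof -
    obtain g i j where g: "D = conjH g (Cdbl i j)" "g \<in> carrier HG" "1 \<le> i" "1 \<le> j" using D C(4) unfolding basic_levels_def by blast
    then have "conjH h D = conjH (h \<otimes>\<^bsub>HG\<^esub> g) (Cdbl i j)"
      unfolding conjH_eq using HG.cnj_cnj[OF assms(2) g(2) sub[OF g(4)]] by simp
    moreover have "h \<otimes>\<^bsub>HG\<^esub> g \<in> carrier HG" using assms(2) g(2) by (rule HG.m_closed)
    ultimately have "conjH h D \<in> basic_levels" using g(3,4) unfolding basic_levels_def by blast
    then show ?thesis using HG.cnj_subset[OF g(2) sub[OF g(4)]] unfolding g(1) conjH_eq by blast
  qed
  then have "conjH h C = \<Inter>(conjH h ` \<C>)"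
    unfolding conjH_eq C(1) using C(3) assms(2) by (intro HG.cnj_Inter) blast+
  moreover have "finite (conjH h ` \<C>)" "conjH h ` \<C> \<noteq> {}" "conjH h ` \<C> \<subseteq> basic_levels" using C * by auto
  ultimately show ?thesis unfolding CH_eq by blast
qed

lemma upper_triangular_mult:
  fixes A B :: "(('f::field, 'm::{finite,linorder}) vec, 'm) vec"
  assumes A: "upper_triangular A" and B: "upper_triangular B"
  shows "upper_triangular (A ** B)"
  unfolding upper_triangular_def
proof (intro allI impI)
  fix r s :: 'm assume "s < r"
  then have "A $ r $ k * B $ k $ s = 0" for k
    using A B unfolding upper_triangular_def by (cases "k < r") auto
  then show "(A ** B) $ r $ s = 0" by (simp only: matrix_matrix_mult_def vec_lambda_beta sum.neutral_const)
qed

lemma BH_group: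
  "\<one>\<^bsub>HG\<^esub> \<in> BH" "b \<in> BH \<Longrightarrow> b \<in> carrier HG" "\<lbrakk>b \<in> BH; b' \<in> BH\<rbrakk> \<Longrightarrow> b \<otimes>\<^bsub>HG\<^esub> b' \<in> BH"
proof -
  show "\<lbrakk>b \<in> BH; b' \<in> BH\<rbrakk> \<Longrightarrow> b \<otimes>\<^bsub>HG\<^esub> b' \<in> BH"
    using HG.m_closed[of b b'] by (auto simp: BH_def upper_triangular_mult HG_sel(1))
  show "\<one>\<^bsub>HG\<^esub> \<in> BH" using HG.one_closed by (auto simp: BH_def upper_triangular_def HG_sel(2) mat_def)
qed (auto simp: BH_def)

section \<open>Linear categories of families\<close>

locale lin_category = closed_lincat A for A :: "('o, 'a, 's::zero) lincat" +
  assumes add_left: "\<lbrakk>w \<in> Ob A; x \<in> Ob A; y \<in> Ob A; e \<in> Hom A w x; f \<in> Hom A x y; g \<in> Hom A x y\<rbrakk> \<Longrightarrow>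
      Cmp A w x y (AAdd A x y f g) e = AAdd A w y (Cmp A w x y f e) (Cmp A w x y g e)"
    and scl_left: "\<lbrakk>w \<in> Ob A; x \<in> Ob A; y \<in> Ob A; e \<in> Hom A w x; f \<in> Hom A x y\<rbrakk> \<Longrightarrow>
      Cmp A w x y (AScl A x y c f) e = AScl A w y c (Cmp A w x y f e)"
    and add_right: "\<lbrakk>x \<in> Ob A; y \<in> Ob A; z \<in> Ob A; f \<in> Hom A x y; g \<in> Hom A x y; e \<in> Hom A y z\<rbrakk> \<Longrightarrow>
      Cmp A x y z e (AAdd A x y f g) = AAdd A x z (Cmp A x y z e f) (Cmp A x y z e g)"
    and scl_right: "\<lbrakk>x \<in> Ob A; y \<in> Ob A; z \<in> Ob A; f \<in> Hom A x y; e \<in> Hom A y z\<rbrakk> \<Longrightarrow>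
      Cmp A x y z e (AScl A x y c f) = AScl A x z c (Cmp A x y z e f)"

lemma (in vec_space) add_interchange:
  assumes "a \<in> Vcar V" "b \<in> Vcar V" "c \<in> Vcar V" "d \<in> Vcar V"
  shows "Vadd V (Vadd V a b) (Vadd V c d) = Vadd V (Vadd V a c) (Vadd V b d)"
proof -
  have "Vadd V (Vadd V a b) (Vadd V c d) = Vadd V a (Vadd V b (Vadd V c d))"
    using assms by (simp add: add_assoc add_closed)
  also have "Vadd V b (Vadd V c d) = Vadd V c (Vadd V b d)"
    using assms add_assoc[of b c d] add_assoc[of c b d] add_comm[of b c] by simp
  finally show ?thesis using assms by (simp add: add_assoc add_closed)
qed

lemma lin_category_vect: "lin_category (vect \<U> :: (('s::field, 'v) vspace, 'v \<Rightarrow> 'v, 's) lincat)"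
proof (unfold_locales; simp add: vect_def)
  fix V :: "('s, 'v) vspace" assume "vec_space V \<and> Vcar V \<in> \<U>"
  then interpret vec_space V by simp
  show "(\<lambda>x\<in>Vcar V. x) \<in> lin_maps V V" by (auto simp: lin_maps_def add_closed scl_closed)
next
  fix U V W :: "('s, 'v) vspace" and f g
  assume U: "vec_space U \<and> Vcar U \<in> \<U>" and fg: "f \<in> lin_maps U V" "g \<in> lin_maps V W"
  then interpret vec_space U by simp
  show "compose (Vcar U) g f \<in> lin_maps U W"
    using fg by (auto simp: lin_maps_def compose_def PiE_def Pi_iff add_closed scl_closed)
next
  fix V W :: "('s, 'v) vspace" and f assume f: "f \<in> lin_maps V W"
  then show "compose (Vcar V) (\<lambda>x\<in>Vcar W. x) f = f" "compose (Vcar V) f (\<lambda>x\<in>Vcar V. x) = f"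
    by (auto simp: lin_maps_def compose_def PiE_def Pi_iff intro!: extensionalityI[of _ "Vcar V"])
next
  fix U V W X :: "('s, 'v) vspace" and f g h :: "'v \<Rightarrow> 'v"
  assume "f \<in> lin_maps U V"
  then show "compose (Vcar U) (compose (Vcar V) h g) f = compose (Vcar U) h (compose (Vcar U) g f)"
    by (auto simp: lin_maps_def compose_def PiE_def Pi_iff intro!: restrict_ext)
next
  fix V W :: "('s, 'v) vspace" and f g
  assume V: "vec_space V \<and> Vcar V \<in> \<U>" and W: "vec_space W \<and> Vcar W \<in> \<U>" and f: "f \<in> lin_maps V W"
  interpret V: vec_space V using V by simp
  interpret W: vec_space W using W by simp
  show "(\<lambda>x\<in>Vcar V. Vscl W c (f x)) \<in> lin_maps V W" for c
    using f by (auto simp: lin_maps_def PiE_def Pi_iff V.add_closed V.scl_closed W.scl_closed W.scl_add_right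
        W.scl_mult[symmetric] mult.commute)
  assume g: "g \<in> lin_maps V W"
  show "(\<lambda>x\<in>Vcar V. Vadd W (f x) (g x)) \<in> lin_maps V W"
    using f g by (auto simp: lin_maps_def PiE_def Pi_iff V.add_closed V.scl_closed W.add_closed W.scl_add_right
        W.add_interchange)
next
  fix U V W :: "('s, 'v) vspace" and e f g
  assume "e \<in> lin_maps U V"
  then have e: "x \<in> Vcar U \<Longrightarrow> e x \<in> Vcar V" for x by (auto simp: lin_maps_def)
  show "compose (Vcar U) (\<lambda>x\<in>Vcar V. Vadd W (f x) (g x)) e =
      (\<lambda>x\<in>Vcar U. Vadd W (compose (Vcar U) f e x) (compose (Vcar U) g e x))"
    using e by (auto simp: compose_def intro!: restrict_ext)
  show "compose (Vcar U) (\<lambda>x\<in>Vcar V. Vscl W c (f x)) e = (\<lambda>x\<in>Vcar U. Vscl W c (compose (Vcar U) f e x))" for c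
    using e by (auto simp: compose_def intro!: restrict_ext)
next
  fix V W X :: "('s, 'v) vspace" and f g e
  assume f: "f \<in> lin_maps V W" and e: "e \<in> lin_maps W X"
  show "compose (Vcar V) e (\<lambda>x\<in>Vcar V. Vscl W c (f x)) = (\<lambda>x\<in>Vcar V. Vscl X c (compose (Vcar V) e f x))" for c
    using f e by (auto simp: compose_def lin_maps_def PiE_def Pi_iff intro!: restrict_ext)
  assume g: "g \<in> lin_maps V W"
  show "compose (Vcar V) e (\<lambda>x\<in>Vcar V. Vadd W (f x) (g x)) =
      (\<lambda>x\<in>Vcar V. Vadd X (compose (Vcar V) e f x) (compose (Vcar V) e g x))"
    using f g e by (auto simp: compose_def lin_maps_def PiE_def Pi_iff intro!: restrict_ext)
qed

lemma lin_category_fun: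
  assumes "lin_category A" shows "lin_category (fun_lincat S A)"
proof -
  interpret lin_category A by fact
  show ?thesis
    by (unfold_locales; simp add: fun_lincat_def)
      (auto simp: PiE_iff Idn_hom Cmp_hom Idn_left Idn_right Cmp_assoc add_hom scl_hom add_left scl_left add_right
        scl_right intro!: restrict_ext extensionalityI[of _ S])
qed

interpretation VC: lin_category "VC \<U> C" for \<U> C
  unfolding VC_def by (intro lin_category_fun lin_category_vect)

definition pull :: "'i set \<Rightarrow> ('i \<Rightarrow> 'j) \<Rightarrow> ('j \<Rightarrow> 'x) \<Rightarrow> 'i \<Rightarrow> 'x" where
  "pull S p V = (\<lambda>s\<in>S. V (p s))"

lemma pull_pull: "p \<in> S \<rightarrow> S' \<Longrightarrow> pull S p (pull S' q V) = pull S (\<lambda>s. q (p s)) V"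
  by (auto simp: pull_def intro!: restrict_ext)

lemma pull_cong: "(\<And>s. s \<in> S \<Longrightarrow> p s = q s) \<Longrightarrow> pull S p V = pull S q V"
  by (auto simp: pull_def intro!: restrict_ext)

lemma pull_ident: "V \<in> extensional S \<Longrightarrow> (\<And>s. s \<in> S \<Longrightarrow> p s = s) \<Longrightarrow> pull S p V = V"
  by (auto simp: pull_def intro!: extensionalityI[of _ S])

context
  fixes S :: "'i set" and S' :: "'j set" and p :: "'i \<Rightarrow> 'j" and A :: "('o, 'a, 's) lincat"
  assumes p: "p \<in> S \<rightarrow> S'"
begin

lemma pull_ob: "V \<in> Ob (fun_lincat S' A) \<Longrightarrow> pull S p V \<in> Ob (fun_lincat S A)"
  using p by (auto simp: fun_lincat_def pull_def)

lemma pull_hom: "f \<in> Hom (fun_lincat S' A) V W \<Longrightarrow> pull S p f \<in> Hom (fun_lincat S A) (pull S p V) (pull S p W)"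
  using p by (auto simp: fun_lincat_def pull_def PiE_iff Pi_iff)

lemma pull_id: "pull S p (Idn (fun_lincat S' A) V) = Idn (fun_lincat S A) (pull S p V)"
  using p by (auto simp: fun_lincat_def pull_def intro!: restrict_ext)

lemma pull_cmp: "pull S p (Cmp (fun_lincat S' A) U V W g f) =
    Cmp (fun_lincat S A) (pull S p U) (pull S p V) (pull S p W) (pull S p g) (pull S p f)"
  using p by (auto simp: fun_lincat_def pull_def intro!: restrict_ext)

lemma pull_add: "pull S p (AAdd (fun_lincat S' A) V W f g) = AAdd (fun_lincat S A) (pull S p V) (pull S p W) (pull S p f) (pull S p g)"
  using p by (auto simp: fun_lincat_def pull_def intro!: restrict_ext)

lemma pull_scl: "pull S p (AScl (fun_lincat S' A) V W c f) = AScl (fun_lincat S A) (pull S p V) (pull S p W) c (pull S p f)"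
  using p by (auto simp: fun_lincat_def pull_def intro!: restrict_ext)

lemma pull_iso: "is_iso (fun_lincat S' A) V W f \<Longrightarrow> is_iso (fun_lincat S A) (pull S p V) (pull S p W) (pull S p f)"
  unfolding is_iso_def using pull_hom by (metis pull_cmp pull_id)

end

section \<open>Equivariant maps of coset spaces\<close>

text \<open>The maps of coset spaces that commute with left translation. The refinement \<open>g D \<mapsto> g C\<close> and the right translation
  by \<open>h\<close> are of this kind, and the constructions at a level are natural for all of them.\<close>

definition coset_map :: "('k::field, 'n::finite) hmat set \<Rightarrow> ('k, 'n) hmat set
    \<Rightarrow> (('k, 'n) hmat set \<Rightarrow> ('k, 'n) hmat set) \<Rightarrow> bool" where
  "coset_map D C p \<longleftrightarrow> p \<in> SH D \<rightarrow> SH C \<and>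
     (\<forall>b\<in>carrier HG. \<forall>s\<in>SH D. p (b <#\<^bsub>HG\<^esub> s) = b <#\<^bsub>HG\<^esub> p s)"

lemma SH_act: "\<lbrakk>C \<in> CH; b \<in> carrier HG; s \<in> SH C\<rbrakk> \<Longrightarrow> b <#\<^bsub>HG\<^esub> s \<in> SH C"
proof -
  assume C: "C \<in> CH" and b: "b \<in> carrier HG" and "s \<in> SH C"
  then obtain g where g: "g \<in> carrier HG" "s = g <#\<^bsub>HG\<^esub> C" by (meson HG.lcosetsE)
  then show ?thesis using HG.lcosetsI[OF HG.m_closed[OF b g(1)]] C b by (simp add: HG.lcos_m_assoc CH_carrier)
qed

lemma SH_carrier: "\<lbrakk>C \<in> CH; s \<in> SH C\<rbrakk> \<Longrightarrow> s \<subseteq> carrier HG"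
  by (auto elim!: HG.lcosetsE dest!: HG.l_coset_subset_G[OF CH_carrier])

lemma coset_map_refine:
  assumes "D \<in> CH" "C \<in> CH" "D \<subseteq> C" shows "coset_map D C (\<lambda>s. s <#>\<^bsub>HG\<^esub> C)"
  unfolding coset_map_def using assms
  by (auto elim!: HG.lcosetsE simp: HG.lcos_absorb CH_subgroup HG.lcos_m_assoc CH_carrier intro: HG.lcosetsI)

lemma coset_map_translate:
  assumes C: "C \<in> CH" and h: "h \<in> carrier HG" shows "coset_map (conjH h C) C (\<lambda>s. s #>\<^bsub>HG\<^esub> h)"
  unfolding coset_map_def
proof (intro conjI funcsetI ballI)
  note [simp] = HG.lcos_translate HG.lcos_m_assoc CH_carrier HG.cnj_subset HG.m_assoc C h HG.lcosetsI
  show "s #>\<^bsub>HG\<^esub> h \<in> SH C" if s: "s \<in> SH (conjH h C)" for s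
  proof -
    obtain g where "g \<in> carrier HG" "s = g <#\<^bsub>HG\<^esub> conjH h C" using s by (rule HG.lcosetsE)
    then show ?thesis by (simp add: conjH_eq)
  qed
  show "(b <#\<^bsub>HG\<^esub> s) #>\<^bsub>HG\<^esub> h = b <#\<^bsub>HG\<^esub> (s #>\<^bsub>HG\<^esub> h)" if b: "b \<in> carrier HG" and s: "s \<in> SH (conjH h C)" for b s
  proof -
    obtain g where "g \<in> carrier HG" "s = g <#\<^bsub>HG\<^esub> conjH h C" using s by (rule HG.lcosetsE)
    then show ?thesis using b by (simp add: conjH_eq)
  qed
qed

lemma coset_map_act:
  assumes "C \<in> CH" "b \<in> carrier HG" shows "(\<lambda>s. b <#\<^bsub>HG\<^esub> s) \<in> SH C \<rightarrow> SH C"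
  using SH_act assms by blast

lemma translate_refine:
  assumes "D \<in> CH" "C \<in> CH" "D \<subseteq> C" "h \<in> carrier HG" "s \<in> SH (conjH h D)"
  shows "(s <#>\<^bsub>HG\<^esub> conjH h C) #>\<^bsub>HG\<^esub> h = (s #>\<^bsub>HG\<^esub> h) <#>\<^bsub>HG\<^esub> C"
proof -
  obtain g where g: "g \<in> carrier HG" "s = g <#\<^bsub>HG\<^esub> conjH h D" using assms(5) by (rule HG.lcosetsE)
  have "conjH h D \<subseteq> conjH h C" using assms(3) unfolding conjH_eq subset_iff HG.cnj_iff by blast
  then show ?thesis
    using assms g CH_conj[OF assms(1,4)] CH_conj[OF assms(2,4)]
    by (simp add: HG.lcos_absorb CH_subgroup) (simp add: conjH_eq HG.lcos_translate HG.lcos_absorb CH_carrier CH_subgroup)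
qed

lemma refine_pull: "refine D C = pull (SH D) (\<lambda>s. s <#>\<^bsub>HG\<^esub> C)"
  and rtrans_pull: "rtrans h C = pull (SH (conjH h C)) (\<lambda>s. s #>\<^bsub>HG\<^esub> h)"
  and shift_pull: "shift C b = pull (SH C) (\<lambda>s. inv\<^bsub>HG\<^esub> b <#\<^bsub>HG\<^esub> s)"
  by (simp_all add: refine_def rtrans_def shift_def pull_def fun_eq_iff)

definition pull_psob :: "('k::field, 'n::{finite,linorder}) hmat set set \<Rightarrow> (('k, 'n) hmat set \<Rightarrow> ('k, 'n) hmat set)
    \<Rightarrow> ('k, 'n, 'v) psob \<Rightarrow> ('k, 'n, 'v) psob" where
  "pull_psob S p X = (pull S p (fst X), \<lambda>b\<in>BH. pull S p (snd X b))"

lemma refine_ob_pull: "refine_ob D C = pull_psob (SH D) (\<lambda>s. s <#>\<^bsub>HG\<^esub> C)"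
  and rtrans_ob_pull: "rtrans_ob h C = pull_psob (SH (conjH h C)) (\<lambda>s. s #>\<^bsub>HG\<^esub> h)"
  by (simp_all add: refine_ob_def rtrans_ob_def pull_psob_def fun_eq_iff refine_pull rtrans_pull)

lemma shift_coset_map:
  assumes "coset_map D C p" "D \<in> CH" "b \<in> carrier HG"
  shows "shift D b (pull (SH D) p V) = pull (SH D) p (shift C b V)"
proof -
  have b: "inv\<^bsub>HG\<^esub> b \<in> carrier HG" using assms(3) by simp
  have p: "p \<in> SH D \<rightarrow> SH C" using assms(1) by (simp add: coset_map_def)
  have e: "p (inv\<^bsub>HG\<^esub> b <#\<^bsub>HG\<^esub> s) = inv\<^bsub>HG\<^esub> b <#\<^bsub>HG\<^esub> p s" if "s \<in> SH D" for s
    using assms(1) b that unfolding coset_map_def by blast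
  show ?thesis
    unfolding shift_pull pull_pull[OF coset_map_act[OF assms(2) b]] pull_pull[OF p]
    by (rule pull_cong) (rule e)
qed

lemma shift_in_VC:
  assumes "C \<in> CH" "b \<in> carrier HG"
  shows "V \<in> Ob (VC \<U> C) \<Longrightarrow> shift C b V \<in> Ob (VC \<U> C)"
    and "f \<in> Hom (VC \<U> C) V W \<Longrightarrow> shift C b f \<in> Hom (VC \<U> C) (shift C b V) (shift C b W)"
    and "shift C b (Cmp (VC \<U> C) U V W g f) = Cmp (VC \<U> C) (shift C b U) (shift C b V) (shift C b W) (shift C b g) (shift C b f)"
    and "shift C b (Idn (VC \<U> C) V) = Idn (VC \<U> C) (shift C b V)"
    and "shift C b (AAdd (VC \<U> C) V W f f') = AAdd (VC \<U> C) (shift C b V) (shift C b W) (shift C b f) (shift C b f')"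
    and "shift C b (AScl (VC \<U> C) V W c f) = AScl (VC \<U> C) (shift C b V) (shift C b W) c (shift C b f)"
  unfolding VC_def shift_pull
  by (rule pull_ob pull_hom pull_cmp pull_id pull_add pull_scl; (assumption | rule coset_map_act[OF assms(1) HG.inv_closed[OF assms(2)]]))+

section \<open>The categories of the principal series at a level\<close>

lemma ps_cat_sel:
  "X \<in> Ob (ps_cat \<alpha> \<U> C) \<longleftrightarrow> is_psob \<alpha> \<U> C X"
  "f \<in> Hom (ps_cat \<alpha> \<U> C) X Y \<longleftrightarrow> f \<in> Hom (VC \<U> C) (fst X) (fst Y) \<and> (\<forall>b\<in>BH.
     Cmp (VC \<U> C) (shift C b (fst X)) (fst X) (fst Y) f (snd X b) =
     Cmp (VC \<U> C) (shift C b (fst X)) (shift C b (fst Y)) (fst Y) (snd Y b) (shift C b f))"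
  "Idn (ps_cat \<alpha> \<U> C) X = Idn (VC \<U> C) (fst X)"
  "Cmp (ps_cat \<alpha> \<U> C) X Y Z g f = Cmp (VC \<U> C) (fst X) (fst Y) (fst Z) g f"
  "AAdd (ps_cat \<alpha> \<U> C) X Y f f' = AAdd (VC \<U> C) (fst X) (fst Y) f f'"
  "AScl (ps_cat \<alpha> \<U> C) X Y c f = AScl (VC \<U> C) (fst X) (fst Y) c f"
  by (cases X; cases Y; simp add: ps_cat_def)+

lemma psobD:
  assumes "is_psob \<alpha> \<U> C X"
  shows "fst X \<in> Ob (VC \<U> C)" "snd X \<in> extensional BH"
    and "b \<in> BH \<Longrightarrow> is_iso (VC \<U> C) (shift C b (fst X)) (fst X) (snd X b)"
    and "b \<in> BH \<Longrightarrow> snd X b \<in> Hom (VC \<U> C) (shift C b (fst X)) (fst X)"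
  using assms by (cases X; auto simp: is_psob_def is_iso_def)+

text \<open>A morphism satisfies, for every \<open>b\<close>, an equation between two composites in \<open>\<V>\<^sub>C\<close>. Since \<open>T\<^sub>b\<close> is a linear functor and
  composition is bilinear, the solutions are closed under composition and form a linear subspace.\<close>

lemma lin_category_ps:
  assumes C: "C \<in> CH" shows "lin_category (ps_cat \<alpha> \<U> C)"
proof -
  note sh = shift_in_VC[OF C BH_group(2)]
  note [simp] = ps_cat_sel psobD sh
  show ?thesis
  proof unfold_locales
    fix X assume "X \<in> Ob (ps_cat \<alpha> \<U> C)"
    then show "Idn (ps_cat \<alpha> \<U> C) X \<in> Hom (ps_cat \<alpha> \<U> C) X X"
      by (simp add: VC.Idn_hom VC.Idn_left[of "shift C _ (fst X)"] VC.Idn_right[of "shift C _ (fst X)"])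
  next
    fix X Y Z f g assume o: "X \<in> Ob (ps_cat \<alpha> \<U> C)" "Y \<in> Ob (ps_cat \<alpha> \<U> C)" "Z \<in> Ob (ps_cat \<alpha> \<U> C)"
      and f: "f \<in> Hom (ps_cat \<alpha> \<U> C) X Y" and g: "g \<in> Hom (ps_cat \<alpha> \<U> C) Y Z"
    let ?c = "Cmp (VC \<U> C)" and ?t = "shift C"
    have "?c (?t b (fst X)) (fst X) (fst Z) (?c (fst X) (fst Y) (fst Z) g f) (snd X b) =
       ?c (?t b (fst X)) (?t b (fst Z)) (fst Z) (snd Z b) (?t b (?c (fst X) (fst Y) (fst Z) g f))" if b: "b \<in> BH" for b
    proof -
      have "?c (?t b (fst X)) (fst X) (fst Z) (?c (fst X) (fst Y) (fst Z) g f) (snd X b) =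
          ?c (?t b (fst X)) (fst Y) (fst Z) g (?c (?t b (fst X)) (fst X) (fst Y) f (snd X b))"
        using o f g b by (intro VC.Cmp_assoc) auto
      also have "\<dots> = ?c (?t b (fst X)) (fst Y) (fst Z) g (?c (?t b (fst X)) (?t b (fst Y)) (fst Y) (snd Y b) (?t b f))"
        using f b by simp
      also have "\<dots> = ?c (?t b (fst X)) (?t b (fst Y)) (fst Z) (?c (?t b (fst Y)) (fst Y) (fst Z) g (snd Y b)) (?t b f)"
        using o f g b by (intro VC.Cmp_assoc[symmetric]) auto
      also have "\<dots> = ?c (?t b (fst X)) (?t b (fst Y)) (fst Z) (?c (?t b (fst Y)) (?t b (fst Z)) (fst Z) (snd Z b) (?t b g)) (?t b f)"
        using g b by simp
      also have "\<dots> = ?c (?t b (fst X)) (?t b (fst Z)) (fst Z) (snd Z b) (?c (?t b (fst X)) (?t b (fst Y)) (?t b (fst Z)) (?t b g) (?t b f))"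
        using o f g b by (intro VC.Cmp_assoc) auto
      finally show ?thesis using b by simp
    qed
    then show "Cmp (ps_cat \<alpha> \<U> C) X Y Z g f \<in> Hom (ps_cat \<alpha> \<U> C) X Z" using o f g by (simp add: VC.Cmp_hom)
  next
    fix X Y f g assume o: "X \<in> Ob (ps_cat \<alpha> \<U> C)" "Y \<in> Ob (ps_cat \<alpha> \<U> C)"
      and f: "f \<in> Hom (ps_cat \<alpha> \<U> C) X Y"
    show "AScl (ps_cat \<alpha> \<U> C) X Y c f \<in> Hom (ps_cat \<alpha> \<U> C) X Y" for c
      using o f by (simp add: VC.scl_hom VC.scl_left[of "shift C _ (fst X)"] VC.scl_right[of "shift C _ (fst X)"])
    assume g: "g \<in> Hom (ps_cat \<alpha> \<U> C) X Y"
    show "AAdd (ps_cat \<alpha> \<U> C) X Y f g \<in> Hom (ps_cat \<alpha> \<U> C) X Y"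
      using o f g by (simp add: VC.add_hom VC.add_left[of "shift C _ (fst X)"] VC.add_right[of "shift C _ (fst X)"])
  qed (simp_all add: VC.Idn_left VC.Idn_right VC.Cmp_assoc VC.add_left VC.add_right VC.scl_left VC.scl_right)
qed

text \<open>Pullback along an equivariant map of coset spaces is a functor between the categories at two levels:
  all conditions on the isomorphisms \<open>\<epsilon>\<^sub>b\<close> are identities between families on the coset space.\<close>

context
  fixes D C :: "('k::field, 'n::{finite,linorder}) hmat set" and p
  assumes D: "D \<in> CH" and C: "C \<in> CH" and p: "coset_map D C p"
begin

lemma pull_shift: "b \<in> BH \<Longrightarrow> shift D b (pull (SH D) p V) = pull (SH D) p (shift C b V)"
  by (rule shift_coset_map[OF p D BH_group(2)])

lemma p_in: "p \<in> SH D \<rightarrow> SH C"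
  using p by (simp add: coset_map_def)

lemma is_psob_pull:
  fixes X :: "('k, 'n, 'v) psob"
  assumes "is_psob \<alpha> \<U> C X" shows "is_psob \<alpha> \<U> D (pull_psob (SH D) p X)"
proof -
  obtain V \<epsilon> where X: "X = (V, \<epsilon>)" by (cases X)
  let ?V = "pull (SH D) p V"
  have iso: "is_iso (VC \<U> C) (shift C b V) V (\<epsilon> b)" if "b \<in> BH" for b using psobD(3)[OF assms that] by (simp add: X)
  have coc: "Cmp (VC \<U> C) (shift C b (shift C b' V)) (shift C (b \<otimes>\<^bsub>HG\<^esub> b') V) V (\<epsilon> (b \<otimes>\<^bsub>HG\<^esub> b')) (muT \<alpha> C b b' V) =
      Cmp (VC \<U> C) (shift C b (shift C b' V)) (shift C b V) V (\<epsilon> b) (shift C b (\<epsilon> b'))" if "b \<in> BH" "b' \<in> BH" for b b'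
    using assms that by (simp add: X is_psob_def)
  have unit: "\<epsilon> \<one>\<^bsub>HG\<^esub> = unitT C V" using assms by (simp add: X is_psob_def)
  have mu: "muT \<alpha> D b b' ?V = pull (SH D) p (muT \<alpha> C b b' V)" if b: "b \<in> BH" "b' \<in> BH" for b b'
    using p_in unfolding muT_def pull_shift[OF b(1)] pull_shift[OF b(2)] pull_shift[OF BH_group(3)[OF b]]
    by (auto simp: pull_def intro!: restrict_ext)
  have un: "unitT D ?V = pull (SH D) p (unitT C V)"
    using p_in unfolding unitT_def pull_shift[OF BH_group(1)] by (auto simp: pull_def intro!: restrict_ext)
  have cmp: "Cmp (VC \<U> D) (pull (SH D) p U) (pull (SH D) p V) (pull (SH D) p W) (pull (SH D) p g) (pull (SH D) p f) =
     pull (SH D) p (Cmp (VC \<U> C) U V W g f)" for U V W :: "('k, 'n, 'v) vfam" and g f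
    unfolding VC_def by (rule pull_cmp[OF p_in, symmetric])
  show ?thesis
    unfolding is_psob_def pull_psob_def X prod.case fst_conv snd_conv
  proof (intro conjI ballI)
    show "?V \<in> Ob (VC \<U> D)" using psobD(1)[OF assms] unfolding VC_def X by (simp add: pull_ob[OF p_in])
    fix b :: "('k, 'n) hmat" assume b: "b \<in> BH"
    show "is_iso (VC \<U> D) (shift D b ?V) ?V ((\<lambda>b\<in>BH. pull (SH D) p (\<epsilon> b)) b)"
      using iso[OF b] b unfolding pull_shift[OF b] VC_def by (simp add: pull_iso[OF p_in])
    fix b' :: "('k, 'n) hmat" assume b': "b' \<in> BH"
    show "Cmp (VC \<U> D) (shift D b (shift D b' ?V)) (shift D (b \<otimes>\<^bsub>HG\<^esub> b') ?V) ?V ((\<lambda>b\<in>BH. pull (SH D) p (\<epsilon> b)) (b \<otimes>\<^bsub>HG\<^esub> b')) (muT \<alpha> D b b' ?V) =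
        Cmp (VC \<U> D) (shift D b (shift D b' ?V)) (shift D b ?V) ?V ((\<lambda>b\<in>BH. pull (SH D) p (\<epsilon> b)) b) (shift D b ((\<lambda>b\<in>BH. pull (SH D) p (\<epsilon> b)) b'))"
      using b b' BH_group(3)[OF b b'] by (simp add: pull_shift mu cmp coc)
  qed (use BH_group(1) unit un in auto)
qed

lemma ps_hom_pull:
  assumes "f \<in> Hom (ps_cat \<alpha> \<U> C) X Y"
  shows "pull (SH D) p f \<in> Hom (ps_cat \<alpha> \<U> D) (pull_psob (SH D) p X) (pull_psob (SH D) p Y)"
proof -
  have "pull (SH D) p f \<in> Hom (VC \<U> D) (pull (SH D) p (fst X)) (pull (SH D) p (fst Y))"
    using assms unfolding ps_cat_sel VC_def by (blast intro: pull_hom[OF p_in])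
  moreover have "Cmp (VC \<U> D) (shift D b (pull (SH D) p (fst X))) (pull (SH D) p (fst X)) (pull (SH D) p (fst Y)) (pull (SH D) p f) (pull (SH D) p (snd X b)) =
     Cmp (VC \<U> D) (shift D b (pull (SH D) p (fst X))) (shift D b (pull (SH D) p (fst Y))) (pull (SH D) p (fst Y)) (pull (SH D) p (snd Y b)) (shift D b (pull (SH D) p f))"
    if "b \<in> BH" for b
    using assms that unfolding ps_cat_sel pull_shift[OF that] VC_def pull_cmp[OF p_in, symmetric] by simp
  ultimately show ?thesis by (simp add: ps_cat_sel pull_psob_def)
qed

lemma ps_ops_pull:
  "pull (SH D) p (Idn (ps_cat \<alpha> \<U> C) X) = Idn (ps_cat \<alpha> \<U> D) (pull_psob (SH D) p X)"
  "pull (SH D) p (Cmp (ps_cat \<alpha> \<U> C) X Y Z g f) = Cmp (ps_cat \<alpha> \<U> D) (pull_psob (SH D) p X) (pull_psob (SH D) p Y)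
     (pull_psob (SH D) p Z) (pull (SH D) p g) (pull (SH D) p f)"
  "pull (SH D) p (AAdd (ps_cat \<alpha> \<U> C) X Y f f') = AAdd (ps_cat \<alpha> \<U> D) (pull_psob (SH D) p X) (pull_psob (SH D) p Y)
     (pull (SH D) p f) (pull (SH D) p f')"
  "pull (SH D) p (AScl (ps_cat \<alpha> \<U> C) X Y c f) = AScl (ps_cat \<alpha> \<U> D) (pull_psob (SH D) p X) (pull_psob (SH D) p Y)
     c (pull (SH D) p f)"
  unfolding ps_cat_sel pull_psob_def fst_conv VC_def
  by (rule pull_id[OF p_in] pull_cmp[OF p_in] pull_add[OF p_in] pull_scl[OF p_in])+

end

section \<open>The category of uniformly smooth objects\<close>

context
  fixes \<alpha> :: "'n::{finite,linorder} \<Rightarrow> Lam" and \<U> :: "'v set set"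
begin

abbreviation usm :: "(('k::field, 'n, 'v) usm_ob, ('k, 'n, 'v) usm_ar, Lam) lincat" where
  "usm \<equiv> usm_cat \<alpha> \<U>"

abbreviation at_level :: "('k::field, 'n) hmat set \<Rightarrow> ('k, 'n, 'v) usm_ob \<Rightarrow> ('k, 'n, 'v) psob" where
  "at_level D X \<equiv> refine_ob D (fst X) (snd X)"

abbreviation germ :: "('k::field, 'n, 'v) usm_ob \<Rightarrow> ('k, 'n, 'v) usm_ob \<Rightarrow> ('k, 'n) hmat set
    \<Rightarrow> ('k, 'n, 'v) varr \<Rightarrow> ('k, 'n, 'v) usm_ar" where
  "germ X Y D f \<equiv> usm_rel \<alpha> \<U> X Y `` {(D, f)}"

lemma usm_ob: "X \<in> Ob usm \<longleftrightarrow> fst X \<in> CH \<and> is_psob \<alpha> \<U> (fst X) (snd X)"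
  by (cases X) (simp add: usm_cat_def ps_cat_sel)

lemma levels_iff: "D \<in> levels C C' \<longleftrightarrow> D \<in> CH \<and> D \<subseteq> C \<and> D \<subseteq> C'"
  by (auto simp: levels_def)

lemma refine_refine:
  assumes "C \<in> CH" "D \<in> CH" "E \<in> CH" "E \<subseteq> D" "D \<subseteq> C"
  shows "refine E D (refine D C V) = refine E C V"
proof -
  have "E \<subseteq> C" using assms by blast
  have p: "(\<lambda>s. s <#>\<^bsub>HG\<^esub> D) \<in> SH E \<rightarrow> SH D"
    using coset_map_refine[OF assms(3,2,4)] by (simp add: coset_map_def)
  show ?thesis
    unfolding refine_pull pull_pull[OF p]
  proof (rule pull_cong)
    fix s assume "s \<in> SH E"
    then obtain g where "g \<in> carrier HG" "s = g <#\<^bsub>HG\<^esub> E" by (rule HG.lcosetsE)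
    then show "s <#>\<^bsub>HG\<^esub> D <#>\<^bsub>HG\<^esub> C = s <#>\<^bsub>HG\<^esub> C"
      using assms \<open>E \<subseteq> C\<close> by (simp add: HG.lcos_absorb CH_subgroup)
  qed
qed

lemma at_level_refine:
  assumes "fst X \<in> CH" "D \<in> CH" "E \<in> CH" "E \<subseteq> D" "D \<subseteq> fst X"
  shows "refine_ob E D (at_level D X) = at_level E X"
  by (simp add: refine_ob_def refine_refine[OF assms] cong: restrict_cong)

lemma at_level_ob:
  assumes "X \<in> Ob usm" "D \<in> CH" "D \<subseteq> fst X" shows "at_level D X \<in> Ob (ps_cat \<alpha> \<U> D)"
proof -
  have X: "fst X \<in> CH" "is_psob \<alpha> \<U> (fst X) (snd X)" using assms(1) by (auto simp: usm_ob)
  show ?thesis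
    unfolding ps_cat_sel refine_ob_pull
    by (rule is_psob_pull[OF assms(2) X(1) coset_map_refine[OF assms(2) X(1) assms(3)] X(2)])
qed

lemma refine_hom:
  assumes X: "fst X \<in> CH" and Y: "fst Y \<in> CH" and D: "D \<in> CH" "D \<subseteq> fst X" "D \<subseteq> fst Y" and E: "E \<in> CH" "E \<subseteq> D"
    and f: "f \<in> level_homs \<alpha> \<U> X Y D"
  shows "refine E D f \<in> level_homs \<alpha> \<U> X Y E"
  using ps_hom_pull[OF E(1) D(1) coset_map_refine[OF E(1) D(1) E(2)] f[unfolded level_homs_def]]
    at_level_refine[OF X D(1) E D(2)] at_level_refine[OF Y D(1) E D(3)]
  unfolding level_homs_def refine_pull refine_ob_pull by simp

lemma refine_ops:
  assumes D: "D \<in> CH" and E: "E \<in> CH" "E \<subseteq> D"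
    and X: "fst X \<in> CH" "D \<subseteq> fst X" and Y: "fst Y \<in> CH" "D \<subseteq> fst Y"
  shows "refine E D (Idn (ps_cat \<alpha> \<U> D) (at_level D X)) = Idn (ps_cat \<alpha> \<U> E) (at_level E X)"
    and "\<lbrakk>fst Z \<in> CH; D \<subseteq> fst Z\<rbrakk> \<Longrightarrow> refine E D (Cmp (ps_cat \<alpha> \<U> D) (at_level D X) (at_level D Y) (at_level D Z) g f) =
      Cmp (ps_cat \<alpha> \<U> E) (at_level E X) (at_level E Y) (at_level E Z) (refine E D g) (refine E D f)"
    and "refine E D (AAdd (ps_cat \<alpha> \<U> D) (at_level D X) (at_level D Y) f f') =
      AAdd (ps_cat \<alpha> \<U> E) (at_level E X) (at_level E Y) (refine E D f) (refine E D f')"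
    and "refine E D (AScl (ps_cat \<alpha> \<U> D) (at_level D X) (at_level D Y) c f) =
      AScl (ps_cat \<alpha> \<U> E) (at_level E X) (at_level E Y) c (refine E D f)"
  using X Y at_level_refine[OF _ D E]
  by (simp_all add: ps_ops_pull[OF E(1) D coset_map_refine[OF E(1) D E(2)], folded refine_pull refine_ob_pull])

lemma usm_system:
  assumes "fst X \<in> CH" "fst Y \<in> CH"
  shows "direct_system (levels (fst X) (fst Y)) (\<lambda>D D'. D' \<subseteq> D) (level_homs \<alpha> \<U> X Y) (\<lambda>D D' f. refine D' D f)"
proof
  show "\<exists>l\<in>levels (fst X) (fst Y). l \<subseteq> D \<and> l \<subseteq> E" if "D \<in> levels (fst X) (fst Y)" "E \<in> levels (fst X) (fst Y)" for D E
    using that CH_Int[of D E] by (intro bexI[of _ "D \<inter> E"]) (auto simp: levels_iff)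
  show "refine E D f \<in> level_homs \<alpha> \<U> X Y E"
    if "D \<in> levels (fst X) (fst Y)" "E \<in> levels (fst X) (fst Y)" "E \<subseteq> D" "f \<in> level_homs \<alpha> \<U> X Y D" for D E f
    using that assms refine_hom[of X Y D E f] by (simp add: levels_iff)
  show "refine E' E (refine E D f) = refine E' D f"
    if "D \<in> levels (fst X) (fst Y)" "E \<in> levels (fst X) (fst Y)" "E' \<in> levels (fst X) (fst Y)" "E \<subseteq> D" "E' \<subseteq> E"
    for D E E' f
    using that refine_refine[of D E E' f] by (simp add: levels_iff)
qed auto

lemma usm_hom: "Hom usm X Y = dir_colim (levels (fst X) (fst Y)) (\<lambda>D D'. D' \<subseteq> D) (level_homs \<alpha> \<U> X Y) (\<lambda>D D' f. refine D' D f)"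
  by (simp add: usm_cat_def)

lemmas germ_hom = usm_system[THEN direct_system.cls_in, folded usm_hom usm_rel_def]
lemmas germ_push = usm_system[THEN direct_system.push, folded usm_rel_def]
lemmas germ_Image' = usm_system[THEN direct_system.Image_eq_cls, folded usm_rel_def]
lemmas germ_self = usm_system[THEN direct_system.mem_cls, folded usm_rel_def]
lemmas usm_rel_iff = usm_system[THEN direct_system.rel_iff, folded usm_rel_def]

text \<open>Representatives can be refined. Finitely many arrows therefore have representatives at a common level.\<close>

lemma germ_cases:
  assumes XY: "X \<in> Ob usm" "Y \<in> Ob usm" and \<gamma>: "\<gamma> \<in> Hom usm X Y"
  obtains D where "D \<in> CH" "D \<subseteq> fst X" "D \<subseteq> fst Y"
    "\<And>E. \<lbrakk>E \<in> CH; E \<subseteq> D\<rbrakk> \<Longrightarrow> \<exists>f\<in>level_homs \<alpha> \<U> X Y E. \<gamma> = germ X Y E f"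
proof -
  have C: "fst X \<in> CH" "fst Y \<in> CH" using XY by (auto simp: usm_ob)
  interpret direct_system "levels (fst X) (fst Y)" "\<lambda>D D'. D' \<subseteq> D" "level_homs \<alpha> \<U> X Y" "\<lambda>D D' f. refine D' D f"
    by (rule usm_system[OF C])
  obtain D f where D: "D \<in> levels (fst X) (fst Y)" and f: "f \<in> level_homs \<alpha> \<U> X Y D" "\<gamma> = germ X Y D f"
    using \<gamma> unfolding usm_hom usm_rel_def by (rule colimE)
  show thesis
  proof (rule that)
    show "D \<in> CH" "D \<subseteq> fst X" "D \<subseteq> fst Y" using D by (auto simp: levels_iff)
    fix E assume E: "E \<in> CH" "E \<subseteq> D"
    then have "E \<in> levels (fst X) (fst Y)" using D by (auto simp: levels_iff)
    then show "\<exists>f\<in>level_homs \<alpha> \<U> X Y E. \<gamma> = germ X Y E f"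
      using D E f \<tau>_in[of D E f] push[of D E f] unfolding usm_rel_def by (intro bexI[of _ "refine E D f"]) auto
  qed
qed

text \<open>Representatives of one germ agree on every sufficiently small level \<open>G\<close>, also when the refinement to \<open>G\<close>
  passes through an intermediate level \<open>K\<close>.\<close>

lemma germ_agree:
  assumes "(E, f') \<in> germ X Y D f" and C: "fst X \<in> CH" "fst Y \<in> CH"
  obtains F where "F \<in> CH" "F \<subseteq> D" "F \<subseteq> E" "E \<in> levels (fst X) (fst Y)" "f' \<in> level_homs \<alpha> \<U> X Y E"
    "\<And>G K. \<lbrakk>G \<in> CH; K \<in> CH; G \<subseteq> F; G \<subseteq> K; K \<subseteq> E\<rbrakk> \<Longrightarrow> refine G K (refine K E f') = refine G D f"
proof -
  have "((D, f), (E, f')) \<in> usm_rel \<alpha> \<U> X Y" using assms(1) by simp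
  then obtain F where D: "D \<in> levels (fst X) (fst Y)" "E \<in> levels (fst X) (fst Y)" "f' \<in> level_homs \<alpha> \<U> X Y E"
    and F: "F \<in> CH" "F \<subseteq> D" "F \<subseteq> E" "refine F D f = refine F E f'"
    unfolding usm_rel_iff[OF C] by (auto simp: levels_iff)
  have L: "D \<in> CH" "E \<in> CH" using D by (auto simp: levels_iff)
  show thesis
  proof (rule that[OF F(1-3) D(2,3)])
    fix G K assume G: "G \<in> CH" "K \<in> CH" "G \<subseteq> F" "G \<subseteq> K" "K \<subseteq> E"
    have "refine G K (refine K E f') = refine G E f'" by (rule refine_refine[OF L(2) G(2,1,4,5)])
    also have "\<dots> = refine G F (refine F E f')" by (rule refine_refine[OF L(2) F(1) G(1,3) F(3), symmetric])
    also have "\<dots> = refine G D f" unfolding F(4)[symmetric] by (rule refine_refine[OF L(1) F(1) G(1,3) F(2)])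
    finally show "refine G K (refine K E f') = refine G D f" .
  qed
qed

lemma germ_memI:
  assumes "fst X \<in> CH" "fst Y \<in> CH" "D \<in> CH" "D \<subseteq> fst X" "D \<subseteq> fst Y" "E \<in> CH" "E \<subseteq> fst X" "E \<subseteq> fst Y"
    and "f \<in> level_homs \<alpha> \<U> X Y D" "g \<in> level_homs \<alpha> \<U> X Y E"
    and "F \<in> CH" "F \<subseteq> D" "F \<subseteq> E" "refine F D f = refine F E g"
  shows "(E, g) \<in> germ X Y D f"
proof -
  have F: "F \<in> levels (fst X) (fst Y)"
    unfolding levels_iff
    using assms(11) subset_trans[OF assms(12,4)] subset_trans[OF assms(12,5)] by simp
  have "((D, f), (E, g)) \<in> usm_rel \<alpha> \<U> X Y"
    unfolding usm_rel_iff[OF assms(1,2)]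
    by (intro conjI bexI[OF _ F] assms(9,10,12-14)) (simp_all add: levels_iff assms(3-8))
  then show ?thesis by simp
qed

text \<open>A binary operation on representatives that is compatible with refinement induces an operation on
  germs, which may be computed on representatives at any common level. Composition and addition are of
  this kind.\<close>

lemma germ_binary:
  fixes X Y X' Y' A B :: "('k::field, 'n, 'v) usm_ob"
  defines "N \<equiv> fst X \<inter> fst Y \<inter> fst X' \<inter> fst Y'"
  assumes C: "fst X \<in> CH" "fst Y \<in> CH" "fst X' \<in> CH" "fst Y' \<in> CH" "fst A \<in> CH" "fst B \<in> CH"
    and N: "N \<subseteq> fst A" "N \<subseteq> fst B"
    and closed: "\<And>E f g. \<lbrakk>E \<in> CH; E \<subseteq> N; f \<in> level_homs \<alpha> \<U> X Y E; g \<in> level_homs \<alpha> \<U> X' Y' E\<rbrakk>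
      \<Longrightarrow> c E f g \<in> level_homs \<alpha> \<U> A B E"
    and refine: "\<And>E F f g. \<lbrakk>E \<in> CH; F \<in> CH; F \<subseteq> E; E \<subseteq> N\<rbrakk> \<Longrightarrow> refine F E (c E f g) = c F (refine F E f) (refine F E g)"
    and D: "D \<in> CH" "D \<subseteq> N" and f: "f \<in> level_homs \<alpha> \<U> X Y D" and g: "g \<in> level_homs \<alpha> \<U> X' Y' D"
  shows "usm_rel \<alpha> \<U> A B `` {(E \<inter> E', c (E \<inter> E') (refine (E \<inter> E') E f') (refine (E \<inter> E') E' g')) | E f' E' g'.
      (E, f') \<in> germ X Y D f \<and> (E', g') \<in> germ X' Y' D g} = germ A B D (c D f g)" (is "_ `` ?S = _")
proof (rule germ_Image'[OF C(5,6)])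
  have "D \<in> levels (fst X) (fst Y)" "D \<in> levels (fst X') (fst Y')" using D by (auto simp: levels_iff N_def)
  then have "(D, f) \<in> germ X Y D f" "(D, g) \<in> germ X' Y' D g"
    using germ_self[OF C(1,2) _ f] germ_self[OF C(3,4) _ g] by auto
  then show "?S \<noteq> {}" by blast
  show "?S \<subseteq> germ A B D (c D f g)"
  proof
    fix t assume "t \<in> ?S"
    then obtain E f' E' g' where t: "t = (E \<inter> E', c (E \<inter> E') (refine (E \<inter> E') E f') (refine (E \<inter> E') E' g'))"
      and fE: "(E, f') \<in> germ X Y D f" and gE: "(E', g') \<in> germ X' Y' D g" by blast
    obtain F where F: "F \<in> CH" "F \<subseteq> D" "F \<subseteq> E" "E \<in> levels (fst X) (fst Y)" "f' \<in> level_homs \<alpha> \<U> X Y E"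
      and fF: "\<And>G K. \<lbrakk>G \<in> CH; K \<in> CH; G \<subseteq> F; G \<subseteq> K; K \<subseteq> E\<rbrakk> \<Longrightarrow> refine G K (refine K E f') = refine G D f"
      by (rule germ_agree[OF fE C(1,2)]) blast
    obtain F' where F': "F' \<in> CH" "F' \<subseteq> D" "F' \<subseteq> E'" "E' \<in> levels (fst X') (fst Y')" "g' \<in> level_homs \<alpha> \<U> X' Y' E'"
      and gF: "\<And>G K. \<lbrakk>G \<in> CH; K \<in> CH; G \<subseteq> F'; G \<subseteq> K; K \<subseteq> E'\<rbrakk> \<Longrightarrow> refine G K (refine K E' g') = refine G D g"
      by (rule germ_agree[OF gE C(3,4)]) blast
    let ?E = "E \<inter> E'" and ?F = "F \<inter> F'"
    have EE: "E \<in> CH" "E' \<in> CH" "?E \<in> CH" "?F \<in> CH" using F F' CH_Int by (auto simp: levels_iff)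
    have sub: "?E \<subseteq> N" using F F' by (auto simp: levels_iff N_def)
    have f'': "refine ?E E f' \<in> level_homs \<alpha> \<U> X Y ?E"
      using refine_hom[OF C(1,2) EE(1) _ _ EE(3) _ F(5)] F by (auto simp: levels_iff)
    have g'': "refine ?E E' g' \<in> level_homs \<alpha> \<U> X' Y' ?E"
      using refine_hom[OF C(3,4) EE(2) _ _ EE(3) _ F'(5)] F' by (auto simp: levels_iff)
    have FE: "?F \<subseteq> ?E" "?F \<subseteq> D" using F F' by blast+
    have "refine ?F ?E (c ?E (refine ?E E f') (refine ?E E' g')) = c ?F (refine ?F D f) (refine ?F D g)"
      using refine[OF EE(3,4) FE(1) sub] fF[OF EE(4,3) _ FE(1)] gF[OF EE(4,3) _ FE(1)] by simp
    then have e: "refine ?F D (c D f g) = refine ?F ?E (c ?E (refine ?E E f') (refine ?E E' g'))"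
      using refine[OF D(1) EE(4) FE(2) D(2)] by simp
    show "t \<in> germ A B D (c D f g)"
      unfolding t
      by (rule germ_memI[OF C(5,6) D(1) order_trans[OF D(2) N(1)] order_trans[OF D(2) N(2)] EE(3)
        order_trans[OF sub N(1)] order_trans[OF sub N(2)] closed[OF D f g] closed[OF EE(3) sub f'' g''] EE(4) FE(2,1) e])
  qed
qed

lemma usm_cmp:
  assumes o: "X \<in> Ob usm" "Y \<in> Ob usm" "Z \<in> Ob usm"
    and D: "D \<in> CH" "D \<subseteq> fst X" "D \<subseteq> fst Y" "D \<subseteq> fst Z"
    and f: "f \<in> level_homs \<alpha> \<U> X Y D" and g: "g \<in> level_homs \<alpha> \<U> Y Z D"
  shows "Cmp usm X Y Z (germ Y Z D g) (germ X Y D f) =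
      germ X Z D (Cmp (ps_cat \<alpha> \<U> D) (at_level D X) (at_level D Y) (at_level D Z) g f)"
    and "Cmp (ps_cat \<alpha> \<U> D) (at_level D X) (at_level D Y) (at_level D Z) g f \<in> level_homs \<alpha> \<U> X Z D"
proof -
  have C: "fst X \<in> CH" "fst Y \<in> CH" "fst Z \<in> CH" using o by (auto simp: usm_ob)
  let ?c = "\<lambda>D f g. Cmp (ps_cat \<alpha> \<U> D) (at_level D X) (at_level D Y) (at_level D Z) g f"
  have closed: "?c E f g \<in> level_homs \<alpha> \<U> X Z E"
    if "E \<in> CH" "E \<subseteq> fst X \<inter> fst Y \<inter> fst Y \<inter> fst Z" "f \<in> level_homs \<alpha> \<U> X Y E" "g \<in> level_homs \<alpha> \<U> Y Z E" for E f g
  proof -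
    interpret P: lin_category "ps_cat \<alpha> \<U> E" by (rule lin_category_ps[OF that(1)])
    show ?thesis
      using that unfolding level_homs_def by (intro P.Cmp_hom at_level_ob o) auto
  qed
  have refine: "refine F E (?c E f g) = ?c F (refine F E f) (refine F E g)"
    if "E \<in> CH" "F \<in> CH" "F \<subseteq> E" "E \<subseteq> fst X \<inter> fst Y \<inter> fst Y \<inter> fst Z" for E F f g
    using that C by (intro refine_ops(2)) auto
  show "?c D f g \<in> level_homs \<alpha> \<U> X Z D" using D by (intro closed f g) auto
  have "Cmp usm X Y Z (germ Y Z D g) (germ X Y D f) = usm_rel \<alpha> \<U> X Z ``
      {(E \<inter> E', ?c (E \<inter> E') (refine (E \<inter> E') E f') (refine (E \<inter> E') E' g')) | E f' E' g'.
       (E, f') \<in> germ X Y D f \<and> (E', g') \<in> germ Y Z D g}"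
    by (simp add: usm_cat_def)
  also have "\<dots> = germ X Z D (?c D f g)"
    using D by (intro germ_binary[where c = ?c] C closed refine f g) auto
  finally show "Cmp usm X Y Z (germ Y Z D g) (germ X Y D f) = germ X Z D (?c D f g)" .
qed

lemma usm_add:
  assumes o: "X \<in> Ob usm" "Y \<in> Ob usm" and D: "D \<in> CH" "D \<subseteq> fst X" "D \<subseteq> fst Y"
    and f: "f \<in> level_homs \<alpha> \<U> X Y D" and g: "g \<in> level_homs \<alpha> \<U> X Y D"
  shows "AAdd usm X Y (germ X Y D f) (germ X Y D g) = germ X Y D (AAdd (ps_cat \<alpha> \<U> D) (at_level D X) (at_level D Y) f g)"
    and "AAdd (ps_cat \<alpha> \<U> D) (at_level D X) (at_level D Y) f g \<in> level_homs \<alpha> \<U> X Y D"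
proof -
  have C: "fst X \<in> CH" "fst Y \<in> CH" using o by (auto simp: usm_ob)
  let ?c = "\<lambda>D. AAdd (ps_cat \<alpha> \<U> D) (at_level D X) (at_level D Y)"
  have closed: "?c E f g \<in> level_homs \<alpha> \<U> X Y E"
    if "E \<in> CH" "E \<subseteq> fst X \<inter> fst Y \<inter> fst X \<inter> fst Y" "f \<in> level_homs \<alpha> \<U> X Y E" "g \<in> level_homs \<alpha> \<U> X Y E" for E f g
  proof -
    interpret P: lin_category "ps_cat \<alpha> \<U> E" by (rule lin_category_ps[OF that(1)])
    show ?thesis
      using that unfolding level_homs_def by (intro P.add_hom at_level_ob o) auto
  qed
  have refine: "refine F E (?c E f g) = ?c F (refine F E f) (refine F E g)"
    if "E \<in> CH" "F \<in> CH" "F \<subseteq> E" "E \<subseteq> fst X \<inter> fst Y \<inter> fst X \<inter> fst Y" for E F f g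
    using that C by (intro refine_ops(3)) auto
  show "?c D f g \<in> level_homs \<alpha> \<U> X Y D" using D by (intro closed f g) auto
  have "AAdd usm X Y (germ X Y D f) (germ X Y D g) = usm_rel \<alpha> \<U> X Y ``
      {(E \<inter> E', ?c (E \<inter> E') (refine (E \<inter> E') E f') (refine (E \<inter> E') E' g')) | E f' E' g'.
       (E, f') \<in> germ X Y D f \<and> (E', g') \<in> germ X Y D g}"
    by (simp add: usm_cat_def)
  also have "\<dots> = germ X Y D (?c D f g)"
    using D by (intro germ_binary[where c = ?c] C closed refine f g) auto
  finally show "AAdd usm X Y (germ X Y D f) (germ X Y D g) = germ X Y D (?c D f g)" .
qed

lemma usm_scl:
  assumes o: "X \<in> Ob usm" "Y \<in> Ob usm" and D: "D \<in> CH" "D \<subseteq> fst X" "D \<subseteq> fst Y"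
    and f: "f \<in> level_homs \<alpha> \<U> X Y D"
  shows "AScl usm X Y c (germ X Y D f) = germ X Y D (AScl (ps_cat \<alpha> \<U> D) (at_level D X) (at_level D Y) c f)"
    and "AScl (ps_cat \<alpha> \<U> D) (at_level D X) (at_level D Y) c f \<in> level_homs \<alpha> \<U> X Y D"
proof -
  have C: "fst X \<in> CH" "fst Y \<in> CH" using o by (auto simp: usm_ob)
  let ?c = "\<lambda>D. AScl (ps_cat \<alpha> \<U> D) (at_level D X) (at_level D Y) c"
  have closed: "?c E f \<in> level_homs \<alpha> \<U> X Y E"
    if "E \<in> CH" "E \<subseteq> fst X" "E \<subseteq> fst Y" "f \<in> level_homs \<alpha> \<U> X Y E" for E f
  proof -
    interpret P: lin_category "ps_cat \<alpha> \<U> E" by (rule lin_category_ps[OF that(1)])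
    show ?thesis
      unfolding level_homs_def
      by (rule P.scl_hom[OF at_level_ob[OF o(1) that(1,2)] at_level_ob[OF o(2) that(1,3)]
        that(4)[unfolded level_homs_def]])
  qed
  show cl: "?c D f \<in> level_homs \<alpha> \<U> X Y D" by (rule closed[OF D f])
  let ?S = "{(E, ?c E f') | E f'. (E, f') \<in> germ X Y D f}"
  have "AScl usm X Y c (germ X Y D f) = usm_rel \<alpha> \<U> X Y `` ?S"
    by (simp add: usm_cat_def)
  also have "\<dots> = germ X Y D (?c D f)"
  proof (rule germ_Image'[OF C])
    have "(D, f) \<in> germ X Y D f" using germ_self[OF C _ f] D by (auto simp: levels_iff)
    then show "?S \<noteq> {}" by blast
    show "?S \<subseteq> germ X Y D (?c D f)"
    proof
      fix t assume "t \<in> ?S"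
      then obtain E f' where t: "t = (E, ?c E f')" and fE: "(E, f') \<in> germ X Y D f" by blast
      then obtain F where F: "F \<in> CH" "F \<subseteq> D" "F \<subseteq> E" "refine F D f = refine F E f'"
        and E: "E \<in> levels (fst X) (fst Y)" "f' \<in> level_homs \<alpha> \<U> X Y E"
        by (auto simp: usm_rel_iff[OF C] levels_iff)
      have EE: "E \<in> CH" "E \<subseteq> fst X" "E \<subseteq> fst Y" using E by (auto simp: levels_iff)
      have e: "refine F D (?c D f) = refine F E (?c E f')"
        using refine_ops(4)[OF D(1) F(1,2) C(1) D(2) C(2) D(3)] refine_ops(4)[OF EE(1) F(1,3) C(1) EE(2) C(2) EE(3)] F(4)
        by simp
      show "t \<in> germ X Y D (?c D f)"
        unfolding t by (rule germ_memI[OF C D EE cl closed[OF EE E(2)] F(1-3) e])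
    qed
  qed
  finally show "AScl usm X Y c (germ X Y D f) = germ X Y D (?c D f)" .
qed

lemma usm_idn:
  assumes X: "X \<in> Ob usm" and D: "D \<in> CH" "D \<subseteq> fst X"
  shows "Idn usm X = germ X X D (Idn (ps_cat \<alpha> \<U> D) (at_level D X))"
    and "Idn (ps_cat \<alpha> \<U> D) (at_level D X) \<in> level_homs \<alpha> \<U> X X D"
proof -
  have C: "fst X \<in> CH" using X by (auto simp: usm_ob)
  have h: "Idn (ps_cat \<alpha> \<U> E) (at_level E X) \<in> level_homs \<alpha> \<U> X X E" if "E \<in> CH" "E \<subseteq> fst X" for E
  proof -
    interpret P: lin_category "ps_cat \<alpha> \<U> E" by (rule lin_category_ps[OF that(1)])
    show ?thesis unfolding level_homs_def by (rule P.Idn_hom[OF at_level_ob[OF X that]])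
  qed
  show "Idn (ps_cat \<alpha> \<U> D) (at_level D X) \<in> level_homs \<alpha> \<U> X X D" by (rule h[OF D])
  \<comment> \<open>by definition the identity is represented at the level of \<open>X\<close> itself, and it can be refined from there\<close>
  have "Idn usm X = germ X X (fst X) (Idn (ps_cat \<alpha> \<U> (fst X)) (at_level (fst X) X))"
    by (simp add: usm_cat_def)
  also have "\<dots> = germ X X D (refine D (fst X) (Idn (ps_cat \<alpha> \<U> (fst X)) (at_level (fst X) X)))"
    using C D h[OF C order_refl] by (intro germ_push[OF C C]) (auto simp: levels_iff)
  also have "refine D (fst X) (Idn (ps_cat \<alpha> \<U> (fst X)) (at_level (fst X) X)) = Idn (ps_cat \<alpha> \<U> D) (at_level D X)"
    using refine_ops(1)[OF C D C order_refl C order_refl] .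
  finally show "Idn usm X = germ X X D (Idn (ps_cat \<alpha> \<U> D) (at_level D X))" .
qed

lemma category_usm: "category (usm :: (('k::field, 'n, 'v) usm_ob, ('k, 'n, 'v) usm_ar, Lam) lincat)"
proof
  fix X :: "('k, 'n, 'v) usm_ob" assume X: "X \<in> Ob usm"
  then have C: "fst X \<in> CH" by (simp add: usm_ob)
  show "Idn usm X \<in> Hom usm X X"
    unfolding usm_idn(1)[OF X C order_refl]
    using usm_idn(2)[OF X C order_refl] C by (intro germ_hom) (auto simp: levels_iff)
next
  fix X Y Z :: "('k, 'n, 'v) usm_ob" and \<gamma> \<delta>
  assume o: "X \<in> Ob usm" "Y \<in> Ob usm" "Z \<in> Ob usm" and \<gamma>: "\<gamma> \<in> Hom usm X Y" and \<delta>: "\<delta> \<in> Hom usm Y Z"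
  have C: "fst X \<in> CH" "fst Z \<in> CH" using o by (auto simp: usm_ob)
  obtain D where D: "D \<in> CH" "D \<subseteq> fst X" "D \<subseteq> fst Y" and
    rD: "\<And>E. \<lbrakk>E \<in> CH; E \<subseteq> D\<rbrakk> \<Longrightarrow> \<exists>f\<in>level_homs \<alpha> \<U> X Y E. \<gamma> = germ X Y E f" by (rule germ_cases[OF o(1,2) \<gamma>]) blast
  obtain E where E: "E \<in> CH" "E \<subseteq> fst Y" "E \<subseteq> fst Z" and
    rE: "\<And>F. \<lbrakk>F \<in> CH; F \<subseteq> E\<rbrakk> \<Longrightarrow> \<exists>f\<in>level_homs \<alpha> \<U> Y Z F. \<delta> = germ Y Z F f" by (rule germ_cases[OF o(2,3) \<delta>]) blast
  have F: "D \<inter> E \<in> CH" using CH_Int D E by blast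
  obtain f where f: "f \<in> level_homs \<alpha> \<U> X Y (D \<inter> E)" "\<gamma> = germ X Y (D \<inter> E) f" using rD[OF F] by blast
  obtain g where g: "g \<in> level_homs \<alpha> \<U> Y Z (D \<inter> E)" "\<delta> = germ Y Z (D \<inter> E) g" using rE[OF F] by blast
  have sub: "D \<inter> E \<subseteq> fst X" "D \<inter> E \<subseteq> fst Y" "D \<inter> E \<subseteq> fst Z" using D E by auto
  show "Cmp usm X Y Z \<delta> \<gamma> \<in> Hom usm X Z"
    unfolding f(2) g(2) usm_cmp(1)[OF o F sub f(1) g(1)]
    using usm_cmp(2)[OF o F sub f(1) g(1)] F sub C by (intro germ_hom) (auto simp: levels_iff)
next
  fix X Y :: "('k, 'n, 'v) usm_ob" and \<gamma> assume o: "X \<in> Ob usm" "Y \<in> Ob usm" and \<gamma>: "\<gamma> \<in> Hom usm X Y"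
  obtain D where D: "D \<in> CH" "D \<subseteq> fst X" "D \<subseteq> fst Y" and
    "\<And>E. \<lbrakk>E \<in> CH; E \<subseteq> D\<rbrakk> \<Longrightarrow> \<exists>f\<in>level_homs \<alpha> \<U> X Y E. \<gamma> = germ X Y E f" by (rule germ_cases[OF o \<gamma>]) blast
  then obtain f where f: "f \<in> level_homs \<alpha> \<U> X Y D" "\<gamma> = germ X Y D f" by blast
  interpret P: lin_category "ps_cat \<alpha> \<U> D" by (rule lin_category_ps[OF D(1)])
  note p = at_level_ob[OF o(1) D(1,2)] at_level_ob[OF o(2) D(1,3)] f(1)[unfolded level_homs_def]
  show "Cmp usm X Y Y (Idn usm Y) \<gamma> = \<gamma>"
    unfolding f(2) usm_idn(1)[OF o(2) D(1,3)] usm_cmp(1)[OF o o(2) D D(3) f(1) usm_idn(2)[OF o(2) D(1,3)]]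
      P.Idn_left[OF p] ..
  show "Cmp usm X X Y \<gamma> (Idn usm X) = \<gamma>"
    unfolding f(2) usm_idn(1)[OF o(1) D(1,2)] usm_cmp(1)[OF o(1,1,2) D(1,2,2,3) usm_idn(2)[OF o(1) D(1,2)] f(1)]
      P.Idn_right[OF p] ..
next
  fix W X Y Z :: "('k, 'n, 'v) usm_ob" and \<gamma> \<delta> \<epsilon>
  assume o: "W \<in> Ob usm" "X \<in> Ob usm" "Y \<in> Ob usm" "Z \<in> Ob usm"
    and \<gamma>: "\<gamma> \<in> Hom usm W X" and \<delta>: "\<delta> \<in> Hom usm X Y" and \<epsilon>: "\<epsilon> \<in> Hom usm Y Z"
  obtain D where D: "D \<in> CH" "D \<subseteq> fst W" "D \<subseteq> fst X" and
    rD: "\<And>E. \<lbrakk>E \<in> CH; E \<subseteq> D\<rbrakk> \<Longrightarrow> \<exists>f\<in>level_homs \<alpha> \<U> W X E. \<gamma> = germ W X E f" by (rule germ_cases[OF o(1,2) \<gamma>]) blast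
  obtain E where E: "E \<in> CH" "E \<subseteq> fst X" "E \<subseteq> fst Y" and
    rE: "\<And>F. \<lbrakk>F \<in> CH; F \<subseteq> E\<rbrakk> \<Longrightarrow> \<exists>f\<in>level_homs \<alpha> \<U> X Y F. \<delta> = germ X Y F f" by (rule germ_cases[OF o(2,3) \<delta>]) blast
  obtain F where F: "F \<in> CH" "F \<subseteq> fst Y" "F \<subseteq> fst Z" and
    rF: "\<And>E. \<lbrakk>E \<in> CH; E \<subseteq> F\<rbrakk> \<Longrightarrow> \<exists>f\<in>level_homs \<alpha> \<U> Y Z E. \<epsilon> = germ Y Z E f" by (rule germ_cases[OF o(3,4) \<epsilon>]) blast
  define G where "G = D \<inter> E \<inter> F"
  have G: "G \<in> CH" "G \<subseteq> D" "G \<subseteq> E" "G \<subseteq> F" unfolding G_def using CH_Int[OF CH_Int[OF D(1) E(1)] F(1)] by auto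
  have sub: "G \<subseteq> fst W" "G \<subseteq> fst X" "G \<subseteq> fst Y" "G \<subseteq> fst Z" using G D E F by auto
  obtain f where f: "f \<in> level_homs \<alpha> \<U> W X G" "\<gamma> = germ W X G f" using rD[OF G(1,2)] by blast
  obtain g where g: "g \<in> level_homs \<alpha> \<U> X Y G" "\<delta> = germ X Y G g" using rE[OF G(1,3)] by blast
  obtain h where h: "h \<in> level_homs \<alpha> \<U> Y Z G" "\<epsilon> = germ Y Z G h" using rF[OF G(1,4)] by blast
  interpret P: lin_category "ps_cat \<alpha> \<U> G" by (rule lin_category_ps[OF G(1)])
  note p = at_level_ob[OF o(1) G(1) sub(1)] at_level_ob[OF o(2) G(1) sub(2)] at_level_ob[OF o(3) G(1) sub(3)]
    at_level_ob[OF o(4) G(1) sub(4)] f(1)[unfolded level_homs_def] g(1)[unfolded level_homs_def] h(1)[unfolded level_homs_def]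
  note gf = usm_cmp[OF o(1-3) G(1) sub(1-3) f(1) g(1)] and hg = usm_cmp[OF o(2-4) G(1) sub(2-4) g(1) h(1)]
  show "Cmp usm W X Z (Cmp usm X Y Z \<epsilon> \<delta>) \<gamma> = Cmp usm W Y Z \<epsilon> (Cmp usm W X Y \<delta> \<gamma>)"
    unfolding f(2) g(2) h(2) gf(1) hg(1)
      usm_cmp(1)[OF o(1,2,4) G(1) sub(1,2,4) f(1) hg(2)] usm_cmp(1)[OF o(1,3,4) G(1) sub(1,3,4) gf(2) h(1)]
      P.Cmp_assoc[OF p] ..
qed

lemma usm_add_hom:
  assumes o: "X \<in> Ob usm" "Y \<in> Ob usm" and \<gamma>: "\<gamma> \<in> Hom usm X Y" and \<delta>: "\<delta> \<in> Hom usm X Y"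
  obtains D f g where "D \<in> CH" "D \<subseteq> fst X" "D \<subseteq> fst Y" "f \<in> level_homs \<alpha> \<U> X Y D" "g \<in> level_homs \<alpha> \<U> X Y D"
    "\<gamma> = germ X Y D f" "\<delta> = germ X Y D g" "AAdd usm X Y \<gamma> \<delta> \<in> Hom usm X Y"
proof -
  have C: "fst X \<in> CH" "fst Y \<in> CH" using o by (auto simp: usm_ob)
  obtain D where D: "D \<in> CH" "D \<subseteq> fst X" "D \<subseteq> fst Y" and
    rD: "\<And>E. \<lbrakk>E \<in> CH; E \<subseteq> D\<rbrakk> \<Longrightarrow> \<exists>f\<in>level_homs \<alpha> \<U> X Y E. \<gamma> = germ X Y E f" by (rule germ_cases[OF o \<gamma>]) blast
  obtain E where E: "E \<in> CH" and
    rE: "\<And>F. \<lbrakk>F \<in> CH; F \<subseteq> E\<rbrakk> \<Longrightarrow> \<exists>f\<in>level_homs \<alpha> \<U> X Y F. \<delta> = germ X Y F f" by (rule germ_cases[OF o \<delta>]) blast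
  have F: "D \<inter> E \<in> CH" "D \<inter> E \<subseteq> fst X" "D \<inter> E \<subseteq> fst Y" using CH_Int D E by auto
  obtain f where f: "f \<in> level_homs \<alpha> \<U> X Y (D \<inter> E)" "\<gamma> = germ X Y (D \<inter> E) f" using rD[OF F(1)] by blast
  obtain g where g: "g \<in> level_homs \<alpha> \<U> X Y (D \<inter> E)" "\<delta> = germ X Y (D \<inter> E) g" using rE[OF F(1)] by blast
  have "AAdd usm X Y \<gamma> \<delta> \<in> Hom usm X Y"
    unfolding f(2) g(2) usm_add(1)[OF o F f(1) g(1)]
    using usm_add(2)[OF o F f(1) g(1)] F C by (intro germ_hom) (auto simp: levels_iff)
  then show thesis using that[OF F f(1) g(1) f(2) g(2)] by blast
qed

lemma usm_scl_hom:
  assumes o: "X \<in> Ob usm" "Y \<in> Ob usm" and \<gamma>: "\<gamma> \<in> Hom usm X Y"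
  obtains D f where "D \<in> CH" "D \<subseteq> fst X" "D \<subseteq> fst Y" "f \<in> level_homs \<alpha> \<U> X Y D"
    "\<gamma> = germ X Y D f" "AScl usm X Y c \<gamma> \<in> Hom usm X Y"
proof -
  have C: "fst X \<in> CH" "fst Y \<in> CH" using o by (auto simp: usm_ob)
  obtain D where D: "D \<in> CH" "D \<subseteq> fst X" "D \<subseteq> fst Y" and
    rD: "\<And>E. \<lbrakk>E \<in> CH; E \<subseteq> D\<rbrakk> \<Longrightarrow> \<exists>f\<in>level_homs \<alpha> \<U> X Y E. \<gamma> = germ X Y E f" by (rule germ_cases[OF o \<gamma>]) blast
  obtain f where f: "f \<in> level_homs \<alpha> \<U> X Y D" "\<gamma> = germ X Y D f" using rD[OF D(1)] by blast
  have "AScl usm X Y c \<gamma> \<in> Hom usm X Y"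
    unfolding f(2) usm_scl(1)[OF o D f(1)]
    using usm_scl(2)[OF o D f(1)] D C by (intro germ_hom) (auto simp: levels_iff)
  then show thesis using that[OF D f] by blast
qed

end

section \<open>Right translation\<close>

lemma conjH_one: "C \<in> CH \<Longrightarrow> conjH \<one>\<^bsub>HG\<^esub> C = C"
  by (simp add: conjH_eq HG.cnj_one CH_carrier)

context
  fixes h :: "('k::field, 'n::{finite,linorder}) hmat"
  assumes h: "h \<in> carrier HG"
begin

lemma conjH_mono: "E \<subseteq> D \<Longrightarrow> conjH h E \<subseteq> conjH h D"
  unfolding conjH_eq subset_iff HG.cnj_iff by blast

lemma conjH_conjH: "\<lbrakk>C \<in> CH; g \<in> carrier HG\<rbrakk> \<Longrightarrow> conjH g (conjH h C) = conjH (g \<otimes>\<^bsub>HG\<^esub> h) C"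
  using h by (simp add: conjH_eq HG.cnj_cnj CH_carrier)

lemma rtrans_rtrans:
  assumes "D \<in> CH" "g \<in> carrier HG"
  shows "rtrans g (conjH h D) (rtrans h D f) = rtrans (g \<otimes>\<^bsub>HG\<^esub> h) D f"
proof -
  note D' = CH_conj[OF assms(1) h]
  have p: "(\<lambda>s. s #>\<^bsub>HG\<^esub> g) \<in> SH (conjH g (conjH h D)) \<rightarrow> SH (conjH h D)"
    using coset_map_translate[OF D' assms(2)] by (simp add: coset_map_def)
  show ?thesis
    unfolding rtrans_pull pull_pull[OF p] unfolding conjH_conjH[OF assms]
  proof (rule pull_cong)
    fix s assume "s \<in> SH (conjH (g \<otimes>\<^bsub>HG\<^esub> h) D)"
    then have "s \<subseteq> carrier HG" using SH_carrier CH_conj[OF assms(1) HG.m_closed[OF assms(2) h]] by blast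
    then show "s #>\<^bsub>HG\<^esub> g #>\<^bsub>HG\<^esub> h = s #>\<^bsub>HG\<^esub> (g \<otimes>\<^bsub>HG\<^esub> h)"
      using assms h by (simp add: HG.coset_mult_assoc)
  qed
qed

lemma rtrans_refine:
  assumes "D \<in> CH" "E \<in> CH" "E \<subseteq> D"
  shows "refine (conjH h E) (conjH h D) (rtrans h D f) = rtrans h E (refine E D f)"
proof -
  note D' = CH_conj[OF assms(1) h] and E' = CH_conj[OF assms(2) h]
  have p: "(\<lambda>s. s <#>\<^bsub>HG\<^esub> conjH h D) \<in> SH (conjH h E) \<rightarrow> SH (conjH h D)"
    using coset_map_refine[OF E' D' conjH_mono[OF assms(3)]] by (simp add: coset_map_def)
  have q: "(\<lambda>s. s #>\<^bsub>HG\<^esub> h) \<in> SH (conjH h E) \<rightarrow> SH E"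
    using coset_map_translate[OF assms(2) h] by (simp add: coset_map_def)
  show ?thesis
    unfolding rtrans_pull refine_pull pull_pull[OF p] pull_pull[OF q]
    by (rule pull_cong) (rule translate_refine[OF assms(2,1,3) h])
qed

definition Rob :: "('k, 'n, 'v) usm_ob \<Rightarrow> ('k, 'n, 'v) usm_ob" where
  "Rob X = (conjH h (fst X), rtrans_ob h (fst X) (snd X))"

definition transl :: "('k, 'n) hmat set \<times> ('k, 'n, 'v) varr \<Rightarrow> ('k, 'n) hmat set \<times> ('k, 'n, 'v) varr" where
  "transl t = (conjH h (fst t), rtrans h (fst t) (snd t))"

lemma Rob_fst [simp]: "fst (Rob X) = conjH h (fst X)"
  by (simp add: Rob_def)

lemma at_level_Rob:
  assumes "fst X \<in> CH" "D \<in> CH" "D \<subseteq> fst X"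
  shows "at_level (conjH h D) (Rob X) = rtrans_ob h D (at_level D X)"
  unfolding refine_ob_def rtrans_ob_def Rob_def
  by (simp add: rtrans_refine[OF assms] cong: restrict_cong)

end

context
  fixes \<alpha> :: "'n::{finite,linorder} \<Rightarrow> Lam" and \<U> :: "'v set set"
begin

lemma Rob_ob:
  assumes h: "h \<in> carrier HG" and X: "X \<in> Ob (usm \<alpha> \<U>)" shows "Rob h X \<in> Ob (usm \<alpha> \<U>)"
proof -
  have C: "fst X \<in> CH" "is_psob \<alpha> \<U> (fst X) (snd X)" using X by (auto simp: usm_ob)
  show ?thesis
    unfolding usm_ob Rob_def[OF h] fst_conv snd_conv rtrans_ob_pull
    using CH_conj[OF C(1) h] is_psob_pull[OF CH_conj[OF C(1) h] C(1) coset_map_translate[OF C(1) h] C(2)] by simp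
qed

lemma transl_hom:
  assumes h: "h \<in> carrier HG" and C: "fst X \<in> CH" "fst Y \<in> CH" and D: "D \<in> CH" "D \<subseteq> fst X" "D \<subseteq> fst Y"
    and f: "f \<in> level_homs \<alpha> \<U> X Y D"
  shows "rtrans h D f \<in> level_homs \<alpha> \<U> (Rob h X) (Rob h Y) (conjH h D)"
  unfolding level_homs_def at_level_Rob[OF h C(1) D(1,2)] at_level_Rob[OF h C(2) D(1,3)] rtrans_pull rtrans_ob_pull
  by (rule ps_hom_pull[OF CH_conj[OF D(1) h] D(1) coset_map_translate[OF D(1) h] f[unfolded level_homs_def]])

lemma level_homs_ext: "f \<in> level_homs \<alpha> \<U> X Y D \<Longrightarrow> f \<in> extensional (SH D)"
  unfolding level_homs_def ps_cat_sel VC_def by (auto simp: fun_lincat_def PiE_def)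

lemma transl_transl:
  assumes "g \<in> carrier HG" "h \<in> carrier HG" "fst t \<in> CH"
  shows "transl g (transl h t) = transl (g \<otimes>\<^bsub>HG\<^esub> h) t"
  using assms by (simp add: transl_def conjH_conjH rtrans_rtrans)

lemma transl_one:
  assumes "fst t \<in> CH" "snd t \<in> extensional (SH (fst t))" shows "transl \<one>\<^bsub>HG\<^esub> t = t"
proof -
  have "rtrans \<one>\<^bsub>HG\<^esub> (fst t) (snd t) = snd t"
    unfolding rtrans_pull conjH_one[OF assms(1)]
    by (rule pull_ident[OF assms(2)]) (rule HG.coset_mult_one[OF SH_carrier[OF assms(1)]])
  then show ?thesis unfolding transl_def[OF HG.one_closed] conjH_one[OF assms(1)] by simp
qed

lemma Rob_Rob:
  assumes "g \<in> carrier HG" "h \<in> carrier HG" "X \<in> Ob (usm \<alpha> \<U>)"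
  shows "Rob g (Rob h X) = Rob (g \<otimes>\<^bsub>HG\<^esub> h) X"
  using assms
  by (simp add: Rob_def conjH_conjH rtrans_ob_def rtrans_rtrans usm_ob cong: restrict_cong)

lemma psob_ext:
  assumes "is_psob \<alpha> \<U> C X"
  shows "fst X \<in> extensional (SH C)" "b \<in> BH \<Longrightarrow> snd X b \<in> extensional (SH C)" "snd X \<in> extensional BH"
  using psobD[OF assms] by (auto simp: VC_def fun_lincat_def PiE_def)

text \<open>As \<open>g C h = g C\<close> for \<open>h \<in> C\<close>, elements of \<open>C\<close> translate families at level \<open>C\<close> trivially. This is the source of
  smoothness.\<close>

lemma rtrans_fixed:
  assumes "C \<in> CH" "h \<in> C" "V \<in> extensional (SH C)"
  shows "rtrans h C V = V" and "conjH h C = C"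
proof -
  have sub: "subgroup C HG" using CH_subgroup[OF assms(1)] .
  then have h: "h \<in> carrier HG" using assms(2) subgroup.mem_carrier by fastforce
  show c: "conjH h C = C" unfolding conjH_eq by (rule HG.cnj_self[OF sub assms(2)])
  show "rtrans h C V = V"
    unfolding rtrans_pull c
  proof (rule pull_ident[OF assms(3)])
    fix s assume "s \<in> SH C"
    then obtain g where g: "g \<in> carrier HG" "s = g <#\<^bsub>HG\<^esub> C" by (rule HG.lcosetsE)
    have "s #>\<^bsub>HG\<^esub> h = (g \<otimes>\<^bsub>HG\<^esub> h) <#\<^bsub>HG\<^esub> C"
      using HG.lcos_translate[OF CH_carrier[OF assms(1)] g(1) h] g(2) c by (simp add: conjH_eq)
    also have "\<dots> = g <#\<^bsub>HG\<^esub> (h <#\<^bsub>HG\<^esub> C)" using g(1) h CH_carrier[OF assms(1)] by (simp add: HG.lcos_m_assoc)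
    also have "h <#\<^bsub>HG\<^esub> C = C"
    proof -
      interpret C: subgroup C HG by (rule sub)
      show ?thesis
      proof
        show "h <#\<^bsub>HG\<^esub> C \<subseteq> C" using assms(2) unfolding l_coset_def by blast
        show "C \<subseteq> h <#\<^bsub>HG\<^esub> C"
        proof
          fix c assume c: "c \<in> C"
          then have "h \<otimes>\<^bsub>HG\<^esub> (inv\<^bsub>HG\<^esub> h \<otimes>\<^bsub>HG\<^esub> c) = c" using h by simp
          moreover have "inv\<^bsub>HG\<^esub> h \<otimes>\<^bsub>HG\<^esub> c \<in> C" using c assms(2) by simp
          ultimately show "c \<in> h <#\<^bsub>HG\<^esub> C" unfolding l_coset_def by force
        qed
      qed
    qed
    finally show "s #>\<^bsub>HG\<^esub> h = s" using g by simp
  qed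
qed

lemma Rob_fixed:
  assumes "X \<in> Ob (usm \<alpha> \<U>)" "D \<in> CH" "D \<subseteq> fst X" "h \<in> D" shows "Rob h X = X"
proof -
  have X: "fst X \<in> CH" "is_psob \<alpha> \<U> (fst X) (snd X)" "h \<in> fst X" using assms by (auto simp: usm_ob)
  have h: "h \<in> carrier HG" using CH_carrier assms(2,4) by blast
  note e = psob_ext[OF X(2)]
  have "(\<lambda>b\<in>BH. rtrans h (fst X) (snd (snd X) b)) = snd (snd X)"
    by (rule extensionalityI[OF restrict_extensional e(3)]) (simp add: rtrans_fixed(1)[OF X(1,3) e(2)])
  then show ?thesis
    unfolding Rob_def[OF h] rtrans_ob_def using rtrans_fixed[OF X(1,3) e(1)] by simp
qed

lemma Rob_one:
  assumes "X \<in> Ob (usm \<alpha> \<U>)" shows "Rob \<one>\<^bsub>HG\<^esub> X = X"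
proof (rule Rob_fixed[OF assms _ order_refl])
  show "fst X \<in> CH" using assms by (simp add: usm_ob)
  then show "\<one>\<^bsub>HG\<^esub> \<in> fst X" by (rule subgroup.one_closed[OF CH_subgroup])
qed

lemma transl_mem:
  assumes h: "h \<in> carrier HG" and C: "fst X \<in> CH" "fst Y \<in> CH"
    and t: "t \<in> germ \<alpha> \<U> X Y D f"
  shows "transl h t \<in> germ \<alpha> \<U> (Rob h X) (Rob h Y) (conjH h D) (rtrans h D f)"
proof -
  obtain E f' where tE: "t = (E, f')" by (cases t)
  have "((D, f), (E, f')) \<in> usm_rel \<alpha> \<U> X Y" using t tE by simp
  then obtain F where D: "D \<in> CH" "D \<subseteq> fst X" "D \<subseteq> fst Y" and E: "E \<in> CH" "E \<subseteq> fst X" "E \<subseteq> fst Y"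
    and f: "f \<in> level_homs \<alpha> \<U> X Y D" "f' \<in> level_homs \<alpha> \<U> X Y E"
    and F: "F \<in> CH" "F \<subseteq> D" "F \<subseteq> E" "refine F D f = refine F E f'"
    unfolding usm_rel_iff[OF C] by (auto simp: levels_iff)
  have "refine (conjH h F) (conjH h D) (rtrans h D f) = refine (conjH h F) (conjH h E) (rtrans h E f')"
    by (simp add: rtrans_refine[OF h D(1) F(1,2)] rtrans_refine[OF h E(1) F(1,3)] F(4))
  then show ?thesis
    unfolding tE transl_def[OF h] fst_conv snd_conv
    using h C D E f F conjH_mono[OF h] CH_conj transl_hom
    by (intro germ_memI[of _ _ _ _ _ _ _ _ "conjH h F"]) (simp_all add: Rob_fst)
qed

text \<open>Translation by \<open>h\<close> maps classes onto classes, because translation by the inverse does the same.\<close>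

lemma transl_germ:
  assumes h: "h \<in> carrier HG" and X: "X \<in> Ob (usm \<alpha> \<U>)" and Y: "Y \<in> Ob (usm \<alpha> \<U>)"
    and D: "D \<in> CH" and f: "f \<in> level_homs \<alpha> \<U> X Y D"
  shows "transl h ` germ \<alpha> \<U> X Y D f = germ \<alpha> \<U> (Rob h X) (Rob h Y) (conjH h D) (rtrans h D f)"
proof
  have C: "fst X \<in> CH" "fst Y \<in> CH" using X Y by (auto simp: usm_ob)
  show "transl h ` germ \<alpha> \<U> X Y D f \<subseteq> germ \<alpha> \<U> (Rob h X) (Rob h Y) (conjH h D) (rtrans h D f)"
    using transl_mem[OF h C] by blast
  show "germ \<alpha> \<U> (Rob h X) (Rob h Y) (conjH h D) (rtrans h D f) \<subseteq> transl h ` germ \<alpha> \<U> X Y D f"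
  proof
    fix t assume t: "t \<in> germ \<alpha> \<U> (Rob h X) (Rob h Y) (conjH h D) (rtrans h D f)"
    \<comment> \<open>an element of the class on the right is the translate by \<open>h\<close> of its translate by the inverse\<close>
    let ?g = "inv\<^bsub>HG\<^esub> h"
    have g: "?g \<in> carrier HG" using h by simp
    have C': "fst (Rob h X) \<in> CH" "fst (Rob h Y) \<in> CH" using C CH_conj h by (simp_all add: Rob_fst)
    obtain E f' where tE: "t = (E, f')" by (cases t)
    have "((conjH h D, rtrans h D f), (E, f')) \<in> usm_rel \<alpha> \<U> (Rob h X) (Rob h Y)" using t tE by simp
    then have E: "E \<in> CH" "f' \<in> extensional (SH E)"
      unfolding usm_rel_iff[OF C'] by (auto simp: levels_iff level_homs_ext)
    have one: "transl ?g (transl h (D, f)) = (D, f)"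
      using transl_transl[OF g h, of "(D, f)"] transl_one[of "(D, f)"] h D level_homs_ext[OF f] by simp
    have "Rob ?g (Rob h X) = X" "Rob ?g (Rob h Y) = Y"
      using Rob_Rob[OF g h X] Rob_Rob[OF g h Y] Rob_one[OF X] Rob_one[OF Y] h by simp_all
    moreover have "conjH ?g (conjH h D) = D" "rtrans ?g (conjH h D) (rtrans h D f) = f"
      using one unfolding transl_def[OF g] transl_def[OF h] by simp_all
    ultimately have "transl ?g t \<in> germ \<alpha> \<U> X Y D f" using transl_mem[OF g C' t] by simp
    moreover have "transl h (transl ?g t) = t"
      using transl_transl[OF h g, of t] transl_one[of t] h E tE by simp
    ultimately show "t \<in> transl h ` germ \<alpha> \<U> X Y D f" by (metis imageI)
  qed
qed

lemma Rfun_sel: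
  assumes h: "h \<in> carrier HG"
  shows "X \<in> Ob (usm \<alpha> \<U>) \<Longrightarrow> FO (Rfun \<alpha> \<U> h) X = Rob h X"
    and "\<lbrakk>X \<in> Ob (usm \<alpha> \<U>); Y \<in> Ob (usm \<alpha> \<U>); \<gamma> \<in> Hom (usm \<alpha> \<U>) X Y\<rbrakk> \<Longrightarrow> FA (Rfun \<alpha> \<U> h) X Y \<gamma> = transl h ` \<gamma>"
  unfolding Rfun_def by (auto simp: Rob_def[OF h] transl_def[OF h] image_iff split: prod.split) force+

lemma rtrans_ops:
  assumes h: "h \<in> carrier HG" and D: "D \<in> CH"
    and X: "fst X \<in> CH" "D \<subseteq> fst X" and Y: "fst Y \<in> CH" "D \<subseteq> fst Y"
  shows "rtrans h D (Idn (ps_cat \<alpha> \<U> D) (at_level D X)) = Idn (ps_cat \<alpha> \<U> (conjH h D)) (at_level (conjH h D) (Rob h X))"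
    and "\<lbrakk>fst Z \<in> CH; D \<subseteq> fst Z\<rbrakk> \<Longrightarrow> rtrans h D (Cmp (ps_cat \<alpha> \<U> D) (at_level D X) (at_level D Y) (at_level D Z) g f) =
      Cmp (ps_cat \<alpha> \<U> (conjH h D)) (at_level (conjH h D) (Rob h X)) (at_level (conjH h D) (Rob h Y))
        (at_level (conjH h D) (Rob h Z)) (rtrans h D g) (rtrans h D f)"
    and "rtrans h D (AAdd (ps_cat \<alpha> \<U> D) (at_level D X) (at_level D Y) f f') =
      AAdd (ps_cat \<alpha> \<U> (conjH h D)) (at_level (conjH h D) (Rob h X)) (at_level (conjH h D) (Rob h Y)) (rtrans h D f) (rtrans h D f')"
    and "rtrans h D (AScl (ps_cat \<alpha> \<U> D) (at_level D X) (at_level D Y) c f) =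
      AScl (ps_cat \<alpha> \<U> (conjH h D)) (at_level (conjH h D) (Rob h X)) (at_level (conjH h D) (Rob h Y)) c (rtrans h D f)"
  using X Y
  by (simp_all add: at_level_Rob[OF h _ D] ps_ops_pull[OF CH_conj[OF D h] D coset_map_translate[OF D h], folded rtrans_pull rtrans_ob_pull])

text \<open>Right translation is compatible with the operations at each level, by \<open>ps_ops_pull\<close>, and the operations on
  arrows are computed on representatives at a common level.\<close>

lemma Rfun_functor:
  fixes h :: "('k::field, 'n) hmat"
  assumes h: "h \<in> carrier HG" shows "cat_functor (usm \<alpha> \<U>) (usm \<alpha> \<U>) (Rfun \<alpha> \<U> h)"
proof -
  interpret category "usm \<alpha> \<U> :: (('k, 'n, 'v) usm_ob, ('k, 'n, 'v) usm_ar, Lam) lincat" by (rule category_usm)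
  note R = Rfun_sel[OF h]
  show ?thesis
  proof unfold_locales
    fix X :: "('k, 'n, 'v) usm_ob" assume X: "X \<in> Ob (usm \<alpha> \<U>)"
    then have C: "fst X \<in> CH" by (simp add: usm_ob)
    show "FO (Rfun \<alpha> \<U> h) X \<in> Ob (usm \<alpha> \<U>)" using R(1)[OF X] Rob_ob[OF h X] by simp
    note i = usm_idn[OF X C order_refl]
    show "FA (Rfun \<alpha> \<U> h) X X (Idn (usm \<alpha> \<U>) X) = Idn (usm \<alpha> \<U>) (FO (Rfun \<alpha> \<U> h) X)"
      unfolding R(1)[OF X] R(2)[OF X X Idn_hom[OF X]]
      unfolding i(1) transl_germ[OF h X X C i(2)]
        rtrans_ops(1)[OF h C C order_refl C order_refl]
      by (rule usm_idn(1)[OF Rob_ob[OF h X] CH_conj[OF C h], symmetric]) (simp add: Rob_fst[OF h])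
  next
    fix X Y :: "('k, 'n, 'v) usm_ob" and \<gamma> assume o: "X \<in> Ob (usm \<alpha> \<U>)" "Y \<in> Ob (usm \<alpha> \<U>)"
      and \<gamma>: "\<gamma> \<in> Hom (usm \<alpha> \<U>) X Y"
    have C: "fst X \<in> CH" "fst Y \<in> CH" using o by (auto simp: usm_ob)
    obtain D f where D: "D \<in> CH" "D \<subseteq> fst X" "D \<subseteq> fst Y" and f: "f \<in> level_homs \<alpha> \<U> X Y D" "\<gamma> = germ \<alpha> \<U> X Y D f"
      by (rule usm_scl_hom[OF o \<gamma>]) blast
    show "FA (Rfun \<alpha> \<U> h) X Y \<gamma> \<in> Hom (usm \<alpha> \<U>) (FO (Rfun \<alpha> \<U> h) X) (FO (Rfun \<alpha> \<U> h) Y)"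
      unfolding R(1)[OF o(1)] R(1)[OF o(2)] R(2)[OF o \<gamma>]
      unfolding f(2) transl_germ[OF h o D(1) f(1)]
      using transl_hom[OF h C D f(1)] CH_conj[OF _ h] C D conjH_mono[OF h]
      by (intro germ_hom) (simp_all add: levels_iff Rob_fst[OF h])
  next
    fix X Y Z :: "('k, 'n, 'v) usm_ob" and \<gamma> \<delta>
    assume o: "X \<in> Ob (usm \<alpha> \<U>)" "Y \<in> Ob (usm \<alpha> \<U>)" "Z \<in> Ob (usm \<alpha> \<U>)"
      and \<gamma>: "\<gamma> \<in> Hom (usm \<alpha> \<U>) X Y" and \<delta>: "\<delta> \<in> Hom (usm \<alpha> \<U>) Y Z"
    have C: "fst X \<in> CH" "fst Y \<in> CH" "fst Z \<in> CH" using o by (auto simp: usm_ob)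
    obtain D where D: "D \<in> CH" "D \<subseteq> fst X" "D \<subseteq> fst Y" and
      rD: "\<And>E. \<lbrakk>E \<in> CH; E \<subseteq> D\<rbrakk> \<Longrightarrow> \<exists>f\<in>level_homs \<alpha> \<U> X Y E. \<gamma> = germ \<alpha> \<U> X Y E f" by (rule germ_cases[OF o(1,2) \<gamma>]) blast
    obtain E where E: "E \<in> CH" "E \<subseteq> fst Y" "E \<subseteq> fst Z" and
      rE: "\<And>F. \<lbrakk>F \<in> CH; F \<subseteq> E\<rbrakk> \<Longrightarrow> \<exists>f\<in>level_homs \<alpha> \<U> Y Z F. \<delta> = germ \<alpha> \<U> Y Z F f" by (rule germ_cases[OF o(2,3) \<delta>]) blast
    define F where "F = D \<inter> E"
    have F: "F \<in> CH" "F \<subseteq> fst X" "F \<subseteq> fst Y" "F \<subseteq> fst Z" using CH_Int[OF D(1) E(1)] D E unfolding F_def by auto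
    obtain f where f: "f \<in> level_homs \<alpha> \<U> X Y F" "\<gamma> = germ \<alpha> \<U> X Y F f" using rD[OF F(1)] unfolding F_def by blast
    obtain g where g: "g \<in> level_homs \<alpha> \<U> Y Z F" "\<delta> = germ \<alpha> \<U> Y Z F g" using rE[OF F(1)] unfolding F_def by blast
    note gf = usm_cmp[OF o F f(1) g(1)]
    have F': "conjH h F \<in> CH" "conjH h F \<subseteq> fst (Rob h X)" "conjH h F \<subseteq> fst (Rob h Y)" "conjH h F \<subseteq> fst (Rob h Z)"
      using CH_conj[OF F(1) h] conjH_mono[OF h] F by (simp_all add: Rob_fst[OF h])
    show "FA (Rfun \<alpha> \<U> h) X Z (Cmp (usm \<alpha> \<U>) X Y Z \<delta> \<gamma>) =
       Cmp (usm \<alpha> \<U>) (FO (Rfun \<alpha> \<U> h) X) (FO (Rfun \<alpha> \<U> h) Y) (FO (Rfun \<alpha> \<U> h) Z)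
         (FA (Rfun \<alpha> \<U> h) Y Z \<delta>) (FA (Rfun \<alpha> \<U> h) X Y \<gamma>)"
      unfolding R(1)[OF o(1)] R(1)[OF o(2)] R(1)[OF o(3)] R(2)[OF o(1,2) \<gamma>] R(2)[OF o(2,3) \<delta>]
        R(2)[OF o(1,3) Cmp_hom[OF o \<gamma> \<delta>]]
      unfolding f(2) g(2) gf(1) transl_germ[OF h o(1,2) F(1) f(1)] transl_germ[OF h o(2,3) F(1) g(1)]
        transl_germ[OF h o(1,3) F(1) gf(2)] rtrans_ops(2)[OF h F(1) C(1) F(2) C(2) F(3) C(3) F(4)]
      by (rule usm_cmp(1)[OF Rob_ob[OF h o(1)] Rob_ob[OF h o(2)] Rob_ob[OF h o(3)] F'
        transl_hom[OF h C(1,2) F(1,2,3) f(1)] transl_hom[OF h C(2,3) F(1,3,4) g(1)], symmetric])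
  qed
qed

lemma Rfun_linear:
  fixes h :: "('k::field, 'n) hmat"
  assumes h: "h \<in> carrier HG" shows "linear_func (usm \<alpha> \<U>) (usm \<alpha> \<U>) (Rfun \<alpha> \<U> h)"
  unfolding linear_func_def
proof (intro ballI conjI allI)
  note R = Rfun_sel[OF h]
  fix X Y :: "('k, 'n, 'v) usm_ob" and \<gamma> assume o: "X \<in> Ob (usm \<alpha> \<U>)" "Y \<in> Ob (usm \<alpha> \<U>)"
    and \<gamma>: "\<gamma> \<in> Hom (usm \<alpha> \<U>) X Y"
  have C: "fst X \<in> CH" "fst Y \<in> CH" using o by (auto simp: usm_ob)
  note Ro = Rob_ob[OF h o(1)] Rob_ob[OF h o(2)]
  have lev: "conjH h D \<in> CH" "conjH h D \<subseteq> fst (Rob h X)" "conjH h D \<subseteq> fst (Rob h Y)"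
    if "D \<in> CH" "D \<subseteq> fst X" "D \<subseteq> fst Y" for D
    using CH_conj[OF that(1) h] conjH_mono[OF h] that by (simp_all add: Rob_fst[OF h])
  show "FA (Rfun \<alpha> \<U> h) X Y (AScl (usm \<alpha> \<U>) X Y c \<gamma>) =
      AScl (usm \<alpha> \<U>) (FO (Rfun \<alpha> \<U> h) X) (FO (Rfun \<alpha> \<U> h) Y) c (FA (Rfun \<alpha> \<U> h) X Y \<gamma>)" for c
  proof -
    obtain D f where D: "D \<in> CH" "D \<subseteq> fst X" "D \<subseteq> fst Y" and f: "f \<in> level_homs \<alpha> \<U> X Y D" "\<gamma> = germ \<alpha> \<U> X Y D f"
      and cl: "AScl (usm \<alpha> \<U>) X Y c \<gamma> \<in> Hom (usm \<alpha> \<U>) X Y"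
      by (rule usm_scl_hom[OF o \<gamma>, of c]) blast
    note s = usm_scl[OF o D f(1)]
    show ?thesis
      unfolding R(1)[OF o(1)] R(1)[OF o(2)] R(2)[OF o \<gamma>] R(2)[OF o cl]
      unfolding f(2) s(1) transl_germ[OF h o D(1) f(1)] transl_germ[OF h o D(1) s(2)]
        rtrans_ops(4)[OF h D(1) C(1) D(2) C(2) D(3)]
      by (rule usm_scl(1)[OF Ro lev[OF D] transl_hom[OF h C D f(1)], symmetric])
  qed
  fix \<delta> assume \<delta>: "\<delta> \<in> Hom (usm \<alpha> \<U>) X Y"
  obtain D f g where D: "D \<in> CH" "D \<subseteq> fst X" "D \<subseteq> fst Y" and f: "f \<in> level_homs \<alpha> \<U> X Y D"
    and g: "g \<in> level_homs \<alpha> \<U> X Y D" and fg: "\<gamma> = germ \<alpha> \<U> X Y D f" "\<delta> = germ \<alpha> \<U> X Y D g"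
    and cl: "AAdd (usm \<alpha> \<U>) X Y \<gamma> \<delta> \<in> Hom (usm \<alpha> \<U>) X Y"
    by (rule usm_add_hom[OF o \<gamma> \<delta>]) blast
  note s = usm_add[OF o D f g]
  show "FA (Rfun \<alpha> \<U> h) X Y (AAdd (usm \<alpha> \<U>) X Y \<gamma> \<delta>) =
      AAdd (usm \<alpha> \<U>) (FO (Rfun \<alpha> \<U> h) X) (FO (Rfun \<alpha> \<U> h) Y) (FA (Rfun \<alpha> \<U> h) X Y \<gamma>) (FA (Rfun \<alpha> \<U> h) X Y \<delta>)"
    unfolding R(1)[OF o(1)] R(1)[OF o(2)] R(2)[OF o \<gamma>] R(2)[OF o \<delta>] R(2)[OF o cl]
    unfolding fg s(1) transl_germ[OF h o D(1) f] transl_germ[OF h o D(1) g] transl_germ[OF h o D(1) s(2)]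
      rtrans_ops(3)[OF h D(1) C(1) D(2) C(2) D(3)]
    by (rule usm_add(1)[OF Ro lev[OF D] transl_hom[OF h C D f] transl_hom[OF h C D g], symmetric])
qed

text \<open>Every element of an arrow is a representative of it, and hence an extensional family at a level.\<close>

lemma arrow_elements:
  assumes o: "X \<in> Ob (usm \<alpha> \<U>)" "Y \<in> Ob (usm \<alpha> \<U>)" and \<gamma>: "\<gamma> \<in> Hom (usm \<alpha> \<U>) X Y" and t: "t \<in> \<gamma>"
  shows "fst t \<in> CH" "snd t \<in> extensional (SH (fst t))"
proof -
  have C: "fst X \<in> CH" "fst Y \<in> CH" using o by (auto simp: usm_ob)
  obtain D f where "\<gamma> = germ \<alpha> \<U> X Y D f" by (rule usm_scl_hom[OF o \<gamma>]) blast
  then have "((D, f), (fst t, snd t)) \<in> usm_rel \<alpha> \<U> X Y" using t by simp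
  then show "fst t \<in> CH" "snd t \<in> extensional (SH (fst t))"
    unfolding usm_rel_iff[OF C] by (auto simp: levels_iff level_homs_ext)
qed

text \<open>The laws of an action hold literally, because \<open>s g h = s (g h)\<close> for cosets \<open>s\<close>, and because arrows are classes,
  which are translated elementwise.\<close>

lemma Rfun_one: "Rfun \<alpha> \<U> \<one>\<^bsub>HG\<^esub> = id_func (usm \<alpha> \<U> :: (('k::field, 'n, 'v) usm_ob, ('k, 'n, 'v) usm_ar, Lam) lincat)"
proof (rule ext_func_eqI)
  show "ext_func (usm \<alpha> \<U>) (Rfun \<alpha> \<U> \<one>\<^bsub>HG\<^esub>)" unfolding Rfun_def by (rule ext_mk_func)
  show "ext_func (usm \<alpha> \<U>) (id_func (usm \<alpha> \<U>))" by (rule ext_id_func)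
  fix X :: "('k, 'n, 'v) usm_ob" assume X: "X \<in> Ob (usm \<alpha> \<U>)"
  then show "FO (Rfun \<alpha> \<U> \<one>\<^bsub>HG\<^esub>) X = FO (id_func (usm \<alpha> \<U>)) X"
    by (simp add: Rfun_sel Rob_one)
  fix Y \<gamma> assume Y: "Y \<in> Ob (usm \<alpha> \<U>)" and \<gamma>: "\<gamma> \<in> Hom (usm \<alpha> \<U>) X Y"
  have "transl \<one>\<^bsub>HG\<^esub> t = t" if "t \<in> \<gamma>" for t
    by (rule transl_one[OF arrow_elements[OF X Y \<gamma> that]])
  then show "FA (Rfun \<alpha> \<U> \<one>\<^bsub>HG\<^esub>) X Y \<gamma> = FA (id_func (usm \<alpha> \<U>)) X Y \<gamma>"
    using X Y \<gamma> by (simp add: Rfun_sel)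
qed

lemma Rfun_mult:
  fixes g h :: "('k::field, 'n) hmat"
  assumes g: "g \<in> carrier HG" and h: "h \<in> carrier HG"
  shows "Rfun \<alpha> \<U> (g \<otimes>\<^bsub>HG\<^esub> h) = comp_func (usm \<alpha> \<U>) (Rfun \<alpha> \<U> g) (Rfun \<alpha> \<U> h)"
proof (rule ext_func_eqI)
  note gh = HG.m_closed[OF g h]
  interpret R: cat_functor "usm \<alpha> \<U>" "usm \<alpha> \<U>" "Rfun \<alpha> \<U> h" by (rule Rfun_functor[OF h])
  show "ext_func (usm \<alpha> \<U>) (Rfun \<alpha> \<U> (g \<otimes>\<^bsub>HG\<^esub> h))" unfolding Rfun_def by (rule ext_mk_func)
  show "ext_func (usm \<alpha> \<U>) (comp_func (usm \<alpha> \<U>) (Rfun \<alpha> \<U> g) (Rfun \<alpha> \<U> h))" by (rule ext_comp_func)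
  fix X :: "('k, 'n, 'v) usm_ob" assume X: "X \<in> Ob (usm \<alpha> \<U>)"
  then show "FO (Rfun \<alpha> \<U> (g \<otimes>\<^bsub>HG\<^esub> h)) X = FO (comp_func (usm \<alpha> \<U>) (Rfun \<alpha> \<U> g) (Rfun \<alpha> \<U> h)) X"
    by (simp add: Rfun_sel[OF gh] Rfun_sel[OF g] Rfun_sel[OF h] Rob_ob[OF h] Rob_Rob[OF g h])
  fix Y \<gamma> assume Y: "Y \<in> Ob (usm \<alpha> \<U>)" and \<gamma>: "\<gamma> \<in> Hom (usm \<alpha> \<U>) X Y"
  have "FA (comp_func (usm \<alpha> \<U>) (Rfun \<alpha> \<U> g) (Rfun \<alpha> \<U> h)) X Y \<gamma> = transl g ` transl h ` \<gamma>"
    using X Y \<gamma> R.FA_hom[OF X Y \<gamma>] R.FO_ob by (simp add: Rfun_sel(2)[OF g] Rfun_sel(2)[OF h])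
  also have "\<dots> = transl (g \<otimes>\<^bsub>HG\<^esub> h) ` \<gamma>"
    unfolding image_image
    by (rule image_cong[OF refl], rule transl_transl[OF g h arrow_elements(1)[OF X Y \<gamma>]])
  finally show "FA (Rfun \<alpha> \<U> (g \<otimes>\<^bsub>HG\<^esub> h)) X Y \<gamma> = FA (comp_func (usm \<alpha> \<U>) (Rfun \<alpha> \<U> g) (Rfun \<alpha> \<U> h)) X Y \<gamma>"
    using X Y \<gamma> by (simp add: Rfun_sel(2)[OF gh])
qed

lemma Rfun_inverse:
  fixes g h :: "('k::field, 'n) hmat"
  assumes g: "g \<in> carrier HG" and h: "h \<in> carrier HG" and e: "g \<otimes>\<^bsub>HG\<^esub> h = \<one>\<^bsub>HG\<^esub>"
  shows "strictly_inverse (usm \<alpha> \<U>) (Rfun \<alpha> \<U> h) (Rfun \<alpha> \<U> g)"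
proof -
  interpret R: cat_functor "usm \<alpha> \<U>" "usm \<alpha> \<U>" "Rfun \<alpha> \<U> h" by (rule Rfun_functor[OF h])
  have c: "comp_func (usm \<alpha> \<U>) (Rfun \<alpha> \<U> g) (Rfun \<alpha> \<U> h) = id_func (usm \<alpha> \<U>)"
    using Rfun_mult[OF g h] unfolding e Rfun_one by (rule sym)
  show ?thesis
    unfolding strictly_inverse_def
  proof (intro conjI ballI)
    fix X :: "('k, 'n, 'v) usm_ob" assume X: "X \<in> Ob (usm \<alpha> \<U>)"
    have "FO (comp_func (usm \<alpha> \<U>) (Rfun \<alpha> \<U> g) (Rfun \<alpha> \<U> h)) X = FO (id_func (usm \<alpha> \<U>)) X" by (simp only: c)
    then show "FO (Rfun \<alpha> \<U> g) (FO (Rfun \<alpha> \<U> h) X) = X"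
      by (simp only: comp_func_sel(1)[OF X] id_func_sel(1)[OF X])
    fix Y \<gamma> assume Y: "Y \<in> Ob (usm \<alpha> \<U>)" and \<gamma>: "\<gamma> \<in> Hom (usm \<alpha> \<U>) X Y"
    have "FA (comp_func (usm \<alpha> \<U>) (Rfun \<alpha> \<U> g) (Rfun \<alpha> \<U> h)) X Y \<gamma> = FA (id_func (usm \<alpha> \<U>)) X Y \<gamma>" by (simp only: c)
    then show "FA (Rfun \<alpha> \<U> g) (FO (Rfun \<alpha> \<U> h) X) (FO (Rfun \<alpha> \<U> h) Y) (FA (Rfun \<alpha> \<U> h) X Y \<gamma>) = \<gamma>"
      by (simp only: comp_func_sel(2)[OF X Y \<gamma>] id_func_sel(2)[OF X Y \<gamma>])
  qed
qed

end

section \<open>The representation of the determinant 2-group\<close>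

context
  fixes \<alpha> :: "'n::{finite,linorder} \<Rightarrow> Lam" and \<U> :: "'v set set"
begin

lemma closed_lincat_usm:
  "closed_lincat (usm \<alpha> \<U> :: (('k::field, 'n, 'v) usm_ob, ('k, 'n, 'v) usm_ar, Lam) lincat)"
proof (rule closed_lincat.intro[OF category_usm], unfold_locales)
  fix X Y :: "('k, 'n, 'v) usm_ob" and \<gamma> assume o: "X \<in> Ob (usm \<alpha> \<U>)" "Y \<in> Ob (usm \<alpha> \<U>)" and \<gamma>: "\<gamma> \<in> Hom (usm \<alpha> \<U>) X Y"
  show "AScl (usm \<alpha> \<U>) X Y c \<gamma> \<in> Hom (usm \<alpha> \<U>) X Y" for c by (rule usm_scl_hom[OF o \<gamma>, of c])
  fix \<delta> assume \<delta>: "\<delta> \<in> Hom (usm \<alpha> \<U>) X Y"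
  show "AAdd (usm \<alpha> \<U>) X Y \<gamma> \<delta> \<in> Hom (usm \<alpha> \<U>) X Y" by (rule usm_add_hom[OF o \<gamma> \<delta>])
qed

text \<open>The inverse of \<open>R\<^sub>h\<close> is \<open>R\<close> of the inverse of \<open>h\<close>; equivalence and exactness follow from strict invertibility.\<close>

lemma exact_strict_action_Rfun:
  "exact_strict_action HG (usm \<alpha> \<U> :: (('k::field, 'n, 'v) usm_ob, ('k, 'n, 'v) usm_ar, Lam) lincat) (Rfun \<alpha> \<U>)"
  unfolding exact_strict_action_def
proof (intro conjI ballI)
  fix h :: "('k, 'n) hmat" assume h: "h \<in> carrier HG"
  have h': "inv\<^bsub>HG\<^esub> h \<in> carrier HG" using h by (rule HG.inv_closed)
  note F = Rfun_functor[OF h, of \<alpha> \<U>] Rfun_functor[OF h', of \<alpha> \<U>]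
  note I = Rfun_inverse[OF h' h HG.l_inv[OF h], of \<alpha> \<U>] Rfun_inverse[OF h h' HG.r_inv[OF h], of \<alpha> \<U>]
  have "ext_func (usm \<alpha> \<U>) (Rfun \<alpha> \<U> h)" unfolding Rfun_def by (rule ext_mk_func)
  then show "Rfun \<alpha> \<U> h \<in> Ob (exact_aut (usm \<alpha> \<U>))"
    unfolding exact_aut_def endo_moncat_def Let_def
    using equivalence_strict[OF F I] exact_strict[OF F Rfun_linear[OF h] Rfun_linear[OF h'] I] Rfun_linear[OF h]
    by simp
qed (simp_all add: Rfun_one Rfun_mult)

text \<open>An object is fixed by the elements of its own level, and an arrow by those of any level at which it has a
  representative, since that level is contained in the levels of source and target.\<close>

lemma uniformly_smooth_Rfun:
  "uniformly_smooth CH (usm \<alpha> \<U> :: (('k::field, 'n, 'v) usm_ob, ('k, 'n, 'v) usm_ar, Lam) lincat) (Rfun \<alpha> \<U>)"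
  unfolding uniformly_smooth_def
proof (intro conjI ballI)
  fix X :: "('k, 'n, 'v) usm_ob" assume X: "X \<in> Ob (usm \<alpha> \<U>)"
  then have C: "fst X \<in> CH" by (simp add: usm_ob)
  show "\<exists>C\<in>CH. \<forall>h\<in>C. FO (Rfun \<alpha> \<U> h) X = X"
  proof (intro bexI[OF _ C] ballI)
    fix h assume h: "h \<in> fst X"
    then have "h \<in> carrier HG" using CH_carrier[OF C] by blast
    then show "FO (Rfun \<alpha> \<U> h) X = X" by (simp only: Rfun_sel(1)[OF _ X] Rob_fixed[OF X C order_refl h])
  qed
next
  fix t assume t: "t \<in> tarrs (usm \<alpha> \<U> :: (('k, 'n, 'v) usm_ob, ('k, 'n, 'v) usm_ar, Lam) lincat)"
  obtain X Y :: "('k, 'n, 'v) usm_ob" and \<gamma> where tE: "t = (X, \<gamma>, Y)" by (rule prod_cases3)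
  have o: "X \<in> Ob (usm \<alpha> \<U>)" "Y \<in> Ob (usm \<alpha> \<U>)" and \<gamma>: "\<gamma> \<in> Hom (usm \<alpha> \<U>) X Y"
    using t unfolding tE by (simp_all add: tarrs_def)
  obtain D f where D: "D \<in> CH" "D \<subseteq> fst X" "D \<subseteq> fst Y" and f: "f \<in> level_homs \<alpha> \<U> X Y D" "\<gamma> = germ \<alpha> \<U> X Y D f"
    by (rule usm_scl_hom[OF o \<gamma>]) blast
  show "\<exists>C\<in>CH. \<forall>h\<in>C. tmap (Rfun \<alpha> \<U> h) t = t"
  proof (intro bexI[OF _ D(1)] ballI)
    fix h assume hD: "h \<in> D"
    then have h: "h \<in> carrier HG" using CH_carrier[OF D(1)] by blast
    note fixed = Rob_fixed[OF o(1) D(1,2) hD] Rob_fixed[OF o(2) D(1,3) hD] rtrans_fixed[OF D(1) hD level_homs_ext[OF f(1)]]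
    have "transl h ` \<gamma> = \<gamma>"
      unfolding f(2) transl_germ[OF h o D(1) f(1)] fixed ..
    then show "tmap (Rfun \<alpha> \<U> h) t = t"
      unfolding tE tmap.simps Rfun_sel(1)[OF h o(1)] Rfun_sel(1)[OF h o(2)] Rfun_sel(2)[OF h o \<gamma>] fixed by simp
  qed
qed

end

text \<open>In the theorem, \<open>pdet\<close> also occurs applied to an object alone, where its type of arrows is left open; the
  equation holds for each choice of that type.\<close>

lemma FO_pdet: "FO pdet x = fst x"
  by (simp add: pdet_def hpullback_fst_def)

theorem corollary5p5:
  fixes \<alpha> :: "'n::{finite,linorder} \<Rightarrow> complex fls"
    and \<U> :: "'v set set"
    and E :: "('x, 'y) moncat"
    and i :: "(('k::{field,finite}, 'k) vspace \<times> int, 'k \<Rightarrow> 'k, 'x, 'y) mfunc"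
    and q :: "('x, 'y, ('k, 'n) a4, unit) mfunc"
  assumes "\<forall>r. \<alpha> r \<noteq> 0"
    and "small_universe TYPE(complex fls) \<U>"
    and "central_extension picZ E AutW i q"
  defines "A \<equiv> (usm_cat \<alpha> \<U> :: (('k, 'n, 'v) usm_ob, ('k, 'n, 'v) usm_ar, complex fls) lincat)"
    and "\<rho> \<equiv> rho \<alpha> \<U>"
    and "\<Phi> \<equiv> rho_det \<alpha> \<U> E q"
    and "Ker \<equiv> hfiber (Hdet E q) (disc HG) pdet"
  shows "exact_two_rep (Hdet E q) A \<Phi> \<and>
    p_uniformly_smooth (Hdet E q) HG CH A pdet \<Phi> \<and>
    monoidally_equivalent (picZ :: (('k, 'k) vspace \<times> int, 'k \<Rightarrow> 'k) symmoncat) Ker \<and>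
    (\<forall>(x, f)\<in>Ob Ker. FO \<Phi> x = id_func A \<and>
       comps (exact_aut A) [tmap \<rho> (FO pdet x, f, \<one>\<^bsub>HG\<^esub>), tinv (exact_aut A) (tep (disc HG) (exact_aut A) \<rho>)]
         = tid (exact_aut A) (id_func A)) \<and>
    (\<forall>((x, f), a, (y, g))\<in>tarrs Ker. tmap \<Phi> (x, a, y) = tid (exact_aut A) (id_func A))"
proof -
  have E: "coherent_2group E" and AW: "coherent_2group (disc (AutW :: ('k, 'n) a4 monoid))"
    and q: "strong_monoidal_functor E (disc AutW) q"
    and fiber: "monoidally_equivalent (picZ :: (('k, 'k) vspace \<times> int, 'k \<Rightarrow> 'k) symmoncat) (hfiber E (disc AutW) q)"
    using assms(3) unfolding central_extension_def monoidally_equivalent_def by blast+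
  interpret AutW: group "AutW :: ('k, 'n) a4 monoid" by (rule group_if_coherent_2group[OF AW])
  have \<iota>: "strong_monoidal_functor (disc (HG :: ('k, 'n) hmat monoid)) (disc AutW) (disc_map iotaH)"
    by (rule strong_monoidal_disc_map[OF HG.monoid_axioms AutW.monoid_axioms iotaH_hom])
  have H: "coherent_2group (Hdet E q)"
    unfolding Hdet_def
    by (rule coherent_2group_hpullback[OF \<iota> q coherent_2group_disc[OF group_HG] E AutW.group_axioms])
  have p: "strong_monoidal_functor (Hdet E q) (disc HG) pdet"
    unfolding Hdet_def pdet_def by (rule strong_monoidal_hpullback_fst[OF \<iota> q HG.monoid_axioms])
  interpret A: closed_lincat A unfolding A_def by (rule closed_lincat_usm)
  have R: "exact_strict_action HG A (Rfun \<alpha> \<U>)" unfolding A_def by (rule exact_strict_action_Rfun)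
  have S: "uniformly_smooth CH A (Rfun \<alpha> \<U>)" unfolding A_def by (rule uniformly_smooth_Rfun)
  have \<rho>: "\<rho> = strict_two_rep HG A (Rfun \<alpha> \<U>)" by (simp add: \<rho>_def rho_def A_def)
  have \<Phi>: "\<Phi> = comp_mfunc (Hdet E q) (disc HG) (exact_aut A) (strict_two_rep HG A (Rfun \<alpha> \<U>)) pdet"
    by (simp add: \<Phi>_def rho_det_def rho_def A_def)
  note inflation = R group_HG H p
  have "exact_two_rep (Hdet E q) A \<Phi>" unfolding \<Phi> by (rule A.exact_two_rep_inflation[OF inflation])
  moreover have "p_uniformly_smooth (Hdet E q) HG CH A pdet \<Phi>"
    unfolding p_uniformly_smooth_def
    by (intro conjI exI[of _ "Rfun \<alpha> \<U>"] p R S \<Phi>)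
  moreover have "monoidally_equivalent (picZ :: (('k, 'k) vspace \<times> int, 'k \<Rightarrow> 'k) symmoncat) Ker"
    unfolding Ker_def Hdet_def pdet_def
    by (rule monoidally_equivalent_trans[OF fiber hfiber_hpullback[OF \<iota> q HG.monoid_axioms AutW.monoid_axioms]])
  moreover have "\<forall>(x, f)\<in>Ob Ker. FO \<Phi> x = id_func A \<and>
       comps (exact_aut A) [tmap \<rho> (fst x, f, \<one>\<^bsub>HG\<^esub>), tinv (exact_aut A) (tep (disc HG) (exact_aut A) \<rho>)]
         = tid (exact_aut A) (id_func A)"
    unfolding Ker_def \<Phi> \<rho>
  proof (intro ballI case_prodI2 conjI)
    fix X x f assume "X \<in> Ob (hfiber (Hdet E q) (disc HG) pdet)" "X = (x, f)"
    then have k: "(x, f) \<in> Ob (hfiber (Hdet E q) (disc HG) pdet)" by (simp only:)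
    show "FO (comp_mfunc (Hdet E q) (disc HG) (exact_aut A) (strict_two_rep HG A (Rfun \<alpha> \<U>)) pdet) x = id_func A"
      by (rule A.kernel_object_trivial(1)[OF inflation k])
    show "comps (exact_aut A) [tmap (strict_two_rep HG A (Rfun \<alpha> \<U>)) (fst x, f, \<one>\<^bsub>HG\<^esub>),
        tinv (exact_aut A) (tep (disc HG) (exact_aut A) (strict_two_rep HG A (Rfun \<alpha> \<U>)))] = tid (exact_aut A) (id_func A)"
      by (rule A.kernel_object_trivial(2)[OF inflation k, unfolded FO_pdet])
  qed
  moreover have "\<forall>((x, f), a, (y, g))\<in>tarrs Ker. tmap \<Phi> (x, a, y) = tid (exact_aut A) (id_func A)"
    unfolding Ker_def \<Phi>
    by (clarify, rule A.kernel_arrow_trivial[OF inflation])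
  ultimately show ?thesis unfolding FO_pdet by (intro conjI)
qed

end
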